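(* Let $q>3$, $\alpha\in[1,2]$, and let $f_0$ be a non-negative initial datum with $f_0\in C^2(\mathbb{T}\times\mathbb{R})$, $\|f_0\|_{W^{2,\infty}_{q}}<\infty$, $\|f_0\|_{W^{2,\infty}_{q+2}}<\infty$, $\int_{\mathbb T}\int_{\mathbb R}f_0\,dv\,dx=1$ and $f_0(x,v)\ge C_0e^{-|v|^\alpha}$ for some $C_0>0$. Let $(f,\mathbb{E})$ be the unique smooth solution on $[0,T^f]$ of the Vlasov-Poisson-BGK system with initial datum $f_0$, and let $f^n_{i,j}$, $\mathbb{E}^n_i$ be the discrete solution and discrete electric field produced by the scheme described in the context. Let $0<\eta_1<\eta_2<1$ and $\frac12\le\gamma<1$. Then there exist positive numbers $C_M$, $C_{\mathcal M}$ (depending only on $q$), such that, with $C_{\mathbb{E},1},C_{\mathbb{E},2},r_{\Delta x},r_{\Delta v}$ given by the formulas in the context, the following holds. If $\Delta x<r_{\Delta x}$, $\Delta v<r_{\Delta v}$, $$\eta_1\frac{\Delta v}{C_{\mathbb{E},1}}<\Delta t<\eta_2\frac{\Delta v}{C_{\mathbb{E},1}},\qquad V_M=\frac{C_{\mathbb{E},1}}{(\Delta v)^{\gamma}},$$ then $$\|f(T^{f})-f^{N_t}\|_{L^{\infty}_{q}}+\|\mathbb{E}(T^{f})-\mathbb{E}^{N_t}\|_{L^{\infty}_{x}}\le C\left\{\Delta x+\Delta v+\Delta t+\frac{1}{V_M^{q-3}}\right\},$$ where $N_t\Delta t=T^f$ and $C$ depends on $q$, $T^f$, $f_0$, $\alpha$,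 $\eta_1$, $\eta_2$, $\varepsilon$.
   Context: **Model.** Fix $\varepsilon>0$; $\mathbb{T}=[0,1]$ with periodic boundary conditions. The system for $f(x,v,t)$, $(x,v)\in\mathbb T\times\mathbb R$, is $\partial_tf+v\partial_xf+\mathbb{E}\partial_vf=\frac1\varepsilon(\mathcal{M}(f)-f)$, $-\partial_x^2\phi=\int_{\mathbb R}f\,dv-1$, $\mathbb E=-\partial_x\phi$, $f(0)=f_0$. Here $\mathcal M(f)=\frac{\rho}{\sqrt{2\pi T}}\exp(-\frac{|v-U|^2}{2T})$ with $\rho=\int f\,dv$, $\rho U=\int vf\,dv$, $\rho T=\int|v-U|^2f\,dv$. The field is $\mathbb E(x,t)=\int_0^1K(x,y)(\rho(y,t)-1)\,dy$ with $K(x,y)=y$ for $0\le y\le x$ and $K(x,y)=y-1$ for $x<y\le1$. **Norms.** $\|g\|_{L^\infty_q}=\sup_{x,v}|g(x,v)|(1+|v|)^q$, $\|g\|_{W^{N,\infty}_q}=\sum_{a+b\le N}\|\partial_x^a\partial_v^bg\|_{L^\infty_q}$; for grid sequences the sup is over grid points with weight $(1+|v_j|)^q$; $\|f(t^n)-f^n\|_{L^\infty_q}=\sup_{i,j}|f(x_i,v_j,t^n)-f^n_{i,j}|(1+|v_j|)^q$ and $\|\mathbb E(t^n)-\mathbb E^n\|_{L^\infty_x}=\sup_i|\mathbb E(x_i,t^n)-\mathbb E^n_i|$. **Continuous solution (known existence theorem, taken as given).** For $q>3$, $\alpha\in[1,2]$, $f_0\in C^2$ with $\|f_0\|_{W^{2,\infty}_q}<\infty$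 and $f_0\ge C_0e^{-|v|^\alpha}$, there is $T^f>0$ and a unique classical solution $(f,\mathbb E)$ on $[0,T^f]$ with: (1) $\|f(t)\|_{W^{2,\infty}_q}\le Ce^{Ct}(\|f_0\|_{W^{2,\infty}_q}+1)$, $C$ depending on $q,f_0,T^f$; (2) $\rho\ge C_{q,T^f}>0$, $T\ge C_{q,f_0,T^f}>0$, $T+|U|^2\le C_{q,f_0,T^f}$; (3) $\partial_x^a\partial_v^bf\in C([0,T^f]\times\mathbb T\times\mathbb R)$ for $a+b\le2$; (4) $\|\mathbb E(t)\|_{L^\infty_x}\le C_{q,f_0,T^f}$. When $\|f_0\|_{W^{2,\infty}_{q+2}}<\infty$, (1) is also used with $q+2$ in place of $q$. **Scheme.** Grid: $t^n=n\Delta t$ ($0\le n\le N_t$, $N_t\Delta t=T^f$), $x_i=i\Delta x$ ($N_x\Delta x=1$), $v_j=j\Delta v$ ($|j|\le N_v$, $N_v\Delta v=V_M$). Sums over $i,k$ run over $0,\dots,N_x-1$, sums over $j$ over $-N_v,\dots,N_v$. Write $a^+=\max(a,0)$, $a^-=-\min(a,0)$. Initial data: $f^0_{i,j}=f_0(x_i,v_j)$. Ghost values (Neumann): $f^n_{i,\pm(N_v+1)}=f^n_{i,\pm N_v}$. Field: $\mathbb E^n_i=\sum_kK(x_i,y_k)(\rho^n_k-1)\Delta x$, $y_k=x_k$, $\rho^n_k=\sum_jf^n_{k,j}\Delta v$, everything being $N_x$-periodic in the space index. Put $$\tilde f^n_{i,j}=\Big(1-\tfrac{\Delta t}{\Delta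 x}|v_j|-\tfrac{\Delta t}{\Delta v}|\mathbb E^n_i|\Big)f^n_{i,j}+\tfrac{\Delta t}{\Delta x}\big(v_j^+f^n_{i-1,j}+v_j^-f^n_{i+1,j}\big)+\tfrac{\Delta t}{\Delta v}\big((\mathbb E^n_i)^+f^n_{i,j-1}+(\mathbb E^n_i)^-f^n_{i,j+1}\big),$$ $(\tilde\rho^n_i,\tilde\rho^n_i\tilde U^n_i,\tilde\rho^n_i\tilde T^n_i)=\sum_j\tilde f^n_{i,j}(1,v_j,|v_j-\tilde U^n_i|^2)\Delta v$, $\mathcal M(\tilde f^n_{i,j})=\frac{\tilde\rho^n_i}{\sqrt{2\pi\tilde T^n_i}}\exp(-\frac{|v_j-\tilde U^n_i|^2}{2\tilde T^n_i})$, and $f^{n+1}_{i,j}=\frac{\varepsilon\tilde f^n_{i,j}+\Delta t\,\mathcal M(\tilde f^n_{i,j})}{\varepsilon+\Delta t}$. **Constants.** $D_{\alpha',\beta'}=\int_{\mathbb R}e^{-|v|^{\alpha'}-\beta'|v|}dv$, $\tilde D_{\alpha',\beta'}=\sup_v(1+|v|)^qe^{-|v|^{\alpha'}-\beta'|v|}$, $\bar D_{q-m}=\int_{\mathbb R}(1+|v|)^{m-q}dv$; $C_{\mathbb E,1}=(2+T^f)e^{T^f/\varepsilon}+1$, $C_{\mathbb E,2}=(2^q-1)C_{\mathbb E,1}$. Abbreviate $D=D_{\alpha,2\alpha C_{\mathbb E,1}T^f}$, $\tilde D=\tilde D_{\alpha,2\alpha C_{\mathbb E,1}T^f}$, $S=2\alpha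 C_{\mathbb E,1}+\frac{\alpha C_{\mathbb E,1}^2(T^f+1)}{\eta_1}$, $F=\|f_0\|_{L^\infty_q}$, $Q=S+C_{\mathbb E,2}+\frac{C_{\mathcal M}}{\varepsilon}$. Then $a_1=\frac{(C_0D)^{5/9}}{2^{16/9}(1+C_{\mathbb E,2})^{5/9}C_M^{2/9}F^{5/9}}e^{-\frac59QT^f}$; $a_2=\Big\{\frac{C_0^2D\tilde D}{4(q-3)\bar D_{q-2}(C_0D+8)(1+C_{\mathbb E,2})F}\Big\}^{\frac1{q-1}}\exp\big(-\frac{1}{q-1}(2S+C_{\mathbb E,2}+\frac{C_{\mathcal M}+1}{\varepsilon})T^f\big)$; $a_3=\frac{(C_0D)^{\theta}}{2^{\frac{4q+12}{3q+3}}(1+C_{\mathbb E,2})^{\theta}C_M^{\frac{2q}{3q+3}}F^{\theta}}e^{-\theta QT^f}$ with $\theta=\frac{2q+3}{3q+3}$; $a_4=\Big(\frac{C_0D}{4(1+C_{\mathbb E,2})C_MF}e^{-QT^f}\Big)^{2/3}$; $a_5=\Big(2C_{\mathbb E,1}^{1-q}(1+C_{\mathbb E,2})e^{(C_{\mathbb E,2}+\frac{2(C_{\mathcal M}-1)}{\varepsilon})T^f}F\Big)^{-\frac1{q\gamma}}$. $l>0$ is chosen so small that $\Delta x,\Delta v<l$ implies, for $(\alpha',\beta')\in\{(\alpha,2\alpha C_{\mathbb E,1}T^f),(2,0)\}$ and $m\in\{0,1,2\}$: $\frac12D_{\alpha',\beta'}\le\sum_je^{-|v_j|^{\alpha'}-\beta'|v_j|}\Delta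 v\le2D_{\alpha',\beta'}$; $\frac12\tilde D_{\alpha',\beta'}\le\sup_j(1+|v_j|)^qe^{-|v_j|^{\alpha'}-\beta'|v_j|}\le2\tilde D_{\alpha',\beta'}$; $\frac12\bar D_{q-m}\le\sum_j\frac{\Delta v}{(1+|v_j|)^{q-m}}\le2\bar D_{q-m}$; $\sum_{i,j}f_0(x_i,v_j)\Delta x\Delta v\le2$. Finally $r_{\Delta x}=\min\{l,\frac1{4\alpha C_{\mathbb E,1}},\frac12\}$, $r_{\Delta v}=\min\big\{a_1,a_2,a_3,l,l\sqrt{2a_4},a_5,(\frac{1-\eta_2}{\eta_2}\Delta x)^{\frac1{1-\gamma}},\frac1{4\alpha\{C_{\mathbb E,1}(T^f+1)+1\}},\frac12\big\}$ (so $r_{\Delta v}$ depends on $\Delta x$). *)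

theory Defs
  imports "HOL-Analysis.Analysis"
begin

text \<open>
  Functions on the phase space (one-dimensional torus times velocity line) are curried functions
  of type \<^typ>\<open>real \<Rightarrow> real \<Rightarrow> real\<close>, position first, that are 1-periodic in the position.
\<close>

definition periodic_x :: "(real \<Rightarrow> 'a) \<Rightarrow> bool" where
  "periodic_x g \<longleftrightarrow> (\<forall>x. g (x + 1) = g x)"

definition deriv_x :: "(real \<Rightarrow> real \<Rightarrow> real) \<Rightarrow> real \<Rightarrow> real \<Rightarrow> real" where
  "deriv_x g x v = deriv (\<lambda>y. g y v) x"

definition deriv_v :: "(real \<Rightarrow> real \<Rightarrow> real) \<Rightarrow> real \<Rightarrow> real \<Rightarrow> real" where
  "deriv_v g x v = deriv (\<lambda>w. g x w) v"

definition pderiv_xv :: "nat \<Rightarrow> nat \<Rightarrow> (real \<Rightarrow> real \<Rightarrow> real) \<Rightarrow> real \<Rightarrow> real \<Rightarrow> real" where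
  "pderiv_xv a b g = (deriv_x ^^ a) ((deriv_v ^^ b) g)"

text \<open>The class of functions all of whose iterated partial derivatives, in any order, up to
  order \<open>N\<close> exist and are jointly continuous.\<close>

primrec C_class :: "nat \<Rightarrow> (real \<Rightarrow> real \<Rightarrow> real) \<Rightarrow> bool" where
  "C_class 0 g \<longleftrightarrow> continuous_on UNIV (\<lambda>(x, v). g x v)"
| "C_class (Suc N) g \<longleftrightarrow>
     (\<forall>x v. (\<lambda>y. g y v) differentiable (at x) \<and> (\<lambda>w. g x w) differentiable (at v)) \<and>
     C_class N (deriv_x g) \<and> C_class N (deriv_v g)"

text \<open>Valued in the extended nonnegative reals, so that finiteness is meaningful.\<close>

definition Linf_norm :: "real \<Rightarrow> (real \<Rightarrow> real \<Rightarrow> real) \<Rightarrow> ennreal" where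
  "Linf_norm q g = (SUP x. SUP v. ennreal (\<bar>g x v\<bar> * (1 + \<bar>v\<bar>) powr q))"

definition Winf_norm :: "nat \<Rightarrow> real \<Rightarrow> (real \<Rightarrow> real \<Rightarrow> real) \<Rightarrow> ennreal" where
  "Winf_norm N q g = (\<Sum>a\<le>N. \<Sum>b\<le>N - a. Linf_norm q (pderiv_xv a b g))"

definition maxwellian :: "real \<Rightarrow> real \<Rightarrow> real \<Rightarrow> real \<Rightarrow> real" where
  "maxwellian \<rho> U T v = \<rho> / sqrt (2 * pi * T) * exp (- (\<bar>v - U\<bar>\<^sup>2 / (2 * T)))"

definition dens :: "(real \<Rightarrow> real \<Rightarrow> real) \<Rightarrow> real \<Rightarrow> real" where
  "dens g x = (LINT v|lborel. g x v)"

definition bulk :: "(real \<Rightarrow> real \<Rightarrow> real) \<Rightarrow> real \<Rightarrow> real" where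
  "bulk g x = (LINT v|lborel. v * g x v) / dens g x"

definition temp :: "(real \<Rightarrow> real \<Rightarrow> real) \<Rightarrow> real \<Rightarrow> real" where
  "temp g x = (LINT v|lborel. \<bar>v - bulk g x\<bar>\<^sup>2 * g x v) / dens g x"

definition local_maxwellian :: "(real \<Rightarrow> real \<Rightarrow> real) \<Rightarrow> real \<Rightarrow> real \<Rightarrow> real" where
  "local_maxwellian g x v = maxwellian (dens g x) (bulk g x) (temp g x) v"

definition field_kernel :: "real \<Rightarrow> real \<Rightarrow> real" where
  "field_kernel x y = (if y \<le> x then y else y - 1)"

text \<open>
  Time is the first argument: \<open>f t x v\<close>, \<open>E t x\<close>, \<open>\<phi> t x\<close>.  Time derivatives at the end
  points of the time interval are one-sided.
  The Poisson equation is stated both through a periodic potential \<open>\<phi>\<close> and in its integrated form;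
  the latter is the solution of the former, because the kernel has mean zero in its first argument.
\<close>

definition classical_solution ::
  "real \<Rightarrow> (real \<Rightarrow> real \<Rightarrow> real) \<Rightarrow> real \<Rightarrow>
   (real \<Rightarrow> real \<Rightarrow> real \<Rightarrow> real) \<Rightarrow> (real \<Rightarrow> real \<Rightarrow> real) \<Rightarrow> bool" where
  "classical_solution \<epsilon> f0 Tf f E \<longleftrightarrow>
     f 0 = f0 \<and>
     (\<forall>t\<in>{0..Tf}. periodic_x (f t) \<and> periodic_x (E t) \<and> C_class 1 (f t)) \<and>
     (\<forall>t\<in>{0..Tf}. \<forall>x v. \<exists>ft.
        ((\<lambda>s. f s x v) has_real_derivative ft) (at t within {0..Tf}) \<and>
        ft + v * deriv_x (f t) x v + E t x * deriv_v (f t) x v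
          = 1 / \<epsilon> * (local_maxwellian (f t) x v - f t x v)) \<and>
     (\<exists>\<phi>. \<forall>t\<in>{0..Tf}. periodic_x (\<phi> t) \<and>
        (\<forall>x. (\<phi> t has_real_derivative - E t x) (at x) \<and>
             (E t has_real_derivative dens (f t) x - 1) (at x))) \<and>
     (\<forall>t\<in>{0..Tf}. \<forall>x\<in>{0..1}.
        E t x = (LINT y:{0..1}|lborel. field_kernel x y * (dens (f t) y - 1)))"

text \<open>The next two definitions collect what the known existence theorem provides for the solution.\<close>

definition weighted_growth ::
  "real \<Rightarrow> (real \<Rightarrow> real \<Rightarrow> real) \<Rightarrow> real \<Rightarrow> (real \<Rightarrow> real \<Rightarrow> real \<Rightarrow> real) \<Rightarrow> bool" where
  "weighted_growth q f0 Tf f \<longleftrightarrow>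
     (\<exists>C>0. \<forall>t\<in>{0..Tf}. Winf_norm 2 q (f t) \<le> ennreal (C * exp (C * t)) * (Winf_norm 2 q f0 + 1))"

definition solution_bounds ::
  "real \<Rightarrow> (real \<Rightarrow> real \<Rightarrow> real) \<Rightarrow> real \<Rightarrow>
   (real \<Rightarrow> real \<Rightarrow> real \<Rightarrow> real) \<Rightarrow> (real \<Rightarrow> real \<Rightarrow> real) \<Rightarrow> bool" where
  "solution_bounds q f0 Tf f E \<longleftrightarrow>
     weighted_growth q f0 Tf f \<and> weighted_growth (q + 2) f0 Tf f \<and>
     (\<exists>c>0. \<forall>t\<in>{0..Tf}. \<forall>x. dens (f t) x \<ge> c) \<and>
     (\<exists>c>0. \<forall>t\<in>{0..Tf}. \<forall>x. temp (f t) x \<ge> c) \<and>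
     (\<exists>C. \<forall>t\<in>{0..Tf}. \<forall>x. temp (f t) x + \<bar>bulk (f t) x\<bar>\<^sup>2 \<le> C) \<and>
     (\<forall>t\<in>{0..Tf}. C_class 2 (f t)) \<and>
     (\<forall>a b. a + b \<le> 2 \<longrightarrow>
        continuous_on ({0..Tf} \<times> UNIV \<times> UNIV) (\<lambda>(t, x, v). pderiv_xv a b (f t) x v)) \<and>
     (\<exists>C. \<forall>t\<in>{0..Tf}. \<forall>x. \<bar>E t x\<bar> \<le> C)"

text \<open>The lower bound by a multiple of \<open>exp (- (\<bar>v\<bar> powr \<alpha>))\<close> is stated separately, where its constant is bound.\<close>

definition initial_datum :: "real \<Rightarrow> (real \<Rightarrow> real \<Rightarrow> real) \<Rightarrow> bool" where
  "initial_datum q f0 \<longleftrightarrow>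
     periodic_x f0 \<and> (\<forall>x v. 0 \<le> f0 x v) \<and> C_class 2 f0 \<and>
     Winf_norm 2 q f0 < \<infinity> \<and> Winf_norm 2 (q + 2) f0 < \<infinity> \<and>
     (LINT x:{0..1}|lborel. (LINT v|lborel. f0 x v)) = 1"

record mesh =
  Dx :: real
  Dv :: real
  Dt :: real
  Nx :: nat
  Nv :: nat

text \<open>
  Grid functions are indexed by two integers.  Only indices in \<open>xidx\<close> and \<open>vidx\<close> carry data;
  values outside are supplied by \<open>extend\<close>.
\<close>

type_synonym gridfun = "int \<Rightarrow> int \<Rightarrow> real"

definition phase_mesh :: "real \<Rightarrow> mesh \<Rightarrow> bool" where
  "phase_mesh V m \<longleftrightarrow>
     0 < Dx m \<and> 0 < Dv m \<and> real (Nx m) * Dx m = 1 \<and> real (Nv m) * Dv m = V"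

definition xidx :: "mesh \<Rightarrow> int set" where
  "xidx m = {0..<int (Nx m)}"

definition vidx :: "mesh \<Rightarrow> int set" where
  "vidx m = {- int (Nv m)..int (Nv m)}"

definition xpt :: "mesh \<Rightarrow> int \<Rightarrow> real" where
  "xpt m i = real_of_int i * Dx m"

definition vpt :: "mesh \<Rightarrow> int \<Rightarrow> real" where
  "vpt m j = real_of_int j * Dv m"

text \<open>Periodic in the space index; constant continuation (Neumann ghost values) in the velocity
  index.\<close>

definition extend :: "mesh \<Rightarrow> gridfun \<Rightarrow> gridfun" where
  "extend m g i j = g (i mod int (Nx m)) (max (- int (Nv m)) (min (int (Nv m)) j))"

definition dens_h :: "mesh \<Rightarrow> gridfun \<Rightarrow> int \<Rightarrow> real" where
  "dens_h m g i = (\<Sum>j\<in>vidx m. g i j * Dv m)"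

definition bulk_h :: "mesh \<Rightarrow> gridfun \<Rightarrow> int \<Rightarrow> real" where
  "bulk_h m g i = (\<Sum>j\<in>vidx m. g i j * vpt m j * Dv m) / dens_h m g i"

definition temp_h :: "mesh \<Rightarrow> gridfun \<Rightarrow> int \<Rightarrow> real" where
  "temp_h m g i = (\<Sum>j\<in>vidx m. g i j * \<bar>vpt m j - bulk_h m g i\<bar>\<^sup>2 * Dv m) / dens_h m g i"

definition maxwellian_h :: "mesh \<Rightarrow> gridfun \<Rightarrow> gridfun" where
  "maxwellian_h m g i j = maxwellian (dens_h m g i) (bulk_h m g i) (temp_h m g i) (vpt m j)"

definition field_h :: "mesh \<Rightarrow> gridfun \<Rightarrow> int \<Rightarrow> real" where
  "field_h m g i =
     (\<Sum>k\<in>xidx m. field_kernel (xpt m (i mod int (Nx m))) (xpt m k) * (dens_h m g k - 1) * Dx m)"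

definition pos_part :: "real \<Rightarrow> real" where
  "pos_part a = max a 0"

definition neg_part :: "real \<Rightarrow> real" where
  "neg_part a = - min a 0"

definition transport_h :: "mesh \<Rightarrow> gridfun \<Rightarrow> gridfun" where
  "transport_h m g i j =
     (let h = extend m g; e = field_h m g i; v = vpt m j in
       (1 - Dt m / Dx m * \<bar>v\<bar> - Dt m / Dv m * \<bar>e\<bar>) * h i j
       + Dt m / Dx m * (pos_part v * h (i - 1) j + neg_part v * h (i + 1) j)
       + Dt m / Dv m * (pos_part e * h i (j - 1) + neg_part e * h i (j + 1)))"

definition step_h :: "real \<Rightarrow> mesh \<Rightarrow> gridfun \<Rightarrow> gridfun" where
  "step_h \<epsilon> m g i j =
     (let h = transport_h m g in
       (\<epsilon> * h i j + Dt m * maxwellian_h m h i j) / (\<epsilon> + Dt m))"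

primrec f_h :: "real \<Rightarrow> mesh \<Rightarrow> (real \<Rightarrow> real \<Rightarrow> real) \<Rightarrow> nat \<Rightarrow> gridfun" where
  "f_h \<epsilon> m f0 0 = (\<lambda>i j. f0 (xpt m i) (vpt m j))"
| "f_h \<epsilon> m f0 (Suc n) = step_h \<epsilon> m (f_h \<epsilon> m f0 n)"

definition E_h :: "real \<Rightarrow> mesh \<Rightarrow> (real \<Rightarrow> real \<Rightarrow> real) \<Rightarrow> nat \<Rightarrow> int \<Rightarrow> real" where
  "E_h \<epsilon> m f0 n = field_h m (f_h \<epsilon> m f0 n)"

definition Linf_error :: "mesh \<Rightarrow> real \<Rightarrow> (real \<Rightarrow> real \<Rightarrow> real) \<Rightarrow> gridfun \<Rightarrow> real" where
  "Linf_error m q g h =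
     (SUP (i, j)\<in>xidx m \<times> vidx m.
        \<bar>g (xpt m i) (vpt m j) - h i j\<bar> * (1 + \<bar>vpt m j\<bar>) powr q)"

definition field_error :: "mesh \<Rightarrow> (real \<Rightarrow> real) \<Rightarrow> (int \<Rightarrow> real) \<Rightarrow> real" where
  "field_error m e eh = (SUP i\<in>xidx m. \<bar>e (xpt m i) - eh i\<bar>)"

definition D_int :: "real \<Rightarrow> real \<Rightarrow> real" where
  "D_int \<alpha> \<beta> = (LINT v|lborel. exp (- (\<bar>v\<bar> powr \<alpha>) - \<beta> * \<bar>v\<bar>))"

definition D_sup :: "real \<Rightarrow> real \<Rightarrow> real \<Rightarrow> real" where
  "D_sup q \<alpha> \<beta> = (SUP v. (1 + \<bar>v\<bar>) powr q * exp (- (\<bar>v\<bar> powr \<alpha>) - \<beta> * \<bar>v\<bar>))"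

definition D_bar :: "real \<Rightarrow> real" where
  "D_bar s = (LINT v|lborel. (1 + \<bar>v\<bar>) powr (- s))"

definition C_E1 :: "real \<Rightarrow> real \<Rightarrow> real" where
  "C_E1 \<epsilon> Tf = (2 + Tf) * exp (Tf / \<epsilon>) + 1"

definition C_E2 :: "real \<Rightarrow> real \<Rightarrow> real \<Rightarrow> real" where
  "C_E2 q \<epsilon> Tf = (2 powr q - 1) * C_E1 \<epsilon> Tf"

definition beta_E :: "real \<Rightarrow> real \<Rightarrow> real \<Rightarrow> real" where
  "beta_E \<alpha> \<epsilon> Tf = 2 * \<alpha> * C_E1 \<epsilon> Tf * Tf"

text \<open>The velocity cut-off is tied to the mesh size, \<open>V = C_E1 / (Dv powr \<gamma>)\<close>, also in the
  requirement on \<open>l\<close>: the sums over \<open>j\<close> approximate integrals over the whole line only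
  when the cut-off grows as \<open>Dv\<close> decreases.\<close>

definition admissible_l ::
  "real \<Rightarrow> real \<Rightarrow> real \<Rightarrow> real \<Rightarrow> real \<Rightarrow> (real \<Rightarrow> real \<Rightarrow> real) \<Rightarrow> real \<Rightarrow> bool" where
  "admissible_l q \<alpha> \<epsilon> Tf \<gamma> f0 l \<longleftrightarrow> 0 < l \<and>
     (\<forall>m. phase_mesh (C_E1 \<epsilon> Tf / Dv m powr \<gamma>) m \<and> Dx m < l \<and> Dv m < l \<longrightarrow>
        (\<forall>(\<alpha>', \<beta>')\<in>{(\<alpha>, beta_E \<alpha> \<epsilon> Tf), (2, 0)}.
           (let s = (\<Sum>j\<in>vidx m. exp (- (\<bar>vpt m j\<bar> powr \<alpha>') - \<beta>' * \<bar>vpt m j\<bar>) * Dv m) in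
              1 / 2 * D_int \<alpha>' \<beta>' \<le> s \<and> s \<le> 2 * D_int \<alpha>' \<beta>') \<and>
           (let s = (SUP j\<in>vidx m. (1 + \<bar>vpt m j\<bar>) powr q
                       * exp (- (\<bar>vpt m j\<bar> powr \<alpha>') - \<beta>' * \<bar>vpt m j\<bar>)) in
              1 / 2 * D_sup q \<alpha>' \<beta>' \<le> s \<and> s \<le> 2 * D_sup q \<alpha>' \<beta>')) \<and>
        (\<forall>k\<in>{0, 1, 2}.
           (let s = (\<Sum>j\<in>vidx m. Dv m / (1 + \<bar>vpt m j\<bar>) powr (q - k)) in
              1 / 2 * D_bar (q - k) \<le> s \<and> s \<le> 2 * D_bar (q - k))) \<and>
        (\<Sum>i\<in>xidx m. \<Sum>j\<in>vidx m. f0 (xpt m i) (vpt m j) * Dx m * Dv m) \<le> 2)"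

definition S_const :: "real \<Rightarrow> real \<Rightarrow> real \<Rightarrow> real \<Rightarrow> real" where
  "S_const \<alpha> \<epsilon> Tf \<eta>1 =
     2 * \<alpha> * C_E1 \<epsilon> Tf + \<alpha> * (C_E1 \<epsilon> Tf)\<^sup>2 * (Tf + 1) / \<eta>1"

definition r_Dx :: "real \<Rightarrow> real \<Rightarrow> real \<Rightarrow> real \<Rightarrow> real" where
  "r_Dx \<alpha> \<epsilon> Tf l = Min {l, 1 / (4 * \<alpha> * C_E1 \<epsilon> Tf), 1 / 2}"

text \<open>In the following definition \<open>hx\<close> is the space mesh size, and \<open>CM\<close>, \<open>CMax\<close>
  are the two constants depending on \<open>q\<close> only whose existence is asserted by the theorem
  (\<open>CMax\<close> belongs to the Maxwellian and appears in the exponentials divided by \<open>\<epsilon>\<close>).\<close>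

definition r_Dv ::
  "real \<Rightarrow> real \<Rightarrow> real \<Rightarrow> real \<Rightarrow> (real \<Rightarrow> real \<Rightarrow> real) \<Rightarrow> real \<Rightarrow> real \<Rightarrow> real \<Rightarrow> real \<Rightarrow>
   real \<Rightarrow> real \<Rightarrow> real \<Rightarrow> real \<Rightarrow> real" where
  "r_Dv CM CMax q \<alpha> f0 C0 \<epsilon> Tf \<eta>1 \<eta>2 \<gamma> l hx =
     (let CE1 = C_E1 \<epsilon> Tf;
          CE2 = C_E2 q \<epsilon> Tf;
          D = D_int \<alpha> (beta_E \<alpha> \<epsilon> Tf);
          Dtil = D_sup q \<alpha> (beta_E \<alpha> \<epsilon> Tf);
          S = S_const \<alpha> \<epsilon> Tf \<eta>1;
          F = enn2real (Linf_norm q f0);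
          Q = S + CE2 + CMax / \<epsilon>;
          \<theta> = (2 * q + 3) / (3 * q + 3);
          a1 = (C0 * D) powr (5/9)
               / (2 powr (16/9) * (1 + CE2) powr (5/9) * CM powr (2/9) * F powr (5/9))
               * exp (- (5/9) * Q * Tf);
          a2 = (C0\<^sup>2 * D * Dtil
                / (4 * (q - 3) * D_bar (q - 2) * (C0 * D + 8) * (1 + CE2) * F)) powr (1 / (q - 1))
               * exp (- (1 / (q - 1)) * (2 * S + CE2 + (CMax + 1) / \<epsilon>) * Tf);
          a3 = (C0 * D) powr \<theta>
               / (2 powr ((4 * q + 12) / (3 * q + 3)) * (1 + CE2) powr \<theta>
                  * CM powr (2 * q / (3 * q + 3)) * F powr \<theta>)
               * exp (- \<theta> * Q * Tf);
          a4 = (C0 * D / (4 * (1 + CE2) * CM * F) * exp (- Q * Tf)) powr (2/3);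
          a5 = (2 * CE1 powr (1 - q) * (1 + CE2) * exp ((CE2 + 2 * (CMax - 1) / \<epsilon>) * Tf) * F)
               powr (- (1 / (q * \<gamma>)))
      in Min {a1, a2, a3, l, l * sqrt (2 * a4), a5,
              ((1 - \<eta>2) / \<eta>2 * hx) powr (1 / (1 - \<gamma>)),
              1 / (4 * \<alpha> * (CE1 * (Tf + 1) + 1)), 1 / 2})"

end

theory Submission
  imports Defs "HOL-Probability.Sinc_Integral"
begin

text \<open>
  The scheme is a first-order upwind step followed by an implicit relaxation, and it converges
  because it is stable and consistent in the weighted sup norm.

  Stability. As long as the discrete field is at most \<open>C_E1\<close>, the conditions on the mesh make the
  upwind step a convex combination of neighbouring values, so it keeps lower and upper bounds up
  to the distortion that a shift by one velocity cell inflicts on them (\<open>upwind_le\<close>,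
  \<open>upwind_weighted\<close>, \<open>transport_lower\<close>). The field in turn is bounded by the discrete mass plus
  one, and mass can grow only through the ghost cells and through the discrete Maxwellian, whose
  grid sum need not be the density. Both growth rates, and the weighted bound of the Maxwellian by
  the data from which it is built (\<open>maxwellian_grid_bound\<close>, the discrete form of an estimate of
  Perthame and Pulvirenti), are under control once the velocity cell is small compared with the
  thermal speed. A lower bound of the temperature follows from the barrier
  \<open>C0 * exp (- \<bar>v\<bar> powr \<alpha> - \<beta> * \<bar>v\<bar>)\<close> below the discrete solution: the barrier bounds the pressure
  from below, the weighted norm bounds the density from above (\<open>temp_lower\<close>). The first
  entry of the minimum defining \<open>r_Dv\<close> is exactly what turns this bound into the smallness of the
  cell (\<open>mesh_ok_velocity_step\<close>). All these bounds are propagated together by induction on the time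
  step (\<open>apriori\<close>).

  Consistency. Second derivatives in time are avoided by following the straight line
  \<open>s \<mapsto> (x + v * (s - t1), v + e * (s - t1))\<close> with the frozen field \<open>e\<close>: along it the transport
  terms of the equation cancel up to first order, and what remains is the relaxation term, which is
  Lipschitz in time, space and velocity (\<open>local_truncation\<close>). The upwind step agrees with the foot
  of this line up to \<open>Dt * (Dx + Dv + Dt)\<close> (\<open>upwind_consistency\<close>); in the ghost cells the
  missing difference is paid for by two spare powers of the weight, and \<open>\<gamma> \<ge> 1 / 2\<close> makes
  \<open>(1 + V) powr - 2\<close> at most \<open>Dv\<close>. Moments and field are computed by quadrature with an error
  \<open>Dx + Dv + 1 / V powr (q - 3)\<close> (\<open>moment_quadrature\<close>, \<open>field_quadrature\<close>).

  Since a Maxwellian is Lipschitz in its moments as long as density and temperature stay away from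
  zero (\<open>mxw_bounds\<close>), the error \<open>N\<close> after one more step is at most
  \<open>N * (1 + C * Dt) + C * Dt * h\<close>, where \<open>h\<close> is the claimed order (\<open>step_error\<close>), and a discrete Gronwall
  argument concludes (\<open>convergence\<close>).
\<close>

section \<open>Velocity weights and sums over the velocity grid\<close>

text \<open>The reciprocal of the weight in the norms: \<open>\<bar>g v\<bar> \<le> N * wt s v\<close> for all \<open>v\<close> says that the norm of
  \<open>g\<close> with exponent \<open>s\<close> is at most \<open>N\<close>.\<close>

definition wt :: "real \<Rightarrow> real \<Rightarrow> real" where
  "wt s v = (1 + \<bar>v\<bar>) powr (- s)"

lemma wt_pos [simp]: "0 < wt s v"
  by (simp add: wt_def add_pos_nonneg)

lemma wt_nonneg [simp]: "0 \<le> wt s v"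
  using wt_pos less_imp_le by blast

lemma wt_minus [simp]: "wt s (- v) = wt s v"
  by (simp add: wt_def)

lemma wt_mono: "s \<le> s' \<Longrightarrow> wt s' v \<le> wt s v"
  by (simp add: wt_def powr_mono)

lemma wt_inverse: "wt s v * (1 + \<bar>v\<bar>) powr s = 1"
  by (simp add: wt_def powr_minus add_pos_nonneg)

lemma wt_le_iff: "a \<le> N * wt s v \<longleftrightarrow> a * (1 + \<bar>v\<bar>) powr s \<le> N"
proof -
  have p: "0 < (1 + \<bar>v\<bar>) powr s" by (simp add: add_pos_nonneg)
  have "wt s v = 1 / (1 + \<bar>v\<bar>) powr s" by (simp add: wt_def powr_minus_divide)
  then show ?thesis using p by (simp add: pos_le_divide_eq)
qed

lemma wt_add: "wt (s + t) v = wt s v * wt t v"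
  by (simp add: wt_def powr_add[symmetric])

lemma wt_absorb: "(1 + \<bar>v\<bar>) ^ k * wt (s + real k) v = wt s v"
proof -
  have "(1 + \<bar>v\<bar>) ^ k = (1 + \<bar>v\<bar>) powr real k"
    by (simp add: powr_realpow add_pos_nonneg)
  then show ?thesis
    unfolding wt_def by (simp add: powr_add[symmetric])
qed

lemma abs_wt_absorb: "\<bar>v\<bar> ^ k * wt (s + real k) v \<le> wt s v"
proof -
  have "\<bar>v\<bar> ^ k * wt (s + real k) v \<le> (1 + \<bar>v\<bar>) ^ k * wt (s + real k) v"
    by (intro mult_right_mono power_mono) auto
  then show ?thesis by (simp add: wt_absorb)
qed

text \<open>Weights at a bounded distance are comparable, so neither a shift by one cell nor a displacement
  during one time step destroys a weighted bound.\<close>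

lemma wt_shift:
  assumes "\<bar>v - v'\<bar> \<le> K" "0 \<le> s"
  shows "wt s v' \<le> (1 + K) powr s * wt s v"
proof -
  have K: "0 \<le> K" using assms by linarith
  have "1 + \<bar>v\<bar> \<le> 1 + \<bar>v'\<bar> + K" using assms by linarith
  also have "\<dots> \<le> (1 + K) * (1 + \<bar>v'\<bar>)" using K by (simp add: algebra_simps)
  finally have "(1 + \<bar>v\<bar>) powr s \<le> ((1 + K) * (1 + \<bar>v'\<bar>)) powr s"
    using assms by (intro powr_mono2) auto
  also have "\<dots> = (1 + K) powr s * (1 + \<bar>v'\<bar>) powr s"
    using K by (simp add: powr_mult)
  finally have 1: "(1 + \<bar>v\<bar>) powr s \<le> (1 + K) powr s * (1 + \<bar>v'\<bar>) powr s" .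
  have "wt s v' = wt s v' * (wt s v * (1 + \<bar>v\<bar>) powr s)"
    using wt_inverse[of s v] by simp
  also have "\<dots> \<le> wt s v' * (wt s v * ((1 + K) powr s * (1 + \<bar>v'\<bar>) powr s))"
    by (intro mult_left_mono 1) auto
  also have "\<dots> = (1 + K) powr s * wt s v * (wt s v' * (1 + \<bar>v'\<bar>) powr s)"
    by (simp add: mult_ac)
  finally show ?thesis by (simp add: wt_inverse)
qed

text \<open>One integrable majorant with an explicit integral, the Cauchy density, serves for all velocity
  integrals.\<close>

lemma wt_le_Cauchy:
  assumes "2 \<le> s" shows "wt s v \<le> 1 / (1 + v\<^sup>2)"
proof -
  have "wt s v \<le> wt 2 v" using assms by (rule wt_mono)
  also have "wt 2 v = 1 / (1 + \<bar>v\<bar>) ^ 2"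
    by (simp add: wt_def powr_minus_divide powr_numeral)
  also have "\<dots> \<le> 1 / (1 + v\<^sup>2)"
    by (intro divide_left_mono mult_pos_pos)
      (auto simp: power2_eq_square algebra_simps add_pos_nonneg abs_mult_self_eq)
  finally show ?thesis .
qed

lemma finite_vidx [simp]: "finite (vidx m)" and finite_xidx [simp]: "finite (xidx m)"
  by (simp_all add: vidx_def xidx_def)

lemma vpt_minus: "vpt m (- j) = - vpt m j" by (simp add: vpt_def)

lemma sum_vidx_minus: "(\<Sum>j\<in>vidx m. h (- j)) = (\<Sum>j\<in>vidx m. h j)"
  by (rule sum.reindex_bij_witness[of _ uminus uminus]) (auto simp: vidx_def)

lemma vidx_near_sum:
  assumes "0 < Dv m" "0 \<le> r"
  shows "(\<Sum>j\<in>{j\<in>vidx m. \<bar>vpt m j - u\<bar> < r}. Dv m) \<le> 2 * r + Dv m"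
proof -
  let ?S = "{j\<in>vidx m. \<bar>vpt m j - u\<bar> < r}"
  let ?I = "{\<lceil>(u - r) / Dv m\<rceil>..\<lfloor>(u + r) / Dv m\<rfloor>}"
  have "?S \<subseteq> ?I"
  proof
    fix j assume "j \<in> ?S"
    then have "\<bar>j * Dv m - u\<bar> < r" by (simp add: vpt_def)
    then have "(u - r) / Dv m \<le> j" "j \<le> (u + r) / Dv m"
      using assms by (auto simp: field_simps abs_if split: if_splits)
    then show "j \<in> ?I" by (simp add: ceiling_le_iff le_floor_iff)
  qed
  then have "card ?S \<le> card ?I" by (intro card_mono) auto
  also have "\<dots> = nat (\<lfloor>(u + r) / Dv m\<rfloor> - \<lceil>(u - r) / Dv m\<rceil> + 1)"
    by simp
  finally have c: "int (card ?S) \<le> max 0 (\<lfloor>(u + r) / Dv m\<rfloor> - \<lceil>(u - r) / Dv m\<rceil> + 1)"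
    by linarith
  have b: "real_of_int (\<lfloor>(u + r) / Dv m\<rfloor> - \<lceil>(u - r) / Dv m\<rceil>) \<le> 2 * r / Dv m"
  proof -
    have "real_of_int (\<lfloor>(u + r) / Dv m\<rfloor> - \<lceil>(u - r) / Dv m\<rceil>) \<le> (u + r) / Dv m - (u - r) / Dv m"
      by (simp add: diff_mono)
    also have "\<dots> = 2 * r / Dv m" by (simp add: diff_divide_distrib[symmetric])
    finally show ?thesis .
  qed
  have "0 \<le> 2 * r / Dv m" using assms by simp
  then have "real (card ?S) \<le> 2 * r / Dv m + 1"
    using c b by linarith
  then have "real (card ?S) * Dv m \<le> (2 * r / Dv m + 1) * Dv m"
    using assms by (intro mult_right_mono) auto
  also have "\<dots> = 2 * r + Dv m" using assms by (simp add: field_simps)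
  finally show ?thesis by simp
qed

lemma sum_Un_le:
  fixes f :: "'b \<Rightarrow> real"
  assumes "finite A" "finite B" "\<And>x. 0 \<le> f x"
  shows "sum f (A \<union> B) \<le> sum f A + sum f B"
  using sum.union_inter[OF assms(1,2), of f] sum_nonneg[of "A \<inter> B" f] assms(3) by simp

lemma right_telescope_aux:
  fixes A \<psi> :: "real \<Rightarrow> real" and d :: real
  assumes d: "0 < d" and step: "\<And>x. c \<le> x \<Longrightarrow> \<psi> (x + d) * d \<le> A (x + d) - A x"
    and k: "c + d \<le> real_of_int k * d"
  shows "(\<Sum>j\<in>{k..<k + int n}. \<psi> (real_of_int j * d) * d)
    \<le> A (real_of_int (k + int n - 1) * d) - A (real_of_int (k - 1) * d)"
proof (induction n)
  case 0 then show ?case by simp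
next
  case (Suc n)
  have e: "{k..<k + int (Suc n)} = insert (k + int n) {k..<k + int n}" by auto
  have s: "\<psi> (real_of_int (k + int n) * d) * d
     \<le> A (real_of_int (k + int n) * d) - A (real_of_int (k + int n - 1) * d)"
  proof -
    have "c \<le> real_of_int (k - 1) * d" using k by (simp add: algebra_simps)
    also have "\<dots> \<le> real_of_int (k + int n - 1) * d" using d by (intro mult_right_mono) auto
    finally have "c \<le> real_of_int (k + int n - 1) * d" .
    from step[OF this] show ?thesis by (simp add: algebra_simps)
  qed
  show ?case unfolding e using Suc s by simp
qed

text \<open>Comparison of a grid sum with an integral, expressed by a primitive \<open>A\<close>: each increment of \<open>A\<close>
  over a cell dominates the summand at the right end of the cell. The sum starts one cell after
  \<open>c\<close>, so that all cells used lie to the right of \<open>c\<close>.\<close>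

lemma right_telescope:
  assumes d: "0 < Dv m" and step: "\<And>x. c \<le> x \<Longrightarrow> \<psi> (x + Dv m) * Dv m \<le> A (x + Dv m) - A x"
    and low: "\<And>x. c \<le> x \<Longrightarrow> b \<le> A x" and up: "\<And>x. c \<le> x \<Longrightarrow> A x \<le> a" and ba: "b \<le> a"
  shows "(\<Sum>j\<in>{j\<in>vidx m. c + Dv m \<le> vpt m j}. \<psi> (vpt m j) * Dv m) \<le> a - b"
proof -
  let ?d = "Dv m"
  define k where "k = max (- int (Nv m)) \<lceil>(c + ?d) / ?d\<rceil>"
  have kc: "c + ?d \<le> real_of_int j * ?d \<longleftrightarrow> \<lceil>(c + ?d) / ?d\<rceil> \<le> j" for j
    using d by (simp add: ceiling_le_iff pos_divide_le_eq)
  have S: "{j\<in>vidx m. c + ?d \<le> vpt m j} = {k..int (Nv m)}"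
    unfolding vidx_def vpt_def kc k_def by auto
  show ?thesis
  proof (cases "k \<le> int (Nv m)")
    case False
    then show ?thesis unfolding S using ba by simp
  next
    case True
    define n where "n = nat (int (Nv m) + 1 - k)"
    have I: "{k..int (Nv m)} = {k..<k + int n}" using True unfolding n_def by auto
    have k: "c + ?d \<le> real_of_int k * ?d" unfolding kc k_def by simp
    have "c \<le> real_of_int (k - 1) * ?d" using k by (simp add: algebra_simps)
    moreover have "real_of_int (k - 1) * ?d \<le> real_of_int (k + int n - 1) * ?d"
      using d by (intro mult_right_mono) auto
    ultimately have "b \<le> A (real_of_int (k - 1) * ?d)" "A (real_of_int (k + int n - 1) * ?d) \<le> a"
      by (auto intro: low up)
    moreover have "(\<Sum>j\<in>{k..<k + int n}. \<psi> (real_of_int j * ?d) * ?d)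
      \<le> A (real_of_int (k + int n - 1) * ?d) - A (real_of_int (k - 1) * ?d)"
      by (rule right_telescope_aux[where c = c and \<psi> = \<psi> and A = A, OF d step k])
    ultimately show ?thesis unfolding S I by (simp add: vpt_def)
  qed
qed

lemma left_telescope:
  assumes d: "0 < Dv m" and step: "\<And>x. - c \<le> x \<Longrightarrow> \<psi> (- (x + Dv m)) * Dv m \<le> A (x + Dv m) - A x"
    and low: "\<And>x. - c \<le> x \<Longrightarrow> b \<le> A x" and up: "\<And>x. - c \<le> x \<Longrightarrow> A x \<le> a" and ba: "b \<le> a"
  shows "(\<Sum>j\<in>{j\<in>vidx m. vpt m j \<le> c - Dv m}. \<psi> (vpt m j) * Dv m) \<le> a - b"
proof -
  have "(\<Sum>j\<in>{j\<in>vidx m. vpt m j \<le> c - Dv m}. \<psi> (vpt m j) * Dv m)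
    = (\<Sum>j\<in>{j\<in>vidx m. - c + Dv m \<le> vpt m j}. \<psi> (- vpt m j) * Dv m)"
    by (rule sum.reindex_bij_witness[of _ uminus uminus]) (auto simp: vidx_def vpt_def)
  also have "\<dots> \<le> a - b"
    by (rule right_telescope[where A = A and \<psi> = "\<lambda>x. \<psi> (- x)", OF d step low up ba])
  finally show ?thesis .
qed

lemma powr_cell:
  fixes y d s :: real
  assumes "0 < y" "0 < d" "1 < s"
  shows "(y + d) powr (- s) * d \<le> - ((y + d) powr (1 - s)) / (s - 1) - - (y powr (1 - s)) / (s - 1)"
proof -
  have "\<exists>z. y < z \<and> z < y + d \<and> (\<lambda>x. - (x powr (1 - s)) / (s - 1)) (y + d)
    - (\<lambda>x. - (x powr (1 - s)) / (s - 1)) y = (y + d - y) * z powr (- s)"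
  proof (rule MVT2[where f = "\<lambda>x::real. - (x powr (1 - s)) / (s - 1)" and f' = "\<lambda>z. z powr (- s)"])
    fix x :: real assume "y \<le> x" "x \<le> y + d"
    then have x: "0 < x" using assms by simp
    show "((\<lambda>x. - (x powr (1 - s)) / (s - 1)) has_real_derivative x powr (- s)) (at x)"
    proof -
      have "- 1 / (s - 1) * ((1 - s) * x powr (1 - s - 1)) = x powr (- s)"
        using assms by (simp add: field_simps)
      then show ?thesis
        using DERIV_cmult[OF has_real_derivative_powr[OF x, of "1 - s"], of "- 1 / (s - 1)"]
        by (simp only:) simp
    qed
  qed (use assms in auto)
  then obtain z where z: "y < z" "z < y + d"
    "- ((y + d) powr (1 - s)) / (s - 1) - - (y powr (1 - s)) / (s - 1) = d * z powr (- s)"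
    by auto
  have "(y + d) powr (- s) \<le> z powr (- s)"
    using z assms by (intro powr_mono2') auto
  then have "(y + d) powr (- s) * d \<le> d * z powr (- s)"
    using assms by (simp add: mult.commute mult_left_mono)
  then show ?thesis using z(3) by linarith
qed

text \<open>The bound does not see the velocity cut-off, hence it may be used while the cut-off grows.\<close>

lemma sum_wt:
  assumes d: "0 < Dv m" and s: "1 < s"
  shows "(\<Sum>j\<in>vidx m. wt s (vpt m j) * Dv m) \<le> Dv m + 2 / (s - 1)"
proof -
  let ?d = "Dv m"
  define A where "A x = - ((1 + x) powr (1 - s)) / (s - 1)" for x :: real
  have step: "wt s (x + ?d) * ?d \<le> A (x + ?d) - A x" if "0 \<le> x" for x
    using powr_cell[of "1 + x" ?d s] that d s unfolding A_def wt_def by (simp add: add.assoc)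
  have lo: "- 1 / (s - 1) \<le> A x" if "0 \<le> x" for x
  proof -
    have "(1 + x) powr (1 - s) \<le> 1" using that s powr_mono[of "1 - s" 0 "1 + x"] by simp
    then show ?thesis unfolding A_def using s by (simp add: divide_right_mono)
  qed
  have up: "A x \<le> 0" for x unfolding A_def using s by (simp add: divide_nonpos_pos)
  have ba: "- 1 / (s - 1) \<le> (0::real)" using s by simp
  have R: "(\<Sum>j\<in>{j\<in>vidx m. 0 + ?d \<le> vpt m j}. wt s (vpt m j) * ?d) \<le> 0 - - 1 / (s - 1)"
    by (rule right_telescope[where A = A, OF d step lo up ba])
  have L: "(\<Sum>j\<in>{j\<in>vidx m. vpt m j \<le> 0 - ?d}. wt s (vpt m j) * ?d) \<le> 0 - - 1 / (s - 1)"
  proof (rule left_telescope[where A = A, OF d])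
    show "wt s (- (x + ?d)) * ?d \<le> A (x + ?d) - A x" if "- 0 \<le> x" for x
      using step[of x] that by (simp only: wt_minus)
  qed (use lo up ba in auto)
  have V: "vidx m = {0} \<union> {j\<in>vidx m. 0 + ?d \<le> vpt m j} \<union> {j\<in>vidx m. vpt m j \<le> 0 - ?d}"
  proof -
    have "j = 0 \<or> ?d \<le> vpt m j \<or> vpt m j \<le> - ?d" for j
    proof -
      consider "j = 0" | "1 \<le> real_of_int j" | "real_of_int j \<le> - 1" by linarith
      then show ?thesis
      proof cases
        case 2 then have "1 * ?d \<le> real_of_int j * ?d" using d by (intro mult_right_mono) auto
        then show ?thesis by (simp add: vpt_def)
      next
        case 3 then have "real_of_int j * ?d \<le> (-1) * ?d" using d by (intro mult_right_mono) auto
        then show ?thesis by (simp add: vpt_def)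
      qed simp
    qed
    then show ?thesis by (auto simp: vidx_def)
  qed
  have "(\<Sum>j\<in>vidx m. wt s (vpt m j) * ?d)
    \<le> (\<Sum>j\<in>{0} \<union> {j\<in>vidx m. 0 + ?d \<le> vpt m j}. wt s (vpt m j) * ?d)
      + (\<Sum>j\<in>{j\<in>vidx m. vpt m j \<le> 0 - ?d}. wt s (vpt m j) * ?d)"
    by (subst V, rule sum_Un_le) (use d in auto)
  also have "\<dots> \<le> (\<Sum>j\<in>{0}. wt s (vpt m j) * ?d) + (\<Sum>j\<in>{j\<in>vidx m. 0 + ?d \<le> vpt m j}. wt s (vpt m j) * ?d)
      + (\<Sum>j\<in>{j\<in>vidx m. vpt m j \<le> 0 - ?d}. wt s (vpt m j) * ?d)"
    by (intro add_right_mono sum_Un_le) (use d in auto)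
  also have "\<dots> \<le> ?d + 1 / (s - 1) + 1 / (s - 1)"
    using R L by (intro add_mono) (auto simp: vpt_def wt_def)
  finally show ?thesis by (simp add: field_simps)
qed

lemma sum_tail:
  assumes d: "0 < Dv m" and s: "1 < s" and R: "0 < R"
  shows "(\<Sum>j\<in>{j\<in>vidx m. R + Dv m \<le> \<bar>vpt m j\<bar>}. \<bar>vpt m j\<bar> powr (- s) * Dv m)
    \<le> 2 * (R powr (1 - s) / (s - 1))"
proof -
  let ?d = "Dv m"
  define A where "A x = - (x powr (1 - s)) / (s - 1)" for x :: real
  let ?b = "- (R powr (1 - s)) / (s - 1)"
  have step: "\<bar>x + ?d\<bar> powr (- s) * ?d \<le> A (x + ?d) - A x" if "R \<le> x" for x
    using powr_cell[of x ?d s] that d s R unfolding A_def by simp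
  have lo: "?b \<le> A x" if "R \<le> x" for x
  proof -
    have "x powr (1 - s) \<le> R powr (1 - s)" using that s R by (intro powr_mono2') auto
    then show ?thesis unfolding A_def using s by (simp add: divide_right_mono)
  qed
  have up: "A x \<le> 0" for x unfolding A_def using s by (simp add: divide_nonpos_pos)
  have ba: "?b \<le> (0::real)" using s by (simp add: divide_nonpos_pos)
  have Rt: "(\<Sum>j\<in>{j\<in>vidx m. R + ?d \<le> vpt m j}. \<bar>vpt m j\<bar> powr (- s) * ?d) \<le> 0 - ?b"
    by (rule right_telescope[where A = A and \<psi> = "\<lambda>x. \<bar>x\<bar> powr (- s)", OF d step lo up ba])
  have L: "(\<Sum>j\<in>{j\<in>vidx m. vpt m j \<le> - R - ?d}. \<bar>vpt m j\<bar> powr (- s) * ?d) \<le> 0 - ?b"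
  proof (rule left_telescope[where A = A and \<psi> = "\<lambda>x. \<bar>x\<bar> powr (- s)", OF d])
    show "\<bar>- (x + ?d)\<bar> powr (- s) * ?d \<le> A (x + ?d) - A x" if "- (- R) \<le> x" for x
      using step[of x] that by (simp only: abs_minus_cancel minus_minus)
  qed (use lo up ba in auto)
  have V: "{j\<in>vidx m. R + ?d \<le> \<bar>vpt m j\<bar>}
      = {j\<in>vidx m. R + ?d \<le> vpt m j} \<union> {j\<in>vidx m. vpt m j \<le> - R - ?d}"
    using R d by (auto simp: abs_if split: if_splits)
  have "(\<Sum>j\<in>{j\<in>vidx m. R + ?d \<le> \<bar>vpt m j\<bar>}. \<bar>vpt m j\<bar> powr (- s) * ?d)
    \<le> (\<Sum>j\<in>{j\<in>vidx m. R + ?d \<le> vpt m j}. \<bar>vpt m j\<bar> powr (- s) * ?d)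
      + (\<Sum>j\<in>{j\<in>vidx m. vpt m j \<le> - R - ?d}. \<bar>vpt m j\<bar> powr (- s) * ?d)"
    unfolding V by (rule sum_Un_le) (use d in auto)
  then show ?thesis using Rt L by simp
qed

lemma arctan_cell:
  assumes "0 \<le> y" "0 < d" "0 < s"
  shows "1 / (1 + ((y + d) / s)\<^sup>2) * d \<le> s * arctan ((y + d) / s) - s * arctan (y / s)"
proof -
  have "\<exists>z. y < z \<and> z < y + d \<and> (\<lambda>x. s * arctan (x / s)) (y + d)
    - (\<lambda>x. s * arctan (x / s)) y = (y + d - y) * (1 / (1 + (z / s)\<^sup>2))"
  proof (rule MVT2[where f = "\<lambda>x. s * arctan (x / s)" and f' = "\<lambda>z. 1 / (1 + (z / s)\<^sup>2)"])
    fix x :: real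
    show "((\<lambda>x. s * arctan (x / s)) has_real_derivative 1 / (1 + (x / s)\<^sup>2)) (at x)"
      using assms by (auto intro!: derivative_eq_intros simp: divide_inverse)
  qed (use assms in auto)
  then obtain z where z: "y < z" "z < y + d"
    "s * arctan ((y + d) / s) - s * arctan (y / s) = d * (1 / (1 + (z / s)\<^sup>2))"
    by auto
  have "(z / s)\<^sup>2 \<le> ((y + d) / s)\<^sup>2"
    using z assms by (intro power_mono divide_right_mono) auto
  then have "1 / (1 + ((y + d) / s)\<^sup>2) \<le> 1 / (1 + (z / s)\<^sup>2)"
    by (intro divide_left_mono mult_pos_pos add_pos_nonneg) auto
  then have "1 / (1 + ((y + d) / s)\<^sup>2) * d \<le> d * (1 / (1 + (z / s)\<^sup>2))"
    using assms by (simp add: mult.commute mult_left_mono del: times_divide_eq_right times_divide_eq_left)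
  then show ?thesis using z(3) by linarith
qed

text \<open>The primitive is \<open>s * arctan\<close> on both sides of the centre; the points closer to the centre than
  one cell, of which there are at most three, are counted separately.\<close>

lemma Cauchy_grid_sum:
  assumes d: "0 < Dv m" and s: "0 < s"
  shows "(\<Sum>j\<in>vidx m. 1 / (1 + ((vpt m j - u) / s)\<^sup>2) * Dv m) \<le> s * pi + 3 * Dv m"
proof -
  let ?d = "Dv m" and ?\<psi> = "\<lambda>x. 1 / (1 + ((x - u) / s)\<^sup>2)"
  have up: "s * arctan y \<le> s * (pi / 2)" for y
    using s arctan_ubound[of y] by (intro mult_left_mono) auto
  have lo: "0 \<le> s * arctan y" if "0 \<le> y" for y using s that by simp
  have ba: "0 \<le> s * (pi / 2)" using s by simp
  have R: "(\<Sum>j\<in>{j\<in>vidx m. u + ?d \<le> vpt m j}. ?\<psi> (vpt m j) * ?d) \<le> s * (pi / 2) - 0"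
  proof (rule right_telescope[where A = "\<lambda>x. s * arctan ((x - u) / s)" and \<psi> = ?\<psi>, OF d _ _ up ba])
    show "?\<psi> (x + ?d) * ?d \<le> s * arctan ((x + ?d - u) / s) - s * arctan ((x - u) / s)" if "u \<le> x" for x
      using arctan_cell[of "x - u" ?d s] that d s by (simp add: algebra_simps)
  qed (use lo s in auto)
  have L: "(\<Sum>j\<in>{j\<in>vidx m. vpt m j \<le> u - ?d}. ?\<psi> (vpt m j) * ?d) \<le> s * (pi / 2) - 0"
  proof (rule left_telescope[where A = "\<lambda>x. s * arctan ((x + u) / s)" and \<psi> = ?\<psi>, OF d _ _ up ba])
    fix x assume x: "- u \<le> x"
    have e: "((- (x + ?d) - u) / s)\<^sup>2 = ((x + u + ?d) / s)\<^sup>2"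
      by (simp add: power2_eq_square algebra_simps)
    show "?\<psi> (- (x + ?d)) * ?d \<le> s * arctan ((x + ?d + u) / s) - s * arctan ((x + u) / s)"
      using arctan_cell[of "x + u" ?d s] x d s unfolding e by (simp add: add_ac)
  qed (use lo s in auto)
  have N: "(\<Sum>j\<in>{j\<in>vidx m. \<bar>vpt m j - u\<bar> < ?d}. ?\<psi> (vpt m j) * ?d) \<le> 3 * ?d"
  proof -
    have "(\<Sum>j\<in>{j\<in>vidx m. \<bar>vpt m j - u\<bar> < ?d}. ?\<psi> (vpt m j) * ?d) \<le> (\<Sum>j\<in>{j\<in>vidx m. \<bar>vpt m j - u\<bar> < ?d}. ?d)"
    proof (rule sum_mono)
      fix j
      have "1 \<le> 1 + ((vpt m j - u) / s)\<^sup>2" by simp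
      then have "?\<psi> (vpt m j) \<le> 1" by (subst divide_le_eq_1_pos) linarith+
      then have "?\<psi> (vpt m j) * ?d \<le> 1 * ?d" using d by (intro mult_right_mono) auto
      then show "?\<psi> (vpt m j) * ?d \<le> ?d" by simp
    qed
    also have "\<dots> \<le> 2 * ?d + ?d" using d by (intro vidx_near_sum) auto
    finally show ?thesis by simp
  qed
  have V: "vidx m = ({j\<in>vidx m. \<bar>vpt m j - u\<bar> < ?d} \<union> {j\<in>vidx m. u + ?d \<le> vpt m j})
      \<union> {j\<in>vidx m. vpt m j \<le> u - ?d}"
    by (auto simp: abs_if split: if_splits)
  have "(\<Sum>j\<in>vidx m. ?\<psi> (vpt m j) * ?d)
    \<le> (\<Sum>j\<in>{j\<in>vidx m. \<bar>vpt m j - u\<bar> < ?d} \<union> {j\<in>vidx m. u + ?d \<le> vpt m j}. ?\<psi> (vpt m j) * ?d)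
      + (\<Sum>j\<in>{j\<in>vidx m. vpt m j \<le> u - ?d}. ?\<psi> (vpt m j) * ?d)"
    by (subst V, rule sum_Un_le) (use d in auto)
  also have "\<dots> \<le> (\<Sum>j\<in>{j\<in>vidx m. \<bar>vpt m j - u\<bar> < ?d}. ?\<psi> (vpt m j) * ?d)
      + (\<Sum>j\<in>{j\<in>vidx m. u + ?d \<le> vpt m j}. ?\<psi> (vpt m j) * ?d)
      + (\<Sum>j\<in>{j\<in>vidx m. vpt m j \<le> u - ?d}. ?\<psi> (vpt m j) * ?d)"
    by (intro add_right_mono sum_Un_le) (use d in auto)
  finally show ?thesis using R L N by simp
qed

text \<open>From \<open>exp (- y) \<le> 1 / (1 + y)\<close> the Gaussian lies below a Cauchy profile, and
  \<open>sqrt 2 * pi < 2 * sqrt (2 * pi)\<close> leaves room for the three exceptional cells once eight cells fit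
  into the thermal speed. The factor 2 is what the scheme can afford: relaxation then multiplies
  the mass by at most \<open>exp (Dt / \<epsilon>)\<close>, as in the definition of \<open>C_E1\<close>.\<close>

lemma maxwellian_grid_mass:
  assumes d: "0 < Dv m" and T: "0 < T" "64 * (Dv m)\<^sup>2 \<le> T" and \<rho>: "0 \<le> \<rho>"
  shows "(\<Sum>j\<in>vidx m. maxwellian \<rho> U T (vpt m j) * Dv m) \<le> 2 * \<rho>"
proof -
  let ?d = "Dv m" and ?s = "sqrt (2 * T)"
  have s: "0 < ?s" using T by simp
  have dT: "8 * ?d \<le> sqrt T"
    using T d by (intro real_le_rsqrt) (simp add: power_mult_distrib)
  have e: "exp (- (\<bar>v - U\<bar>\<^sup>2 / (2 * T))) \<le> 1 / (1 + ((v - U) / ?s)\<^sup>2)" for v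
  proof -
    have "((v - U) / ?s)\<^sup>2 = \<bar>v - U\<bar>\<^sup>2 / (2 * T)" using T by (simp add: power_divide)
    moreover have "exp (- y) \<le> 1 / (1 + y)" if "0 \<le> y" for y :: real
    proof -
      have "inverse (exp y) \<le> inverse (1 + y)"
        using that by (intro le_imp_inverse_le exp_ge_add_one_self) auto
      then show ?thesis by (simp only: exp_minus inverse_eq_divide)
    qed
    ultimately show ?thesis using T by simp
  qed
  have "(\<Sum>j\<in>vidx m. exp (- (\<bar>vpt m j - U\<bar>\<^sup>2 / (2 * T))) * ?d)
    \<le> (\<Sum>j\<in>vidx m. 1 / (1 + ((vpt m j - U) / ?s)\<^sup>2) * ?d)"
    using d by (intro sum_mono mult_right_mono e) auto
  also have "\<dots> \<le> ?s * pi + 3 * ?d" by (rule Cauchy_grid_sum[OF d s])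
  also have "\<dots> \<le> 5 * sqrt T"
  proof -
    have "sqrt 2 \<le> 1.4143" by (rule real_le_lsqrt) (auto simp: power2_eq_square)
    \<comment> \<open>Eight cells fit into the square root of T, so three cells take at most 3/8 of it.\<close>
    then have "sqrt 2 * pi \<le> 1.4143 * 3.1416"
      using pi_approx(2) by (intro mult_mono) auto
    then have "sqrt 2 * pi * sqrt T \<le> 4.5 * sqrt T"
      using T by (intro mult_right_mono) auto
    moreover have "?s * pi = sqrt 2 * pi * sqrt T" by (simp add: real_sqrt_mult)
    ultimately show ?thesis using dT d by linarith
  qed
  also have "\<dots> \<le> 2 * sqrt (2 * pi * T)"
  proof -
    have "2.5 \<le> sqrt (2 * pi)" using pi_approx(1) by (intro real_le_rsqrt) (simp add: power2_eq_square)
    then have "2.5 * sqrt T \<le> sqrt (2 * pi) * sqrt T" using T by (intro mult_right_mono) auto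
    then show ?thesis by (simp add: real_sqrt_mult)
  qed
  finally have b: "(\<Sum>j\<in>vidx m. exp (- (\<bar>vpt m j - U\<bar>\<^sup>2 / (2 * T))) * ?d) \<le> 2 * sqrt (2 * pi * T)" .
  have "(\<Sum>j\<in>vidx m. maxwellian \<rho> U T (vpt m j) * ?d)
    = \<rho> / sqrt (2 * pi * T) * (\<Sum>j\<in>vidx m. exp (- (\<bar>vpt m j - U\<bar>\<^sup>2 / (2 * T))) * ?d)"
    by (simp add: maxwellian_def sum_distrib_left mult.assoc)
  also have "\<dots> \<le> \<rho> / sqrt (2 * pi * T) * (2 * sqrt (2 * pi * T))"
    using b \<rho> T by (intro mult_left_mono) auto
  also have "\<dots> = 2 * \<rho>" using T by simp
  finally show ?thesis .
qed

lemma first_moment_h: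
  "dens_h m g i \<noteq> 0 \<Longrightarrow> (\<Sum>j\<in>vidx m. g i j * vpt m j * Dv m) = dens_h m g i * bulk_h m g i"
  by (simp add: bulk_h_def)

lemma centred_moment_h:
  "dens_h m g i \<noteq> 0 \<Longrightarrow>
    (\<Sum>j\<in>vidx m. g i j * \<bar>vpt m j - bulk_h m g i\<bar>\<^sup>2 * Dv m) = dens_h m g i * temp_h m g i"
  by (simp add: temp_h_def)

lemma second_moment_h:
  assumes "dens_h m g i \<noteq> 0"
  shows "(\<Sum>j\<in>vidx m. g i j * (vpt m j)\<^sup>2 * Dv m) = dens_h m g i * (temp_h m g i + (bulk_h m g i)\<^sup>2)"
proof -
  let ?U = "bulk_h m g i"
  have "(\<Sum>j\<in>vidx m. g i j * \<bar>vpt m j - ?U\<bar>\<^sup>2 * Dv m)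
    = (\<Sum>j\<in>vidx m. g i j * (vpt m j)\<^sup>2 * Dv m - 2 * ?U * (g i j * vpt m j * Dv m) + ?U\<^sup>2 * (g i j * Dv m))"
    by (intro sum.cong refl) (simp add: power2_eq_square algebra_simps)
  also have "\<dots> = (\<Sum>j\<in>vidx m. g i j * (vpt m j)\<^sup>2 * Dv m)
      - 2 * ?U * (\<Sum>j\<in>vidx m. g i j * vpt m j * Dv m) + ?U\<^sup>2 * dens_h m g i"
    by (simp add: sum.distrib sum_subtractf sum_distrib_left dens_h_def)
  finally show ?thesis
    unfolding centred_moment_h[OF assms] first_moment_h[OF assms]
    by (simp add: power2_eq_square algebra_simps)
qed

text \<open>Completing the square after \<open>1 + y \<le> exp y\<close>: a Gaussian absorbs any polynomial weight.\<close>

lemma exp_times_powr_bound: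
  fixes s z a :: real
  assumes "0 \<le> s" "0 \<le> z" "0 \<le> a"
  shows "(1 + a + z) powr s * exp (- (z\<^sup>2 / 2)) \<le> exp (s * a + s\<^sup>2 / 2)"
proof -
  have "(1 + a + z) powr s \<le> exp (a + z) powr s"
    using assms exp_ge_add_one_self[of "a + z"] by (intro powr_mono2) (auto simp: add_ac)
  also have "\<dots> = exp (s * (a + z))" by (simp add: powr_def)
  finally have "(1 + a + z) powr s * exp (- (z\<^sup>2 / 2)) \<le> exp (s * (a + z)) * exp (- (z\<^sup>2 / 2))"
    by (intro mult_right_mono) auto
  also have "\<dots> = exp (s * (a + z) - z\<^sup>2 / 2)" by (simp add: exp_add[symmetric])
  also have "\<dots> \<le> exp (s * a + s\<^sup>2 / 2)"
  proof -
    have "0 \<le> (s - z)\<^sup>2" by simp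
    then show ?thesis by (simp add: power2_eq_square algebra_simps)
  qed
  finally show ?thesis .
qed

section \<open>Discrete Maxwellians\<close>

text \<open>Chebyshev's inequality for the discrete velocity distribution.\<close>

lemma half_mass_near_bulk:
  assumes d: "0 < Dv m" and g: "\<And>j. j \<in> vidx m \<Longrightarrow> 0 \<le> g i j"
    and \<rho>: "0 < dens_h m g i" and T: "0 < temp_h m g i"
  shows "dens_h m g i / 2 \<le>
    (\<Sum>j\<in>{j\<in>vidx m. \<bar>vpt m j - bulk_h m g i\<bar> < sqrt (2 * temp_h m g i)}. g i j * Dv m)"
proof -
  let ?U = "bulk_h m g i" and ?T = "temp_h m g i" and ?\<rho> = "dens_h m g i"
  let ?near = "{j\<in>vidx m. \<bar>vpt m j - ?U\<bar> < sqrt (2 * ?T)}"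
  let ?far = "{j\<in>vidx m. sqrt (2 * ?T) \<le> \<bar>vpt m j - ?U\<bar>}"
  have "2 * ?T * (\<Sum>j\<in>?far. g i j * Dv m) = (\<Sum>j\<in>?far. g i j * (2 * ?T) * Dv m)"
    by (simp add: sum_distrib_left mult_ac)
  also have "\<dots> \<le> (\<Sum>j\<in>?far. g i j * \<bar>vpt m j - ?U\<bar>\<^sup>2 * Dv m)"
  proof (intro sum_mono mult_right_mono mult_left_mono)
    fix j assume "j \<in> ?far"
    then have "(sqrt (2 * ?T))\<^sup>2 \<le> \<bar>vpt m j - ?U\<bar>\<^sup>2" using T by (intro power_mono) auto
    then show "2 * ?T \<le> \<bar>vpt m j - ?U\<bar>\<^sup>2" using T by simp
  qed (use d g in auto)
  also have "\<dots> \<le> (\<Sum>j\<in>vidx m. g i j * \<bar>vpt m j - ?U\<bar>\<^sup>2 * Dv m)"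
    by (rule sum_mono2) (use d g in auto)
  also have "\<dots> = ?\<rho> * ?T" using \<rho> by (intro centred_moment_h) auto
  finally have far: "(\<Sum>j\<in>?far. g i j * Dv m) \<le> ?\<rho> / 2" using T by (simp add: field_simps)
  have "vidx m = ?near \<union> ?far" by auto
  moreover have "?near \<inter> ?far = {}" by auto
  ultimately have "?\<rho> = (\<Sum>j\<in>?near. g i j * Dv m) + (\<Sum>j\<in>?far. g i j * Dv m)"
    unfolding dens_h_def by (metis (no_types, lifting) finite_Un finite_vidx sum.union_disjoint)
  then show ?thesis using far by linarith
qed

text \<open>When the bulk speed dominates the thermal speed, the half of the mass near the bulk velocity
  sits where the weight is comparable with the weight at \<open>U\<close>, in a window of thermal width.\<close>

lemma dens_bound_fast_bulk:
  assumes d: "0 < Dv m" and q: "0 \<le> q"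
    and g: "\<And>j. j \<in> vidx m \<Longrightarrow> 0 \<le> g i j \<and> g i j \<le> N * wt q (vpt m j)" and N: "0 \<le> N"
    and \<rho>: "0 < dens_h m g i" and T: "0 < temp_h m g i" "64 * (Dv m)\<^sup>2 \<le> temp_h m g i"
    and fast: "3 * sqrt (temp_h m g i) \<le> 1 + \<bar>bulk_h m g i\<bar>"
  shows "dens_h m g i \<le> 6 * 2 powr q * N * sqrt (temp_h m g i) * wt q (bulk_h m g i)"
proof -
  let ?U = "bulk_h m g i" and ?T = "temp_h m g i" and ?\<rho> = "dens_h m g i"
  let ?near = "{j\<in>vidx m. \<bar>vpt m j - ?U\<bar> < sqrt (2 * ?T)}"
  have s2: "sqrt 2 \<le> 71 / 50" by (rule real_le_lsqrt) (auto simp: power2_eq_square)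
  have r: "sqrt (2 * ?T) \<le> 71 / 50 * sqrt ?T"
    unfolding real_sqrt_mult using s2 T by (intro mult_right_mono) auto
  have dT: "8 * Dv m \<le> sqrt ?T"
    using T d by (intro real_le_rsqrt) (simp add: power_mult_distrib)
  have w: "wt q (vpt m j) \<le> 2 powr q * wt q ?U" if "j \<in> ?near" for j
  proof -
    have "1 + \<bar>?U\<bar> \<le> 2 * (1 + \<bar>vpt m j\<bar>)" using that r fast by simp argo
    then have "(1 + \<bar>?U\<bar>) powr q \<le> (2 * (1 + \<bar>vpt m j\<bar>)) powr q" using q by (intro powr_mono2) auto
    also have "\<dots> = 2 powr q * (1 + \<bar>vpt m j\<bar>) powr q" by (rule powr_mult)
    finally have "(1 + \<bar>?U\<bar>) powr q \<le> 2 powr q * (1 + \<bar>vpt m j\<bar>) powr q" .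
    then have "wt q (vpt m j) * (1 + \<bar>?U\<bar>) powr q
        \<le> wt q (vpt m j) * (2 powr q * (1 + \<bar>vpt m j\<bar>) powr q)"
      by (intro mult_left_mono) auto
    also have "\<dots> = 2 powr q * (wt q (vpt m j) * (1 + \<bar>vpt m j\<bar>) powr q)" by (simp only: mult_ac)
    finally have "wt q (vpt m j) * (1 + \<bar>?U\<bar>) powr q \<le> 2 powr q" by (simp only: wt_inverse mult_1_right)
    then show ?thesis by (simp add: wt_le_iff)
  qed
  have "?\<rho> / 2 \<le> (\<Sum>j\<in>?near. g i j * Dv m)" using assms by (intro half_mass_near_bulk) auto
  also have "\<dots> \<le> (\<Sum>j\<in>?near. N * (2 powr q * wt q ?U) * Dv m)"
  proof (intro sum_mono mult_right_mono)
    fix j assume j: "j \<in> ?near"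
    then have "g i j \<le> N * wt q (vpt m j)" using g by auto
    also have "\<dots> \<le> N * (2 powr q * wt q ?U)" using w[OF j] N by (intro mult_left_mono)
    finally show "g i j \<le> N * (2 powr q * wt q ?U)" .
  qed (use d in auto)
  also have "\<dots> = N * (2 powr q * wt q ?U) * (\<Sum>j\<in>?near. Dv m)" by (simp only: sum_distrib_left)
  also have "\<dots> \<le> N * (2 powr q * wt q ?U) * (3 * sqrt ?T)"
  proof (intro mult_left_mono)
    have "(\<Sum>j\<in>?near. Dv m) \<le> 2 * sqrt (2 * ?T) + Dv m"
      using d T by (intro vidx_near_sum) auto
    then show "(\<Sum>j\<in>?near. Dv m) \<le> 3 * sqrt ?T" using r dT d by linarith
  qed (use N in auto)
  finally show ?thesis by (simp add: mult_ac)
qed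

text \<open>Velocities below a fixed fraction of the root mean square speed \<open>e\<close> carry at most half of the
  energy \<open>\<rho> * e\<^sup>2\<close>; the other half is bounded by the weighted norm, through a tail sum that needs
  \<open>q > 3\<close>.\<close>

lemma dens_bound_energy:
  assumes d: "0 < Dv m" and q: "3 < q"
    and g: "\<And>j. j \<in> vidx m \<Longrightarrow> 0 \<le> g i j \<and> g i j \<le> N * wt q (vpt m j)" and N: "0 \<le> N"
    and \<rho>: "0 < dens_h m g i" and T: "0 < temp_h m g i" "64 * (Dv m)\<^sup>2 \<le> temp_h m g i"
  shows "dens_h m g i \<le> 4 / (q - 3) * (2 / 5) powr (3 - q) * N * sqrt (temp_h m g i) powr (1 - q)"
proof -
  let ?U = "bulk_h m g i" and ?T = "temp_h m g i" and ?\<rho> = "dens_h m g i"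
  define e where "e = sqrt (?T + ?U\<^sup>2)"
  have e0: "0 < e" unfolding e_def using T by (simp add: add_pos_nonneg)
  have e2: "e\<^sup>2 = ?T + ?U\<^sup>2" unfolding e_def using T by simp
  have Te: "sqrt ?T \<le> e" unfolding e_def by simp
  have dT: "8 * Dv m \<le> sqrt ?T"
    using T d by (intro real_le_rsqrt) (simp add: power_mult_distrib)
  define R where "R = 2 / 5 * e"
  have R0: "0 < R" using e0 by (simp add: R_def)
  \<comment> \<open>0.6 squared is less than one half, and one cell is at most e / 8.\<close>
  have Rd: "R + Dv m \<le> 0.6 * e" unfolding R_def using dT Te e0 by simp
  let ?low = "{j\<in>vidx m. \<bar>vpt m j\<bar> < R + Dv m}"
  let ?high = "{j\<in>vidx m. R + Dv m \<le> \<bar>vpt m j\<bar>}"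
  have low: "(\<Sum>j\<in>?low. g i j * (vpt m j)\<^sup>2 * Dv m) \<le> ?\<rho> * e\<^sup>2 / 2"
  proof -
    have "(\<Sum>j\<in>?low. g i j * (vpt m j)\<^sup>2 * Dv m) \<le> (\<Sum>j\<in>?low. g i j * (e\<^sup>2 / 2) * Dv m)"
    proof (intro sum_mono mult_right_mono mult_left_mono)
      fix j assume "j \<in> ?low"
      then have "\<bar>vpt m j\<bar> \<le> 0.6 * e" using Rd by auto
      then have "\<bar>vpt m j\<bar>\<^sup>2 \<le> (0.6 * e)\<^sup>2" by (intro power_mono) auto
      moreover have "(0.6 * e)\<^sup>2 = 9 / 25 * e\<^sup>2" by (simp add: power2_eq_square)
      moreover have "0 \<le> e\<^sup>2" by simp
      ultimately show "(vpt m j)\<^sup>2 \<le> e\<^sup>2 / 2"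
        unfolding power2_abs by linarith
    qed (use d g in auto)
    also have "\<dots> \<le> (\<Sum>j\<in>vidx m. g i j * (e\<^sup>2 / 2) * Dv m)"
      by (rule sum_mono2) (use d g in auto)
    also have "\<dots> = (\<Sum>j\<in>vidx m. g i j * Dv m * (e\<^sup>2 / 2))" by (simp only: mult_ac)
    also have "\<dots> = ?\<rho> * (e\<^sup>2 / 2)" unfolding dens_h_def by (rule sum_distrib_right[symmetric])
    finally show ?thesis by simp
  qed
  have high: "(\<Sum>j\<in>?high. g i j * (vpt m j)\<^sup>2 * Dv m) \<le> N * (2 * (R powr (3 - q) / (q - 3)))"
  proof -
    have "(\<Sum>j\<in>?high. g i j * (vpt m j)\<^sup>2 * Dv m)
      \<le> (\<Sum>j\<in>?high. N * (\<bar>vpt m j\<bar> powr (- (q - 2)) * Dv m))"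
    proof (rule sum_mono)
      fix j assume j: "j \<in> ?high"
      let ?v = "vpt m j"
      have v: "0 < \<bar>?v\<bar>" using j R0 d by auto
      have "wt q ?v \<le> \<bar>?v\<bar> powr (- q)" unfolding wt_def using v q by (intro powr_mono2') auto
      then have "N * wt q ?v \<le> N * \<bar>?v\<bar> powr (- q)" using N by (rule mult_left_mono)
      moreover have "g i j \<le> N * wt q ?v" using g[of j] j by simp
      ultimately have "g i j \<le> N * \<bar>?v\<bar> powr (- q)" by linarith
      then have "g i j * ?v\<^sup>2 * Dv m \<le> N * \<bar>?v\<bar> powr (- q) * ?v\<^sup>2 * Dv m"
        using d by (intro mult_right_mono) auto
      also have "\<dots> = N * (\<bar>?v\<bar> powr (- q) * ?v\<^sup>2 * Dv m)" by (simp only: mult_ac)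
      also have "\<bar>?v\<bar> powr (- q) * ?v\<^sup>2 = \<bar>?v\<bar> powr (- (q - 2))"
      proof -
        have "?v\<^sup>2 = \<bar>?v\<bar> powr 2"
          using v powr_numeral[of "\<bar>?v\<bar>" "num.Bit0 num.One"] by (simp only: power2_abs)
        then show ?thesis by (simp only: powr_add[symmetric]) simp
      qed
      finally show "g i j * ?v\<^sup>2 * Dv m \<le> N * (\<bar>?v\<bar> powr (- (q - 2)) * Dv m)" .
    qed
    also have "\<dots> = N * (\<Sum>j\<in>?high. \<bar>vpt m j\<bar> powr (- (q - 2)) * Dv m)"
      by (simp only: sum_distrib_left)
    also have "\<dots> \<le> N * (2 * (R powr (1 - (q - 2)) / ((q - 2) - 1)))"
      using q d R0 N by (intro mult_left_mono sum_tail) auto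
    finally show ?thesis by simp
  qed
  have "?low \<union> ?high = vidx m" "?low \<inter> ?high = {}" by auto
  then have "(\<Sum>j\<in>vidx m. g i j * (vpt m j)\<^sup>2 * Dv m)
    = (\<Sum>j\<in>?low. g i j * (vpt m j)\<^sup>2 * Dv m) + (\<Sum>j\<in>?high. g i j * (vpt m j)\<^sup>2 * Dv m)"
    by (metis (no_types, lifting) finite_Un finite_vidx sum.union_disjoint)
  moreover have "(\<Sum>j\<in>vidx m. g i j * (vpt m j)\<^sup>2 * Dv m) = ?\<rho> * e\<^sup>2"
    unfolding e2 using \<rho> by (intro second_moment_h) auto
  ultimately have "?\<rho> * e\<^sup>2 / 2 \<le> N * (2 * (R powr (3 - q) / (q - 3)))" using low high by linarith
  also have "R powr (3 - q) = (2 / 5) powr (3 - q) * e powr (3 - q)"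
    unfolding R_def by (rule powr_mult)
  finally have "?\<rho> * e\<^sup>2 \<le> (4 / (q - 3) * (2 / 5) powr (3 - q) * N) * e powr (3 - q)"
    by (simp add: mult_ac)
  moreover have "e powr (3 - q) = e powr (1 - q) * e\<^sup>2"
  proof -
    have "e\<^sup>2 = e powr 2" using e0 by (simp add: powr_numeral)
    then show ?thesis by (simp add: powr_add[symmetric])
  qed
  ultimately have "?\<rho> * e\<^sup>2 \<le> ((4 / (q - 3) * (2 / 5) powr (3 - q) * N) * e powr (1 - q)) * e\<^sup>2"
    by (simp only: mult.assoc)
  then have "?\<rho> \<le> (4 / (q - 3) * (2 / 5) powr (3 - q) * N) * e powr (1 - q)"
    using e0 by (simp only: mult_le_cancel_right) auto
  also have "\<dots> \<le> (4 / (q - 3) * (2 / 5) powr (3 - q) * N) * sqrt ?T powr (1 - q)"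
    using q T Te N by (intro mult_left_mono powr_mono2') auto
  finally show ?thesis .
qed

text \<open>The estimate of Perthame and Pulvirenti on the grid, with a constant depending on \<open>q\<close> only.
  Resolution of the thermal speed by the grid is essential: data concentrated at a single grid
  point have temperature zero, and nearby data have arbitrarily high Maxwellians.\<close>

lemma maxwellian_grid_bound:
  assumes q: "3 < q"
  obtains C where "1 \<le> C"
    "\<And>m g i N v. 0 < Dv m \<Longrightarrow> 0 \<le> N \<Longrightarrow>
       (\<And>j. j \<in> vidx m \<Longrightarrow> 0 \<le> g i j \<and> g i j \<le> N * wt q (vpt m j)) \<Longrightarrow>
       0 < dens_h m g i \<Longrightarrow> 0 < temp_h m g i \<Longrightarrow> 64 * (Dv m)\<^sup>2 \<le> temp_h m g i \<Longrightarrow>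
       maxwellian (dens_h m g i) (bulk_h m g i) (temp_h m g i) v \<le> C * N * wt q v"
proof -
  define G where "G = exp (q * 2 + q\<^sup>2 / 2)"
  define K :: real where "K = 6 * 2 powr q + 4 / (q - 3) * (2 / 5) powr (3 - q)"
  have G1: "1 \<le> G" unfolding G_def using q by simp
  have "1 \<le> 2 powr q" using q by (intro ge_one_powr_ge_zero) auto
  then have K1: "1 \<le> K" unfolding K_def using q by (intro add_increasing2) auto
  have K: "6 * 2 powr q \<le> K" "4 / (q - 3) * (2 / 5) powr (3 - q) \<le> K"
    unfolding K_def using q by auto
  show thesis
  proof (rule that[of "K * G"])
    show "1 \<le> K * G" using G1 K1 by (metis mult_mono mult_1 order_trans zero_le_one le_cases)
    fix m :: mesh and g :: gridfun and i N v
    assume d: "0 < Dv m" and N: "0 \<le> N"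
      and g: "\<And>j. j \<in> vidx m \<Longrightarrow> 0 \<le> g i j \<and> g i j \<le> N * wt q (vpt m j)"
      and \<rho>: "0 < dens_h m g i" and T: "0 < temp_h m g i" "64 * (Dv m)\<^sup>2 \<le> temp_h m g i"
    let ?U = "bulk_h m g i" and ?T = "temp_h m g i" and ?\<rho> = "dens_h m g i"
    define t where "t = sqrt ?T"
    have t: "0 < t" using T by (simp add: t_def)
    define z where "z = \<bar>v - ?U\<bar> / t"
    have z: "0 \<le> z" using t by (simp add: z_def)
    have z2: "\<bar>v - ?U\<bar>\<^sup>2 / (2 * ?T) = z\<^sup>2 / 2"
      using T by (simp add: z_def t_def power_divide)
    have G: "(3 + z) powr q * exp (- (z\<^sup>2 / 2)) \<le> G"
      using exp_times_powr_bound[of q z 2] q z unfolding G_def by simp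
    have s: "t \<le> sqrt (2 * pi * ?T)"
    proof -
      have "1 * ?T \<le> 2 * pi * ?T" using T pi_ge_two by (intro mult_right_mono) auto
      then show ?thesis unfolding t_def by simp
    qed
    have M: "maxwellian ?\<rho> ?U ?T v \<le> ?\<rho> / t * exp (- (z\<^sup>2 / 2))"
      unfolding maxwellian_def z2 using s t \<rho> T
      by (intro mult_right_mono divide_left_mono mult_pos_pos) auto
    have "?\<rho> / t * exp (- (z\<^sup>2 / 2)) * (1 + \<bar>v\<bar>) powr q \<le> K * G * N"
    proof (cases "3 * t \<le> 1 + \<bar>?U\<bar>")
      case True
      have "?\<rho> \<le> 6 * 2 powr q * N * t * wt q ?U"
        unfolding t_def by (rule dens_bound_fast_bulk[where g = g and i = i, OF d _ g N \<rho> T])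
          (use True q in \<open>auto simp: t_def\<close>)
      then have 1: "?\<rho> / t \<le> 6 * 2 powr q * N * wt q ?U" using t by (simp add: field_simps)
      have "1 + \<bar>v\<bar> \<le> (1 + \<bar>?U\<bar>) * (3 + z)"
      proof -
        have "1 + \<bar>v\<bar> \<le> (1 + \<bar>?U\<bar>) + t * z" unfolding z_def using t by simp
        also have "t * z \<le> (1 + \<bar>?U\<bar>) * z" using True z t by (intro mult_right_mono) auto
        also have "(1 + \<bar>?U\<bar>) + (1 + \<bar>?U\<bar>) * z \<le> (1 + \<bar>?U\<bar>) * (3 + z)" by (simp add: algebra_simps)
        finally show ?thesis by simp
      qed
      then have "(1 + \<bar>v\<bar>) powr q \<le> ((1 + \<bar>?U\<bar>) * (3 + z)) powr q" using q by (intro powr_mono2) auto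
      then have 2: "(1 + \<bar>v\<bar>) powr q \<le> (1 + \<bar>?U\<bar>) powr q * (3 + z) powr q" using z by (simp add: powr_mult)
      have "?\<rho> / t * exp (- (z\<^sup>2 / 2)) * (1 + \<bar>v\<bar>) powr q
        \<le> (6 * 2 powr q * N * wt q ?U) * exp (- (z\<^sup>2 / 2)) * ((1 + \<bar>?U\<bar>) powr q * (3 + z) powr q)"
        using 1 2 \<rho> t N by (intro mult_mono mult_right_mono) auto
      also have "\<dots> = 6 * 2 powr q * N * (wt q ?U * (1 + \<bar>?U\<bar>) powr q) * ((3 + z) powr q * exp (- (z\<^sup>2 / 2)))"
        by (simp only: mult_ac)
      also have "\<dots> \<le> K * N * 1 * G"
        using K K1 G N unfolding wt_inverse by (intro mult_mono) auto
      finally show ?thesis by (simp add: mult_ac)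
    next
      case False
      have "?\<rho> \<le> 4 / (q - 3) * (2 / 5) powr (3 - q) * N * t powr (1 - q)"
        unfolding t_def by (rule dens_bound_energy[where g = g and i = i, OF d q g N \<rho> T])
      also have "t powr (1 - q) = t * t powr (- q)" using t by (simp add: powr_diff powr_minus_divide)
      finally have 1: "?\<rho> / t \<le> 4 / (q - 3) * (2 / 5) powr (3 - q) * N * t powr (- q)"
        using t by (simp add: field_simps)
      have "1 + \<bar>v\<bar> \<le> t * (3 + z)"
        using False t unfolding z_def by (simp add: distrib_left)
      then have "(1 + \<bar>v\<bar>) powr q \<le> (t * (3 + z)) powr q" using q by (intro powr_mono2) auto
      then have 2: "(1 + \<bar>v\<bar>) powr q \<le> t powr q * (3 + z) powr q" using z t by (simp add: powr_mult)
      have "?\<rho> / t * exp (- (z\<^sup>2 / 2)) * (1 + \<bar>v\<bar>) powr q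
        \<le> (4 / (q - 3) * (2 / 5) powr (3 - q) * N * t powr (- q)) * exp (- (z\<^sup>2 / 2)) * (t powr q * (3 + z) powr q)"
        using 1 2 \<rho> t N q by (intro mult_mono mult_right_mono) auto
      also have "\<dots> = 4 / (q - 3) * (2 / 5) powr (3 - q) * N * (t powr (- q) * t powr q) * ((3 + z) powr q * exp (- (z\<^sup>2 / 2)))"
        by (simp only: mult_ac)
      also have "t powr (- q) * t powr q = 1" using t by (simp add: powr_minus)
      also have "4 / (q - 3) * (2 / 5) powr (3 - q) * N * 1 * ((3 + z) powr q * exp (- (z\<^sup>2 / 2))) \<le> K * N * 1 * G"
        using K G N K1 by (intro mult_mono) auto
      finally show ?thesis by (simp add: mult_ac)
    qed
    then have "?\<rho> / t * exp (- (z\<^sup>2 / 2)) \<le> K * G * N * wt q v" by (simp only: wt_le_iff)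
    then show "maxwellian ?\<rho> ?U ?T v \<le> K * G * N * wt q v" using M by linarith
  qed
qed

section \<open>The upwind transport step\<close>

text \<open>The transport step with the field as a separate argument. It is linear in the grid function, so
  the error of the density and the error of the field can be treated one after the other.\<close>

definition upwind :: "mesh \<Rightarrow> (int \<Rightarrow> real) \<Rightarrow> gridfun \<Rightarrow> gridfun" where
  "upwind m e g i j =
     (let h = extend m g; v = vpt m j in
       (1 - Dt m / Dx m * \<bar>v\<bar> - Dt m / Dv m * \<bar>e i\<bar>) * h i j
       + Dt m / Dx m * (pos_part v * h (i - 1) j + neg_part v * h (i + 1) j)
       + Dt m / Dv m * (pos_part (e i) * h i (j - 1) + neg_part (e i) * h i (j + 1)))"

lemma transport_h_upwind: "transport_h m g = upwind m (field_h m g) g"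
  by (intro ext) (simp add: transport_h_def upwind_def Let_def)

definition west :: "mesh \<Rightarrow> int \<Rightarrow> int" where "west m i = (i - 1) mod int (Nx m)"
definition east :: "mesh \<Rightarrow> int \<Rightarrow> int" where "east m i = (i + 1) mod int (Nx m)"
text \<open>Neumann ghost values are values at the nearest index of the grid.\<close>

definition clampv :: "mesh \<Rightarrow> int \<Rightarrow> int" where
  "clampv m j = max (- int (Nv m)) (min (int (Nv m)) j)"

lemma clampv_in [simp]: "clampv m j \<in> vidx m"
  by (auto simp: clampv_def vidx_def)

lemma west_in: "i \<in> xidx m \<Longrightarrow> west m i \<in> xidx m" and east_in: "i \<in> xidx m \<Longrightarrow> east m i \<in> xidx m"
  by (auto simp: west_def east_def xidx_def)

lemma upwind_eq:
  assumes "i \<in> xidx m" "j \<in> vidx m"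
  shows "upwind m e g i j =
    (1 - Dt m / Dx m * \<bar>vpt m j\<bar> - Dt m / Dv m * \<bar>e i\<bar>) * g i j
    + Dt m / Dx m * (pos_part (vpt m j) * g (west m i) j + neg_part (vpt m j) * g (east m i) j)
    + Dt m / Dv m * (pos_part (e i) * g i (clampv m (j - 1)) + neg_part (e i) * g i (clampv m (j + 1)))"
proof -
  have "i mod int (Nx m) = i" using assms by (simp add: xidx_def)
  moreover have "max (- int (Nv m)) (min (int (Nv m)) j) = j" using assms by (simp add: vidx_def)
  ultimately show ?thesis by (simp add: upwind_def extend_def Let_def west_def east_def clampv_def)
qed

lemma pos_part_nonneg [simp]: "0 \<le> pos_part a" and neg_part_nonneg [simp]: "0 \<le> neg_part a"
  and abs_parts: "\<bar>a\<bar> = pos_part a + neg_part a"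
  by (auto simp: pos_part_def neg_part_def)

text \<open>The step is a convex combination under the CFL condition: the share \<open>Dt / Dv * \<bar>e\<bar>\<close> comes from
  neighbouring velocities, and the rest from the same velocity.\<close>

lemma upwind_le:
  assumes ij: "i \<in> xidx m" "j \<in> vidx m"
    and pos: "0 \<le> Dt m" "0 < Dx m" "0 < Dv m"
    and cfl: "Dt m / Dx m * \<bar>vpt m j\<bar> + Dt m / Dv m * \<bar>e i\<bar> \<le> 1"
    and B0: "\<And>i. i \<in> xidx m \<Longrightarrow> g i j \<le> B0"
    and B1: "g i (clampv m (j - 1)) \<le> B1" "g i (clampv m (j + 1)) \<le> B1"
  shows "upwind m e g i j \<le> (1 - Dt m / Dv m * \<bar>e i\<bar>) * B0 + Dt m / Dv m * \<bar>e i\<bar> * B1"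
proof -
  let ?a = "Dt m / Dx m" and ?b = "Dt m / Dv m" and ?v = "vpt m j"
  have ab: "0 \<le> ?a" "0 \<le> ?b" using pos by auto
  have 1: "(1 - ?a * \<bar>?v\<bar> - ?b * \<bar>e i\<bar>) * g i j \<le> (1 - ?a * \<bar>?v\<bar> - ?b * \<bar>e i\<bar>) * B0"
    using cfl B0[OF ij(1)] by (intro mult_left_mono) auto
  have 2: "?a * (pos_part ?v * g (west m i) j + neg_part ?v * g (east m i) j)
      \<le> ?a * (pos_part ?v * B0 + neg_part ?v * B0)"
    using ab B0[OF west_in[OF ij(1)]] B0[OF east_in[OF ij(1)]]
    by (intro mult_left_mono add_mono) auto
  have 3: "?b * (pos_part (e i) * g i (clampv m (j - 1)) + neg_part (e i) * g i (clampv m (j + 1)))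
      \<le> ?b * (pos_part (e i) * B1 + neg_part (e i) * B1)"
    using ab B1 by (intro mult_left_mono add_mono) auto
  have "upwind m e g i j \<le> (1 - ?a * \<bar>?v\<bar> - ?b * \<bar>e i\<bar>) * B0 + ?a * (pos_part ?v * B0 + neg_part ?v * B0)
     + ?b * (pos_part (e i) * B1 + neg_part (e i) * B1)"
    unfolding upwind_eq[OF ij] using 1 2 3 by linarith
  also have "\<dots> = (1 - ?a * \<bar>?v\<bar> - ?b * \<bar>e i\<bar>) * B0 + ?a * (\<bar>?v\<bar> * B0) + ?b * (\<bar>e i\<bar> * B1)"
    by (simp only: abs_parts[of ?v] abs_parts[of "e i"] distrib_right)
  also have "\<dots> = (1 - ?b * \<bar>e i\<bar>) * B0 + ?b * \<bar>e i\<bar> * B1" by (simp add: left_diff_distrib)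
  finally show ?thesis .
qed

lemma upwind_uminus:
  "i \<in> xidx m \<Longrightarrow> j \<in> vidx m \<Longrightarrow> upwind m e (\<lambda>i j. - g i j) i j = - upwind m e g i j"
  by (simp add: upwind_eq right_diff_distrib algebra_simps)

lemma upwind_diff:
  "i \<in> xidx m \<Longrightarrow> j \<in> vidx m \<Longrightarrow>
    upwind m e (\<lambda>i j. g i j - h i j) i j = upwind m e g i j - upwind m e h i j"
  by (simp add: upwind_eq algebra_simps add_divide_distrib diff_divide_distrib)

lemma upwind_ge:
  assumes ij: "i \<in> xidx m" "j \<in> vidx m"
    and pos: "0 \<le> Dt m" "0 < Dx m" "0 < Dv m"
    and cfl: "Dt m / Dx m * \<bar>vpt m j\<bar> + Dt m / Dv m * \<bar>e i\<bar> \<le> 1"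
    and B0: "\<And>i. i \<in> xidx m \<Longrightarrow> B0 \<le> g i j"
    and B1: "B1 \<le> g i (clampv m (j - 1))" "B1 \<le> g i (clampv m (j + 1))"
  shows "(1 - Dt m / Dv m * \<bar>e i\<bar>) * B0 + Dt m / Dv m * \<bar>e i\<bar> * B1 \<le> upwind m e g i j"
proof -
  have "upwind m e (\<lambda>i j. - g i j) i j
      \<le> (1 - Dt m / Dv m * \<bar>e i\<bar>) * (- B0) + Dt m / Dv m * \<bar>e i\<bar> * (- B1)"
    by (rule upwind_le[OF ij pos]) (use cfl B0 B1 in auto)
  then show ?thesis unfolding upwind_uminus[OF ij] by (simp add: algebra_simps)
qed

lemma clampv_dist:
  assumes "j \<in> vidx m" "0 < Dv m"
  shows "\<bar>vpt m j - vpt m (clampv m (j - 1))\<bar> \<le> Dv m" "\<bar>vpt m j - vpt m (clampv m (j + 1))\<bar> \<le> Dv m"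
proof -
  have "\<bar>vpt m j - vpt m k\<bar> \<le> Dv m" if "\<bar>j - k\<bar> \<le> 1" for k
  proof -
    have "\<bar>vpt m j - vpt m k\<bar> = real_of_int \<bar>j - k\<bar> * Dv m"
      unfolding vpt_def using assms by (simp add: left_diff_distrib[symmetric] abs_mult)
    also have "\<dots> \<le> 1 * Dv m" using that assms by (intro mult_right_mono) auto
    finally show ?thesis by simp
  qed
  moreover have "\<bar>j - clampv m (j - 1)\<bar> \<le> 1" "\<bar>j - clampv m (j + 1)\<bar> \<le> 1"
    using assms by (auto simp: vidx_def clampv_def)
  ultimately show "\<bar>vpt m j - vpt m (clampv m (j - 1))\<bar> \<le> Dv m" "\<bar>vpt m j - vpt m (clampv m (j + 1))\<bar> \<le> Dv m"
    by blast+
qed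

lemma powr_chord:
  fixes d q :: real
  assumes "0 \<le> d" "d \<le> 1" "1 \<le> q"
  shows "(1 + d) powr q \<le> 1 + d * (2 powr q - 1)"
proof -
  have "((1 - d) *\<^sub>R 1 + d *\<^sub>R 2) powr q \<le> (1 - d) * 1 powr q + d * 2 powr q"
    by (rule convex_onD[OF powr_convex[OF assms(3)]]) (use assms in auto)
  then show ?thesis by (simp add: algebra_simps)
qed

text \<open>A neighbouring velocity distorts the weight by a factor \<open>(1 + Dv) powr q \<le> 1 + Dv * (2 powr q - 1)\<close>;
  its share \<open>Dt / Dv * \<bar>e\<bar>\<close> cancels the factor \<open>Dv\<close>.\<close>

lemma upwind_weighted:
  assumes ij: "i \<in> xidx m" "j \<in> vidx m"
    and pos: "0 \<le> Dt m" "0 < Dx m" "0 < Dv m" and d1: "Dv m \<le> 1" and q: "1 \<le> q"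
    and cfl: "Dt m / Dx m * \<bar>vpt m j\<bar> + Dt m / Dv m * \<bar>e i\<bar> \<le> 1"
    and e: "\<bar>e i\<bar> \<le> E" and N: "0 \<le> N"
    and g: "\<And>i j. i \<in> xidx m \<Longrightarrow> j \<in> vidx m \<Longrightarrow> g i j \<le> N * wt q (vpt m j)"
  shows "upwind m e g i j \<le> N * (1 + Dt m * ((2 powr q - 1) * E)) * wt q (vpt m j)"
proof -
  let ?b = "Dt m / Dv m" and ?w = "wt q (vpt m j)"
  have q2: "0 \<le> 2 powr q - (1::real)" using q ge_one_powr_ge_zero[of 2 q] by simp
  have w: "wt q (vpt m k) \<le> (1 + Dv m * (2 powr q - 1)) * ?w" if "\<bar>vpt m j - vpt m k\<bar> \<le> Dv m" for k
  proof -
    have "wt q (vpt m k) \<le> (1 + Dv m) powr q * ?w" using that q by (intro wt_shift) auto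
    also have "\<dots> \<le> (1 + Dv m * (2 powr q - 1)) * ?w"
      using powr_chord[of "Dv m" q] pos d1 q by (intro mult_right_mono) auto
    finally show ?thesis .
  qed
  have "upwind m e g i j \<le> (1 - ?b * \<bar>e i\<bar>) * (N * ?w)
      + ?b * \<bar>e i\<bar> * (N * ((1 + Dv m * (2 powr q - 1)) * ?w))"
  proof (rule upwind_le[where e = e and g = g and i = i and j = j, OF ij pos cfl])
    show "g i' j \<le> N * ?w" if "i' \<in> xidx m" for i' using g that ij by auto
    show "g i (clampv m (j - 1)) \<le> N * ((1 + Dv m * (2 powr q - 1)) * ?w)"
      using g[OF ij(1), of "clampv m (j - 1)"]
        mult_left_mono[OF w[OF clampv_dist(1)[OF ij(2) pos(3)]] N] by simp
    show "g i (clampv m (j + 1)) \<le> N * ((1 + Dv m * (2 powr q - 1)) * ?w)"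
      using g[OF ij(1), of "clampv m (j + 1)"]
        mult_left_mono[OF w[OF clampv_dist(2)[OF ij(2) pos(3)]] N] by simp
  qed
  also have "\<dots> = N * (1 + Dt m * ((2 powr q - 1) * \<bar>e i\<bar>)) * ?w"
    using pos by (simp add: field_simps)
  also have "\<dots> \<le> N * (1 + Dt m * ((2 powr q - 1) * E)) * ?w"
    using pos q2 e N by (intro mult_right_mono mult_left_mono add_left_mono) auto
  finally show ?thesis .
qed

lemma upwind_weighted_abs:
  assumes ij: "i \<in> xidx m" "j \<in> vidx m"
    and pos: "0 \<le> Dt m" "0 < Dx m" "0 < Dv m" and d1: "Dv m \<le> 1" and q: "1 \<le> q"
    and cfl: "Dt m / Dx m * \<bar>vpt m j\<bar> + Dt m / Dv m * \<bar>e i\<bar> \<le> 1"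
    and e: "\<bar>e i\<bar> \<le> E" and N: "0 \<le> N"
    and g: "\<And>i j. i \<in> xidx m \<Longrightarrow> j \<in> vidx m \<Longrightarrow> \<bar>g i j\<bar> \<le> N * wt q (vpt m j)"
  shows "\<bar>upwind m e g i j\<bar> \<le> N * (1 + Dt m * ((2 powr q - 1) * E)) * wt q (vpt m j)"
proof -
  have "upwind m e g i j \<le> N * (1 + Dt m * ((2 powr q - 1) * E)) * wt q (vpt m j)"
    by (rule upwind_weighted[where e = e, OF ij pos d1 q cfl e N]) (use g in \<open>auto simp: abs_le_iff\<close>)
  moreover have "upwind m e (\<lambda>i j. - g i j) i j \<le> N * (1 + Dt m * ((2 powr q - 1) * E)) * wt q (vpt m j)"
    by (rule upwind_weighted[where e = e, OF ij pos d1 q cfl e N]) (use g in \<open>auto simp: abs_le_iff\<close>)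
  ultimately show ?thesis unfolding upwind_uminus[OF ij] by (simp add: abs_le_iff)
qed

lemma west_east: "i \<in> xidx m \<Longrightarrow> west m (east m i) = i" "i \<in> xidx m \<Longrightarrow> east m (west m i) = i"
  by (auto simp: west_def east_def xidx_def mod_simps)

lemma sum_west: "(\<Sum>i\<in>xidx m. h (west m i)) = (\<Sum>i\<in>xidx m. h i)"
  by (rule sum.reindex_bij_witness[of _ "east m" "west m"]) (auto simp: west_east west_in east_in)

lemma sum_east: "(\<Sum>i\<in>xidx m. h (east m i)) = (\<Sum>i\<in>xidx m. h i)"
  by (rule sum.reindex_bij_witness[of _ "west m" "east m"]) (auto simp: west_east west_in east_in)

lemma sum_clampv:
  fixes h :: "int \<Rightarrow> real"
  assumes h: "\<And>j. j \<in> vidx m \<Longrightarrow> 0 \<le> h j"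
  shows "(\<Sum>j\<in>vidx m. h (clampv m (j - 1))) \<le> h (- int (Nv m)) + (\<Sum>j\<in>vidx m. h j)"
    "(\<Sum>j\<in>vidx m. h (clampv m (j + 1))) \<le> h (int (Nv m)) + (\<Sum>j\<in>vidx m. h j)"
proof -
  let ?N = "int (Nv m)"
  have "(\<Sum>j\<in>vidx m. h (clampv m (j - 1)))
      = h (clampv m (- ?N - 1)) + (\<Sum>j\<in>vidx m - {- ?N}. h (clampv m (j - 1)))"
    by (rule sum.remove) (auto simp: vidx_def)
  also have "(\<Sum>j\<in>vidx m - {- ?N}. h (clampv m (j - 1))) = (\<Sum>j\<in>{- ?N..?N - 1}. h j)"
    by (rule sum.reindex_bij_witness[of _ "\<lambda>j. j + 1" "\<lambda>j. j - 1"]) (auto simp: vidx_def clampv_def)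
  also have "\<dots> \<le> (\<Sum>j\<in>vidx m. h j)" by (rule sum_mono2) (use h in \<open>auto simp: vidx_def\<close>)
  finally show "(\<Sum>j\<in>vidx m. h (clampv m (j - 1))) \<le> h (- ?N) + (\<Sum>j\<in>vidx m. h j)"
    by (simp add: clampv_def)
  have "(\<Sum>j\<in>vidx m. h (clampv m (j + 1)))
      = h (clampv m (?N + 1)) + (\<Sum>j\<in>vidx m - {?N}. h (clampv m (j + 1)))"
    by (rule sum.remove) (auto simp: vidx_def)
  also have "(\<Sum>j\<in>vidx m - {?N}. h (clampv m (j + 1))) = (\<Sum>j\<in>{- ?N + 1..?N}. h j)"
    by (rule sum.reindex_bij_witness[of _ "\<lambda>j. j - 1" "\<lambda>j. j + 1"]) (auto simp: vidx_def clampv_def)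
  also have "\<dots> \<le> (\<Sum>j\<in>vidx m. h j)" by (rule sum_mono2) (use h in \<open>auto simp: vidx_def\<close>)
  finally show "(\<Sum>j\<in>vidx m. h (clampv m (j + 1))) \<le> h ?N + (\<Sum>j\<in>vidx m. h j)"
    by (simp add: clampv_def)
qed

definition mass_h :: "mesh \<Rightarrow> gridfun \<Rightarrow> real" where
  "mass_h m g = (\<Sum>i\<in>xidx m. dens_h m g i * Dx m)"

lemma sum_Dx: "real (Nx m) * Dx m = 1 \<Longrightarrow> (\<Sum>i\<in>xidx m. Dx m) = 1"
  by (simp add: xidx_def)

text \<open>Transport in space is a telescoping sum over the torus. Transport in velocity is one as well,
  up to the ghost cell at the inflow end, and \<open>B\<close> bounds the flux through it.\<close>

lemma upwind_mass:
  assumes pos: "0 \<le> Dt m" "0 < Dx m" "0 < Dv m" and N: "real (Nx m) * Dx m = 1"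
    and g: "\<And>i j. i \<in> xidx m \<Longrightarrow> j \<in> vidx m \<Longrightarrow> 0 \<le> g i j"
    and b: "\<And>i j. i \<in> xidx m \<Longrightarrow> \<bar>j\<bar> = int (Nv m) \<Longrightarrow> \<bar>e i\<bar> * g i j \<le> B"
  shows "mass_h m (upwind m e g) \<le> mass_h m g + Dt m * B"
proof -
  let ?a = "Dt m / Dx m" and ?b = "Dt m / Dv m"
  define X where "X i j = ?a * (pos_part (vpt m j) * g (west m i) j + neg_part (vpt m j) * g (east m i) j
      - \<bar>vpt m j\<bar> * g i j)" for i j
  define Y where "Y i j = ?b * (pos_part (e i) * g i (clampv m (j - 1)) + neg_part (e i) * g i (clampv m (j + 1))
      - \<bar>e i\<bar> * g i j)" for i j
  have u: "upwind m e g i j = g i j + X i j + Y i j" if "i \<in> xidx m" "j \<in> vidx m" for i j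
    unfolding upwind_eq[OF that] X_def Y_def by (simp add: algebra_simps)
  have X0: "(\<Sum>i\<in>xidx m. X i j) = 0" for j
  proof -
    have "(\<Sum>i\<in>xidx m. X i j) = ?a * (pos_part (vpt m j) * (\<Sum>i\<in>xidx m. g (west m i) j)
       + neg_part (vpt m j) * (\<Sum>i\<in>xidx m. g (east m i) j) - \<bar>vpt m j\<bar> * (\<Sum>i\<in>xidx m. g i j))"
      unfolding X_def by (simp only: sum_distrib_left[symmetric] sum.distrib sum_subtractf)
    also have "\<dots> = 0" unfolding sum_west[where h = "\<lambda>i. g i j"] sum_east[where h = "\<lambda>i. g i j"]
      unfolding abs_parts by (simp add: distrib_right)
    finally show ?thesis .
  qed
  have Y0: "(\<Sum>j\<in>vidx m. Y i j * Dv m) \<le> Dt m * B" if i: "i \<in> xidx m" for i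
  proof -
    let ?G = "\<Sum>j\<in>vidx m. g i j"
    have "(\<Sum>j\<in>vidx m. Y i j * Dv m) = Dt m * (\<Sum>j\<in>vidx m. pos_part (e i) * g i (clampv m (j - 1))
       + neg_part (e i) * g i (clampv m (j + 1)) - \<bar>e i\<bar> * g i j)"
      unfolding Y_def sum_distrib_left using pos by (intro sum.cong) auto
    also have "\<dots> = Dt m * (pos_part (e i) * (\<Sum>j\<in>vidx m. g i (clampv m (j - 1)))
       + neg_part (e i) * (\<Sum>j\<in>vidx m. g i (clampv m (j + 1))) - \<bar>e i\<bar> * ?G)"
      by (simp only: sum_distrib_left sum.distrib sum_subtractf)
    also have "\<dots> \<le> Dt m * (pos_part (e i) * (g i (- int (Nv m)) + ?G)
       + neg_part (e i) * (g i (int (Nv m)) + ?G) - \<bar>e i\<bar> * ?G)"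
      using pos sum_clampv[of m "g i"] g[OF i]
      by (intro mult_left_mono diff_right_mono add_mono) auto
    also have "\<dots> = Dt m * (pos_part (e i) * g i (- int (Nv m)) + neg_part (e i) * g i (int (Nv m)))"
      unfolding abs_parts by (simp add: algebra_simps)
    also have "\<dots> \<le> Dt m * B"
    proof (rule mult_left_mono)
      have "pos_part (e i) * g i (- int (Nv m)) + neg_part (e i) * g i (int (Nv m)) =
        (if 0 \<le> e i then \<bar>e i\<bar> * g i (- int (Nv m)) else \<bar>e i\<bar> * g i (int (Nv m)))"
        by (auto simp: pos_part_def neg_part_def)
      also have "\<dots> \<le> B" using b[OF i] by auto
      finally show "pos_part (e i) * g i (- int (Nv m)) + neg_part (e i) * g i (int (Nv m)) \<le> B" .
    qed (rule pos)
    finally show ?thesis .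
  qed
  have "mass_h m (upwind m e g) = (\<Sum>i\<in>xidx m. \<Sum>j\<in>vidx m. (g i j + X i j + Y i j) * Dv m * Dx m)"
    unfolding mass_h_def dens_h_def sum_distrib_right by (intro sum.cong refl) (simp add: u)
  also have "\<dots> = mass_h m g + (\<Sum>i\<in>xidx m. \<Sum>j\<in>vidx m. X i j * Dv m * Dx m)
      + (\<Sum>i\<in>xidx m. (\<Sum>j\<in>vidx m. Y i j * Dv m) * Dx m)"
    unfolding mass_h_def dens_h_def sum_distrib_right by (simp only: distrib_right sum.distrib)
  also have "(\<Sum>i\<in>xidx m. \<Sum>j\<in>vidx m. X i j * Dv m * Dx m) = 0"
  proof -
    have "(\<Sum>i\<in>xidx m. \<Sum>j\<in>vidx m. X i j * Dv m * Dx m) = (\<Sum>j\<in>vidx m. (\<Sum>i\<in>xidx m. X i j) * (Dv m * Dx m))"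
      by (subst sum.swap) (simp only: sum_distrib_right mult.assoc)
    then show ?thesis by (simp add: X0)
  qed
  also have "(\<Sum>i\<in>xidx m. (\<Sum>j\<in>vidx m. Y i j * Dv m) * Dx m) \<le> (\<Sum>i\<in>xidx m. Dt m * B * Dx m)"
    using pos Y0 by (intro sum_mono mult_right_mono) auto
  also have "\<dots> = Dt m * B" unfolding sum_distrib_left[symmetric] sum_Dx[OF N] by simp
  finally show ?thesis by simp
qed

lemma field_h_bound:
  assumes pos: "0 < Dx m" "0 < Dv m" and N: "real (Nx m) * Dx m = 1"
    and g: "\<And>i j. i \<in> xidx m \<Longrightarrow> j \<in> vidx m \<Longrightarrow> 0 \<le> g i j"
  shows "\<bar>field_h m g i\<bar> \<le> mass_h m g + 1"
proof -
  have Nx0: "0 < Nx m" using N by (cases "Nx m = 0") auto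
  have x: "0 \<le> xpt m k \<and> xpt m k < 1" if "k \<in> xidx m" for k
  proof -
    have "real_of_int k * Dx m < real (Nx m) * Dx m"
      using that pos by (intro mult_strict_right_mono) (auto simp: xidx_def)
    then show ?thesis using that pos unfolding N by (auto simp: xpt_def xidx_def)
  qed
  have i: "i mod int (Nx m) \<in> xidx m" using Nx0 by (simp add: xidx_def)
  have "\<bar>field_h m g i\<bar> \<le> (\<Sum>k\<in>xidx m. \<bar>field_kernel (xpt m (i mod int (Nx m))) (xpt m k) * (dens_h m g k - 1) * Dx m\<bar>)"
    unfolding field_h_def by (rule sum_abs)
  also have "\<dots> \<le> (\<Sum>k\<in>xidx m. (dens_h m g k + 1) * Dx m)"
  proof (rule sum_mono)
    fix k assume k: "k \<in> xidx m"
    have "\<bar>field_kernel (xpt m (i mod int (Nx m))) (xpt m k)\<bar> \<le> 1"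
      using x[OF k] by (auto simp: field_kernel_def)
    moreover have "0 \<le> dens_h m g k" unfolding dens_h_def using g[OF k] pos by (intro sum_nonneg) auto
    then have "\<bar>dens_h m g k - 1\<bar> \<le> dens_h m g k + 1" by auto
    ultimately have "\<bar>field_kernel (xpt m (i mod int (Nx m))) (xpt m k)\<bar> * \<bar>dens_h m g k - 1\<bar> \<le> 1 * (dens_h m g k + 1)"
      by (intro mult_mono) auto
    then have "\<bar>field_kernel (xpt m (i mod int (Nx m))) (xpt m k)\<bar> * \<bar>dens_h m g k - 1\<bar> * Dx m
        \<le> (dens_h m g k + 1) * Dx m"
      using pos by (intro mult_right_mono) auto
    then show "\<bar>field_kernel (xpt m (i mod int (Nx m))) (xpt m k) * (dens_h m g k - 1) * Dx m\<bar> \<le> (dens_h m g k + 1) * Dx m"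
      using pos by (simp add: abs_mult)
  qed
  also have "\<dots> = mass_h m g + 1"
    unfolding mass_h_def distrib_right sum.distrib using sum_Dx[OF N] by simp
  finally show ?thesis .
qed

section \<open>A priori bounds for the scheme\<close>

text \<open>The shape of the lower barrier; \<open>b\<close> grows linearly in time because the field shifts the tails.\<close>

definition tail_profile :: "real \<Rightarrow> real \<Rightarrow> real \<Rightarrow> real" where
  "tail_profile \<alpha> b v = exp (- (\<bar>v\<bar> powr \<alpha>) - b * \<bar>v\<bar>)"

lemma tail_profile_pos [simp]: "0 < tail_profile \<alpha> b v" and tail_profile_nonneg [simp]: "0 \<le> tail_profile \<alpha> b v"
  by (simp_all add: tail_profile_def)

lemma tail_profile_le_1: "0 \<le> b \<Longrightarrow> tail_profile \<alpha> b v \<le> 1"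
proof -
  assume "0 \<le> b"
  then have "0 \<le> b * \<bar>v\<bar>" "0 \<le> \<bar>v\<bar> powr \<alpha>" by auto
  then have "- (\<bar>v\<bar> powr \<alpha>) - b * \<bar>v\<bar> \<le> 0" by linarith
  then show ?thesis by (simp add: tail_profile_def)
qed

lemma tail_profile_antimono: "b \<le> b' \<Longrightarrow> tail_profile \<alpha> b' v \<le> tail_profile \<alpha> b v"
  unfolding tail_profile_def by (simp add: mult_right_mono)

text \<open>The shift costs a term linear in \<open>x\<close>, because \<open>\<alpha> \<le> 2\<close>; this is why the barrier has the additional
  factor \<open>exp (- b * \<bar>v\<bar>)\<close>.\<close>

lemma powr_shift:
  fixes x d \<alpha> :: real
  assumes "0 \<le> x" "0 < d" "d \<le> 1 / 2" "1 \<le> \<alpha>" "\<alpha> \<le> 2"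
  shows "(x + d) powr \<alpha> \<le> x powr \<alpha> + d * (\<alpha> * (3 / 2 + x))"
proof -
  have "\<exists>l z. x < z \<and> z < x + d \<and> ((\<lambda>x. x powr \<alpha>) has_real_derivative l) (at z) \<and>
      (x + d) powr \<alpha> - x powr \<alpha> = (x + d - x) * l"
  proof (rule MVT)
    show "continuous_on {x..x + d} (\<lambda>x. x powr \<alpha>)"
      using assms by (intro continuous_on_powr' continuous_intros) auto
    show "(\<lambda>x. x powr \<alpha>) differentiable (at y)" if "x < y" for y
      using that assms by (intro differentiableI[OF has_real_derivative_powr[of y \<alpha>,
            THEN DERIV_subset, THEN has_field_derivative_imp_has_derivative]]) auto
  qed (use assms in auto)
  then obtain l z where z: "x < z" "z < x + d" "((\<lambda>x. x powr \<alpha>) has_real_derivative l) (at z)"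
      "(x + d) powr \<alpha> - x powr \<alpha> = d * l" by auto
  have z0: "0 < z" using z assms by linarith
  have l: "l = \<alpha> * z powr (\<alpha> - 1)"
    by (rule DERIV_unique[OF z(3) has_real_derivative_powr[OF z0]])
  have "z powr (\<alpha> - 1) \<le> (1 + z) powr (\<alpha> - 1)" using z0 assms by (intro powr_mono2) auto
  also have "\<dots> \<le> (1 + z) powr 1" using z0 assms by (intro powr_mono) auto
  finally have "z powr (\<alpha> - 1) \<le> 3 / 2 + x" using z0 z assms by simp
  then have "d * l \<le> d * (\<alpha> * (3 / 2 + x))" unfolding l using assms by (intro mult_left_mono) auto
  then show ?thesis using z(4) by linarith
qed

lemma exp_Jensen:
  fixes l y :: real
  assumes "0 \<le> l" "l \<le> 1" shows "exp (- (l * y)) \<le> 1 - l + l * exp (- y)"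
proof -
  have "exp ((1 - l) *\<^sub>R 0 + l *\<^sub>R (- y)) \<le> (1 - l) * exp 0 + l * exp (- y)"
    by (rule convex_onD[OF exp_convex]) (use assms in auto)
  then show ?thesis by simp
qed

lemma tail_profile_shift:
  assumes "\<bar>v - w\<bar> \<le> d" "0 < d" "d \<le> 1 / 2" "1 \<le> \<alpha>" "\<alpha> \<le> 2" "0 \<le> b"
  shows "tail_profile \<alpha> b v * exp (- (d * (\<alpha> * (3 / 2 + \<bar>v\<bar>) + b))) \<le> tail_profile \<alpha> b w"
proof -
  have w: "\<bar>w\<bar> \<le> \<bar>v\<bar> + d" using assms by linarith
  have "\<bar>w\<bar> powr \<alpha> \<le> (\<bar>v\<bar> + d) powr \<alpha>" using w assms by (intro powr_mono2) auto
  also have "\<dots> \<le> \<bar>v\<bar> powr \<alpha> + d * (\<alpha> * (3 / 2 + \<bar>v\<bar>))" using assms by (intro powr_shift) auto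
  finally have 1: "\<bar>w\<bar> powr \<alpha> \<le> \<bar>v\<bar> powr \<alpha> + d * (\<alpha> * (3 / 2 + \<bar>v\<bar>))" .
  have 2: "b * \<bar>w\<bar> \<le> b * (\<bar>v\<bar> + d)" using w assms by (intro mult_left_mono) auto
  show ?thesis unfolding tail_profile_def exp_add[symmetric] exp_le_cancel_iff
    using 1 2 by (simp add: algebra_simps)
qed

lemma divide_le_if_le_mult:
  fixes A X T :: real
  assumes "A / 1024 \<le> X * T" "0 < X" shows "A / (1024 * X) \<le> T"
  using assms by (simp add: field_simps)

text \<open>The barrier bounds the pressure from below, and the weighted norm bounds the density from above.
  For the pressure, the barrier on \<open>\<bar>v\<bar> < D / 16\<close> has mass at most \<open>D / 4\<close>, so a mass \<open>D / 4\<close> remains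
  outside; and centring at \<open>U\<close> instead of zero only increases the second moment of a symmetric
  function.\<close>

lemma temp_lower:
  assumes d: "0 < Dv m" and q: "1 < q" and d1: "Dv m \<le> 1" and L: "0 < L" and N: "0 < N" and b: "0 \<le> b"
    and lo: "\<And>j. j \<in> vidx m \<Longrightarrow> L * tail_profile \<alpha> b (vpt m j) \<le> g i j"
    and up: "\<And>j. j \<in> vidx m \<Longrightarrow> g i j \<le> N * wt q (vpt m j)"
    and D: "0 < D" "D / 2 \<le> (\<Sum>j\<in>vidx m. tail_profile \<alpha> b (vpt m j) * Dv m)" and dD: "Dv m \<le> D / 8"
  shows "L * (D / 2) \<le> dens_h m g i" "dens_h m g i \<le> N * (1 + 2 / (q - 1))"
    "L * D ^ 3 / (1024 * (N * (1 + 2 / (q - 1)))) \<le> temp_h m g i"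
proof -
  let ?p = "\<lambda>j. tail_profile \<alpha> b (vpt m j)" and ?U = "bulk_h m g i"
  have "L * (D / 2) \<le> L * (\<Sum>j\<in>vidx m. ?p j * Dv m)" using D L by (intro mult_left_mono) auto
  also have "\<dots> = (\<Sum>j\<in>vidx m. L * ?p j * Dv m)" by (simp only: sum_distrib_left mult.assoc)
  also have "\<dots> \<le> dens_h m g i" unfolding dens_h_def using d lo by (intro sum_mono mult_right_mono) auto
  finally show lower: "L * (D / 2) \<le> dens_h m g i" .
  then have \<rho>: "0 < dens_h m g i" using L D by (meson half_gt_zero less_le_trans mult_pos_pos)
  have "dens_h m g i \<le> (\<Sum>j\<in>vidx m. N * (wt q (vpt m j) * Dv m))"
    unfolding dens_h_def mult.assoc[symmetric] using d up by (intro sum_mono mult_right_mono) auto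
  also have "\<dots> = N * (\<Sum>j\<in>vidx m. wt q (vpt m j) * Dv m)" by (simp only: sum_distrib_left)
  also have "\<dots> \<le> N * (1 + 2 / (q - 1))"
    using sum_wt[OF d q] d1 N by (intro mult_left_mono) auto
  finally show upper: "dens_h m g i \<le> N * (1 + 2 / (q - 1))" .
  let ?r = "D / 16"
  let ?far = "{j\<in>vidx m. ?r \<le> \<bar>vpt m j\<bar>}" and ?near = "{j\<in>vidx m. \<bar>vpt m j - 0\<bar> < ?r}"
  have near: "(\<Sum>j\<in>?near. ?p j * Dv m) \<le> D / 4"
  proof -
    have "(\<Sum>j\<in>?near. ?p j * Dv m) \<le> (\<Sum>j\<in>?near. Dv m)"
      using tail_profile_le_1[OF b] d by (intro sum_mono) (simp add: mult_le_cancel_right1)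
    also have "\<dots> \<le> 2 * ?r + Dv m" using d D by (intro vidx_near_sum) auto
    finally show ?thesis using dD by simp
  qed
  have "?near \<union> ?far = vidx m" "?near \<inter> ?far = {}" by auto
  then have "(\<Sum>j\<in>vidx m. ?p j * Dv m) = (\<Sum>j\<in>?near. ?p j * Dv m) + (\<Sum>j\<in>?far. ?p j * Dv m)"
    by (metis (no_types, lifting) finite_Un finite_vidx sum.union_disjoint)
  then have far: "D / 4 \<le> (\<Sum>j\<in>?far. ?p j * Dv m)" using near D by linarith
  have "?r\<^sup>2 * (D / 4) \<le> ?r\<^sup>2 * (\<Sum>j\<in>?far. ?p j * Dv m)" using far by (intro mult_left_mono) auto
  also have "\<dots> = (\<Sum>j\<in>?far. ?p j * ?r\<^sup>2 * Dv m)" by (simp only: sum_distrib_left mult_ac)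
  also have "\<dots> \<le> (\<Sum>j\<in>?far. ?p j * (vpt m j)\<^sup>2 * Dv m)"
  proof (intro sum_mono mult_right_mono mult_left_mono)
    fix j assume "j \<in> ?far"
    then have "?r\<^sup>2 \<le> \<bar>vpt m j\<bar>\<^sup>2" using D by (intro power_mono) auto
    then show "?r\<^sup>2 \<le> (vpt m j)\<^sup>2" by (simp only: power2_abs)
  qed (use d in auto)
  also have "\<dots> \<le> (\<Sum>j\<in>vidx m. ?p j * (vpt m j)\<^sup>2 * Dv m)"
    by (rule sum_mono2) (use d in auto)
  also have "\<dots> \<le> (\<Sum>j\<in>vidx m. ?p j * \<bar>vpt m j - ?U\<bar>\<^sup>2 * Dv m)"
  proof -
    have odd: "(\<Sum>j\<in>vidx m. ?p j * vpt m j * Dv m) = 0"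
    proof -
      have "(\<Sum>j\<in>vidx m. ?p j * vpt m j * Dv m) = (\<Sum>j\<in>vidx m. ?p (- j) * vpt m (- j) * Dv m)"
        by (rule sum_vidx_minus[symmetric])
      also have "\<dots> = - (\<Sum>j\<in>vidx m. ?p j * vpt m j * Dv m)"
        by (simp add: vpt_minus tail_profile_def sum_negf)
      finally show ?thesis by simp
    qed
    have "(\<Sum>j\<in>vidx m. ?p j * \<bar>vpt m j - ?U\<bar>\<^sup>2 * Dv m) = (\<Sum>j\<in>vidx m. ?p j * (vpt m j)\<^sup>2 * Dv m
        - 2 * ?U * (?p j * vpt m j * Dv m) + ?U\<^sup>2 * (?p j * Dv m))"
      by (intro sum.cong refl) (simp add: power2_eq_square algebra_simps)
    also have "\<dots> = (\<Sum>j\<in>vidx m. ?p j * (vpt m j)\<^sup>2 * Dv m) - 2 * ?U * (\<Sum>j\<in>vidx m. ?p j * vpt m j * Dv m)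
       + ?U\<^sup>2 * (\<Sum>j\<in>vidx m. ?p j * Dv m)"
      by (simp add: sum.distrib sum_subtractf sum_distrib_left)
    also have "\<dots> \<ge> (\<Sum>j\<in>vidx m. ?p j * (vpt m j)\<^sup>2 * Dv m)"
      unfolding odd using d by (simp add: sum_nonneg)
    finally show ?thesis .
  qed
  finally have "L * (?r\<^sup>2 * (D / 4)) \<le> L * (\<Sum>j\<in>vidx m. ?p j * \<bar>vpt m j - ?U\<bar>\<^sup>2 * Dv m)"
    using L by (intro mult_left_mono) auto
  also have "\<dots> = (\<Sum>j\<in>vidx m. L * ?p j * \<bar>vpt m j - ?U\<bar>\<^sup>2 * Dv m)"
    by (simp only: sum_distrib_left mult.assoc)
  also have "\<dots> \<le> (\<Sum>j\<in>vidx m. g i j * \<bar>vpt m j - ?U\<bar>\<^sup>2 * Dv m)"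
    using d lo by (intro sum_mono mult_right_mono) auto
  also have "\<dots> = dens_h m g i * temp_h m g i" using \<rho> by (intro centred_moment_h) auto
  finally have P: "L * D ^ 3 / 1024 \<le> dens_h m g i * temp_h m g i"
    by (simp add: power2_eq_square power3_eq_cube mult_ac)
  have "0 < L * D ^ 3 / 1024" using L D by simp
  then have T: "0 < temp_h m g i" using P \<rho> by (metis less_le_trans zero_less_mult_pos)
  have "L * D ^ 3 / 1024 \<le> (N * (1 + 2 / (q - 1))) * temp_h m g i"
    using P mult_right_mono[OF upper, of "temp_h m g i"] T by linarith
  moreover have "0 < N * (1 + 2 / (q - 1))" using N q by (intro mult_pos_pos add_pos_nonneg) auto
  ultimately show "L * D ^ 3 / (1024 * (N * (1 + 2 / (q - 1)))) \<le> temp_h m g i"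
    using divide_le_if_le_mult by blast
qed

text \<open>A mesh satisfying the CFL condition for every field up to \<open>C_E1\<close>, the bound that the discrete
  field is later shown to obey.\<close>

locale scheme_run =
  fixes q \<epsilon> \<alpha> Tf V :: real and m :: mesh and f0 :: "real \<Rightarrow> real \<Rightarrow> real"
  assumes q: "3 < q" and \<epsilon>: "0 < \<epsilon>" and \<alpha>: "1 \<le> \<alpha>" "\<alpha> \<le> 2" and Tf: "0 < Tf"
    and mesh: "phase_mesh V m" and dt: "0 < Dt m" and dv_half: "Dv m \<le> 1 / 2"
    and cfl: "\<And>j e. j \<in> vidx m \<Longrightarrow> \<bar>e\<bar> \<le> C_E1 \<epsilon> Tf \<Longrightarrow>
        Dt m / Dx m * \<bar>vpt m j\<bar> + Dt m / Dv m * \<bar>e\<bar> \<le> 1"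
begin

abbreviation "CE \<equiv> C_E1 \<epsilon> Tf"
abbreviation "CE2 \<equiv> C_E2 q \<epsilon> Tf"
abbreviation "fn n \<equiv> f_h \<epsilon> m f0 n"
abbreviation "tn n \<equiv> transport_h m (f_h \<epsilon> m f0 n)"
abbreviation "K \<equiv> 1 + 2 / (q - 1)"
text \<open>The rate at which the barrier decays: shifts by the field contribute all but \<open>1 / \<epsilon>\<close>, which is due
  to the relaxation.\<close>

definition "rate = \<alpha> * CE * (3 / 2 + CE * Tf) + 1 / \<epsilon>"
abbreviation "field_ok n \<equiv> \<forall>i\<in>xidx m. \<bar>E_h \<epsilon> m f0 n i\<bar> \<le> CE"
definition "lower n C0 \<longleftrightarrow> (\<forall>i\<in>xidx m. \<forall>j\<in>vidx m.
   C0 * exp (- (rate * (real n * Dt m))) * tail_profile \<alpha> (\<alpha> * CE * (real n * Dt m)) (vpt m j) \<le> fn n i j)"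

lemma CE: "1 \<le> CE"
  unfolding C_E1_def using Tf \<epsilon> by (simp add: add_increasing)

lemma CE2: "0 \<le> CE2"
  unfolding C_E2_def using CE q ge_one_powr_ge_zero[of 2 q] by simp

lemma pos: "0 \<le> Dt m" "0 < Dx m" "0 < Dv m" and Nx: "real (Nx m) * Dx m = 1"
  using mesh dt by (auto simp: phase_mesh_def)

lemma dt_half: "Dt m \<le> 1 / 2"
proof -
  have "(0::int) \<in> vidx m" by (simp add: vidx_def)
  from cfl[OF this, of CE] have "Dt m / Dv m * CE \<le> 1" using CE by (simp add: vpt_def)
  then have "Dt m * CE \<le> Dv m" using pos by (simp add: field_simps)
  moreover have "Dt m * 1 \<le> Dt m * CE" using CE pos by (intro mult_left_mono) auto
  ultimately show ?thesis using dv_half by linarith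
qed

text \<open>Jensen's inequality turns the convex combination of the profile and its shifted copy into a single
  exponential: a share \<open>l\<close> of a loss \<open>y\<close> in the exponent costs \<open>l * y\<close>, and here \<open>l * y\<close> no longer
  contains the cell size.\<close>

lemma transport_lower:
  assumes c: "0 \<le> c" and b: "0 \<le> b" and E: "\<And>i. i \<in> xidx m \<Longrightarrow> \<bar>field_h m g i\<bar> \<le> CE"
    and g: "\<And>i j. i \<in> xidx m \<Longrightarrow> j \<in> vidx m \<Longrightarrow> c * tail_profile \<alpha> b (vpt m j) \<le> g i j"
    and ij: "i \<in> xidx m" "j \<in> vidx m"
  shows "c * exp (- (Dt m * (CE * (3 / 2 * \<alpha> + b)))) * tail_profile \<alpha> (b + \<alpha> * CE * Dt m) (vpt m j)
     \<le> transport_h m g i j"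
proof -
  let ?v = "vpt m j" and ?e = "field_h m g i"
  define y where "y = Dv m * (\<alpha> * (3 / 2 + \<bar>?v\<bar>) + b)"
  define l where "l = Dt m / Dv m * \<bar>?e\<bar>"
  have e: "\<bar>?e\<bar> \<le> CE" using E ij by auto
  have l0: "0 \<le> l" unfolding l_def using pos by simp
  have "0 \<le> Dt m / Dx m * \<bar>?v\<bar>" using pos by simp
  then have l1: "l \<le> 1" unfolding l_def using cfl[OF ij(2) e] by linarith
  have p: "c * (tail_profile \<alpha> b ?v * exp (- y)) \<le> g i k" if "k \<in> vidx m" "\<bar>?v - vpt m k\<bar> \<le> Dv m" for k
    using g[OF ij(1) that(1)]
      mult_left_mono[OF tail_profile_shift[OF that(2) pos(3) dv_half \<alpha> b] c] unfolding y_def by linarith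
  have "(1 - l) * (c * tail_profile \<alpha> b ?v) + l * (c * (tail_profile \<alpha> b ?v * exp (- y))) \<le> upwind m (field_h m g) g i j"
    unfolding l_def
  proof (rule upwind_ge[where e = "field_h m g" and g = g and i = i and j = j, OF ij pos cfl[OF ij(2) e]])
    show "c * (tail_profile \<alpha> b ?v * exp (- y)) \<le> g i (clampv m (j - 1))"
      by (rule p[OF clampv_in clampv_dist(1)[OF ij(2) pos(3)]])
    show "c * (tail_profile \<alpha> b ?v * exp (- y)) \<le> g i (clampv m (j + 1))"
      by (rule p[OF clampv_in clampv_dist(2)[OF ij(2) pos(3)]])
  qed (use g ij in auto)
  moreover have "(1 - l) * (c * tail_profile \<alpha> b ?v) + l * (c * (tail_profile \<alpha> b ?v * exp (- y)))
      = c * tail_profile \<alpha> b ?v * (1 - l + l * exp (- y))" by (simp add: algebra_simps)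
  moreover have "c * tail_profile \<alpha> b ?v * exp (- (l * y)) \<le> c * tail_profile \<alpha> b ?v * (1 - l + l * exp (- y))"
    using c exp_Jensen[OF l0 l1] by (intro mult_left_mono) auto
  moreover have "c * exp (- (Dt m * (CE * (3 / 2 * \<alpha> + b)))) * tail_profile \<alpha> (b + \<alpha> * CE * Dt m) ?v
      \<le> c * tail_profile \<alpha> b ?v * exp (- (l * y))"
  proof -
    have "l * y = Dt m * (\<bar>?e\<bar> * (\<alpha> * (3 / 2 + \<bar>?v\<bar>) + b))"
      unfolding l_def y_def using pos by (simp add: field_simps)
    also have "\<dots> \<le> Dt m * (CE * (\<alpha> * (3 / 2 + \<bar>?v\<bar>) + b))"
      using pos e \<alpha> b by (intro mult_left_mono mult_right_mono) auto
    finally have "- (Dt m * (CE * (3 / 2 * \<alpha> + b))) + (- (\<bar>?v\<bar> powr \<alpha>) - (b + \<alpha> * CE * Dt m) * \<bar>?v\<bar>)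
        \<le> (- (\<bar>?v\<bar> powr \<alpha>) - b * \<bar>?v\<bar>) + - (l * y)"
      by (simp add: algebra_simps)
    then show ?thesis unfolding tail_profile_def mult.assoc exp_add[symmetric]
      using c by (intro mult_left_mono) auto
  qed
  ultimately show ?thesis unfolding transport_h_upwind by linarith
qed

lemma maxwellian_h_nonneg:
  assumes "\<And>j. j \<in> vidx m \<Longrightarrow> 0 \<le> h i j"
  shows "0 \<le> maxwellian_h m h i j"
proof -
  have "0 \<le> dens_h m h i" unfolding dens_h_def using assms pos by (intro sum_nonneg) auto
  moreover have "0 \<le> temp_h m h i" unfolding temp_h_def using assms pos calculation
    by (intro divide_nonneg_nonneg sum_nonneg) auto
  ultimately show ?thesis by (simp add: maxwellian_h_def maxwellian_def)
qed

lemma lower_transport: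
  assumes lo: "lower n C0" and C0: "0 \<le> C0" and E: "field_ok n" and n: "real (Suc n) * Dt m \<le> Tf"
    and ij: "i \<in> xidx m" "j \<in> vidx m"
  shows "C0 * exp (- (rate * (real (Suc n) * Dt m))) * exp (Dt m / \<epsilon>)
      * tail_profile \<alpha> (\<alpha> * CE * (real (Suc n) * Dt m)) (vpt m j) \<le> tn n i j"
proof -
  let ?t = "real n * Dt m" and ?v = "vpt m j"
  let ?b = "\<alpha> * CE * ?t"
  have b: "0 \<le> ?b" using \<alpha> CE pos by simp
  have t: "?t + Dt m \<le> Tf" using n by (simp add: distrib_right)
  have "C0 * exp (- (rate * ?t)) * exp (- (Dt m * (CE * (3 / 2 * \<alpha> + ?b)))) * tail_profile \<alpha> (?b + \<alpha> * CE * Dt m) ?v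
      \<le> tn n i j"
    by (rule transport_lower[OF _ b])
      (use C0 E lo ij in \<open>auto simp: lower_def E_h_def\<close>)
  moreover have "?b + \<alpha> * CE * Dt m = \<alpha> * CE * (real (Suc n) * Dt m)" by (simp add: algebra_simps)
  moreover have "C0 * exp (- (rate * (real (Suc n) * Dt m))) * exp (Dt m / \<epsilon>)
      \<le> C0 * exp (- (rate * ?t)) * exp (- (Dt m * (CE * (3 / 2 * \<alpha> + ?b))))"
  proof -
    have "CE * (3 / 2 * \<alpha> + ?b) \<le> CE * (3 / 2 * \<alpha> + \<alpha> * CE * Tf)"
      using CE \<alpha> t pos by (intro mult_left_mono add_left_mono) auto
    then have "Dt m * (CE * (3 / 2 * \<alpha> + ?b)) \<le> Dt m * (CE * (3 / 2 * \<alpha> + \<alpha> * CE * Tf))"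
      by (rule mult_left_mono) (rule pos)
    also have "\<dots> = Dt m * rate - Dt m / \<epsilon>" unfolding rate_def by (simp add: algebra_simps)
    finally have "- (rate * (real (Suc n) * Dt m)) + Dt m / \<epsilon>
        \<le> - (rate * ?t) + - (Dt m * (CE * (3 / 2 * \<alpha> + ?b)))"
      by (simp add: algebra_simps)
    then show ?thesis unfolding mult.assoc exp_add[symmetric] using C0 by (intro mult_left_mono) auto
  qed
  then have "C0 * exp (- (rate * (real (Suc n) * Dt m))) * exp (Dt m / \<epsilon>)
      * tail_profile \<alpha> (\<alpha> * CE * (real (Suc n) * Dt m)) ?v
      \<le> C0 * exp (- (rate * ?t)) * exp (- (Dt m * (CE * (3 / 2 * \<alpha> + ?b))))
      * tail_profile \<alpha> (\<alpha> * CE * (real (Suc n) * Dt m)) ?v"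
    by (intro mult_right_mono) auto
  ultimately show ?thesis by simp
qed

text \<open>Relaxation towards a nonnegative Maxwellian costs the factor
  \<open>\<epsilon> / (\<epsilon> + Dt) \<ge> exp (- Dt / \<epsilon>)\<close>. The second claim replaces the barrier by a smaller one
  that is the same at all times.\<close>

lemma lower_step:
  assumes lo: "lower n C0" and C0: "0 \<le> C0" and E: "field_ok n" and n: "real (Suc n) * Dt m \<le> Tf"
  shows "lower (Suc n) C0"
    "\<And>i j. i \<in> xidx m \<Longrightarrow> j \<in> vidx m \<Longrightarrow>
      C0 * exp (- (rate * Tf)) * tail_profile \<alpha> (beta_E \<alpha> \<epsilon> Tf) (vpt m j) \<le> tn n i j"
proof -
  let ?L = "C0 * exp (- (rate * (real (Suc n) * Dt m)))"
  have rate: "0 \<le> rate" unfolding rate_def using \<alpha> CE Tf \<epsilon> by simp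
  have L: "0 \<le> ?L" using C0 by simp
  have e1: "1 \<le> exp (Dt m / \<epsilon>)" using pos \<epsilon> by simp
  have T: "0 \<le> tn n i j" if "i \<in> xidx m" "j \<in> vidx m" for i j
    using lower_transport[OF lo C0 E n that] C0 by (meson mult_nonneg_nonneg exp_ge_zero order_trans tail_profile_nonneg)
  show "lower (Suc n) C0"
    unfolding lower_def
  proof (intro ballI)
    fix i j assume ij: "i \<in> xidx m" "j \<in> vidx m"
    let ?P = "?L * tail_profile \<alpha> (\<alpha> * CE * (real (Suc n) * Dt m)) (vpt m j)"
    have M: "0 \<le> maxwellian_h m (tn n) i j" using T ij by (intro maxwellian_h_nonneg) auto
    have P0: "0 \<le> ?P" using L by simp
    have "(1 + Dt m / \<epsilon>) * ?P \<le> exp (Dt m / \<epsilon>) * ?P" using P0 by (intro mult_right_mono exp_ge_add_one_self) auto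
    also have "\<dots> \<le> tn n i j" using lower_transport[OF lo C0 E n ij] by (simp only: mult_ac)
    finally have "(\<epsilon> + Dt m) * ?P \<le> \<epsilon> * tn n i j"
      using \<epsilon> by (simp add: field_simps)
    also have "\<dots> \<le> \<epsilon> * tn n i j + Dt m * maxwellian_h m (tn n) i j" using M pos by simp
    finally show "?P \<le> fn (Suc n) i j"
      using \<epsilon> dt by (simp add: step_h_def Let_def pos_le_divide_eq mult.commute)
  qed
  fix i j assume ij: "i \<in> xidx m" "j \<in> vidx m"
  let ?v = "vpt m j"
  have "C0 * exp (- (rate * Tf)) * tail_profile \<alpha> (beta_E \<alpha> \<epsilon> Tf) ?v
      \<le> ?L * tail_profile \<alpha> (\<alpha> * CE * (real (Suc n) * Dt m)) ?v"
  proof (intro mult_mono mult_left_mono)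
    show "exp (- (rate * Tf)) \<le> exp (- (rate * (real (Suc n) * Dt m)))"
      unfolding exp_le_cancel_iff neg_le_iff_le by (rule mult_left_mono[OF n rate])
    have "\<alpha> * CE * (real (Suc n) * Dt m) \<le> \<alpha> * CE * (2 * Tf)"
      using n \<alpha> CE Tf by (intro mult_left_mono) auto
    then show "tail_profile \<alpha> (beta_E \<alpha> \<epsilon> Tf) ?v \<le> tail_profile \<alpha> (\<alpha> * CE * (real (Suc n) * Dt m)) ?v"
      unfolding beta_E_def by (intro tail_profile_antimono) (simp add: mult_ac)
  qed (use C0 in auto)
  also have "\<dots> \<le> ?L * exp (Dt m / \<epsilon>) * tail_profile \<alpha> (\<alpha> * CE * (real (Suc n) * Dt m)) ?v"
    using e1 L by (intro mult_right_mono) (auto simp: mult_le_cancel_left1)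
  also have "\<dots> \<le> tn n i j" by (rule lower_transport[OF lo C0 E n ij])
  finally show "C0 * exp (- (rate * Tf)) * tail_profile \<alpha> (beta_E \<alpha> \<epsilon> Tf) ?v \<le> tn n i j" .
qed

end

context scheme_run
begin

text \<open>Growth rate of the weighted norm: transport contributes \<open>C_E2\<close>, and the relaxation towards a
  Maxwellian that is at most \<open>Cm\<close> times larger contributes the rest.\<close>

definition "growth Cm = CE2 + (Cm - 1) / \<epsilon>"

text \<open>A bound for the transported solution at all times; the factor \<open>1 + CE2\<close> is the growth in the last
  transport step, which is not followed by a relaxation.\<close>

definition "sup_bound Cm F = (1 + CE2) * F * exp (growth Cm * Tf)"

definition "upper Cm F n \<longleftrightarrow> (\<forall>i\<in>xidx m. \<forall>j\<in>vidx m.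
   fn n i j \<le> F * exp (growth Cm * (real n * Dt m)) * wt q (vpt m j))"

definition "mass_ok n \<longleftrightarrow> mass_h m (fn n) \<le> (2 + real n * Dt m) * exp (real n * Dt m / \<epsilon>)"

lemma growth_nonneg: "1 \<le> Cm \<Longrightarrow> 0 \<le> growth Cm"
  unfolding growth_def using CE2 \<epsilon> by simp

lemma lower_nonneg: "lower n C0 \<Longrightarrow> 0 \<le> C0 \<Longrightarrow> i \<in> xidx m \<Longrightarrow> j \<in> vidx m \<Longrightarrow> 0 \<le> fn n i j"
  unfolding lower_def by (meson mult_nonneg_nonneg exp_ge_zero order_trans tail_profile_nonneg)

lemma field_ok_if_mass_ok:
  assumes "mass_ok n" and nonneg: "\<And>i j. i \<in> xidx m \<Longrightarrow> j \<in> vidx m \<Longrightarrow> 0 \<le> fn n i j"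
    and n: "real n * Dt m \<le> Tf"
  shows "field_ok n"
proof
  fix i
  have "\<bar>E_h \<epsilon> m f0 n i\<bar> \<le> mass_h m (fn n) + 1"
    unfolding E_h_def by (rule field_h_bound[OF pos(2,3) Nx nonneg])
  also have "\<dots> \<le> (2 + real n * Dt m) * exp (real n * Dt m / \<epsilon>) + 1" using assms by (simp add: mass_ok_def)
  also have "\<dots> \<le> (2 + Tf) * exp (Tf / \<epsilon>) + 1"
    using n \<epsilon> pos Tf by (intro add_right_mono mult_mono) (auto simp: divide_right_mono)
  finally show "\<bar>E_h \<epsilon> m f0 n i\<bar> \<le> CE" by (simp add: C_E1_def)
qed

lemma upper_transport:
  assumes up: "upper Cm F n" and Cm: "1 \<le> Cm" and F: "0 < F" and E: "field_ok n"
    and n: "real n * Dt m \<le> Tf" and ij: "i \<in> xidx m" "j \<in> vidx m"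
  shows "tn n i j \<le> F * exp (growth Cm * (real n * Dt m)) * (1 + Dt m * CE2) * wt q (vpt m j)"
    "tn n i j \<le> sup_bound Cm F * wt q (vpt m j)"
proof -
  let ?U = "F * exp (growth Cm * (real n * Dt m))"
  have e: "\<bar>field_h m (fn n) i\<bar> \<le> CE" using E ij by (auto simp: E_h_def)
  show 1: "tn n i j \<le> ?U * (1 + Dt m * CE2) * wt q (vpt m j)"
    unfolding transport_h_upwind C_E2_def
    by (rule upwind_weighted[where e = "field_h m (fn n)" and i = i and j = j, OF ij pos _ _ cfl[OF ij(2) e] e])
      (use dv_half q F up in \<open>auto simp: upper_def\<close>)
  also have "\<dots> \<le> sup_bound Cm F * wt q (vpt m j)"
  proof (rule mult_right_mono)
    have "?U * (1 + Dt m * CE2) \<le> F * exp (growth Cm * Tf) * (1 + 1 * CE2)"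
      using dt_half CE2 F pos n growth_nonneg[OF Cm]
      by (intro mult_mono add_left_mono) (auto intro: mult_left_mono)
    then show "?U * (1 + Dt m * CE2) \<le> sup_bound Cm F" by (simp add: sup_bound_def mult_ac)
  qed simp
  finally show "tn n i j \<le> sup_bound Cm F * wt q (vpt m j)" .
qed

lemma step_h_eq: "fn (Suc n) i j = (\<epsilon> * tn n i j + Dt m * maxwellian_h m (tn n) i j) / (\<epsilon> + Dt m)"
  by (simp add: step_h_def Let_def)

lemma upper_step:
  assumes up: "upper Cm F n" and Cm: "1 \<le> Cm" and F: "0 < F" and E: "field_ok n"
    and n: "real n * Dt m \<le> Tf"
    and M: "\<And>i j. i \<in> xidx m \<Longrightarrow> j \<in> vidx m \<Longrightarrow>
      maxwellian_h m (tn n) i j \<le> Cm * (F * exp (growth Cm * (real n * Dt m)) * (1 + Dt m * CE2)) * wt q (vpt m j)"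
  shows "upper Cm F (Suc n)"
  unfolding upper_def
proof (intro ballI)
  fix i j assume ij: "i \<in> xidx m" "j \<in> vidx m"
  let ?U = "F * exp (growth Cm * (real n * Dt m))"
  define W where "W = ?U * (1 + Dt m * CE2) * wt q (vpt m j)"
  have W: "0 \<le> W" unfolding W_def using F CE2 pos by simp
  have "\<epsilon> * tn n i j + Dt m * maxwellian_h m (tn n) i j \<le> \<epsilon> * W + Dt m * (Cm * W)"
    using upper_transport(1)[OF up Cm F E n ij] M[OF ij] \<epsilon> pos unfolding W_def
    by (intro add_mono mult_left_mono) (auto simp: mult.assoc)
  then have "fn (Suc n) i j \<le> (\<epsilon> * W + Dt m * (Cm * W)) / (\<epsilon> + Dt m)"
    unfolding step_h_eq using \<epsilon> dt by (intro divide_right_mono) auto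
  also have "\<dots> \<le> (1 + Dt m * (Cm - 1) / \<epsilon>) * W"
  proof -
    have "\<epsilon> + Dt m * Cm \<le> (1 + Dt m * (Cm - 1) / \<epsilon>) * (\<epsilon> + Dt m)"
      using \<epsilon> dt Cm by (simp add: field_simps)
    then have "(\<epsilon> + Dt m * Cm) * W \<le> (1 + Dt m * (Cm - 1) / \<epsilon>) * (\<epsilon> + Dt m) * W"
      using W by (rule mult_right_mono)
    moreover have "\<epsilon> * W + Dt m * (Cm * W) = (\<epsilon> + Dt m * Cm) * W" by (simp add: distrib_right)
    ultimately show ?thesis using \<epsilon> dt by (subst pos_divide_le_eq) (auto simp only: mult_ac add_pos_pos)
  qed
  also have "\<dots> \<le> exp (Dt m * (Cm - 1) / \<epsilon>) * W" using W by (intro mult_right_mono exp_ge_add_one_self)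
  also have "\<dots> \<le> exp (Dt m * (Cm - 1) / \<epsilon>) * (?U * exp (Dt m * CE2) * wt q (vpt m j))"
    unfolding W_def using F by (intro mult_left_mono mult_right_mono exp_ge_add_one_self) auto
  also have "\<dots> = F * exp (growth Cm * (real (Suc n) * Dt m)) * wt q (vpt m j)"
  proof -
    have "growth Cm * (real (Suc n) * Dt m) = Dt m * (Cm - 1) / \<epsilon> + growth Cm * (real n * Dt m) + Dt m * CE2"
      unfolding growth_def using \<epsilon> by (simp add: field_simps)
    then show ?thesis by (simp add: exp_add)
  qed
  finally show "fn (Suc n) i j \<le> F * exp (growth Cm * (real (Suc n) * Dt m)) * wt q (vpt m j)" .
qed

text \<open>The ghost cells add at most \<open>Dt\<close>, and the relaxation multiplies by at most \<open>exp (Dt / \<epsilon>)\<close>.\<close>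

lemma mass_step:
  assumes mass: "mass_ok n" and nonneg: "\<And>i j. i \<in> xidx m \<Longrightarrow> j \<in> vidx m \<Longrightarrow> 0 \<le> fn n i j"
    and nonneg_t: "\<And>i j. i \<in> xidx m \<Longrightarrow> j \<in> vidx m \<Longrightarrow> 0 \<le> tn n i j"
    and b: "\<And>i j. i \<in> xidx m \<Longrightarrow> \<bar>j\<bar> = int (Nv m) \<Longrightarrow> \<bar>E_h \<epsilon> m f0 n i\<bar> * fn n i j \<le> 1"
    and T: "\<And>i. i \<in> xidx m \<Longrightarrow> 0 < temp_h m (tn n) i" "\<And>i. i \<in> xidx m \<Longrightarrow> 64 * (Dv m)\<^sup>2 \<le> temp_h m (tn n) i"
  shows "mass_ok (Suc n)"
proof -
  let ?t = "real n * Dt m"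
  have 1: "mass_h m (tn n) \<le> mass_h m (fn n) + Dt m * 1"
    unfolding transport_h_upwind by (rule upwind_mass[OF pos Nx nonneg]) (use b in \<open>auto simp: E_h_def\<close>)
  have 2: "dens_h m (fn (Suc n)) i \<le> exp (Dt m / \<epsilon>) * dens_h m (tn n) i" if i: "i \<in> xidx m" for i
  proof -
    let ?\<rho> = "dens_h m (tn n) i"
    have \<rho>: "0 \<le> ?\<rho>" unfolding dens_h_def using nonneg_t[OF i] pos by (intro sum_nonneg) auto
    have "dens_h m (fn (Suc n)) i = (\<Sum>j\<in>vidx m. (\<epsilon> * (tn n i j * Dv m) + Dt m * (maxwellian_h m (tn n) i j * Dv m)) / (\<epsilon> + Dt m))"
      unfolding dens_h_def step_h_eq by (intro sum.cong refl) (simp add: field_simps)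
    also have "\<dots> = (\<epsilon> * ?\<rho> + Dt m * (\<Sum>j\<in>vidx m. maxwellian_h m (tn n) i j * Dv m)) / (\<epsilon> + Dt m)"
      unfolding dens_h_def by (simp only: sum_divide_distrib[symmetric] sum.distrib sum_distrib_left)
    also have "\<dots> \<le> (\<epsilon> * ?\<rho> + Dt m * (2 * ?\<rho>)) / (\<epsilon> + Dt m)"
      unfolding maxwellian_h_def using \<epsilon> dt \<rho> T[OF i] pos
      by (intro divide_right_mono add_left_mono mult_left_mono maxwellian_grid_mass) auto
    also have "\<dots> \<le> (1 + Dt m / \<epsilon>) * ?\<rho>"
    proof -
      have "\<epsilon> + 2 * Dt m \<le> (1 + Dt m / \<epsilon>) * (\<epsilon> + Dt m)" using \<epsilon> dt by (simp add: field_simps)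
      then have "(\<epsilon> + 2 * Dt m) * ?\<rho> \<le> (1 + Dt m / \<epsilon>) * (\<epsilon> + Dt m) * ?\<rho>" using \<rho> by (rule mult_right_mono)
      moreover have "\<epsilon> * ?\<rho> + Dt m * (2 * ?\<rho>) = (\<epsilon> + 2 * Dt m) * ?\<rho>" by (simp add: distrib_right)
      ultimately show ?thesis using \<epsilon> dt by (subst pos_divide_le_eq) (auto simp only: mult_ac add_pos_pos)
    qed
    also have "\<dots> \<le> exp (Dt m / \<epsilon>) * ?\<rho>" using \<rho> by (intro mult_right_mono exp_ge_add_one_self)
    finally show ?thesis .
  qed
  have "mass_h m (fn (Suc n)) \<le> (\<Sum>i\<in>xidx m. exp (Dt m / \<epsilon>) * dens_h m (tn n) i * Dx m)"
    unfolding mass_h_def using 2 pos by (intro sum_mono mult_right_mono) auto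
  also have "\<dots> = exp (Dt m / \<epsilon>) * mass_h m (tn n)"
    unfolding mass_h_def by (simp only: sum_distrib_left mult.assoc)
  also have "\<dots> \<le> exp (Dt m / \<epsilon>) * ((2 + ?t) * exp (?t / \<epsilon>) + Dt m * exp (?t / \<epsilon>))"
  proof (rule mult_left_mono)
    have "Dt m * 1 \<le> Dt m * exp (?t / \<epsilon>)" using pos \<epsilon> by (intro mult_left_mono) auto
    then show "mass_h m (tn n) \<le> (2 + ?t) * exp (?t / \<epsilon>) + Dt m * exp (?t / \<epsilon>)"
      using 1 mass unfolding mass_ok_def by linarith
  qed simp
  also have "\<dots> = (2 + real (Suc n) * Dt m) * exp (real (Suc n) * Dt m / \<epsilon>)"
    by (simp add: algebra_simps add_divide_distrib exp_add)
  finally show ?thesis by (simp add: mass_ok_def)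
qed

text \<open>The bounds depend on each other in a cycle that closes over one time step: mass bounds the field,
  the field gives the CFL condition and with it barrier and weighted norm of the transported
  solution, these bound its temperature from below, and a resolved temperature controls the
  Maxwellian and hence the next weighted norm and the next mass.\<close>

lemma apriori:
  assumes Cm: "1 \<le> Cm"
    and mx: "\<And>g i N v. 0 \<le> N \<Longrightarrow>
       (\<And>j. j \<in> vidx m \<Longrightarrow> 0 \<le> g i j \<and> g i j \<le> N * wt q (vpt m j)) \<Longrightarrow>
       0 < dens_h m g i \<Longrightarrow> 0 < temp_h m g i \<Longrightarrow> 64 * (Dv m)\<^sup>2 \<le> temp_h m g i \<Longrightarrow>
       maxwellian (dens_h m g i) (bulk_h m g i) (temp_h m g i) v \<le> Cm * N * wt q v"
    and F: "0 < F" and up0: "upper Cm F 0" and C0: "0 < C0" and lo0: "lower 0 C0" and mass0: "mass_ok 0"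
    and V: "0 < V" and bd: "CE * (sup_bound Cm F * V powr (- q)) \<le> 1"
    and D: "0 < D" "D / 2 \<le> (\<Sum>j\<in>vidx m. tail_profile \<alpha> (beta_E \<alpha> \<epsilon> Tf) (vpt m j) * Dv m)" and dD: "Dv m \<le> D / 8"
    and press: "64 * (Dv m)\<^sup>2 \<le> C0 * exp (- (rate * Tf)) * D ^ 3 / (1024 * (sup_bound Cm F * K))"
    and n: "real n * Dt m \<le> Tf"
  shows "lower n C0 \<and> upper Cm F n \<and> mass_ok n"
  using n
proof (induction n)
  case 0 then show ?case using up0 lo0 mass0 by simp
next
  case (Suc n)
  let ?t = "real n * Dt m"
  have n: "?t \<le> Tf" using Suc.prems pos by (simp add: algebra_simps)
  have IH: "lower n C0" "upper Cm F n" "mass_ok n" using Suc.IH n by auto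
  have nonneg: "0 \<le> fn n i j" if "i \<in> xidx m" "j \<in> vidx m" for i j
    using lower_nonneg[OF IH(1) _ that] C0 by simp
  have E: "field_ok n" by (rule field_ok_if_mass_ok[OF IH(3) nonneg n])
  have C0': "0 \<le> C0" using C0 by simp
  note low = lower_step[OF IH(1) C0' E Suc.prems]
  have L: "0 < C0 * exp (- (rate * Tf))" using C0 by simp
  have nonneg_t: "0 \<le> tn n i j" if "i \<in> xidx m" "j \<in> vidx m" for i j
    using low(2)[OF that] L by (meson mult_nonneg_nonneg less_imp_le order_trans tail_profile_nonneg)
  have N: "0 < sup_bound Cm F" unfolding sup_bound_def using F CE2 by simp
  have b: "0 \<le> beta_E \<alpha> \<epsilon> Tf" unfolding beta_E_def using \<alpha> CE Tf by simp
  have T: "0 < dens_h m (tn n) i" "0 < temp_h m (tn n) i" "64 * (Dv m)\<^sup>2 \<le> temp_h m (tn n) i"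
    if i: "i \<in> xidx m" for i
  proof -
    \<comment> \<open>The temperature of the transported solution, from the barrier and the weighted norm just obtained.\<close>
    note tl = temp_lower[where g = "tn n" and i = i and \<alpha> = \<alpha> and b = "beta_E \<alpha> \<epsilon> Tf" and q = q and m = m,
        OF pos(3) _ _ L N b low(2)[OF i] upper_transport(2)[OF IH(2) Cm F E n i] D dD]
    have 1: "C0 * exp (- (rate * Tf)) * (D / 2) \<le> dens_h m (tn n) i" using tl(1) q dv_half by simp
    show "0 < dens_h m (tn n) i"
      using mult_pos_pos[OF L half_gt_zero[OF D(1)]] 1 by linarith
    show 3: "64 * (Dv m)\<^sup>2 \<le> temp_h m (tn n) i" using tl(3) q dv_half press by simp
    have "0 < 64 * (Dv m)\<^sup>2" using pos by simp
    then show "0 < temp_h m (tn n) i" using 3 by linarith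
  qed
  have up: "upper Cm F (Suc n)"
  proof (rule upper_step[OF IH(2) Cm F E n])
    fix i j assume ij: "i \<in> xidx m" "j \<in> vidx m"
    show "maxwellian_h m (tn n) i j \<le> Cm * (F * exp (growth Cm * ?t) * (1 + Dt m * CE2)) * wt q (vpt m j)"
      unfolding maxwellian_h_def
      by (rule mx) (use nonneg_t upper_transport(1)[OF IH(2) Cm F E n] ij T F CE2 pos in auto)
  qed
  have mass: "mass_ok (Suc n)"
  proof (rule mass_step[OF IH(3) nonneg nonneg_t])
    fix i j assume ij: "i \<in> xidx m" "\<bar>j\<bar> = int (Nv m)"
    then have j: "j \<in> vidx m" by (auto simp: vidx_def)
    have "real_of_int \<bar>j\<bar> * Dv m = V" using ij mesh by (simp add: phase_mesh_def)
    then have v: "\<bar>vpt m j\<bar> = V" using pos by (simp add: vpt_def abs_mult)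
    have "fn n i j \<le> F * exp (growth Cm * ?t) * wt q (vpt m j)" using IH(2) ij j by (simp add: upper_def)
    also have "\<dots> \<le> sup_bound Cm F * V powr (- q)"
    proof (intro mult_mono)
      have "F * exp (growth Cm * ?t) \<le> F * exp (growth Cm * Tf)"
        using n growth_nonneg[OF Cm] F by (auto intro: mult_left_mono)
      also have "\<dots> \<le> (1 + CE2) * (F * exp (growth Cm * Tf))" 
        using mult_right_mono[of 1 "1 + CE2" "F * exp (growth Cm * Tf)"] F CE2 by simp
      finally show "F * exp (growth Cm * ?t) \<le> sup_bound Cm F" by (simp add: sup_bound_def mult.assoc)
      show "wt q (vpt m j) \<le> V powr (- q)" unfolding wt_def v using V q by (intro powr_mono2') auto
    qed (use N in auto)
    finally have "\<bar>E_h \<epsilon> m f0 n i\<bar> * fn n i j \<le> CE * (sup_bound Cm F * V powr (- q))"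
      using E ij CE nonneg[OF ij(1) j] by (intro mult_mono) auto
    then show "\<bar>E_h \<epsilon> m f0 n i\<bar> * fn n i j \<le> 1" using bd by linarith
  qed (use T in auto)
  show ?case using low(1) up mass by blast
qed

text \<open>The barrier for an arbitrary constant \<open>C1\<close>, once the field is known to be bounded. The constant
  that enters the conditions on the mesh may be arbitrarily small, whereas the error bound has to
  be uniform in it; this lemma allows to return to a fixed constant.\<close>

lemma lower_run:
  assumes E: "\<And>k. k < n \<Longrightarrow> field_ok k" and C1: "0 \<le> C1" and lo0: "lower 0 C1" and n: "real n * Dt m \<le> Tf"
  shows "lower n C1"
  using n E
proof (induction n)
  case 0 then show ?case using lo0 by simp
next
  case (Suc n)
  have "real n * Dt m \<le> Tf" using Suc.prems(1) pos by (simp add: algebra_simps)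
  then have "lower n C1" using Suc by auto
  then show ?case using lower_step(1)[OF _ C1 _ Suc.prems(1)] Suc.prems(2)[of n] by simp
qed

end

section \<open>Consequences of the conditions on the mesh\<close>

lemma D_int_tail_profile: "D_int \<alpha> b = (LINT v|lborel. tail_profile \<alpha> b v)"
  by (simp add: D_int_def tail_profile_def)

text \<open>The integral is at least \<open>exp (- 2) / (1 + b)\<close>, from the interval \<open>{0..1 / (1 + b)}\<close>. The exponential
  form can be compared with the factor \<open>exp (- S * Tf)\<close> in the conditions on the mesh.\<close>

lemma D_int_lower:
  assumes D: "0 < D_int \<alpha> b" and b: "0 \<le> b" and \<alpha>: "1 \<le> \<alpha>"
  shows "exp (- 2) / 18 * exp (- (b / 18)) \<le> D_int \<alpha> b"
proof -
  have int: "integrable lborel (tail_profile \<alpha> b)"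
    using D not_integrable_integral_eq[of lborel "tail_profile \<alpha> b"] unfolding D_int_tail_profile by force
  \<comment> \<open>On the interval up to w both terms of the exponent are at most 1.\<close>
  define w where "w = 1 / (1 + b)"
  have w: "0 < w" "w \<le> 1" "b * w \<le> 1" unfolding w_def using b by (auto simp: field_simps)
  have "exp (- 2) * w = (LINT v|lborel. exp (- 2) * indicator {0..w} v)" using w by simp
  also have "\<dots> \<le> (LINT v|lborel. tail_profile \<alpha> b v)"
  proof (rule integral_mono[OF _ int])
    show "integrable lborel (\<lambda>v. exp (- 2) * indicator {0..w} v :: real)"
      using w by (intro integrable_mult_right integrable_real_indicator) auto
    fix v :: real
    show "exp (- 2) * indicator {0..w} v \<le> tail_profile \<alpha> b v"
    proof (cases "v \<in> {0..w}")
      case True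
      have "\<bar>v\<bar> powr \<alpha> \<le> 1" using True w \<alpha> powr_mono2[of \<alpha> "\<bar>v\<bar>" 1] by simp
      moreover have "b * \<bar>v\<bar> \<le> b * w" using True b by (intro mult_left_mono) auto
      ultimately have "- 2 \<le> - (\<bar>v\<bar> powr \<alpha>) - b * \<bar>v\<bar>" using w by linarith
      then show ?thesis using True by (simp add: tail_profile_def)
    qed simp
  qed
  finally have 1: "exp (- 2) * w \<le> D_int \<alpha> b" by (simp add: D_int_tail_profile)
  have "(1 + b) \<le> 18 * exp (b / 18)"
    using exp_ge_add_one_self[of "b / 18"] by linarith
  then have "exp (- (b / 18)) * (1 + b) \<le> exp (- (b / 18)) * (18 * exp (b / 18))"
    by (intro mult_left_mono) auto
  also have "\<dots> = 18" by (simp add: exp_minus)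
  finally have "exp (- (b / 18)) / 18 \<le> w" unfolding w_def using b by (simp add: field_simps)
  then have "exp (- 2) * (exp (- (b / 18)) / 18) \<le> exp (- 2) * w" by (intro mult_left_mono) auto
  moreover have "exp (- 2) / 18 * exp (- (b / 18)) = exp (- 2) * (exp (- (b / 18)) / 18)" by simp
  ultimately show ?thesis using 1 by linarith
qed

lemma Linf_norm_bound:
  assumes "Linf_norm q g < \<infinity>"
  shows "\<bar>g x v\<bar> \<le> enn2real (Linf_norm q g) * wt q v"
proof -
  have "ennreal (\<bar>g x v\<bar> * (1 + \<bar>v\<bar>) powr q) \<le> Linf_norm q g"
    unfolding Linf_norm_def by (rule SUP_upper2[of x], simp, rule SUP_upper2[of v]) auto
  then have "enn2real (ennreal (\<bar>g x v\<bar> * (1 + \<bar>v\<bar>) powr q)) \<le> enn2real (Linf_norm q g)"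
    using assms by (intro enn2real_mono) auto
  then show ?thesis by (simp add: wt_le_iff)
qed

definition "mesh_ok CM Cm q \<alpha> f0 C0 \<epsilon> Tf \<eta>1 \<eta>2 \<gamma> l V m \<longleftrightarrow>
  0 < C0 \<and> (\<forall>x v. C0 * exp (- (\<bar>v\<bar> powr \<alpha>)) \<le> f0 x v) \<and>
  1 / 2 \<le> \<gamma> \<and> \<gamma> < 1 \<and> admissible_l q \<alpha> \<epsilon> Tf \<gamma> f0 l \<and> phase_mesh V m \<and>
  Dx m < r_Dx \<alpha> \<epsilon> Tf l \<and>
  Dv m < r_Dv CM Cm q \<alpha> f0 C0 \<epsilon> Tf \<eta>1 \<eta>2 \<gamma> l (Dx m) \<and>
  \<eta>1 * (Dv m / C_E1 \<epsilon> Tf) < Dt m \<and> Dt m < \<eta>2 * (Dv m / C_E1 \<epsilon> Tf) \<and>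
  V = C_E1 \<epsilon> Tf / Dv m powr \<gamma>"

lemma C_E1_ge: "0 < \<epsilon> \<Longrightarrow> 0 < Tf \<Longrightarrow> 3 \<le> C_E1 \<epsilon> Tf"
  unfolding C_E1_def using mult_mono[of 2 "2 + Tf" 1 "exp (Tf / \<epsilon>)"] by simp

lemma less_Min_components:
  fixes x :: real
  assumes "x < Min {a1, a2, a3, a4, a5, a6, a7, a8, a9}"
  shows "x < a1 \<and> x < a4 \<and> x < a6 \<and> x < a7 \<and> x < a9"
proof -
  let ?A = "{a1, a2, a3, a4, a5, a6, a7, a8, a9}"
  have "x < a" if "a \<in> ?A" for a
    using assms Min_le[OF _ that] by (meson finite.emptyI finite.insertI less_le_trans)
  then show ?thesis by blast
qed

lemma less_r_Dv:
  assumes "hv < r_Dv CM Cm q \<alpha> f0 C0 \<epsilon> Tf \<eta>1 \<eta>2 \<gamma> l hx"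
  shows "hv < (C0 * D_int \<alpha> (beta_E \<alpha> \<epsilon> Tf)) powr (5/9)
      / (2 powr (16/9) * (1 + C_E2 q \<epsilon> Tf) powr (5/9) * CM powr (2/9) * enn2real (Linf_norm q f0) powr (5/9))
      * exp (- (5/9) * (S_const \<alpha> \<epsilon> Tf \<eta>1 + C_E2 q \<epsilon> Tf + Cm / \<epsilon>) * Tf)"
    "hv < l"
    "hv < (2 * C_E1 \<epsilon> Tf powr (1 - q) * (1 + C_E2 q \<epsilon> Tf)
      * exp ((C_E2 q \<epsilon> Tf + 2 * (Cm - 1) / \<epsilon>) * Tf) * enn2real (Linf_norm q f0)) powr (- (1 / (q * \<gamma>)))"
    "hv < ((1 - \<eta>2) / \<eta>2 * hx) powr (1 / (1 - \<gamma>))" "hv < 1 / 2"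
proof -
  note c = less_Min_components[OF assms[unfolded r_Dv_def Let_def]]
  show "hv < (C0 * D_int \<alpha> (beta_E \<alpha> \<epsilon> Tf)) powr (5/9)
      / (2 powr (16/9) * (1 + C_E2 q \<epsilon> Tf) powr (5/9) * CM powr (2/9) * enn2real (Linf_norm q f0) powr (5/9))
      * exp (- (5/9) * (S_const \<alpha> \<epsilon> Tf \<eta>1 + C_E2 q \<epsilon> Tf + Cm / \<epsilon>) * Tf)" by (rule c[THEN conjunct1])
  show "hv < l" by (rule c[THEN conjunct2, THEN conjunct1])
  show "hv < (2 * C_E1 \<epsilon> Tf powr (1 - q) * (1 + C_E2 q \<epsilon> Tf)
      * exp ((C_E2 q \<epsilon> Tf + 2 * (Cm - 1) / \<epsilon>) * Tf) * enn2real (Linf_norm q f0)) powr (- (1 / (q * \<gamma>)))" by (rule c[THEN conjunct2, THEN conjunct2, THEN conjunct1])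
  show "hv < ((1 - \<eta>2) / \<eta>2 * hx) powr (1 / (1 - \<gamma>))" by (rule c[THEN conjunct2, THEN conjunct2, THEN conjunct2, THEN conjunct1])
  show "hv < 1 / 2" by (rule c[THEN conjunct2, THEN conjunct2, THEN conjunct2, THEN conjunct2])
qed

text \<open>The power \<open>2 / 9\<close>, in which the constant enters \<open>r_Dv\<close>, is undone; the base is what comparing the
  square of the velocity cell with the temperature bound requires.\<close>

definition "CM_const q = (65536 * (2 * (1 + 2 / (q - 1)))\<^sup>2 / (exp (- 2) / 18)\<^sup>2) powr (9 / 2)"

text \<open>The CFL condition splits into \<open>Dt * V / Dx \<le> 1 - \<eta>2\<close>, which is the condition relating \<open>Dv\<close> to \<open>Dx\<close>,
  and \<open>Dt * C_E1 / Dv \<le> \<eta>2\<close>. The third claim is where \<open>\<gamma> \<ge> 1 / 2\<close> enters.\<close>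

lemma mesh_ok_basic:
  assumes ok: "mesh_ok CM Cm q \<alpha> f0 C0 \<epsilon> Tf \<eta>1 \<eta>2 \<gamma> l V m"
    and q: "3 < q" and eps: "0 < \<epsilon>" and al: "1 \<le> \<alpha>" "\<alpha> \<le> 2" and Tf: "0 < Tf"
    and eta: "0 < \<eta>1" "\<eta>1 < \<eta>2" "\<eta>2 < 1"
  shows "scheme_run q \<epsilon> \<alpha> Tf V m" "1 \<le> V" "(1 + V) powr (- 2) \<le> Dv m" "Dv m \<le> 1 / 2"
    "D_int \<alpha> (beta_E \<alpha> \<epsilon> Tf) / 2 \<le> (\<Sum>j\<in>vidx m. tail_profile \<alpha> (beta_E \<alpha> \<epsilon> Tf) (vpt m j) * Dv m)"
    "(\<Sum>i\<in>xidx m. \<Sum>j\<in>vidx m. f0 (xpt m i) (vpt m j) * Dx m * Dv m) \<le> 2"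
proof -
  let ?CE = "C_E1 \<epsilon> Tf" and ?d = "Dv m"
  have CE: "3 \<le> ?CE" by (rule C_E1_ge[OF eps Tf])
  have m: "phase_mesh V m" "0 < ?d" "0 < Dx m" and g: "1 / 2 \<le> \<gamma>" "\<gamma> < 1"
    and Veq: "V = ?CE / ?d powr \<gamma>"
    and dt1: "\<eta>1 * (?d / ?CE) < Dt m" and dt2: "Dt m < \<eta>2 * (?d / ?CE)"
    and adm: "admissible_l q \<alpha> \<epsilon> Tf \<gamma> f0 l"
    using ok by (auto simp: mesh_ok_def phase_mesh_def)
  have dx: "Dx m < l" using ok by (auto simp: mesh_ok_def r_Dx_def)
  have "?d < r_Dv CM Cm q \<alpha> f0 C0 \<epsilon> Tf \<eta>1 \<eta>2 \<gamma> l (Dx m)" using ok by (simp add: mesh_ok_def)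
  note dv = less_r_Dv(2,5,4)[OF this]
  show "?d \<le> 1 / 2" using dv by auto
  have "?d powr \<gamma> \<le> 1" using m dv g powr_mono2[of \<gamma> ?d 1] by simp
  then have "?CE * ?d powr \<gamma> \<le> ?CE * 1" using CE by (intro mult_left_mono) auto
  then have VCE: "?CE \<le> V" unfolding Veq using m by (simp add: pos_le_divide_eq)
  then show V1: "1 \<le> V" using CE by linarith
  show "(1 + V) powr (- 2) \<le> ?d"
  proof -
    have "1 / ?d powr \<gamma> \<le> V" unfolding Veq using CE by (intro divide_right_mono) auto
    then have "(1 + V) powr (- 2) \<le> (1 / ?d powr \<gamma>) powr (- 2)"
      using m by (intro powr_mono2') auto
    also have "\<dots> = (?d powr (- \<gamma>)) powr (- 2)" by (simp add: powr_minus_divide)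
    also have "\<dots> = ?d powr (2 * \<gamma>)" by (simp add: powr_powr mult.commute)
    also have "\<dots> \<le> ?d powr 1" using g dv m by (intro powr_mono') auto
    finally show ?thesis using m by simp
  qed
  have "0 < \<eta>1 * (?d / ?CE)" using eta m CE by simp
  then have dt: "0 < Dt m" using dt1 by linarith
  show "scheme_run q \<epsilon> \<alpha> Tf V m"
  proof
    fix j :: int and e :: real assume j: "j \<in> vidx m" and e: "\<bar>e\<bar> \<le> ?CE"
    have "\<bar>real_of_int j\<bar> \<le> real (Nv m)" using j by (auto simp: vidx_def abs_le_iff)
    then have v: "\<bar>vpt m j\<bar> \<le> V"
      using m mult_right_mono[of "\<bar>real_of_int j\<bar>" "real (Nv m)" ?d]
      by (simp add: phase_mesh_def vpt_def abs_mult)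
    have "?d powr (1 - \<gamma>) \<le> (((1 - \<eta>2) / \<eta>2 * Dx m) powr (1 / (1 - \<gamma>))) powr (1 - \<gamma>)"
      using dv m g by (intro powr_mono2) auto
    also have "\<dots> = (1 - \<eta>2) / \<eta>2 * Dx m" using g eta m by (simp add: powr_powr)
    finally have d1: "?d powr (1 - \<gamma>) \<le> (1 - \<eta>2) / \<eta>2 * Dx m" .
    have "Dt m * V \<le> \<eta>2 * (?d / ?CE) * V" using dt2 V1 by (intro mult_right_mono) auto
    also have "\<dots> = \<eta>2 * ?d powr (1 - \<gamma>)" unfolding Veq using CE m by (simp add: powr_diff)
    also have "\<dots> \<le> \<eta>2 * ((1 - \<eta>2) / \<eta>2 * Dx m)" using d1 eta by (intro mult_left_mono) auto
    finally have "Dt m * V \<le> (1 - \<eta>2) * Dx m" using eta by simp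
    then have "Dt m / Dx m * V \<le> 1 - \<eta>2" using m by (simp add: field_simps)
    moreover have "Dt m / Dx m * \<bar>vpt m j\<bar> \<le> Dt m / Dx m * V" using dt m v by (intro mult_left_mono) auto
    moreover have "Dt m / ?d * \<bar>e\<bar> \<le> Dt m / ?d * ?CE" using dt m e by (intro mult_left_mono) auto
    moreover have "Dt m / ?d * ?CE \<le> \<eta>2" using dt2 m CE by (simp add: field_simps)
    ultimately show "Dt m / Dx m * \<bar>vpt m j\<bar> + Dt m / ?d * \<bar>e\<bar> \<le> 1" by linarith
  qed (use q eps al Tf m dt dv in auto)
  have A: "D_int \<alpha> (beta_E \<alpha> \<epsilon> Tf) / 2 \<le> (\<Sum>j\<in>vidx m. tail_profile \<alpha> (beta_E \<alpha> \<epsilon> Tf) (vpt m j) * ?d) \<and>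
     (\<Sum>i\<in>xidx m. \<Sum>j\<in>vidx m. f0 (xpt m i) (vpt m j) * Dx m * ?d) \<le> 2"
    using adm dx dv(1) m(1) unfolding admissible_l_def Veq tail_profile_def Let_def by (auto simp: split_beta)
  then show "D_int \<alpha> (beta_E \<alpha> \<epsilon> Tf) / 2 \<le> (\<Sum>j\<in>vidx m. tail_profile \<alpha> (beta_E \<alpha> \<epsilon> Tf) (vpt m j) * ?d)"
    "(\<Sum>i\<in>xidx m. \<Sum>j\<in>vidx m. f0 (xpt m i) (vpt m j) * Dx m * ?d) \<le> 2" by auto
qed

text \<open>The inflow through the ghost cells is small because the weighted norm bounds the solution by
  \<open>V powr - q\<close> there.\<close>

lemma mesh_ok_boundary:
  assumes ok: "mesh_ok CM Cm q \<alpha> f0 C0 \<epsilon> Tf \<eta>1 \<eta>2 \<gamma> l V m"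
    and q: "3 < q" and eps: "0 < \<epsilon>" and Tf: "0 < Tf" and Cm: "1 \<le> Cm"
    and F: "F = enn2real (Linf_norm q f0)" "0 < F"
  shows "C_E1 \<epsilon> Tf * ((1 + C_E2 q \<epsilon> Tf) * F * exp ((C_E2 q \<epsilon> Tf + (Cm - 1) / \<epsilon>) * Tf) * V powr (- q)) \<le> 1"
proof -
  let ?CE = "C_E1 \<epsilon> Tf" and ?CE2 = "C_E2 q \<epsilon> Tf" and ?d = "Dv m"
  have CE: "3 \<le> ?CE" by (rule C_E1_ge[OF eps Tf])
  have CE2: "0 \<le> ?CE2" unfolding C_E2_def using CE q ge_one_powr_ge_zero[of 2 q] by simp
  define B where "B = 2 * ?CE powr (1 - q) * (1 + ?CE2) * exp ((?CE2 + 2 * (Cm - 1) / \<epsilon>) * Tf) * F"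
  have B: "0 < B" unfolding B_def using CE CE2 F by (simp add: add_pos_nonneg)
  have m: "0 < ?d" "1 / 2 \<le> \<gamma>" "V = ?CE / ?d powr \<gamma>" using ok by (auto simp: mesh_ok_def phase_mesh_def)
  have "?d < B powr (- (1 / (q * \<gamma>)))"
    using ok less_r_Dv(3)[of ?d] unfolding mesh_ok_def B_def F(1) by blast
  then have "?d powr (q * \<gamma>) \<le> (B powr (- (1 / (q * \<gamma>)))) powr (q * \<gamma>)" using m q by (intro powr_mono2) auto
  also have "\<dots> = 1 / B"
  proof -
    have "- (1 / (q * \<gamma>)) * (q * \<gamma>) = - 1" using q m by simp
    then show ?thesis unfolding powr_powr using B by (simp add: powr_minus_divide)
  qed
  finally have 1: "B * ?d powr (q * \<gamma>) \<le> 1" using B by (simp add: field_simps)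
  have V: "V powr (- q) = ?CE powr (- q) * ?d powr (q * \<gamma>)"
  proof -
    have "(?d powr \<gamma>) powr (- q) = 1 / ?d powr (q * \<gamma>)"
      using powr_minus_divide[of ?d "q * \<gamma>"] by (simp add: powr_powr mult.commute)
    then show ?thesis unfolding m(3) powr_divide by simp
  qed
  have "?CE * ((1 + ?CE2) * F * exp ((?CE2 + (Cm - 1) / \<epsilon>) * Tf) * V powr (- q))
    = (?CE * ?CE powr (- q)) * (1 + ?CE2) * exp ((?CE2 + (Cm - 1) / \<epsilon>) * Tf) * F * ?d powr (q * \<gamma>)"
    unfolding V by (simp only: mult_ac)
  also have "?CE * ?CE powr (- q) = ?CE powr (1 - q)" using CE by (simp add: powr_diff powr_minus_divide)
  also have "?CE powr (1 - q) * (1 + ?CE2) * exp ((?CE2 + (Cm - 1) / \<epsilon>) * Tf) * F * ?d powr (q * \<gamma>) \<le> B * ?d powr (q * \<gamma>)"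
    unfolding B_def
  proof (intro mult_right_mono mult_mono)
    show "exp ((?CE2 + (Cm - 1) / \<epsilon>) * Tf) \<le> exp ((?CE2 + 2 * (Cm - 1) / \<epsilon>) * Tf)"
      unfolding exp_le_cancel_iff using Cm eps Tf
      by (intro mult_right_mono add_left_mono divide_right_mono) auto
  qed (use CE2 F in auto)
  finally show ?thesis using 1 by linarith
qed

lemma CM_const_root:
  fixes q :: real
  assumes "3 < q"
  shows "0 < CM_const q" "CM_const q powr (2 / 9) = 65536 * (2 * (1 + 2 / (q - 1)))\<^sup>2 / (exp (- 2) / 18)\<^sup>2"
proof -
  have "0 < 1 + 2 / (q - 1)" using assms by (simp add: add_pos_pos)
  then show "0 < CM_const q" "CM_const q powr (2 / 9) = 65536 * (2 * (1 + 2 / (q - 1)))\<^sup>2 / (exp (- 2) / 18)\<^sup>2"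
    unfolding CM_const_def by (simp_all add: powr_powr)
qed

text \<open>Let \<open>X = C0 * D / ((1 + CE2) * F) * exp (- Q * Tf)\<close>. The temperature bound to be reached is, up to a
  constant depending on \<open>q\<close>, equal to \<open>X * D\<^sup>2\<close>, while the condition on \<open>Dv\<close> reads
  \<open>Dv \<le> X powr (5 / 9) / CM powr (2 / 9)\<close>. Squaring gives the factor \<open>X * X powr (1 / 9)\<close>, and
  \<open>X powr (1 / 9)\<close> is at most a multiple of \<open>exp (- \<beta> / 9)\<close>, hence of \<open>D\<^sup>2\<close>, by comparison of barrier and
  weighted norm of the initial datum. A large \<open>CM\<close> provides the constant.\<close>

lemma mesh_ok_velocity_step:
  assumes ok: "mesh_ok (CM_const q) Cm q \<alpha> f0 C0 \<epsilon> Tf \<eta>1 \<eta>2 \<gamma> l V m"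
    and q: "3 < q" and eps: "0 < \<epsilon>" and al: "1 \<le> \<alpha>" "\<alpha> \<le> 2" and Tf: "0 < Tf" and Cm: "1 \<le> Cm"
    and eta: "0 < \<eta>1" "\<eta>1 < 1"
    and F: "F = enn2real (Linf_norm q f0)" "0 < F" and f0F: "\<And>x v. f0 x v \<le> F * wt q v"
    and half: "D_int \<alpha> (beta_E \<alpha> \<epsilon> Tf) / 2 \<le> (\<Sum>j\<in>vidx m. tail_profile \<alpha> (beta_E \<alpha> \<epsilon> Tf) (vpt m j) * Dv m)"
    and D: "D = D_int \<alpha> (beta_E \<alpha> \<epsilon> Tf)"
  shows "0 < D" "Dv m \<le> D / 8"
    "64 * (Dv m)\<^sup>2 \<le> C0 * exp (- ((\<alpha> * C_E1 \<epsilon> Tf * (3 / 2 + C_E1 \<epsilon> Tf * Tf) + 1 / \<epsilon>) * Tf)) * D ^ 3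
       / (1024 * ((1 + C_E2 q \<epsilon> Tf) * F * exp ((C_E2 q \<epsilon> Tf + (Cm - 1) / \<epsilon>) * Tf) * (1 + 2 / (q - 1))))"
proof -
  let ?CE = "C_E1 \<epsilon> Tf" and ?CE2 = "C_E2 q \<epsilon> Tf" and ?d = "Dv m" and ?b = "beta_E \<alpha> \<epsilon> Tf"
  define K where "K = 1 + 2 / (q - 1)"
  define c :: real where "c = exp (- 2) / 18"
  define P where "P = 65536 * (2 * K)\<^sup>2 / c\<^sup>2"
  define S where "S = S_const \<alpha> \<epsilon> Tf \<eta>1"
  define Q where "Q = S + ?CE2 + Cm / \<epsilon>"
  have K1: "1 \<le> K" unfolding K_def using q by simp
  have c: "0 < c" "c \<le> 1" unfolding c_def by (auto simp: exp_le_one_iff order_trans[of "exp (-2)" 1])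
  have CE: "3 \<le> ?CE" by (rule C_E1_ge[OF eps Tf])
  have CE2: "0 \<le> ?CE2" unfolding C_E2_def using CE q ge_one_powr_ge_zero[of 2 q] by simp
  have CMr: "CM_const q powr (2 / 9) = P" using CM_const_root[OF q] by (simp add: P_def K_def c_def)
  have c2: "c\<^sup>2 \<le> 1" "0 < c\<^sup>2" using c by (auto simp: power_le_one)
  have P1: "65536 * (2 * K)\<^sup>2 \<le> P" unfolding P_def using c2 by (simp add: pos_le_divide_eq mult_left_le)
  have K2: "1 \<le> (2 * K)\<^sup>2" using K1 by (intro one_le_power) auto
  have P0: "1 \<le> P" using P1 K2 by linarith
  have m: "0 < ?d" "0 < C0" and f0lo: "\<And>x v. C0 * exp (- (\<bar>v\<bar> powr \<alpha>)) \<le> f0 x v"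
    and rdv: "?d < r_Dv (CM_const q) Cm q \<alpha> f0 C0 \<epsilon> Tf \<eta>1 \<eta>2 \<gamma> l (Dx m)"
    using ok by (auto simp: mesh_ok_def phase_mesh_def)
  note dhalf = less_r_Dv(5)[OF rdv]
  have b: "?b = 2 * \<alpha> * ?CE * Tf" "0 \<le> ?b" unfolding beta_E_def using al CE Tf by auto
  have a1: "?d < (C0 * D) powr (5/9) / (2 powr (16/9) * (1 + ?CE2) powr (5/9) * P * F powr (5/9)) * exp (- (5/9) * Q * Tf)"
    using less_r_Dv(1)[OF rdv] unfolding F(1) D Q_def S_def CMr .
  have "0 \<le> D" unfolding D D_int_def by (intro Bochner_Integration.integral_nonneg) auto
  moreover have "D \<noteq> 0" using a1 m by auto
  ultimately show D0: "0 < D" by simp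
  have Dlow: "c * exp (- (?b / 18)) \<le> D"
    unfolding c_def D by (rule D_int_lower) (use D0 D b al in auto)
  define X where "X = C0 * D / ((1 + ?CE2) * F) * exp (- (Q * Tf))"
  have X0: "0 < X" unfolding X_def using m D0 CE2 F by simp
  have "(X::real) powr (5/9) = (C0 * D) powr (5/9) / ((1 + ?CE2) powr (5/9) * F powr (5/9)) * exp (- (5/9) * Q * Tf)"
  proof -
    have "exp (- (Q * Tf)) powr (5/9) = exp (- (5/9) * Q * Tf)" by (simp add: powr_def)
    then show ?thesis unfolding X_def by (simp only: powr_mult powr_divide)
  qed
  then have aeq: "(C0 * D) powr (5/9) / (2 powr (16/9) * (1 + ?CE2) powr (5/9) * P * F powr (5/9)) * exp (- (5/9) * Q * Tf)
      = X powr (5/9) / (2 powr (16/9) * P)" by (simp only: times_divide_eq_left times_divide_eq_right divide_divide_eq_left mult_ac)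
  have "X powr (5/9) / (2 powr (16/9) * P) \<le> X powr (5/9) / (1 * P)"
    using P0 ge_one_powr_ge_zero[of 2 "16/9"] by (intro divide_left_mono mult_right_mono mult_pos_pos) auto
  then have "?d \<le> X powr (5/9) / P" using a1 unfolding aeq by simp
  then have dX: "?d * P \<le> X powr (5/9)" using P0 by (simp add: pos_le_divide_eq)
  have XK: "X \<le> 2 * K * exp (- ?b)"
  proof -
    have "C0 * (D / 2) \<le> C0 * (\<Sum>j\<in>vidx m. tail_profile \<alpha> ?b (vpt m j) * ?d)"
      using half m unfolding D by (intro mult_left_mono) auto
    also have "\<dots> = (\<Sum>j\<in>vidx m. C0 * tail_profile \<alpha> ?b (vpt m j) * ?d)" by (simp only: sum_distrib_left mult.assoc)
    also have "\<dots> \<le> (\<Sum>j\<in>vidx m. F * wt q (vpt m j) * ?d)"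
    proof (intro sum_mono mult_right_mono)
      fix j
      have "C0 * tail_profile \<alpha> ?b (vpt m j) \<le> C0 * tail_profile \<alpha> 0 (vpt m j)" using m b by (intro mult_left_mono tail_profile_antimono) auto
      also have "\<dots> \<le> f0 0 (vpt m j)" using f0lo by (simp add: tail_profile_def)
      also have "\<dots> \<le> F * wt q (vpt m j)" by (rule f0F)
      finally show "C0 * tail_profile \<alpha> ?b (vpt m j) \<le> F * wt q (vpt m j)" .
    qed (use m in auto)
    also have "\<dots> = F * (\<Sum>j\<in>vidx m. wt q (vpt m j) * ?d)" by (simp only: sum_distrib_left mult.assoc)
    also have "\<dots> \<le> F * K" unfolding K_def using sum_wt[of m q] m dhalf q F by (intro mult_left_mono) auto
    finally have "C0 * D \<le> 2 * K * F" by (simp add: mult_ac)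
    also have "\<dots> \<le> 2 * K * ((1 + ?CE2) * F)" using K1 CE2 F by (intro mult_left_mono) (auto simp: mult_le_cancel_right1)
    finally have "C0 * D / ((1 + ?CE2) * F) \<le> 2 * K" using CE2 F by (simp add: pos_divide_le_eq)
    moreover have "?b \<le> Q * Tf"
    proof -
      have "2 * \<alpha> * ?CE \<le> S" unfolding S_def S_const_def using al CE Tf eta by simp
      also have "\<dots> \<le> Q" unfolding Q_def using CE2 Cm eps by simp
      finally show ?thesis unfolding b using Tf by (intro mult_right_mono) auto
    qed
    ultimately show ?thesis unfolding X_def using K1 by (intro mult_mono) auto
  qed
  have root: "X powr r \<le> 2 * K * exp (- (r * ?b))" if "0 < r" "r \<le> 1" for r
  proof -
    have "X powr r \<le> (2 * K * exp (- ?b)) powr r" using XK X0 that by (intro powr_mono2) auto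
    also have "\<dots> = (2 * K) powr r * exp (- (r * ?b))" by (simp add: powr_mult powr_def[of "exp _"])
    also have "\<dots> \<le> (2 * K) powr 1 * exp (- (r * ?b))" using that K1 by (intro mult_right_mono powr_mono) auto
    finally show ?thesis using K1 by simp
  qed
  show dD: "?d \<le> D / 8"
  proof -
    have "?d * P \<le> 2 * K * exp (- (5 / 9 * ?b))" using dX root[of "5/9"] by simp
    also have "\<dots> \<le> 2 * K * exp (- (?b / 18))" using K1 b by (intro mult_left_mono) auto
    finally have 1: "?d * P \<le> 2 * K * exp (- (?b / 18))" .
    have "8 * (2 * K) \<le> c * P"
    proof -
      have "2 * K \<le> (2 * K)\<^sup>2" using K1 by (simp add: power2_eq_square)
      then have "8 * (2 * K) \<le> 65536 * (2 * K)\<^sup>2" using K1 by linarith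
      also have "\<dots> \<le> 65536 * (2 * K)\<^sup>2 / c" using c by (simp add: pos_le_divide_eq mult_left_le)
      also have "\<dots> = c * P" unfolding P_def using c by (simp add: power2_eq_square)
      finally show ?thesis .
    qed
    then have "8 * (2 * K) * exp (- (?b / 18)) \<le> c * P * exp (- (?b / 18))" by (intro mult_right_mono) auto
    also have "\<dots> = (c * exp (- (?b / 18))) * P" by (simp only: mult_ac)
    also have "\<dots> \<le> D * P" using Dlow P0 by (intro mult_right_mono) auto
    finally have "8 * (?d * P) \<le> D * P" using 1 by linarith
    then have "(8 * ?d) * P \<le> D * P" by simp
    then show ?thesis using P0 by (simp only: mult_le_cancel_right) linarith
  qed
  \<comment> \<open>The exponent 5/9 doubled is 1 + 1/9.\<close>
  have sq: "?d\<^sup>2 * P\<^sup>2 \<le> X * (X powr (1/9))"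
  proof -
    have "(?d * P)\<^sup>2 \<le> (X powr (5/9))\<^sup>2" using dX m P0 by (intro power_mono) auto
    also have "\<dots> = X powr (1 + 1 / 9)" by (simp only: power2_eq_square powr_add[symmetric]) simp
    also have "\<dots> = X * X powr (1/9)" using X0 by (simp only: powr_add) simp
    finally show ?thesis by (simp add: power_mult_distrib)
  qed
  have "64 * ?d\<^sup>2 \<le> X * D\<^sup>2 / (1024 * K)"
  proof -
    have "c\<^sup>2 * exp (- (1/9 * ?b)) = (c * exp (- (?b / 18)))\<^sup>2"
      by (simp add: power_mult_distrib power2_eq_square exp_add[symmetric])
    also have "\<dots> \<le> D\<^sup>2" using Dlow c by (intro power_mono) auto
    finally have D2: "c\<^sup>2 * exp (- (1/9 * ?b)) \<le> D\<^sup>2" .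
    have "?d\<^sup>2 * P\<^sup>2 * c\<^sup>2 \<le> X * (2 * K * exp (- (1/9 * ?b))) * c\<^sup>2"
      using sq root[of "1/9"] X0 by (intro mult_right_mono order_trans[OF sq] mult_left_mono) auto
    also have "\<dots> = X * (2 * K) * (c\<^sup>2 * exp (- (1/9 * ?b)))" by (simp only: mult_ac)
    also have "\<dots> \<le> X * (2 * K) * D\<^sup>2" using D2 X0 K1 by (intro mult_left_mono) auto
    finally have 1: "?d\<^sup>2 * P\<^sup>2 * c\<^sup>2 \<le> X * (2 * K) * D\<^sup>2" .
    have "65536 * (2 * K)\<^sup>2 * 1 \<le> (c\<^sup>2 * P) * P"
    proof -
      have "c\<^sup>2 * P = 65536 * (2 * K)\<^sup>2" unfolding P_def using c2 by simp
      then show ?thesis using P0 by (simp only:) (intro mult_left_mono, auto)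
    qed
    then have "?d\<^sup>2 * (65536 * (2 * K)\<^sup>2) \<le> ?d\<^sup>2 * ((c\<^sup>2 * P) * P)" by (intro mult_left_mono) auto
    also have "\<dots> = ?d\<^sup>2 * P\<^sup>2 * c\<^sup>2" by (simp add: power2_eq_square mult_ac)
    finally have "?d\<^sup>2 * (65536 * (2 * K)\<^sup>2) \<le> X * (2 * K) * D\<^sup>2" using 1 by linarith
    then have "(64 * ?d\<^sup>2 * (1024 * K)) * (4 * K) \<le> (X * D\<^sup>2) * (2 * K)" by (simp add: power2_eq_square mult_ac)
    also have "\<dots> \<le> (X * D\<^sup>2) * (4 * K)" using X0 K1 by (intro mult_left_mono) auto
    finally have "64 * ?d\<^sup>2 * (1024 * K) \<le> X * D\<^sup>2" by (rule mult_right_le_imp_le) (use K1 in auto)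
    then show ?thesis using K1 by (subst pos_le_divide_eq) auto
  qed
  also have "\<dots> \<le> C0 * exp (- ((\<alpha> * ?CE * (3 / 2 + ?CE * Tf) + 1 / \<epsilon>) * Tf)) * D ^ 3
       / (1024 * ((1 + ?CE2) * F * exp ((?CE2 + (Cm - 1) / \<epsilon>) * Tf) * K))"
  proof -
    let ?r = "\<alpha> * ?CE * (3 / 2 + ?CE * Tf) + 1 / \<epsilon>" and ?g = "?CE2 + (Cm - 1) / \<epsilon>"
    have "\<alpha> * ?CE * (3 / 2 + ?CE * Tf) \<le> S"
    proof -
      have "1 * (\<alpha> * ?CE\<^sup>2 * (Tf + 1)) \<le> 1 / \<eta>1 * (\<alpha> * ?CE\<^sup>2 * (Tf + 1))"
        using eta al Tf by (intro mult_right_mono) auto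
      moreover have "\<alpha> * ?CE * (3 / 2 + ?CE * Tf) \<le> 2 * \<alpha> * ?CE + \<alpha> * ?CE\<^sup>2 * (Tf + 1)"
        using al CE by (simp add: algebra_simps power2_eq_square)
      ultimately show ?thesis unfolding S_def S_const_def by simp
    qed
    then have "?r + ?g \<le> Q" unfolding Q_def using eps by (simp add: diff_divide_distrib)
    then have "(?r + ?g) * Tf \<le> Q * Tf" using Tf by (intro mult_right_mono) auto
    then have e: "exp (- (Q * Tf)) \<le> exp (- (?r * Tf)) / exp (?g * Tf)"
      by (simp add: exp_diff[symmetric] distrib_right)
    have "X * D\<^sup>2 / (1024 * K) = (C0 * D ^ 3 / ((1 + ?CE2) * F * (1024 * K))) * exp (- (Q * Tf))"
      unfolding X_def by (simp add: power2_eq_square power3_eq_cube mult_ac)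
    also have "\<dots> \<le> (C0 * D ^ 3 / ((1 + ?CE2) * F * (1024 * K))) * (exp (- (?r * Tf)) / exp (?g * Tf))"
      using e m D0 CE2 F K1 by (intro mult_left_mono) auto
    also have "\<dots> = C0 * exp (- (?r * Tf)) * D ^ 3 / (1024 * ((1 + ?CE2) * F * exp (?g * Tf) * K))"
      by (simp only: times_divide_eq_left times_divide_eq_right divide_divide_eq_left mult_ac)
    finally show ?thesis .
  qed
  finally show "64 * ?d\<^sup>2 \<le> C0 * exp (- ((\<alpha> * ?CE * (3 / 2 + ?CE * Tf) + 1 / \<epsilon>) * Tf)) * D ^ 3
       / (1024 * ((1 + ?CE2) * F * exp ((?CE2 + (Cm - 1) / \<epsilon>) * Tf) * (1 + 2 / (q - 1))))"
    unfolding K_def .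
qed

section \<open>Dependence of the Maxwellian on its moments\<close>

text \<open>Uniform weighted decay of Gaussians whose centre and width range over bounded sets.\<close>

lemma gaussian_wt:
  fixes s u \<theta> v U T :: real
  assumes s: "0 \<le> s" and U: "\<bar>U\<bar> \<le> u" and T: "0 < T" "T \<le> \<theta>"
  shows "exp (- (\<bar>v - U\<bar>\<^sup>2 / (2 * T))) \<le> (1 + sqrt \<theta>) powr s * exp (s * u + s\<^sup>2 / 2) * wt s v"
proof -
  have \<theta>: "0 < \<theta>" and u: "0 \<le> u" using T U by auto
  define z where "z = \<bar>v - U\<bar> / sqrt \<theta>"
  have z: "0 \<le> z" unfolding z_def using \<theta> by simp
  have "exp (- (\<bar>v - U\<bar>\<^sup>2 / (2 * T))) \<le> exp (- (\<bar>v - U\<bar>\<^sup>2 / (2 * \<theta>)))"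
    using T \<theta> by (simp add: divide_left_mono)
  also have "\<bar>v - U\<bar>\<^sup>2 / (2 * \<theta>) = z\<^sup>2 / 2" unfolding z_def using \<theta> by (simp add: power_divide)
  finally have 1: "exp (- (\<bar>v - U\<bar>\<^sup>2 / (2 * T))) \<le> exp (- (z\<^sup>2 / 2))" .
  have "1 + \<bar>v\<bar> \<le> 1 + u + sqrt \<theta> * z" unfolding z_def using \<theta> U by simp
  also have "\<dots> \<le> (1 + sqrt \<theta>) * (1 + u + z)" using \<theta> z u by (simp add: algebra_simps)
  finally have "(1 + \<bar>v\<bar>) powr s \<le> ((1 + sqrt \<theta>) * (1 + u + z)) powr s" using s by (intro powr_mono2) auto
  also have "\<dots> = (1 + sqrt \<theta>) powr s * (1 + u + z) powr s" by (rule powr_mult)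
  finally have 2: "(1 + \<bar>v\<bar>) powr s \<le> (1 + sqrt \<theta>) powr s * (1 + u + z) powr s" .
  have "exp (- (\<bar>v - U\<bar>\<^sup>2 / (2 * T))) * (1 + \<bar>v\<bar>) powr s
      \<le> exp (- (z\<^sup>2 / 2)) * ((1 + sqrt \<theta>) powr s * (1 + u + z) powr s)"
    using 1 2 by (intro mult_mono) auto
  also have "\<dots> = (1 + sqrt \<theta>) powr s * ((1 + u + z) powr s * exp (- (z\<^sup>2 / 2)))" by (simp only: mult_ac)
  also have "\<dots> \<le> (1 + sqrt \<theta>) powr s * exp (s * u + s\<^sup>2 / 2)"
    using exp_times_powr_bound[OF s z u] by (intro mult_left_mono) auto
  finally show ?thesis by (simp only: wt_le_iff)
qed

lemma maxwellian_unit_deriv_U: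
  assumes "0 < T"
  shows "((\<lambda>U. maxwellian 1 U T v) has_real_derivative maxwellian 1 U T v * ((v - U) / T)) (at U within S)"
  unfolding maxwellian_def power2_abs using assms
  by (auto intro!: derivative_eq_intros simp: power2_eq_square divide_simps) (simp add: algebra_simps)

lemma maxwellian_unit_deriv_T:
  assumes T: "0 < T"
  shows "((\<lambda>T. maxwellian 1 U T v) has_real_derivative
      maxwellian 1 U T v * ((v - U)\<^sup>2 / (2 * T\<^sup>2) - 1 / (2 * T))) (at T within S)"
proof -
  have p: "0 < 2 * pi * T" using T by simp
  then have s: "sqrt (2 * pi * T) \<noteq> 0" "sqrt (2 * pi * T) * sqrt (2 * pi * T) = 2 * pi * T"
    by (simp_all only: real_sqrt_mult_self abs_of_pos real_sqrt_eq_0_iff)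
  have a: "((\<lambda>T. 1 / sqrt (2 * pi * T)) has_real_derivative (1 / sqrt (2 * pi * T)) * (- 1 / (2 * T))) (at T within S)"
  proof -
    have "((\<lambda>T. 1 / sqrt (2 * pi * T)) has_real_derivative
       - (inverse (sqrt (2 * pi * T)) * (2 * pi) / 2) / (sqrt (2 * pi * T) * sqrt (2 * pi * T))) (at T within S)"
      using T s by (auto intro!: derivative_eq_intros simp: mult_less_0_iff)
    also have "- (inverse (sqrt (2 * pi * T)) * (2 * pi) / 2) / (sqrt (2 * pi * T) * sqrt (2 * pi * T))
       = (1 / sqrt (2 * pi * T)) * (- 1 / (2 * T))"
      unfolding s using T by (simp add: inverse_eq_divide)
    finally show ?thesis .
  qed
  have b: "((\<lambda>T. exp (- ((v - U)\<^sup>2 / (2 * T)))) has_real_derivative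
     exp (- ((v - U)\<^sup>2 / (2 * T))) * ((v - U)\<^sup>2 / (2 * T\<^sup>2))) (at T within S)"
    using T by (auto intro!: derivative_eq_intros simp: power2_eq_square divide_simps)
  show ?thesis
    using DERIV_mult[OF a b] unfolding maxwellian_def power2_abs
    by (simp add: algebra_simps)
qed

lemma maxwellian_scale: "maxwellian \<rho> U T v = \<rho> * maxwellian 1 U T v"
  by (simp add: maxwellian_def)

lemma maxwellian_shift: "maxwellian \<rho> U T w = maxwellian \<rho> (U + (v - w)) T v"
  by (simp add: maxwellian_def)

lemma maxwellian_unit_bound:
  fixes s u \<tau> \<theta> :: real
  assumes "0 \<le> s" "0 < \<tau>"
  obtains G where "0 \<le> G" "\<And>U T v. \<bar>U\<bar> \<le> u \<Longrightarrow> \<tau> \<le> T \<Longrightarrow> T \<le> \<theta> \<Longrightarrow>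
    0 \<le> maxwellian 1 U T v \<and> maxwellian 1 U T v \<le> G * wt s v"
proof (rule that[of "1 / sqrt (2 * pi * \<tau>) * ((1 + sqrt \<theta>) powr s * exp (s * u + s\<^sup>2 / 2))"])
  fix U T v assume U: "\<bar>U\<bar> \<le> u" and T: "\<tau> \<le> T" "T \<le> \<theta>"
  have "maxwellian 1 U T v = 1 / sqrt (2 * pi * T) * exp (- (\<bar>v - U\<bar>\<^sup>2 / (2 * T)))"
    by (simp add: maxwellian_def)
  also have "\<dots> \<le> 1 / sqrt (2 * pi * \<tau>) * ((1 + sqrt \<theta>) powr s * exp (s * u + s\<^sup>2 / 2) * wt s v)"
  proof (intro mult_mono gaussian_wt)
    have "2 * pi * \<tau> \<le> 2 * pi * T" using T by simp
    then show "1 / sqrt (2 * pi * T) \<le> 1 / sqrt (2 * pi * \<tau>)"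
      using assms T by (intro divide_left_mono) auto
  qed (use assms U T in auto)
  finally show "0 \<le> maxwellian 1 U T v \<and> maxwellian 1 U T v
    \<le> 1 / sqrt (2 * pi * \<tau>) * ((1 + sqrt \<theta>) powr s * exp (s * u + s\<^sup>2 / 2)) * wt s v"
    using assms T by (simp add: maxwellian_def mult.assoc)
qed (use assms in auto)

text \<open>Both partial derivatives equal the Maxwellian times a polynomial of degree at most two in the
  velocity, which is absorbed by two additional powers of the weight.\<close>

lemma maxwellian_unit_Lipschitz:
  fixes s u \<tau> \<theta> :: real
  assumes s: "0 \<le> s" and \<tau>: "0 < \<tau>" and u: "0 \<le> u"
  obtains L where "0 \<le> L" "\<And>U T U' T' v. \<bar>U\<bar> \<le> u \<Longrightarrow> \<bar>U'\<bar> \<le> u \<Longrightarrow> \<tau> \<le> T \<Longrightarrow> T \<le> \<theta> \<Longrightarrow> \<tau> \<le> T' \<Longrightarrow> T' \<le> \<theta> \<Longrightarrow>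
    \<bar>maxwellian 1 U T v - maxwellian 1 U' T' v\<bar> \<le> L * (\<bar>U - U'\<bar> + \<bar>T - T'\<bar>) * wt s v"
proof -
  obtain G where G: "0 \<le> G" "\<And>U T v. \<bar>U\<bar> \<le> u \<Longrightarrow> \<tau> \<le> T \<Longrightarrow> T \<le> \<theta> \<Longrightarrow>
    0 \<le> maxwellian 1 U T v \<and> maxwellian 1 U T v \<le> G * wt (s + real 2) v"
    using maxwellian_unit_bound[of "s + real 2" \<tau> u \<theta>] s \<tau> by auto
  \<comment> \<open>The first summand bounds the derivative in U, the others the derivative in T.\<close>
  define c where "c = 1 / \<tau> + (1 / (2 * \<tau>\<^sup>2) + 1 / (2 * \<tau>))"
  define L where "L = G * (c * (1 + u)\<^sup>2)"
  have n: "0 \<le> 1 / \<tau>" "0 \<le> 1 / (2 * \<tau>\<^sup>2)" "0 \<le> 1 / (2 * \<tau>)" using \<tau> by simp_all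
  have c: "1 / \<tau> \<le> c" "1 / (2 * \<tau>\<^sup>2) + 1 / (2 * \<tau>) \<le> c" unfolding c_def using n by linarith+
  have c0: "0 \<le> c" using c(1) \<tau> by (meson divide_nonneg_pos order_trans zero_le_one)
  have key: "\<bar>maxwellian 1 U T v * d\<bar> \<le> L * wt s v"
    if "\<bar>U\<bar> \<le> u" "\<tau> \<le> T" "T \<le> \<theta>" and d: "\<bar>d\<bar> \<le> c * (1 + u)\<^sup>2 * (1 + \<bar>v\<bar>) ^ 2" for U T v d
  proof -
    have "\<bar>maxwellian 1 U T v * d\<bar> \<le> (G * wt (s + real 2) v) * (c * (1 + u)\<^sup>2 * (1 + \<bar>v\<bar>) ^ 2)"
      unfolding abs_mult using G(2)[OF that(1-3), of v] d c0 by (intro mult_mono) auto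
    also have "\<dots> = L * ((1 + \<bar>v\<bar>) ^ 2 * wt (s + real 2) v)" unfolding L_def by (simp only: mult_ac)
    finally show ?thesis unfolding wt_absorb .
  qed
  have vU: "1 + \<bar>v - U\<bar> \<le> (1 + u) * (1 + \<bar>v\<bar>)" if "\<bar>U\<bar> \<le> u" for U v
  proof -
    have "1 + \<bar>v - U\<bar> \<le> 1 + u + \<bar>v\<bar>" using that by linarith
    also have "\<dots> \<le> (1 + u) * (1 + \<bar>v\<bar>)" using u by (simp add: algebra_simps)
    finally show ?thesis .
  qed
  have vU2: "1 + \<bar>v - U\<bar> \<le> (1 + u)\<^sup>2 * (1 + \<bar>v\<bar>) ^ 2 \<and> 1 + (v - U)\<^sup>2 \<le> (1 + u)\<^sup>2 * (1 + \<bar>v\<bar>) ^ 2"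
    if "\<bar>U\<bar> \<le> u" for U v
  proof -
    have "(1 + \<bar>v - U\<bar>)\<^sup>2 \<le> ((1 + u) * (1 + \<bar>v\<bar>))\<^sup>2" using vU[OF that] by (intro power_mono) auto
    then have 1: "(1 + \<bar>v - U\<bar>)\<^sup>2 \<le> (1 + u)\<^sup>2 * (1 + \<bar>v\<bar>) ^ 2" by (simp only: power_mult_distrib)
    have e: "(1 + \<bar>v - U\<bar>)\<^sup>2 = 1 + 2 * \<bar>v - U\<bar> + (v - U)\<^sup>2" by (simp add: power2_sum)
    have "1 + \<bar>v - U\<bar> \<le> (1 + \<bar>v - U\<bar>)\<^sup>2" "1 + (v - U)\<^sup>2 \<le> (1 + \<bar>v - U\<bar>)\<^sup>2"
      unfolding e by auto
    then show ?thesis using order_trans[OF _ 1] by blast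
  qed
  have LU: "\<bar>maxwellian 1 U T v - maxwellian 1 U' T v\<bar> \<le> L * wt s v * \<bar>U - U'\<bar>"
    if U: "\<bar>U\<bar> \<le> u" "\<bar>U'\<bar> \<le> u" and T: "\<tau> \<le> T" "T \<le> \<theta>" for U U' T v
  proof -
    have "norm (maxwellian 1 U T v - maxwellian 1 U' T v) \<le> L * wt s v * norm (U - U')"
    proof (rule field_differentiable_bound[of "{- u..u}" _ "\<lambda>U. maxwellian 1 U T v * ((v - U) / T)"])
      fix z assume z: "z \<in> {- u..u}"
      show "((\<lambda>U. maxwellian 1 U T v) has_real_derivative maxwellian 1 z T v * ((v - z) / T)) (at z within {- u..u})"
        using T \<tau> by (intro maxwellian_unit_deriv_U) auto
      have zu: "\<bar>z\<bar> \<le> u" using z by auto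
      have "\<bar>(v - z) / T\<bar> \<le> 1 / \<tau> * \<bar>v - z\<bar>"
        using T \<tau> by (simp add: abs_divide divide_left_mono)
      also have "\<dots> \<le> c * ((1 + u)\<^sup>2 * (1 + \<bar>v\<bar>) ^ 2)"
        using c c0 vU2[OF zu, of v] by (intro mult_mono) auto
      finally show "norm (maxwellian 1 z T v * ((v - z) / T)) \<le> L * wt s v"
        unfolding real_norm_def by (intro key) (use zu T in \<open>auto simp: mult.assoc\<close>)
    qed (use U in auto)
    then show ?thesis by simp
  qed
  have LT: "\<bar>maxwellian 1 U T v - maxwellian 1 U T' v\<bar> \<le> L * wt s v * \<bar>T - T'\<bar>"
    if U: "\<bar>U\<bar> \<le> u" and T: "\<tau> \<le> T" "T \<le> \<theta>" "\<tau> \<le> T'" "T' \<le> \<theta>" for U T T' v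
  proof -
    have "norm (maxwellian 1 U T v - maxwellian 1 U T' v) \<le> L * wt s v * norm (T - T')"
    proof (rule field_differentiable_bound[of "{\<tau>..\<theta>}" _ "\<lambda>T. maxwellian 1 U T v * ((v - U)\<^sup>2 / (2 * T\<^sup>2) - 1 / (2 * T))"])
      fix z assume z: "z \<in> {\<tau>..\<theta>}"
      then have z0: "0 < z" using \<tau> by auto
      show "((\<lambda>T. maxwellian 1 U T v) has_real_derivative maxwellian 1 U z v * ((v - U)\<^sup>2 / (2 * z\<^sup>2) - 1 / (2 * z)))
          (at z within {\<tau>..\<theta>})"
        by (rule maxwellian_unit_deriv_T[OF z0])
      have 1: "(v - U)\<^sup>2 / (2 * z\<^sup>2) \<le> (v - U)\<^sup>2 / (2 * \<tau>\<^sup>2)"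
        using z \<tau> z0 by (intro divide_left_mono mult_left_mono power_mono) auto
      have 2: "1 / (2 * z) \<le> 1 / (2 * \<tau>)" using z \<tau> z0 by (intro divide_left_mono) auto
      have n: "0 \<le> (v - U)\<^sup>2 / (2 * z\<^sup>2)" "0 \<le> 1 / (2 * z)" "0 \<le> 1 / (2 * \<tau>\<^sup>2)" "0 \<le> 1 / (2 * \<tau>)" using z0 \<tau> by auto
      have "\<bar>(v - U)\<^sup>2 / (2 * z\<^sup>2) - 1 / (2 * z)\<bar> \<le> 1 / (2 * \<tau>\<^sup>2) * (v - U)\<^sup>2 + 1 / (2 * \<tau>)"
        using 1 2 n unfolding abs_le_iff by (simp only: times_divide_eq_left mult_1_left) linarith
      also have "\<dots> \<le> (1 / (2 * \<tau>\<^sup>2) + 1 / (2 * \<tau>)) * (1 + (v - U)\<^sup>2)"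
      proof -
        have "a * x + b \<le> (a + b) * (1 + x)" if "0 \<le> a" "0 \<le> b" "0 \<le> x" for a b x :: real
          using that by (simp add: algebra_simps add_nonneg_nonneg)
        then show ?thesis using n(3,4) zero_le_power2 by blast
      qed
      also have "\<dots> \<le> c * ((1 + u)\<^sup>2 * (1 + \<bar>v\<bar>) ^ 2)"
        using c c0 vU2[OF U, of v] by (intro mult_mono) auto
      finally show "norm (maxwellian 1 U z v * ((v - U)\<^sup>2 / (2 * z\<^sup>2) - 1 / (2 * z))) \<le> L * wt s v"
        unfolding real_norm_def by (intro key) (use U z in \<open>auto simp: mult.assoc\<close>)
    qed (use T in auto)
    then show ?thesis by simp
  qed
  show thesis
  proof (rule that[of L])
    show "0 \<le> L" unfolding L_def using G c0 by simp
    fix U T U' T' v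
    assume a: "\<bar>U\<bar> \<le> u" "\<bar>U'\<bar> \<le> u" "\<tau> \<le> T" "T \<le> \<theta>" "\<tau> \<le> T'" "T' \<le> \<theta>"
    have "\<bar>maxwellian 1 U T v - maxwellian 1 U' T' v\<bar> \<le> L * wt s v * \<bar>U - U'\<bar> + L * wt s v * \<bar>T - T'\<bar>"
      using LU[of U U' T v] LT[of U' T T' v] a by linarith
    then show "\<bar>maxwellian 1 U T v - maxwellian 1 U' T' v\<bar> \<le> L * (\<bar>U - U'\<bar> + \<bar>T - T'\<bar>) * wt s v"
      by (simp add: algebra_simps)
  qed
qed

text \<open>The Maxwellian as a function of the first three velocity moments. These are linear in the density,
  so that errors in the density pass to them directly.\<close>

definition mxw :: "real \<Rightarrow> real \<Rightarrow> real \<Rightarrow> real \<Rightarrow> real" where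
  "mxw a0 a1 a2 v = maxwellian a0 (a1 / a0) (a2 / a0 - (a1 / a0)\<^sup>2) v"

lemma quotient_Lipschitz:
  fixes a b a0 b0 r1 r2 :: real
  assumes "0 < r1" "r1 \<le> a0" "r1 \<le> b0" "\<bar>b\<bar> \<le> r2"
  shows "\<bar>a / a0 - b / b0\<bar> \<le> (1 / r1 + r2 / r1\<^sup>2) * (\<bar>a - b\<bar> + \<bar>a0 - b0\<bar>)"
proof -
  have "a / a0 - b / b0 = (a - b) / a0 + b * (b0 - a0) / (a0 * b0)" using assms by (simp add: field_simps)
  then have "\<bar>a / a0 - b / b0\<bar> \<le> \<bar>(a - b) / a0\<bar> + \<bar>b * (b0 - a0) / (a0 * b0)\<bar>"
    by (simp only: abs_triangle_ineq)
  also have "\<bar>(a - b) / a0\<bar> \<le> \<bar>a - b\<bar> / r1" using assms by (simp add: abs_divide divide_left_mono)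
  also have "\<bar>b * (b0 - a0) / (a0 * b0)\<bar> \<le> r2 * \<bar>a0 - b0\<bar> / r1\<^sup>2"
    unfolding abs_divide abs_mult power2_eq_square
    using assms by (intro frac_le mult_mono mult_pos_pos) auto
  also have "\<bar>a - b\<bar> / r1 + r2 * \<bar>a0 - b0\<bar> / r1\<^sup>2 \<le> (1 / r1 + r2 / r1\<^sup>2) * (\<bar>a - b\<bar> + \<bar>a0 - b0\<bar>)"
    using assms by (simp add: algebra_simps)
  finally show ?thesis by simp
qed

text \<open>A set of moments on which density and temperature stay away from zero and infinity; on it the
  Maxwellian is a Lipschitz function.\<close>

definition mom_region :: "real \<Rightarrow> real \<Rightarrow> real \<Rightarrow> real \<Rightarrow> real \<Rightarrow> real \<Rightarrow> bool" where
  "mom_region r1 r2 \<tau> a0 a1 a2 \<longleftrightarrow> r1 \<le> a0 \<and> a0 \<le> r2 \<and> \<bar>a1\<bar> \<le> r2 \<and> \<bar>a2\<bar> \<le> r2 \<and> \<tau> \<le> a2 / a0 - (a1 / a0)\<^sup>2"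

text \<open>A change of the velocity at which the Maxwellian is evaluated is a change of its bulk velocity,
  which reduces the second bound to a fixed velocity.\<close>

lemma mxw_bounds:
  fixes s r1 r2 \<tau> \<kappa> :: real
  assumes s: "0 \<le> s" and r1: "0 < r1" and \<tau>: "0 < \<tau>" and \<kappa>: "0 \<le> \<kappa>" and r2: "0 \<le> r2"
  obtains L where "0 \<le> L"
    "\<And>a0 a1 a2 v. mom_region r1 r2 \<tau> a0 a1 a2 \<Longrightarrow> \<bar>mxw a0 a1 a2 v\<bar> \<le> L * wt s v"
    "\<And>a0 a1 a2 b0 b1 b2 v w. mom_region r1 r2 \<tau> a0 a1 a2 \<Longrightarrow> mom_region r1 r2 \<tau> b0 b1 b2 \<Longrightarrow> \<bar>v - w\<bar> \<le> \<kappa> \<Longrightarrow>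
      \<bar>mxw a0 a1 a2 v - mxw b0 b1 b2 w\<bar> \<le> L * (\<bar>a0 - b0\<bar> + \<bar>a1 - b1\<bar> + \<bar>a2 - b2\<bar> + \<bar>v - w\<bar>) * wt s v"
proof -
  define \<theta> where "\<theta> = r2 / r1"
  define u where "u = \<theta> + \<kappa>"
  have \<theta>: "0 \<le> \<theta>" unfolding \<theta>_def using r1 r2 by simp
  have u: "0 \<le> u" using \<theta> \<kappa> by (simp add: u_def)
  obtain G where G: "0 \<le> G" "\<And>U T v. \<bar>U\<bar> \<le> u \<Longrightarrow> \<tau> \<le> T \<Longrightarrow> T \<le> \<theta> \<Longrightarrow>
    0 \<le> maxwellian 1 U T v \<and> maxwellian 1 U T v \<le> G * wt s v"
    using maxwellian_unit_bound[OF s \<tau>] by blast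
  obtain H where H: "0 \<le> H" "\<And>U T U' T' v. \<bar>U\<bar> \<le> u \<Longrightarrow> \<bar>U'\<bar> \<le> u \<Longrightarrow> \<tau> \<le> T \<Longrightarrow> T \<le> \<theta> \<Longrightarrow> \<tau> \<le> T' \<Longrightarrow> T' \<le> \<theta> \<Longrightarrow>
    \<bar>maxwellian 1 U T v - maxwellian 1 U' T' v\<bar> \<le> H * (\<bar>U - U'\<bar> + \<bar>T - T'\<bar>) * wt s v"
    using maxwellian_unit_Lipschitz[OF s \<tau> u, of \<theta>] by auto
  define k where "k = 1 / r1 + r2 / r1\<^sup>2"
  have k: "0 \<le> k" unfolding k_def using r1 r2 by simp
  define M where "M = G + r2 * H * (1 + 2 * k + 2 * \<theta> * k)"
  have M0: "0 \<le> r2 * H * (1 + 2 * k + 2 * \<theta> * k)" using r2 H k \<theta> by simp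
  define L where "L = M + r2 * G"
  have UT: "\<bar>a1 / a0\<bar> \<le> \<theta> \<and> a2 / a0 - (a1 / a0)\<^sup>2 \<le> \<theta>" if "mom_region r1 r2 \<tau> a0 a1 a2" for a0 a1 a2
  proof -
    have a: "r1 \<le> a0" "\<bar>a1\<bar> \<le> r2" "\<bar>a2\<bar> \<le> r2" using that by (auto simp: mom_region_def)
    have "\<bar>a1 / a0\<bar> \<le> \<theta>" "\<bar>a2 / a0\<bar> \<le> \<theta>"
      unfolding \<theta>_def abs_divide using a r1 r2 by (auto intro!: frac_le)
    then show ?thesis using zero_le_power2[of "a1 / a0"] by linarith
  qed
  show thesis
  proof (rule that[of L])
    show "0 \<le> L" unfolding L_def M_def using M0 G r2 by simp
    fix a0 a1 a2 v assume a: "mom_region r1 r2 \<tau> a0 a1 a2"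
    let ?g = "maxwellian 1 (a1 / a0) (a2 / a0 - (a1 / a0)\<^sup>2) v"
    have g: "0 \<le> ?g \<and> ?g \<le> G * wt s v"
      using UT[OF a] a \<kappa> by (intro G(2)) (auto simp: u_def mom_region_def)
    have a0: "0 \<le> a0" "a0 \<le> r2" using a r1 by (auto simp: mom_region_def)
    have "\<bar>mxw a0 a1 a2 v\<bar> = a0 * ?g"
      unfolding mxw_def using a0 g by (subst maxwellian_scale) (simp add: abs_mult)
    also have "\<dots> \<le> r2 * (G * wt s v)" using a0 g by (intro mult_mono) auto
    also have "\<dots> \<le> L * wt s v" unfolding L_def M_def using G M0 by (simp add: distrib_right)
    finally show "\<bar>mxw a0 a1 a2 v\<bar> \<le> L * wt s v" .
  next
    fix a0 a1 a2 b0 b1 b2 v w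
    assume a: "mom_region r1 r2 \<tau> a0 a1 a2" and b: "mom_region r1 r2 \<tau> b0 b1 b2" and vw: "\<bar>v - w\<bar> \<le> \<kappa>"
    define U T U' T' where "U = a1 / a0" and "T = a2 / a0 - (a1 / a0)\<^sup>2"
      and "U' = b1 / b0 + (v - w)" and "T' = b2 / b0 - (b1 / b0)\<^sup>2"
    define \<delta> where "\<delta> = \<bar>a0 - b0\<bar> + \<bar>a1 - b1\<bar> + \<bar>a2 - b2\<bar> + \<bar>v - w\<bar>"
    have "\<bar>U'\<bar> \<le> \<bar>b1 / b0\<bar> + \<bar>v - w\<bar>" unfolding U'_def by (rule abs_triangle_ineq)
    then have "\<bar>U'\<bar> \<le> u" using UT[OF b] vw unfolding u_def by linarith
    moreover have "\<bar>U\<bar> \<le> u" using UT[OF a] \<kappa> unfolding u_def U_def by linarith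
    ultimately have r: "\<bar>U\<bar> \<le> u" "\<bar>U'\<bar> \<le> u" "\<tau> \<le> T" "T \<le> \<theta>" "\<tau> \<le> T'" "T' \<le> \<theta>"
      using UT[OF a] UT[OF b] a b unfolding T_def T'_def
      by (auto simp: mom_region_def)
    have b0: "0 \<le> b0" "b0 \<le> r2" "r1 \<le> b0" "\<bar>b1\<bar> \<le> r2" "\<bar>b2\<bar> \<le> r2" and a0: "r1 \<le> a0"
      using a b r1 by (auto simp: mom_region_def)
    have dU: "\<bar>a1 / a0 - b1 / b0\<bar> \<le> k * \<delta>"
    proof -
      have "\<bar>a1 / a0 - b1 / b0\<bar> \<le> k * (\<bar>a1 - b1\<bar> + \<bar>a0 - b0\<bar>)"
        unfolding k_def by (rule quotient_Lipschitz[OF r1 a0 b0(3,4)])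
      also have "\<dots> \<le> k * \<delta>" using k by (intro mult_left_mono) (auto simp: \<delta>_def)
      finally show ?thesis .
    qed
    have d2: "\<bar>a2 / a0 - b2 / b0\<bar> \<le> k * \<delta>"
    proof -
      have "\<bar>a2 / a0 - b2 / b0\<bar> \<le> k * (\<bar>a2 - b2\<bar> + \<bar>a0 - b0\<bar>)"
        unfolding k_def by (rule quotient_Lipschitz[OF r1 a0 b0(3,5)])
      also have "\<dots> \<le> k * \<delta>" using k by (intro mult_left_mono) (auto simp: \<delta>_def)
      finally show ?thesis .
    qed
    have dsq: "\<bar>(a1 / a0)\<^sup>2 - (b1 / b0)\<^sup>2\<bar> \<le> 2 * \<theta> * (k * \<delta>)"
    proof -
      have "(a1 / a0)\<^sup>2 - (b1 / b0)\<^sup>2 = (a1 / a0 + b1 / b0) * (a1 / a0 - b1 / b0)"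
        by (simp add: power2_eq_square algebra_simps)
      then have "\<bar>(a1 / a0)\<^sup>2 - (b1 / b0)\<^sup>2\<bar> = \<bar>a1 / a0 + b1 / b0\<bar> * \<bar>a1 / a0 - b1 / b0\<bar>" by (simp only: abs_mult)
      also have "\<dots> \<le> (2 * \<theta>) * (k * \<delta>)"
      proof (rule mult_mono[OF _ dU])
        show "\<bar>a1 / a0 + b1 / b0\<bar> \<le> 2 * \<theta>"
          using UT[OF a] UT[OF b] abs_triangle_ineq[of "a1 / a0" "b1 / b0"] by linarith
      qed (use \<theta> in auto)
      finally show ?thesis .
    qed
    have \<delta>: "0 \<le> \<delta>" "\<bar>v - w\<bar> \<le> \<delta>" "\<bar>a0 - b0\<bar> \<le> \<delta>" unfolding \<delta>_def by auto
    have "\<bar>U - U'\<bar> + \<bar>T - T'\<bar> \<le> (k * \<delta> + \<delta>) + (k * \<delta> + 2 * \<theta> * (k * \<delta>))"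
      unfolding U_def U'_def T_def T'_def using dU d2 dsq \<delta> by linarith
    also have "\<dots> = (1 + 2 * k + 2 * \<theta> * k) * \<delta>" by (simp add: algebra_simps)
    finally have dUT: "\<bar>U - U'\<bar> + \<bar>T - T'\<bar> \<le> (1 + 2 * k + 2 * \<theta> * k) * \<delta>" .
    let ?g = "maxwellian 1 U T v" and ?h = "maxwellian 1 U' T' v"
    have "mxw a0 a1 a2 v - mxw b0 b1 b2 w = a0 * ?g - b0 * ?h"
      unfolding mxw_def U_def T_def U'_def T'_def maxwellian_shift[of b0 _ _ w v]
      using maxwellian_scale by metis
    also have "\<dots> = (a0 - b0) * ?g + b0 * (?g - ?h)" by (simp add: algebra_simps)
    finally have "\<bar>mxw a0 a1 a2 v - mxw b0 b1 b2 w\<bar> \<le> \<bar>a0 - b0\<bar> * \<bar>?g\<bar> + \<bar>b0\<bar> * \<bar>?g - ?h\<bar>"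
      using abs_triangle_ineq[of "(a0 - b0) * ?g" "b0 * (?g - ?h)"] by (simp only: abs_mult)
    also have "\<dots> \<le> \<delta> * (G * wt s v) + r2 * (H * ((1 + 2 * k + 2 * \<theta> * k) * \<delta>) * wt s v)"
    proof (intro add_mono mult_mono)
      show "\<bar>?g\<bar> \<le> G * wt s v" using G(2)[OF r(1,3,4), of v] by auto
      have "\<bar>?g - ?h\<bar> \<le> H * (\<bar>U - U'\<bar> + \<bar>T - T'\<bar>) * wt s v" by (rule H(2)[OF r])
      also have "\<dots> \<le> H * ((1 + 2 * k + 2 * \<theta> * k) * \<delta>) * wt s v"
        using dUT H by (intro mult_right_mono mult_left_mono) auto
      finally show "\<bar>?g - ?h\<bar> \<le> H * ((1 + 2 * k + 2 * \<theta> * k) * \<delta>) * wt s v" .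
    qed (use \<delta> b0 r2 G in auto)
    also have "\<dots> = M * \<delta> * wt s v" unfolding M_def by (simp add: algebra_simps)
    also have "\<dots> \<le> L * \<delta> * wt s v" unfolding L_def using \<delta> r2 G by (intro mult_right_mono) auto
    finally show "\<bar>mxw a0 a1 a2 v - mxw b0 b1 b2 w\<bar>
        \<le> L * (\<bar>a0 - b0\<bar> + \<bar>a1 - b1\<bar> + \<bar>a2 - b2\<bar> + \<bar>v - w\<bar>) * wt s v" unfolding \<delta>_def .
  qed
qed

section \<open>Regularity of the continuous solution\<close>

lemma Cauchy_integrable: "integrable lborel (\<lambda>v::real. 1 / (1 + v\<^sup>2))"
  and Cauchy_integral: "(LINT v|lborel. 1 / (1 + v\<^sup>2)) = pi"
proof -
  have e: "(\<lambda>v::real. indicator (einterval (-\<infinity>) \<infinity>) v *\<^sub>R inverse (1 + v\<^sup>2)) = (\<lambda>v. 1 / (1 + v\<^sup>2))"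
    by (simp add: inverse_eq_divide)
  show "integrable lborel (\<lambda>v::real. 1 / (1 + v\<^sup>2))"
    using integrable_inverse_1_plus_square unfolding set_integrable_def e .
  show "(LINT v|lborel. 1 / (1 + v\<^sup>2)) = pi"
    using LBINT_inverse_1_plus_square
    unfolding interval_lebesgue_integral_def set_lebesgue_integral_def e by simp
qed

lemma weighted_integral:
  fixes h :: "real \<Rightarrow> real"
  assumes h: "h \<in> borel_measurable borel" and b: "\<And>v. \<bar>h v\<bar> \<le> C * wt 2 v"
  shows "integrable lborel h" "\<bar>LINT v|lborel. h v\<bar> \<le> C * pi"
proof -
  have C: "0 \<le> C" using b[of 0] by (simp add: wt_def)
  have b': "\<bar>h v\<bar> \<le> C * (1 / (1 + v\<^sup>2))" for v
    using b[of v] mult_left_mono[OF wt_le_Cauchy[of 2 v] C] by simp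
  have c: "integrable lborel (\<lambda>v::real. C * (1 / (1 + v\<^sup>2)))"
    by (intro integrable_mult_right Cauchy_integrable)
  have C1: "0 \<le> C * (1 / (1 + v\<^sup>2))" for v using C by simp
  show i: "integrable lborel h"
    by (rule Bochner_Integration.integrable_bound[OF c])
      (use h b' C1 in \<open>auto simp: abs_of_nonneg simp del: times_divide_eq_right\<close>)
  have "\<bar>LINT v|lborel. h v\<bar> \<le> (LINT v|lborel. C * (1 / (1 + v\<^sup>2)))"
    by (rule integral_abs_bound_integral[OF i c b'])
  also have "\<dots> = C * (LINT v|lborel. 1 / (1 + v\<^sup>2))" by (rule Bochner_Integration.integral_mult_right_zero)
  finally show "\<bar>LINT v|lborel. h v\<bar> \<le> C * pi" by (simp only: Cauchy_integral)
qed

text \<open>A chain rule in which only one of the two partial derivatives is continuous. It applies to the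
  solution along a line: the equation provides a time derivative at each point, the derivatives in
  space and velocity are jointly continuous.\<close>

lemma diagonal_derivative:
  fixes F G :: "real \<Rightarrow> real \<Rightarrow> real"
  assumes F1: "((\<lambda>s. F s r) has_real_derivative a) (at r within S)"
    and F2: "\<And>s p. s \<in> S \<Longrightarrow> (F s has_real_derivative G s p) (at p)"
    and cont: "continuous (at (r, r) within S \<times> UNIV) (\<lambda>(s, p). G s p)"
  shows "((\<lambda>s. F s s) has_real_derivative a + G r r) (at r within S)"
proof -
  have "((\<lambda>s. (F s s - F s r) / (s - r)) \<longlongrightarrow> G r r) (at r within S)"
  proof (rule tendstoI)
    fix e :: real assume e: "0 < e"
    from cont[unfolded continuous_within_eps_delta, rule_format, of "e / 2"] e
    obtain d where d: "0 < d" "\<And>s p. s \<in> S \<Longrightarrow> dist (s, p) (r, r) < d \<Longrightarrow> dist (G s p) (G r r) < e / 2"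
      by auto
    have "dist ((F s s - F s r) / (s - r)) (G r r) < e" if s: "s \<in> S" "s \<noteq> r" "dist s r < d / 2" for s
    proof -
      have "norm ((F s s - G r r * s) - (F s r - G r r * r)) \<le> e / 2 * norm (s - r)"
      proof (rule field_differentiable_bound[of "cball r (dist s r)" "\<lambda>p. F s p - G r r * p" "\<lambda>p. G s p - G r r"])
        fix p assume p: "p \<in> cball r (dist s r)"
        show "((\<lambda>p. F s p - G r r * p) has_real_derivative G s p - G r r) (at p within cball r (dist s r))"
          using has_field_derivative_at_within[OF F2[OF s(1), of p]] by (auto intro!: derivative_eq_intros)
        have "dist (s, p) (r, r) \<le> dist s r + dist p r"
          using sqrt_sum_squares_le_sum[of "dist s r" "dist p r"] by (simp add: dist_prod_def)
        also have "\<dots> < d" using s p by (simp add: dist_commute)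
        finally show "norm (G s p - G r r) \<le> e / 2" using d(2)[OF s(1), of p] by (simp add: dist_norm)
      qed (auto simp: dist_commute)
      then have "\<bar>(F s s - F s r) - G r r * (s - r)\<bar> \<le> e / 2 * \<bar>s - r\<bar>" by (simp add: algebra_simps)
      moreover have "dist ((F s s - F s r) / (s - r)) (G r r) = \<bar>(F s s - F s r) - G r r * (s - r)\<bar> / \<bar>s - r\<bar>"
      proof -
        have "(F s s - F s r) / (s - r) - G r r = ((F s s - F s r) - G r r * (s - r)) / (s - r)"
          using s by (simp add: diff_divide_distrib)
        then show ?thesis by (simp only: dist_real_def abs_divide)
      qed
      ultimately have "dist ((F s s - F s r) / (s - r)) (G r r) \<le> e / 2" using s by (simp add: pos_divide_le_eq)
      then show ?thesis using e by linarith
    qed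
    then show "\<forall>\<^sub>F s in at r within S. dist ((F s s - F s r) / (s - r)) (G r r) < e"
      unfolding eventually_at using d(1) by (intro exI[of _ "d / 2"]) auto
  qed
  moreover have "((\<lambda>s. (F s r - F r r) / (s - r)) \<longlongrightarrow> a) (at r within S)"
    using F1 by (simp add: has_field_derivative_iff)
  ultimately have "((\<lambda>s. (F s r - F r r) / (s - r) + (F s s - F s r) / (s - r)) \<longlongrightarrow> a + G r r) (at r within S)"
    by (intro tendsto_add)
  then show ?thesis unfolding has_field_derivative_iff by (simp add: add_divide_distrib[symmetric])
qed

lemma line_derivative:
  fixes f fx fv :: "real \<Rightarrow> real \<Rightarrow> real \<Rightarrow> real"
  assumes ft: "((\<lambda>s. f s (x + a * t) (v + b * t)) has_real_derivative ft) (at t within S)" and t: "t \<in> S"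
    and Dx: "\<And>s x v. s \<in> S \<Longrightarrow> ((\<lambda>y. f s y v) has_real_derivative fx s x v) (at x)"
    and Dv: "\<And>s x v. s \<in> S \<Longrightarrow> ((\<lambda>w. f s x w) has_real_derivative fv s x v) (at v)"
    and cx: "continuous_on (S \<times> UNIV \<times> UNIV) (\<lambda>(s, x, v). fx s x v)"
    and cv: "continuous_on (S \<times> UNIV \<times> UNIV) (\<lambda>(s, x, v). fv s x v)"
  shows "((\<lambda>s. f s (x + a * s) (v + b * s)) has_real_derivative
    ft + (a * fx t (x + a * t) (v + b * t) + b * fv t (x + a * t) (v + b * t))) (at t within S)"
proof -
  have inner: "((\<lambda>r. f s (x + a * r) (v + b * r)) has_real_derivative
      a * fx s (x + a * r) (v + b * r) + b * fv s (x + a * r) (v + b * r)) (at r)" if s: "s \<in> S" for s r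
  proof (rule diagonal_derivative[where F = "\<lambda>p r. f s (x + a * p) (v + b * r)"
        and G = "\<lambda>p r. b * fv s (x + a * p) (v + b * r)"])
    show "((\<lambda>p. f s (x + a * p) (v + b * r)) has_real_derivative a * fx s (x + a * r) (v + b * r)) (at r)"
    proof -
      have "((\<lambda>p. x + a * p) has_real_derivative a) (at r)" by (auto intro!: derivative_eq_intros)
      from DERIV_chain2[OF Dx[OF s] this] show ?thesis by (simp only: mult.commute[of a])
    qed
    show "((\<lambda>r. f s (x + a * p) (v + b * r)) has_real_derivative b * fv s (x + a * p) (v + b * r)) (at r)" for p r
    proof -
      have "((\<lambda>p. v + b * p) has_real_derivative b) (at r)" by (auto intro!: derivative_eq_intros)
      from DERIV_chain2[OF Dv[OF s] this] show ?thesis by (simp only: mult.commute[of b])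
    qed
    have "continuous_on (UNIV \<times> UNIV) (\<lambda>z. b * (\<lambda>(s, x, v). fv s x v) (s, x + a * fst z, v + b * snd z))"
      by (intro continuous_intros continuous_on_compose2[OF cv]) (use s in auto)
    then show "continuous (at (r, r) within UNIV \<times> UNIV) (\<lambda>(p, r). b * fv s (x + a * p) (v + b * r))"
      by (auto simp: continuous_on_eq_continuous_within case_prod_unfold)
  qed
  show ?thesis
  proof (rule diagonal_derivative[where F = "\<lambda>s r. f s (x + a * r) (v + b * r)"
        and G = "\<lambda>s r. a * fx s (x + a * r) (v + b * r) + b * fv s (x + a * r) (v + b * r)", OF ft])
    show "((\<lambda>r. f s (x + a * r) (v + b * r)) has_real_derivative
      a * fx s (x + a * p) (v + b * p) + b * fv s (x + a * p) (v + b * p)) (at p)" if "s \<in> S" for s p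
      by (rule inner[OF that])
    have "continuous_on (S \<times> UNIV) (\<lambda>z. a * (\<lambda>(s, x, v). fx s x v) (fst z, x + a * snd z, v + b * snd z)
        + b * (\<lambda>(s, x, v). fv s x v) (fst z, x + a * snd z, v + b * snd z))"
      by (intro continuous_intros continuous_on_compose2[OF cv] continuous_on_compose2[OF cx]) auto
    then show "continuous (at (t, t) within S \<times> UNIV)
        (\<lambda>(s, r). a * fx s (x + a * r) (v + b * r) + b * fv s (x + a * r) (v + b * r))"
      using t by (auto simp: continuous_on_eq_continuous_within case_prod_unfold)
  qed
qed

text \<open>The solution together with names for its derivatives and for the constants bounding it. The time
  derivative is described by the equation alone.\<close>

locale vp_solution =
  fixes q \<epsilon> Tf B \<rho>0 \<tau>0 Ce :: real and f fx fv fxx fvx fvv :: "real \<Rightarrow> real \<Rightarrow> real \<Rightarrow> real"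
    and E :: "real \<Rightarrow> real \<Rightarrow> real"
  assumes q: "3 < q" and \<epsilon>: "0 < \<epsilon>" and Tf: "0 < Tf" and B: "0 \<le> B" and \<rho>0: "0 < \<rho>0" and \<tau>0: "0 < \<tau>0" and Ce: "0 \<le> Ce"
    and bf: "\<And>t x v. t \<in> {0..Tf} \<Longrightarrow> \<bar>f t x v\<bar> \<le> B * wt (q + 2) v"
    and bfx: "\<And>t x v. t \<in> {0..Tf} \<Longrightarrow> \<bar>fx t x v\<bar> \<le> B * wt (q + 2) v"
    and bfv: "\<And>t x v. t \<in> {0..Tf} \<Longrightarrow> \<bar>fv t x v\<bar> \<le> B * wt (q + 2) v"
    and bfxx: "\<And>t x v. t \<in> {0..Tf} \<Longrightarrow> \<bar>fxx t x v\<bar> \<le> B * wt (q + 2) v"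
    and bfvx: "\<And>t x v. t \<in> {0..Tf} \<Longrightarrow> \<bar>fvx t x v\<bar> \<le> B * wt (q + 2) v"
    and bfvv: "\<And>t x v. t \<in> {0..Tf} \<Longrightarrow> \<bar>fvv t x v\<bar> \<le> B * wt (q + 2) v"
    and Dx: "\<And>t x v. t \<in> {0..Tf} \<Longrightarrow> ((\<lambda>y. f t y v) has_real_derivative fx t x v) (at x)"
    and Dv: "\<And>t x v. t \<in> {0..Tf} \<Longrightarrow> ((\<lambda>w. f t x w) has_real_derivative fv t x v) (at v)"
    and Dxx: "\<And>t x v. t \<in> {0..Tf} \<Longrightarrow> ((\<lambda>y. fx t y v) has_real_derivative fxx t x v) (at x)"
    and Dvx: "\<And>t x v. t \<in> {0..Tf} \<Longrightarrow> ((\<lambda>y. fv t y v) has_real_derivative fvx t x v) (at x)"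
    and Dvv: "\<And>t x v. t \<in> {0..Tf} \<Longrightarrow> ((\<lambda>w. fv t x w) has_real_derivative fvv t x v) (at v)"
    and cx: "continuous_on ({0..Tf} \<times> UNIV \<times> UNIV) (\<lambda>(s, x, v). fx s x v)"
    and cv: "continuous_on ({0..Tf} \<times> UNIV \<times> UNIV) (\<lambda>(s, x, v). fv s x v)"
    and Dt: "\<And>t x v. t \<in> {0..Tf} \<Longrightarrow> ((\<lambda>s. f s x v) has_real_derivative
        1 / \<epsilon> * (local_maxwellian (f t) x v - f t x v) - v * fx t x v - E t x * fv t x v) (at t within {0..Tf})"
    and DE: "\<And>t x. t \<in> {0..Tf} \<Longrightarrow> (E t has_real_derivative dens (f t) x - 1) (at x)"
    and E_eq: "\<And>t x. t \<in> {0..Tf} \<Longrightarrow> x \<in> {0..1} \<Longrightarrow>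
        E t x = (LINT y:{0..1}|lborel. field_kernel x y * (dens (f t) y - 1))"
    and bE: "\<And>t x. t \<in> {0..Tf} \<Longrightarrow> \<bar>E t x\<bar> \<le> Ce"
    and dens_ge: "\<And>t x. t \<in> {0..Tf} \<Longrightarrow> \<rho>0 \<le> dens (f t) x"
    and temp_ge: "\<And>t x. t \<in> {0..Tf} \<Longrightarrow> \<tau>0 \<le> temp (f t) x"
    and per: "\<And>t x v. t \<in> {0..Tf} \<Longrightarrow> f t (x + 1) v = f t x v"
begin

definition "mom k t x = (LINT v|lborel. v ^ k * f t x v)"

lemma meas: "t \<in> {0..Tf} \<Longrightarrow> (\<lambda>v. v ^ k * f t x v) \<in> borel_measurable borel"
proof -
  assume t: "t \<in> {0..Tf}"
  have "continuous_on UNIV (\<lambda>v. f t x v)"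
    using Dv[OF t] by (intro DERIV_continuous_on) (auto intro: DERIV_subset)
  then show ?thesis by (intro borel_measurable_continuous_onI continuous_intros)
qed

lemma power_wt: "k \<le> 2 \<Longrightarrow> \<bar>v\<bar> ^ k * wt (q + 1) v \<le> wt 2 v"
proof -
  assume k: "k \<le> 2"
  have "\<bar>v\<bar> ^ k * wt (q + 1) v \<le> \<bar>v\<bar> ^ k * wt (2 + real k) v"
    using k q by (intro mult_left_mono wt_mono) auto
  also have "\<dots> \<le> wt 2 v" by (rule abs_wt_absorb)
  finally show ?thesis .
qed

lemma wt_q: "wt (q + 2) v \<le> wt (q + 1) v" "wt (q + 1) v \<le> wt q v" "wt (q + 2) v \<le> wt q v"
  by (auto intro!: wt_mono)

lemma mom_bound:
  assumes t: "t \<in> {0..Tf}" and k: "k \<le> 2"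
  shows "integrable lborel (\<lambda>v. v ^ k * f t x v)" "\<bar>mom k t x\<bar> \<le> B * pi"
proof -
  have b: "\<bar>v ^ k * f t x v\<bar> \<le> B * wt 2 v" for v
  proof -
    have "\<bar>v ^ k * f t x v\<bar> \<le> \<bar>v\<bar> ^ k * (B * wt (q + 1) v)"
      unfolding abs_mult power_abs using bf[OF t, of x v] mult_left_mono[OF wt_q(1)[of v] B]
      by (intro mult_left_mono) auto
    also have "\<dots> = B * (\<bar>v\<bar> ^ k * wt (q + 1) v)" by (simp only: mult_ac)
    also have "\<dots> \<le> B * wt 2 v" using power_wt[OF k] B by (intro mult_left_mono)
    finally show ?thesis .
  qed
  show "integrable lborel (\<lambda>v. v ^ k * f t x v)" by (rule weighted_integral(1)[OF meas[OF t] b])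
  show "\<bar>mom k t x\<bar> \<le> B * pi" unfolding mom_def by (rule weighted_integral(2)[OF meas[OF t] b])
qed

text \<open>Multiplication by \<open>v ^ k\<close> leaves the exponent \<open>q + 1 - k \<ge> q - 1 \<ge> 2\<close> of the weight, so the moments up to
  order two inherit a weighted bound of the difference.\<close>

lemma mom_diff:
  assumes s: "s \<in> {0..Tf}" and t: "t \<in> {0..Tf}" and k: "k \<le> 2"
    and d: "\<And>v. \<bar>f s y v - f t x v\<bar> \<le> C * wt (q + 1) v"
  shows "\<bar>mom k s y - mom k t x\<bar> \<le> C * pi"
proof -
  have C: "0 \<le> C" using d[of 0] by (simp add: wt_def)
  have b: "\<bar>v ^ k * f s y v - v ^ k * f t x v\<bar> \<le> C * wt 2 v" for v
  proof -
    have "\<bar>v ^ k * f s y v - v ^ k * f t x v\<bar> = \<bar>v\<bar> ^ k * \<bar>f s y v - f t x v\<bar>"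
      by (simp add: right_diff_distrib[symmetric] abs_mult power_abs)
    also have "\<dots> \<le> \<bar>v\<bar> ^ k * (C * wt (q + 1) v)" using d by (intro mult_left_mono) auto
    also have "\<dots> = C * (\<bar>v\<bar> ^ k * wt (q + 1) v)" by (simp only: mult_ac)
    also have "\<dots> \<le> C * wt 2 v" using power_wt[OF k] C by (intro mult_left_mono)
    finally show ?thesis .
  qed
  have "mom k s y - mom k t x = (LINT v|lborel. v ^ k * f s y v - v ^ k * f t x v)"
    unfolding mom_def using mom_bound(1)[OF s k] mom_bound(1)[OF t k] by simp
  also have "\<bar>\<dots>\<bar> \<le> C * pi"
    by (rule weighted_integral(2)[OF borel_measurable_diff[OF meas[OF s] meas[OF t]] b])
  finally show ?thesis .
qed

lemma dens_mom: "dens (f t) x = mom 0 t x"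
  by (simp add: dens_def mom_def)

lemma bulk_mom: "bulk (f t) x = mom 1 t x / mom 0 t x"
  by (simp add: bulk_def dens_mom mom_def)

lemma temp_mom:
  assumes t: "t \<in> {0..Tf}"
  shows "temp (f t) x = mom 2 t x / mom 0 t x - (mom 1 t x / mom 0 t x)\<^sup>2"
proof -
  let ?U = "bulk (f t) x"
  have m0: "mom 0 t x \<noteq> 0" using dens_ge[OF t, of x] \<rho>0 by (simp add: dens_mom)
  note i = mom_bound(1)[OF t, of _ x]
  have "(LINT v|lborel. \<bar>v - ?U\<bar>\<^sup>2 * f t x v)
    = (LINT v|lborel. v ^ 2 * f t x v - (2 * ?U) * (v ^ 1 * f t x v) + ?U\<^sup>2 * (v ^ 0 * f t x v))"
    by (intro Bochner_Integration.integral_cong refl) (simp add: power2_eq_square algebra_simps)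
  also have "\<dots> = mom 2 t x - (2 * ?U) * mom 1 t x + ?U\<^sup>2 * mom 0 t x"
    unfolding mom_def using i[of 0] i[of 1] i[of 2] by simp
  finally have "temp (f t) x = (mom 2 t x - (2 * ?U) * mom 1 t x + ?U\<^sup>2 * mom 0 t x) / mom 0 t x"
    by (simp add: temp_def dens_mom)
  then show ?thesis unfolding bulk_mom using m0 by (simp add: field_simps power2_eq_square)
qed

lemma local_maxwellian_mxw:
  "t \<in> {0..Tf} \<Longrightarrow> local_maxwellian (f t) x v = mxw (mom 0 t x) (mom 1 t x) (mom 2 t x) v"
  by (simp add: local_maxwellian_def mxw_def dens_mom bulk_mom temp_mom)

lemma mom_in_region:
  assumes t: "t \<in> {0..Tf}" and r: "r1 \<le> \<rho>0" "B * pi \<le> r2" "\<tau> \<le> \<tau>0"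
  shows "mom_region r1 r2 \<tau> (mom 0 t x) (mom 1 t x) (mom 2 t x)"
  using mom_bound(2)[OF t, of 0 x] mom_bound(2)[OF t, of 1 x] mom_bound(2)[OF t, of 2 x]
    dens_ge[OF t, of x] temp_ge[OF t, of x] r
  unfolding mom_region_def temp_mom[OF t, symmetric] dens_mom by auto

lemma x_Lipschitz: "t \<in> {0..Tf} \<Longrightarrow> \<bar>f t y v - f t x v\<bar> \<le> B * wt (q + 2) v * \<bar>y - x\<bar>"
  using field_differentiable_bound[of UNIV "\<lambda>y. f t y v" "\<lambda>x. fx t x v" "B * wt (q + 2) v" y x] Dx bfx by simp

lemma v_Lipschitz:
  assumes t: "t \<in> {0..Tf}" and k: "\<bar>w - v\<bar> \<le> \<kappa>"
  shows "\<bar>f t x w - f t x v\<bar> \<le> B * (1 + \<kappa>) powr (q + 2) * wt (q + 2) v * \<bar>w - v\<bar>"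
proof -
  have "norm (f t x w - f t x v) \<le> B * (1 + \<kappa>) powr (q + 2) * wt (q + 2) v * norm (w - v)"
  proof (rule field_differentiable_bound[of "cball v \<kappa>" "\<lambda>w. f t x w" "\<lambda>v. fv t x v"])
    fix z assume z: "z \<in> cball v \<kappa>"
    show "((\<lambda>w. f t x w) has_real_derivative fv t x z) (at z within cball v \<kappa>)"
      using Dv[OF t] by (rule DERIV_subset) auto
    have "\<bar>fv t x z\<bar> \<le> B * wt (q + 2) z" by (rule bfv[OF t])
    also have "\<dots> \<le> B * ((1 + \<kappa>) powr (q + 2) * wt (q + 2) v)"
      using z q B by (intro mult_left_mono wt_shift) (auto simp: dist_real_def)
    finally show "norm (fv t x z) \<le> B * (1 + \<kappa>) powr (q + 2) * wt (q + 2) v" by (simp add: mult.assoc)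
  qed (use k in \<open>auto simp: dist_real_def abs_minus_commute\<close>)
  then show ?thesis by simp
qed

text \<open>All terms of the equation are bounded by the weight \<open>q + 1\<close>: transport in space loses one of
  the \<open>q + 2\<close> powers available.\<close>

lemma t_Lipschitz:
  obtains L where "0 \<le> L"
    "\<And>s t x v. s \<in> {0..Tf} \<Longrightarrow> t \<in> {0..Tf} \<Longrightarrow> \<bar>f s x v - f t x v\<bar> \<le> L * \<bar>s - t\<bar> * wt (q + 1) v"
proof -
  obtain M where M: "0 \<le> M" "\<And>a0 a1 a2 v. mom_region \<rho>0 (B * pi) \<tau>0 a0 a1 a2 \<Longrightarrow> \<bar>mxw a0 a1 a2 v\<bar> \<le> M * wt (q + 1) v"
    by (rule mxw_bounds[of "q + 1" \<rho>0 \<tau>0 0 "B * pi"]) (use q B \<rho>0 \<tau>0 in auto)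
  define L where "L = 1 / \<epsilon> * (M + B) + B + Ce * B"
  have b: "\<bar>1 / \<epsilon> * (local_maxwellian (f t) x v - f t x v) - v * fx t x v - E t x * fv t x v\<bar> \<le> L * wt (q + 1) v"
    if t: "t \<in> {0..Tf}" for t x v
  proof -
    have 1: "\<bar>local_maxwellian (f t) x v\<bar> \<le> M * wt (q + 1) v"
      unfolding local_maxwellian_mxw[OF t] by (rule M(2)[OF mom_in_region[OF t]]) auto
    have 2: "\<bar>f t x v\<bar> \<le> B * wt (q + 1) v"
      using bf[OF t, of x v] mult_left_mono[OF wt_q(1)[of v] B] by linarith
    have "\<bar>1 / \<epsilon> * (local_maxwellian (f t) x v - f t x v)\<bar> \<le> 1 / \<epsilon> * (M * wt (q + 1) v + B * wt (q + 1) v)"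
      unfolding abs_mult using 1 2 \<epsilon> by (intro mult_mono) auto
    moreover have "\<bar>v * fx t x v\<bar> \<le> B * wt (q + 1) v"
    proof -
      have "\<bar>v * fx t x v\<bar> \<le> \<bar>v\<bar> * (B * wt (q + 1 + real 1) v)"
        unfolding abs_mult using bfx[OF t, of x v] by (intro mult_left_mono) (auto simp: add.assoc)
      also have "\<dots> = B * (\<bar>v\<bar> ^ 1 * wt (q + 1 + real 1) v)" by simp
      also have "\<dots> \<le> B * wt (q + 1) v" by (intro mult_left_mono abs_wt_absorb B)
      finally show ?thesis .
    qed
    moreover have "\<bar>E t x * fv t x v\<bar> \<le> Ce * (B * wt (q + 1) v)"
      unfolding abs_mult using bE[OF t] bfv[OF t, of x v] mult_left_mono[OF wt_q(1)[of v] B] Ce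
      by (intro mult_mono) auto
    ultimately have "\<bar>1 / \<epsilon> * (local_maxwellian (f t) x v - f t x v) - v * fx t x v - E t x * fv t x v\<bar>
       \<le> 1 / \<epsilon> * (M * wt (q + 1) v + B * wt (q + 1) v) + B * wt (q + 1) v + Ce * (B * wt (q + 1) v)" by linarith
    also have "\<dots> = L * wt (q + 1) v" unfolding L_def by (simp add: algebra_simps add_divide_distrib)
    finally show ?thesis .
  qed
  show thesis
  proof (rule that[of L])
    show "0 \<le> L" unfolding L_def using M B \<epsilon> Ce by simp
    fix s t x v assume st: "s \<in> {0..Tf}" "t \<in> {0..Tf}"
    have "norm (f s x v - f t x v) \<le> L * wt (q + 1) v * norm (s - t)"
      by (rule field_differentiable_bound[of "{0..Tf}" "\<lambda>s. f s x v", OF _ Dt]) (use b st in auto)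
    then show "\<bar>f s x v - f t x v\<bar> \<le> L * \<bar>s - t\<bar> * wt (q + 1) v" by (simp add: mult_ac)
  qed
qed

lemma mom_Lipschitz:
  obtains L where "0 \<le> L" "\<And>s t x y k. s \<in> {0..Tf} \<Longrightarrow> t \<in> {0..Tf} \<Longrightarrow> k \<le> 2 \<Longrightarrow>
    \<bar>mom k s y - mom k t x\<bar> \<le> L * (\<bar>s - t\<bar> + \<bar>y - x\<bar>)"
proof -
  obtain L where L: "0 \<le> L"
    "\<And>s t x v. s \<in> {0..Tf} \<Longrightarrow> t \<in> {0..Tf} \<Longrightarrow> \<bar>f s x v - f t x v\<bar> \<le> L * \<bar>s - t\<bar> * wt (q + 1) v"
    using t_Lipschitz by blast
  show thesis
  proof (rule that[of "(L + B) * pi"])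
    show "0 \<le> (L + B) * pi" using L B by simp
    fix s t x y and k :: nat assume st: "s \<in> {0..Tf}" "t \<in> {0..Tf}" and k: "k \<le> 2"
    have "\<bar>f s y v - f t x v\<bar> \<le> ((L + B) * (\<bar>s - t\<bar> + \<bar>y - x\<bar>)) * wt (q + 1) v" for v
    proof -
      have "B * wt (q + 2) v * \<bar>y - x\<bar> \<le> B * wt (q + 1) v * \<bar>y - x\<bar>"
        using B wt_q(1) by (intro mult_right_mono mult_left_mono) auto
      then have "\<bar>f s y v - f t x v\<bar> \<le> L * \<bar>s - t\<bar> * wt (q + 1) v + B * wt (q + 1) v * \<bar>y - x\<bar>"
        using L(2)[OF st, of y v] x_Lipschitz[OF st(2), of y v x] by linarith
      also have "\<dots> \<le> ((L + B) * (\<bar>s - t\<bar> + \<bar>y - x\<bar>)) * wt (q + 1) v"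
        using L(1) B by (simp add: algebra_simps add_nonneg_nonneg)
      finally show ?thesis .
    qed
    from mom_diff[OF st k this] show "\<bar>mom k s y - mom k t x\<bar> \<le> (L + B) * pi * (\<bar>s - t\<bar> + \<bar>y - x\<bar>)"
      by (simp add: mult_ac)
  qed
qed

end

section \<open>The local truncation error\<close>

lemma kernel_bound: "x \<in> {0..1} \<Longrightarrow> y \<in> {0..1} \<Longrightarrow> \<bar>field_kernel x y\<bar> \<le> 1"
  by (auto simp: field_kernel_def)

text \<open>The kernel is \<open>y\<close> minus the indicator of \<open>{x<..}\<close>.\<close>

lemma kernel_integrable:
  assumes g: "continuous_on UNIV (g :: real \<Rightarrow> real)"
  shows "integrable lborel (\<lambda>y. indicator {0..1} y * (field_kernel x y * g y))"
proof -
  have a: "set_integrable lborel {0..1} (\<lambda>y. y * g y)"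
    by (intro borel_integrable_atLeastAtMost' continuous_intros continuous_on_subset[OF g]) auto
  have b: "set_integrable lborel {0..1} g"
    by (intro borel_integrable_atLeastAtMost' continuous_on_subset[OF g]) auto
  have c: "set_integrable lborel ({0..1} \<inter> {x<..}) g"
    by (rule set_integrable_subset[OF b]) auto
  have "integrable lborel (\<lambda>y. indicator {0..1} y *\<^sub>R (y * g y) - indicator ({0..1} \<inter> {x<..}) y *\<^sub>R g y)"
    using a c unfolding set_integrable_def by (rule Bochner_Integration.integrable_diff)
  also have "(\<lambda>y. indicator {0..1} y *\<^sub>R (y * g y) - indicator ({0..1} \<inter> {x<..}) y *\<^sub>R g y)
      = (\<lambda>y. indicator {0..1} y * (field_kernel x y * g y))"
    by (intro ext) (auto simp: field_kernel_def indicator_def algebra_simps)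
  finally show ?thesis .
qed

lemma indicator_integral:
  fixes a b :: real
  assumes "a \<le> b"
  shows "integrable lborel (\<lambda>y. C * indicator {a..b} y :: real)" "(LINT y|lborel. C * indicator {a..b} y) = C * (b - a)"
    "integrable lborel (\<lambda>y. C * indicator {a..<b} y :: real)" "(LINT y|lborel. C * indicator {a..<b} y) = C * (b - a)"
  using assms by (auto intro!: integrable_mult_right integrable_real_indicator)

lemma cell_eq_floor:
  fixes d y :: real
  assumes "0 < d"
  shows "y \<in> {real_of_int j * d..<real_of_int j * d + d} \<longleftrightarrow> j = \<lfloor>y / d\<rfloor>"
proof -
  have "j = \<lfloor>y / d\<rfloor> \<longleftrightarrow> real_of_int j \<le> y / d \<and> y / d < real_of_int j + 1"
    by (metis floor_eq_iff)
  also have "\<dots> \<longleftrightarrow> real_of_int j * d \<le> y \<and> y < (real_of_int j + 1) * d"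
    using assms by (simp add: pos_le_divide_eq pos_divide_less_eq)
  finally show ?thesis by (simp add: distrib_right)
qed

text \<open>The step function whose integral is the Riemann sum of \<open>g\<close> over the cells with index in \<open>J\<close>.\<close>

definition step_fun :: "int set \<Rightarrow> real \<Rightarrow> (real \<Rightarrow> real) \<Rightarrow> real \<Rightarrow> real" where
  "step_fun J d g y = (\<Sum>j\<in>J. g (real_of_int j * d) * indicator {real_of_int j * d..<real_of_int j * d + d} y)"

lemma step_fun_eq:
  assumes "finite J" "0 < d"
  shows "step_fun J d g y = (if \<lfloor>y / d\<rfloor> \<in> J then g (real_of_int \<lfloor>y / d\<rfloor> * d) else 0)"
proof -
  have "step_fun J d g y = (\<Sum>j\<in>J. if j = \<lfloor>y / d\<rfloor> then g (real_of_int j * d) else 0)"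
    unfolding step_fun_def
    by (intro sum.cong refl) (simp del: atLeastLessThan_iff add: indicator_def cell_eq_floor[OF assms(2)])
  then show ?thesis using assms by simp
qed

lemma step_fun_integral:
  assumes "finite J" "0 < d"
  shows "integrable lborel (step_fun J d g)" "(LINT y|lborel. step_fun J d g y) = (\<Sum>j\<in>J. g (real_of_int j * d) * d)"
proof -
  have i: "integrable lborel (\<lambda>y. g (real_of_int j * d) * indicator {real_of_int j * d..<real_of_int j * d + d} y)" for j
    using assms by (intro indicator_integral) auto
  show "integrable lborel (step_fun J d g)"
    unfolding step_fun_def using i by (intro Bochner_Integration.integrable_sum)
  have "(LINT y|lborel. step_fun J d g y)
    = (\<Sum>j\<in>J. LINT y|lborel. g (real_of_int j * d) * indicator {real_of_int j * d..<real_of_int j * d + d} y)"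
    unfolding step_fun_def using i by (intro Bochner_Integration.integral_sum)
  also have "\<dots> = (\<Sum>j\<in>J. g (real_of_int j * d) * d)"
    using assms by (intro sum.cong refl) (subst indicator_integral(4), auto)
  finally show "(LINT y|lborel. step_fun J d g y) = (\<Sum>j\<in>J. g (real_of_int j * d) * d)" .
qed

lemma floor_cell:
  fixes d y :: real
  assumes "0 < d"
  shows "real_of_int \<lfloor>y / d\<rfloor> * d \<le> y" "y < real_of_int \<lfloor>y / d\<rfloor> * d + d"
  using cell_eq_floor[OF assms, of y "\<lfloor>y / d\<rfloor>"] by auto

context vp_solution
begin

lemma dens_continuous: "t \<in> {0..Tf} \<Longrightarrow> continuous_on UNIV (\<lambda>y. dens (f t) y - 1)"
proof -
  assume t: "t \<in> {0..Tf}"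
  obtain L where L: "0 \<le> L" "\<And>s t x y k. s \<in> {0..Tf} \<Longrightarrow> t \<in> {0..Tf} \<Longrightarrow> k \<le> 2 \<Longrightarrow>
    \<bar>mom k s y - mom k t x\<bar> \<le> L * (\<bar>s - t\<bar> + \<bar>y - x\<bar>)"
    using mom_Lipschitz by blast
  have "L-lipschitz_on UNIV (\<lambda>y. mom 0 t y)"
    using L(2)[OF t t, of 0] by (intro lipschitz_onI L(1)) (auto simp: dist_real_def)
  then have "continuous_on UNIV (\<lambda>y. mom 0 t y)" by (rule lipschitz_on_continuous_on)
  then show ?thesis unfolding dens_mom by (intro continuous_intros)
qed

lemma E_eq': "t \<in> {0..Tf} \<Longrightarrow> x \<in> {0..1} \<Longrightarrow>
   E t x = (LINT y|lborel. indicator {0..1} y * (field_kernel x y * (dens (f t) y - 1)))"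
  by (simp add: E_eq set_lebesgue_integral_def)

lemma E_Lipschitz:
  obtains L where "0 \<le> L" "\<And>s t x y. s \<in> {0..Tf} \<Longrightarrow> t \<in> {0..Tf} \<Longrightarrow> x \<in> {0..1} \<Longrightarrow>
    \<bar>E s y - E t x\<bar> \<le> L * (\<bar>s - t\<bar> + \<bar>y - x\<bar>)"
proof -
  obtain L where L: "0 \<le> L" "\<And>s t x y k. s \<in> {0..Tf} \<Longrightarrow> t \<in> {0..Tf} \<Longrightarrow> k \<le> 2 \<Longrightarrow>
    \<bar>mom k s y - mom k t x\<bar> \<le> L * (\<bar>s - t\<bar> + \<bar>y - x\<bar>)"
    using mom_Lipschitz by blast
  define M where "M = L + (B * pi + 1)"
  show thesis
  proof (rule that[of M])
    show M: "0 \<le> M" unfolding M_def using L B by simp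
    fix s t x y :: real assume s: "s \<in> {0..Tf}" and t: "t \<in> {0..Tf}" and x: "x \<in> {0..1}"
    have 1: "\<bar>E s y - E s x\<bar> \<le> (B * pi + 1) * \<bar>y - x\<bar>"
    proof -
      have "\<bar>dens (f s) z - 1\<bar> \<le> B * pi + 1" for z
        using mom_bound(2)[OF s, of 0 z] unfolding dens_mom by linarith
      then show ?thesis
        using field_differentiable_bound[of UNIV "E s" "\<lambda>x. dens (f s) x - 1" "B * pi + 1" y x] DE[OF s] by simp
    qed
    have 2: "\<bar>E s x - E t x\<bar> \<le> L * \<bar>s - t\<bar>"
    proof -
      let ?h = "\<lambda>r y. indicator {0..1} y * (field_kernel x y * (dens (f r) y - 1)) :: real"
      have i: "integrable lborel (?h s)" "integrable lborel (?h t)"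
        using kernel_integrable[OF dens_continuous[OF s]] kernel_integrable[OF dens_continuous[OF t]] by auto
      have eq: "E s x - E t x = (LINT y|lborel. ?h s y - ?h t y)"
        unfolding E_eq'[OF s x] E_eq'[OF t x] by (rule Bochner_Integration.integral_diff[OF i, symmetric])
      have le: "\<bar>LINT y|lborel. ?h s y - ?h t y\<bar> \<le> (LINT y|lborel. L * \<bar>s - t\<bar> * indicator {0..1::real} y)"
      proof (rule Bochner_Integration.integral_abs_bound_integral[OF Bochner_Integration.integrable_diff[OF i]])
        fix y :: real
        show "\<bar>?h s y - ?h t y\<bar> \<le> L * \<bar>s - t\<bar> * indicator {0..1} y"
        proof (cases "y \<in> {0..1}")
          case True
          have "\<bar>?h s y - ?h t y\<bar> = \<bar>field_kernel x y\<bar> * \<bar>mom 0 s y - mom 0 t y\<bar>"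
            using True by (simp add: dens_mom right_diff_distrib[symmetric] abs_mult)
          also have "\<dots> \<le> 1 * (L * \<bar>s - t\<bar>)"
            using kernel_bound[OF x True] L(2)[OF s t, of 0 y y] by (intro mult_mono) auto
          finally show ?thesis using True by simp
        qed simp
      qed (rule indicator_integral(1), simp)
      have "(LINT y|lborel. L * \<bar>s - t\<bar> * indicator {0..1::real} y) = L * \<bar>s - t\<bar> * (1 - 0)"
        by (rule indicator_integral(2)) (rule zero_le_one)
      then show ?thesis using le unfolding eq by (simp only: diff_zero mult_1_right)
    qed
    have "\<bar>E s y - E t x\<bar> \<le> L * \<bar>s - t\<bar> + (B * pi + 1) * \<bar>y - x\<bar>" using 1 2 by linarith
    also have "\<dots> \<le> M * \<bar>s - t\<bar> + M * \<bar>y - x\<bar>"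
    proof (intro add_mono mult_right_mono)
      have "0 \<le> B * pi" using B by simp
      then show "L \<le> M" "B * pi + 1 \<le> M" unfolding M_def using L(1) by linarith+
    qed auto
    finally show "\<bar>E s y - E t x\<bar> \<le> M * (\<bar>s - t\<bar> + \<bar>y - x\<bar>)" by (simp add: distrib_left)
  qed
qed

lemma abs_wt_1: "\<bar>v\<bar> * wt (s + 1) v \<le> wt s v" "(1 + \<bar>v\<bar>) * wt (s + 1) v = wt s v"
  using abs_wt_absorb[of v 1 s] wt_absorb[of v 1 s] by auto

abbreviation "relax t x v \<equiv> 1 / \<epsilon> * (local_maxwellian (f t) x v - f t x v)"

text \<open>The derivative of the solution along the line ending in \<open>(t1, x, v)\<close> with velocity and field frozen
  is the relaxation term plus \<open>(v - W) * fx + (e - E) * fv\<close>, where \<open>W\<close> is the velocity on the line. All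
  of these are within \<open>O (t1 - t0)\<close> of the relaxation term at the end point, so the mean value
  theorem yields a second-order remainder from first derivatives of the solution. The displacement
  in space is \<open>v * (t1 - t0)\<close>, which costs one power of the weight.\<close>

lemma local_truncation:
  obtains C where "0 \<le> C"
    "\<And>t0 t1 x v. t0 \<in> {0..Tf} \<Longrightarrow> t1 \<in> {0..Tf} \<Longrightarrow> t0 \<le> t1 \<Longrightarrow> x \<in> {0..1} \<Longrightarrow>
      \<bar>f t1 x v - f t0 (x - v * (t1 - t0)) (v - E t0 x * (t1 - t0)) - (t1 - t0) * relax t1 x v\<bar>
      \<le> C * (t1 - t0)\<^sup>2 * wt q v"
proof -
  define \<kappa> where "\<kappa> = Ce * Tf"
  have \<kappa>: "0 \<le> \<kappa>" unfolding \<kappa>_def using Ce Tf by simp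
  define w where "w = (1 + \<kappa>) powr (q + 2)"
  have w: "0 \<le> w" by (simp add: w_def)
  obtain Lt where Lt: "0 \<le> Lt"
    "\<And>s t x v. s \<in> {0..Tf} \<Longrightarrow> t \<in> {0..Tf} \<Longrightarrow> \<bar>f s x v - f t x v\<bar> \<le> Lt * \<bar>s - t\<bar> * wt (q + 1) v"
    using t_Lipschitz by blast
  obtain Lm where Lm: "0 \<le> Lm" "\<And>s t x y k. s \<in> {0..Tf} \<Longrightarrow> t \<in> {0..Tf} \<Longrightarrow> k \<le> 2 \<Longrightarrow>
    \<bar>mom k s y - mom k t x\<bar> \<le> Lm * (\<bar>s - t\<bar> + \<bar>y - x\<bar>)"
    using mom_Lipschitz by blast
  obtain LE where LE: "0 \<le> LE" "\<And>s t x y. s \<in> {0..Tf} \<Longrightarrow> t \<in> {0..Tf} \<Longrightarrow> x \<in> {0..1} \<Longrightarrow>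
    \<bar>E s y - E t x\<bar> \<le> LE * (\<bar>s - t\<bar> + \<bar>y - x\<bar>)"
    using E_Lipschitz by blast
  have q1: "0 \<le> q + 1" using q by simp
  have Bpi: "0 \<le> B * pi" using B by simp
  obtain LM where LM: "0 \<le> LM"
    "\<And>a0 a1 a2 b0 b1 b2 v w. mom_region \<rho>0 (B * pi) \<tau>0 a0 a1 a2 \<Longrightarrow> mom_region \<rho>0 (B * pi) \<tau>0 b0 b1 b2 \<Longrightarrow> \<bar>v - w\<bar> \<le> \<kappa> \<Longrightarrow>
      \<bar>mxw a0 a1 a2 v - mxw b0 b1 b2 w\<bar> \<le> LM * (\<bar>a0 - b0\<bar> + \<bar>a1 - b1\<bar> + \<bar>a2 - b2\<bar> + \<bar>v - w\<bar>) * wt (q + 1) v"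
    using mxw_bounds[OF q1 \<rho>0 \<tau>0 \<kappa> Bpi] by metis
  define Cf where "Cf = B * w + B * w * Ce + Lt"
  define CMx where "CMx = LM * (3 * Lm + Ce)"
  define C where "C = 1 / \<epsilon> * (CMx + Cf) + Ce * (B * w) + LE * (B * w)"
  have C0: "0 \<le> Cf" "0 \<le> CMx" unfolding Cf_def CMx_def using B w Ce Lt LM Lm by auto
  have C: "0 \<le> C" unfolding C_def using C0 \<epsilon> Ce B w LE by simp
  show thesis
  proof (rule that[OF C])
    fix t0 t1 x v :: real assume t0: "t0 \<in> {0..Tf}" and t1: "t1 \<in> {0..Tf}" and le: "t0 \<le> t1" and x: "x \<in> {0..1}"
    define h where "h = t1 - t0"
    define e where "e = E t0 x"
    define x0 where "x0 = x - v * t1"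
    define v0 where "v0 = v - e * t1"
    have h: "0 \<le> h" "h \<le> Tf" using le t0 t1 unfolding h_def by auto
    have e: "\<bar>e\<bar> \<le> Ce" unfolding e_def by (rule bE[OF t0])
    let ?S = "{t0..t1}"
    have S: "?S \<subseteq> {0..Tf}" using t0 t1 by auto
    let ?H' = "\<lambda>s. (relax s (x0 + v * s) (v0 + e * s) - (v0 + e * s) * fx s (x0 + v * s) (v0 + e * s)
        - E s (x0 + v * s) * fv s (x0 + v * s) (v0 + e * s))
        + (v * fx s (x0 + v * s) (v0 + e * s) + e * fv s (x0 + v * s) (v0 + e * s)) - relax t1 x v"
    have der: "((\<lambda>s. f s (x0 + v * s) (v0 + e * s) - s * relax t1 x v) has_real_derivative ?H' s) (at s within ?S)"
      if s: "s \<in> ?S" for s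
    proof -
      have s': "s \<in> {0..Tf}" using s S by auto
      have "((\<lambda>s. f s (x0 + v * s) (v0 + e * s)) has_real_derivative
         (relax s (x0 + v * s) (v0 + e * s) - (v0 + e * s) * fx s (x0 + v * s) (v0 + e * s)
        - E s (x0 + v * s) * fv s (x0 + v * s) (v0 + e * s))
        + (v * fx s (x0 + v * s) (v0 + e * s) + e * fv s (x0 + v * s) (v0 + e * s))) (at s within {0..Tf})"
        by (rule line_derivative[OF Dt[OF s'] s' Dx Dv cx cv])
      then have "((\<lambda>s. f s (x0 + v * s) (v0 + e * s)) has_real_derivative
         (relax s (x0 + v * s) (v0 + e * s) - (v0 + e * s) * fx s (x0 + v * s) (v0 + e * s)
        - E s (x0 + v * s) * fv s (x0 + v * s) (v0 + e * s))
        + (v * fx s (x0 + v * s) (v0 + e * s) + e * fv s (x0 + v * s) (v0 + e * s))) (at s within ?S)"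
        using S by (rule DERIV_subset)
      moreover have "((\<lambda>s. s * c) has_real_derivative c) (at s within ?S)" for c
        by (auto intro!: derivative_eq_intros)
      ultimately show ?thesis by (rule DERIV_diff)
    qed
    have bound: "\<bar>?H' s\<bar> \<le> C * h * wt q v" if s: "s \<in> ?S" for s
    proof -
      define X where "X = x0 + v * s"
      define W where "W = v0 + e * s"
      have s': "s \<in> {0..Tf}" using s S by auto
      have sh: "\<bar>s - t1\<bar> \<le> h" "\<bar>s - t0\<bar> \<le> h" using s unfolding h_def by auto
      have "X - x = v * (s - t1)" unfolding X_def x0_def by (simp add: algebra_simps)
      then have Xx: "\<bar>X - x\<bar> \<le> \<bar>v\<bar> * h" using sh by (simp add: abs_mult mult_left_mono)
      have "W - v = e * (s - t1)" unfolding W_def v0_def by (simp add: algebra_simps)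
      then have Wv: "\<bar>W - v\<bar> \<le> Ce * h" using sh e Ce by (simp add: abs_mult mult_mono)
      have Ch: "Ce * h \<le> \<kappa>" unfolding \<kappa>_def using Ce h by (intro mult_left_mono) auto
      have Wk: "\<bar>W - v\<bar> \<le> \<kappa>" "\<bar>v - W\<bar> \<le> \<kappa>" using Wv Ch by auto
      have wW: "wt (q + 2) W \<le> w * wt (q + 2) v"
        unfolding w_def by (rule wt_shift[OF Wk(2)]) (use q in auto)
      have w1: "wt (q + 2) v \<le> wt (q + 1) v" "wt (q + 1) v \<le> wt q v" "wt (q + 2) v \<le> wt q v" using wt_q by auto
      have av: "\<bar>v\<bar> * wt (q + 2) v \<le> wt (q + 1) v" using abs_wt_1(1)[of v "q + 1"] by (simp add: add.assoc)
      have ff: "\<bar>f s X W - f t1 x v\<bar> \<le> Cf * h * wt q v"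
      proof -
        have "\<bar>f s X W - f s x W\<bar> \<le> B * wt (q + 2) W * \<bar>X - x\<bar>" by (rule x_Lipschitz[OF s'])
        also have "\<dots> \<le> B * (w * wt (q + 2) v) * (\<bar>v\<bar> * h)"
          using wW Xx B w by (intro mult_mono mult_left_mono) auto
        also have "\<dots> = B * w * h * (\<bar>v\<bar> * wt (q + 2) v)" by (simp only: mult_ac)
        also have "\<dots> \<le> B * w * h * wt q v" using av w1 B w h by (intro mult_left_mono) auto
        finally have 1: "\<bar>f s X W - f s x W\<bar> \<le> B * w * h * wt q v" .
        have "\<bar>f s x W - f s x v\<bar> \<le> B * w * wt (q + 2) v * \<bar>W - v\<bar>"
          unfolding w_def by (rule v_Lipschitz[OF s' Wk(1)])
        also have "\<dots> \<le> B * w * wt q v * (Ce * h)" using Wv w1 B w Ce h by (intro mult_mono) auto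
        finally have 2: "\<bar>f s x W - f s x v\<bar> \<le> B * w * wt q v * (Ce * h)" .
        have "\<bar>f s x v - f t1 x v\<bar> \<le> Lt * \<bar>s - t1\<bar> * wt (q + 1) v" by (rule Lt(2)[OF s' t1])
        also have "\<dots> \<le> Lt * h * wt q v" using Lt(1) sh w1 h by (intro mult_mono) auto
        finally have 3: "\<bar>f s x v - f t1 x v\<bar> \<le> Lt * h * wt q v" .
        have "\<bar>f s X W - f t1 x v\<bar> \<le> B * w * h * wt q v + B * w * wt q v * (Ce * h) + Lt * h * wt q v"
          using 1 2 3 by linarith
        also have "\<dots> = Cf * h * wt q v" unfolding Cf_def by (simp add: algebra_simps)
        finally show ?thesis .
      qed
      have MM: "\<bar>local_maxwellian (f s) X W - local_maxwellian (f t1) x v\<bar> \<le> CMx * h * wt q v"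
      proof -
        have mk: "\<bar>mom k t1 x - mom k s X\<bar> \<le> Lm * (h * (1 + \<bar>v\<bar>))" if "k \<le> 2" for k
        proof -
          have "\<bar>mom k s X - mom k t1 x\<bar> \<le> Lm * (\<bar>s - t1\<bar> + \<bar>X - x\<bar>)" by (rule Lm(2)[OF s' t1 that])
          also have "\<dots> \<le> Lm * (h * (1 + \<bar>v\<bar>))"
            using sh Xx Lm(1) by (intro mult_left_mono) (auto simp: algebra_simps)
          finally show ?thesis by (simp add: abs_minus_commute)
        qed
        have "\<bar>local_maxwellian (f t1) x v - local_maxwellian (f s) X W\<bar>
          \<le> LM * (\<bar>mom 0 t1 x - mom 0 s X\<bar> + \<bar>mom 1 t1 x - mom 1 s X\<bar> + \<bar>mom 2 t1 x - mom 2 s X\<bar> + \<bar>v - W\<bar>) * wt (q + 1) v"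
          unfolding local_maxwellian_mxw[OF s'] local_maxwellian_mxw[OF t1]
          by (rule LM(2)[OF mom_in_region[OF t1] mom_in_region[OF s'] Wk(2)]) auto
        also have "\<dots> \<le> LM * ((3 * Lm + Ce) * (h * (1 + \<bar>v\<bar>))) * wt (q + 1) v"
        proof (intro mult_right_mono mult_left_mono)
          have "Ce * h \<le> Ce * (h * (1 + \<bar>v\<bar>))" using Ce h by (intro mult_left_mono) (auto simp: mult_le_cancel_left1)
          then show "\<bar>mom 0 t1 x - mom 0 s X\<bar> + \<bar>mom 1 t1 x - mom 1 s X\<bar> + \<bar>mom 2 t1 x - mom 2 s X\<bar> + \<bar>v - W\<bar>
             \<le> (3 * Lm + Ce) * (h * (1 + \<bar>v\<bar>))"
            using mk[of 0] mk[of 1] mk[of 2] Wv abs_minus_commute[of v W] by (simp only: distrib_right) linarith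
        qed (use LM in auto)
        also have "\<dots> = CMx * h * ((1 + \<bar>v\<bar>) * wt (q + 1) v)" unfolding CMx_def by (simp only: mult_ac)
        finally show ?thesis by (simp only: abs_wt_1(2) abs_minus_commute[of "local_maxwellian (f s) X W"])
      qed
      have RR: "\<bar>relax s X W - relax t1 x v\<bar> \<le> 1 / \<epsilon> * (CMx + Cf) * h * wt q v"
      proof -
        have "relax s X W - relax t1 x v = 1 / \<epsilon> * ((local_maxwellian (f s) X W - local_maxwellian (f t1) x v)
            - (f s X W - f t1 x v))" by (simp add: diff_divide_distrib)
        then have "\<bar>relax s X W - relax t1 x v\<bar> = 1 / \<epsilon> * \<bar>(local_maxwellian (f s) X W - local_maxwellian (f t1) x v)
            - (f s X W - f t1 x v)\<bar>" using \<epsilon> by (simp add: abs_mult)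
        also have "\<dots> \<le> 1 / \<epsilon> * (CMx * h * wt q v + Cf * h * wt q v)"
          using ff MM \<epsilon> by (intro mult_left_mono) auto
        finally show ?thesis by (simp add: algebra_simps add_divide_distrib)
      qed
      have bx: "\<bar>fx s X W\<bar> \<le> B * w * wt (q + 2) v" "\<bar>fv s X W\<bar> \<le> B * w * wt (q + 2) v"
        using bfx[OF s', of X W] bfv[OF s', of X W] mult_left_mono[OF wW B] by (auto simp: mult.assoc)
      have VX: "\<bar>(v - W) * fx s X W\<bar> \<le> Ce * (B * w) * h * wt q v"
      proof -
        have "\<bar>(v - W) * fx s X W\<bar> \<le> (Ce * h) * (B * w * wt (q + 2) v)"
          unfolding abs_mult using Wv bx abs_minus_commute[of v W] Ce h by (intro mult_mono) auto
        also have "\<dots> \<le> (Ce * h) * (B * w * wt q v)" using w1 B w Ce h by (intro mult_left_mono) auto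
        finally show ?thesis by (simp only: mult_ac)
      qed
      have EX: "\<bar>(e - E s X) * fv s X W\<bar> \<le> LE * (B * w) * h * wt q v"
      proof -
        have "\<bar>E s X - E t0 x\<bar> \<le> LE * (\<bar>s - t0\<bar> + \<bar>X - x\<bar>)" by (rule LE(2)[OF s' t0 x])
        also have "\<dots> \<le> LE * (h * (1 + \<bar>v\<bar>))" using sh Xx LE(1) by (intro mult_left_mono) (auto simp: algebra_simps)
        finally have "\<bar>e - E s X\<bar> \<le> LE * (h * (1 + \<bar>v\<bar>))" unfolding e_def by (simp add: abs_minus_commute)
        then have "\<bar>(e - E s X) * fv s X W\<bar> \<le> (LE * (h * (1 + \<bar>v\<bar>))) * (B * w * wt (q + 2) v)"
          unfolding abs_mult using bx LE h by (intro mult_mono) auto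
        also have "\<dots> = LE * (B * w) * h * ((1 + \<bar>v\<bar>) * wt (q + 1 + 1) v)" by (simp add: mult_ac add.assoc)
        also have "\<dots> \<le> LE * (B * w) * h * wt q v"
          unfolding abs_wt_1(2) using w1 LE B w h by (intro mult_left_mono) auto
        finally show ?thesis .
      qed
      have "?H' s = (relax s X W - relax t1 x v) + (v - W) * fx s X W + (e - E s X) * fv s X W"
        unfolding X_def[symmetric] W_def[symmetric] by (simp only: left_diff_distrib)
      then have "\<bar>?H' s\<bar> \<le> 1 / \<epsilon> * (CMx + Cf) * h * wt q v + Ce * (B * w) * h * wt q v + LE * (B * w) * h * wt q v"
        using RR VX EX by linarith
      also have "\<dots> = C * h * wt q v" unfolding C_def by (simp only: distrib_right)
      finally show ?thesis .
    qed
    have "norm ((f t1 (x0 + v * t1) (v0 + e * t1) - t1 * relax t1 x v) - (f t0 (x0 + v * t0) (v0 + e * t0) - t0 * relax t1 x v))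
      \<le> C * h * wt q v * norm (t1 - t0)"
      by (rule field_differentiable_bound[of ?S _ ?H', OF _ der]) (use bound le in auto)
    moreover have "x0 + v * t1 = x" "v0 + e * t1 = v" "x0 + v * t0 = x - v * h" "v0 + e * t0 = v - e * h" "norm (t1 - t0) = h"
      unfolding x0_def v0_def h_def using le by (auto simp: algebra_simps)
    ultimately have n: "\<bar>(f t1 x v - t1 * relax t1 x v) - (f t0 (x - v * h) (v - e * h) - t0 * relax t1 x v)\<bar> \<le> C * h * wt q v * h"
      by (simp only: real_norm_def)
    have "a - b - h * R = (a - t1 * R) - (b - t0 * R)" for a b R
      unfolding h_def by (simp add: algebra_simps)
    then have "\<bar>f t1 x v - f t0 (x - v * h) (v - e * h) - h * relax t1 x v\<bar> \<le> C * h * wt q v * h"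
      using n by (simp only:)
    then show "\<bar>f t1 x v - f t0 (x - v * (t1 - t0)) (v - E t0 x * (t1 - t0)) - (t1 - t0) * relax t1 x v\<bar>
      \<le> C * (t1 - t0)\<^sup>2 * wt q v"
      unfolding h_def e_def by (simp add: power2_eq_square mult_ac)
  qed
qed

end

section \<open>Consistency of the upwind step and of the moments\<close>

lemma abs_le_three_terms:
  fixes a b c :: real
  assumes "\<bar>a\<bar> \<le> r1" "\<bar>b\<bar> \<le> r2" "\<bar>c\<bar> \<le> r3"
  shows "\<bar>a - b + c\<bar> \<le> r1 + r2 + r3" "\<bar>y + a + b - z\<bar> \<le> r1 + r2 + \<bar>z - y\<bar>"
  using assms by linarith+

lemma Taylor2:
  fixes g g' g'' :: "real \<Rightarrow> real"
  assumes d1: "\<And>z. z \<in> cball x \<kappa> \<Longrightarrow> (g has_real_derivative g' z) (at z)"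
    and d2: "\<And>z. z \<in> cball x \<kappa> \<Longrightarrow> (g' has_real_derivative g'' z) (at z)"
    and b: "\<And>z. z \<in> cball x \<kappa> \<Longrightarrow> \<bar>g'' z\<bar> \<le> M" and h: "\<bar>h\<bar> \<le> \<kappa>"
  shows "\<bar>g (x + h) - g x - h * g' x\<bar> \<le> M * h\<^sup>2"
proof -
  have M: "0 \<le> M" using b[of x] h by (simp add: order_trans[OF abs_ge_zero])
  let ?S = "cball x \<bar>h\<bar>"
  have S: "?S \<subseteq> cball x \<kappa>" using h by auto
  have lip: "\<bar>g' z - g' x\<bar> \<le> M * \<bar>h\<bar>" if z: "z \<in> ?S" for z
  proof -
    have "norm (g' z - g' x) \<le> M * norm (z - x)"
    proof (rule field_differentiable_bound[of ?S g' g''])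
      fix y assume "y \<in> ?S"
      then have y: "y \<in> cball x \<kappa>" using S by blast
      show "(g' has_real_derivative g'' y) (at y within ?S)" by (rule has_field_derivative_at_within[OF d2[OF y]])
      show "norm (g'' y) \<le> M" using b[OF y] by simp
    qed (use z in simp_all)
    also have "\<dots> \<le> M * \<bar>h\<bar>" using z M by (intro mult_left_mono) (auto simp: dist_real_def)
    finally show ?thesis by simp
  qed
  have "norm ((g (x + h) - g' x * (x + h)) - (g x - g' x * x)) \<le> M * \<bar>h\<bar> * norm (x + h - x)"
  proof (rule field_differentiable_bound[of ?S "\<lambda>z. g z - g' x * z" "\<lambda>z. g' z - g' x"])
    fix z assume z: "z \<in> ?S"
    then have "z \<in> cball x \<kappa>" using S by blast
    from has_field_derivative_at_within[OF d1[OF this]]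
    have "(g has_real_derivative g' z) (at z within ?S)" .
    then show "((\<lambda>z. g z - g' x * z) has_real_derivative g' z - g' x) (at z within ?S)"
      by (auto intro!: derivative_eq_intros)
    show "norm (g' z - g' x) \<le> M * \<bar>h\<bar>" using lip[OF z] by simp
  qed (auto simp: dist_real_def)
  then show ?thesis by (simp add: algebra_simps power2_eq_square)
qed

context vp_solution
begin

lemma x_Taylor: "t \<in> {0..Tf} \<Longrightarrow> \<bar>f t (x + h) v - f t x v - h * fx t x v\<bar> \<le> B * wt (q + 2) v * h\<^sup>2"
  by (rule Taylor2[where \<kappa> = "\<bar>h\<bar>" and g = "\<lambda>x. f t x v" and g' = "\<lambda>x. fx t x v" and g'' = "\<lambda>x. fxx t x v"])
    (use Dx Dxx bfxx in auto)

lemma v_Taylor: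
  assumes t: "t \<in> {0..Tf}" and h: "\<bar>h\<bar> \<le> \<kappa>"
  shows "\<bar>f t x (v + h) - f t x v - h * fv t x v\<bar> \<le> B * (1 + \<kappa>) powr (q + 2) * wt (q + 2) v * h\<^sup>2"
proof (rule Taylor2[where \<kappa> = \<kappa> and g = "\<lambda>v. f t x v" and g' = "\<lambda>v. fv t x v" and g'' = "\<lambda>v. fvv t x v"])
  fix z assume z: "z \<in> cball v \<kappa>"
  have "\<bar>fvv t x z\<bar> \<le> B * wt (q + 2) z" by (rule bfvv[OF t])
  also have "\<dots> \<le> B * ((1 + \<kappa>) powr (q + 2) * wt (q + 2) v)"
    using z q B by (intro mult_left_mono wt_shift) (auto simp: dist_real_def)
  finally show "\<bar>fvv t x z\<bar> \<le> B * (1 + \<kappa>) powr (q + 2) * wt (q + 2) v" by (simp add: mult.assoc)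
qed (use Dv[OF t] Dvv[OF t] h in auto)

lemma fv_x_Lipschitz: "t \<in> {0..Tf} \<Longrightarrow> \<bar>fv t y v - fv t x v\<bar> \<le> B * wt (q + 2) v * \<bar>y - x\<bar>"
  using field_differentiable_bound[of UNIV "\<lambda>y. fv t y v" "\<lambda>x. fvx t x v" "B * wt (q + 2) v" y x] Dvx bfvx by simp

lemma wt_2_absorb: "v\<^sup>2 * wt (q + 2) v \<le> wt q v"
  using abs_wt_absorb[of v 2 q] by simp

text \<open>The expansion is made first in velocity and then in space, so that the mixed derivative that
  appears is \<open>fvx\<close>. The displacement \<open>v * h\<close> enters squared, which uses up the two spare powers of
  the weight.\<close>

lemma shift_expansion:
  obtains C where "0 \<le> C" "\<And>t x v h e. t \<in> {0..Tf} \<Longrightarrow> 0 \<le> h \<Longrightarrow> h \<le> 1 \<Longrightarrow> \<bar>e\<bar> \<le> Ce \<Longrightarrow>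
    \<bar>f t (x - v * h) (v - e * h) - (f t x v - h * (v * fx t x v + e * fv t x v))\<bar> \<le> C * h\<^sup>2 * wt q v"
proof -
  define w where "w = (1 + Ce) powr (q + 2)"
  define C where "C = B * w * Ce\<^sup>2 + B * Ce + B"
  have w: "0 \<le> w" by (simp add: w_def)
  show thesis
  proof (rule that[of C])
    show "0 \<le> C" unfolding C_def using B w Ce by simp
    fix t x v h e :: real
    assume t: "t \<in> {0..Tf}" and h: "0 \<le> h" "h \<le> 1" and e: "\<bar>e\<bar> \<le> Ce"
    have eh: "\<bar>e * h\<bar> \<le> Ce * h" using e h by (simp add: abs_mult mult_right_mono)
    \<comment> \<open>The displacement in velocity is at most Ce, which fixes the constant in the comparison of weights.\<close>
    have eh1: "\<bar>- (e * h)\<bar> \<le> Ce"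
      using eh mult_left_mono[OF h(2) Ce] by simp
    have w1: "wt (q + 2) v \<le> wt (q + 1) v" "wt (q + 1) v \<le> wt q v" "wt (q + 2) v \<le> wt q v" using wt_q by auto
    have 1: "\<bar>f t (x - v * h) (v - e * h) - f t (x - v * h) v + e * h * fv t (x - v * h) v\<bar> \<le> B * w * Ce\<^sup>2 * h\<^sup>2 * wt q v"
    proof -
      have "\<bar>f t (x - v * h) (v + - (e * h)) - f t (x - v * h) v - - (e * h) * fv t (x - v * h) v\<bar>
         \<le> B * w * wt (q + 2) v * (- (e * h))\<^sup>2"
        unfolding w_def by (rule v_Taylor[OF t eh1])
      also have "\<dots> \<le> B * w * wt q v * (Ce * h)\<^sup>2"
        using eh w1 B w power_mono[of "\<bar>e * h\<bar>" "Ce * h" 2] by (intro mult_mono) auto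
      finally show ?thesis by (simp add: power_mult_distrib mult_ac)
    qed
    have 2: "\<bar>e * h * fv t (x - v * h) v - e * h * fv t x v\<bar> \<le> B * Ce * h\<^sup>2 * wt q v"
    proof -
      have "\<bar>fv t (x - v * h) v - fv t x v\<bar> \<le> B * wt (q + 2) v * \<bar>x - v * h - x\<bar>" by (rule fv_x_Lipschitz[OF t])
      also have "\<dots> = B * h * (\<bar>v\<bar> * wt (q + 1 + 1) v)" using h by (simp add: abs_mult add.assoc)
      also have "\<dots> \<le> B * h * wt q v"
        using abs_wt_1(1)[of v "q + 1"] w1 B h by (intro mult_left_mono) auto
      finally have a: "\<bar>fv t (x - v * h) v - fv t x v\<bar> \<le> B * h * wt q v" .
      have "\<bar>e * h * fv t (x - v * h) v - e * h * fv t x v\<bar> = \<bar>e * h\<bar> * \<bar>fv t (x - v * h) v - fv t x v\<bar>"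
        by (simp only: right_diff_distrib[symmetric] abs_mult)
      also have "\<dots> \<le> (Ce * h) * (B * h * wt q v)" using a eh Ce h by (intro mult_mono) auto
      finally show ?thesis by (simp add: power2_eq_square mult_ac)
    qed
    have 3: "\<bar>f t (x - v * h) v - f t x v + h * v * fx t x v\<bar> \<le> B * h\<^sup>2 * wt q v"
    proof -
      have "\<bar>f t (x + - (v * h)) v - f t x v - - (v * h) * fx t x v\<bar> \<le> B * wt (q + 2) v * (- (v * h))\<^sup>2"
        by (rule x_Taylor[OF t])
      also have "\<dots> = B * h\<^sup>2 * (v\<^sup>2 * wt (q + 2) v)" by (simp add: power_mult_distrib mult_ac)
      also have "\<dots> \<le> B * h\<^sup>2 * wt q v" using wt_2_absorb B by (intro mult_left_mono) auto
      finally show ?thesis by (simp add: mult_ac)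
    qed
    have "\<bar>f t (x - v * h) (v - e * h) - (f t x v - h * (v * fx t x v + e * fv t x v))\<bar>
      \<le> B * w * Ce\<^sup>2 * h\<^sup>2 * wt q v + B * Ce * h\<^sup>2 * wt q v + B * h\<^sup>2 * wt q v"
    proof -
      have eq: "f t (x - v * h) (v - e * h) - (f t x v - h * (v * fx t x v + e * fv t x v))
        = (f t (x - v * h) (v - e * h) - f t (x - v * h) v + e * h * fv t (x - v * h) v)
          - (e * h * fv t (x - v * h) v - e * h * fv t x v) + (f t (x - v * h) v - f t x v + h * v * fx t x v)"
        by (simp add: algebra_simps)
      show ?thesis unfolding eq by (rule abs_le_three_terms(1)[OF 1 2 3])
    qed
    also have "\<dots> = C * h\<^sup>2 * wt q v" unfolding C_def by (simp add: algebra_simps)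
    finally show "\<bar>f t (x - v * h) (v - e * h) - (f t x v - h * (v * fx t x v + e * fv t x v))\<bar> \<le> C * h\<^sup>2 * wt q v" .
  qed
qed

abbreviation "grid m t \<equiv> (\<lambda>i j. f t (xpt m i) (vpt m j))"

lemma grid_west_east:
  assumes t: "t \<in> {0..Tf}" and i: "i \<in> xidx m" and N: "real (Nx m) * Dx m = 1"
  shows "f t (xpt m (west m i)) v = f t (xpt m i - Dx m) v" "f t (xpt m (east m i)) v = f t (xpt m i + Dx m) v"
proof -
  show "f t (xpt m (west m i)) v = f t (xpt m i - Dx m) v"
  proof (cases "i = 0")
    case True
    have "0 < int (Nx m)" using i by (auto simp: xidx_def)
    then have "west m i = int (Nx m) - 1" unfolding True west_def
      by (simp add: zmod_minus1)
    then have "xpt m (west m i) = (xpt m i - Dx m) + 1" unfolding True xpt_def using N by (simp add: left_diff_distrib)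
    then show ?thesis using per[OF t, of "xpt m i - Dx m" v] by simp
  next
    case False
    then have "west m i = i - 1" using i by (simp add: west_def xidx_def)
    then show ?thesis by (simp add: xpt_def left_diff_distrib)
  qed
  show "f t (xpt m (east m i)) v = f t (xpt m i + Dx m) v"
  proof (cases "i = int (Nx m) - 1")
    case True
    then have "east m i = 0" by (simp add: east_def)
    moreover have "xpt m i + Dx m = 0 + 1" unfolding True xpt_def using N by (simp add: left_diff_distrib)
    ultimately show ?thesis using per[OF t, of 0 v] by (simp add: xpt_def)
  next
    case False
    then have "east m i = i + 1" using i by (simp add: east_def xidx_def)
    then show ?thesis by (simp add: xpt_def distrib_right)
  qed
qed

text \<open>At the two ends of the velocity range the ghost value makes the difference vanish, and the error
  is the derivative itself. There the two spare powers of the weight give the factor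
  \<open>(1 + V) powr - 2 \<le> Dv\<close>.\<close>

lemma grid_v_difference:
  assumes t: "t \<in> {0..Tf}" and j: "j \<in> vidx m" and d: "0 < Dv m" "Dv m \<le> 1"
    and V: "phase_mesh V m" "(1 + V) powr (- 2) \<le> Dv m" and s: "s = 1 \<or> s = -1"
  shows "\<bar>f t x (vpt m (clampv m (j + s))) - f t x (vpt m j) - real_of_int s * Dv m * fv t x (vpt m j)\<bar>
    \<le> B * 2 powr (q + 2) * (Dv m)\<^sup>2 * wt q (vpt m j)"
proof (cases "j + s \<in> vidx m")
  case True
  let ?v = "vpt m j"
  have "clampv m (j + s) = j + s" using True by (simp add: clampv_def vidx_def)
  then have c: "vpt m (clampv m (j + s)) = ?v + real_of_int s * Dv m" by (simp add: vpt_def distrib_right)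
  have "\<bar>f t x (?v + real_of_int s * Dv m) - f t x ?v - real_of_int s * Dv m * fv t x ?v\<bar>
    \<le> B * (1 + 1) powr (q + 2) * wt (q + 2) ?v * (real_of_int s * Dv m)\<^sup>2"
    by (rule v_Taylor[OF t]) (use s d in auto)
  also have "\<dots> = B * 2 powr (q + 2) * (Dv m)\<^sup>2 * wt (q + 2) ?v" using s by (auto simp: power_mult_distrib)
  also have "\<dots> \<le> B * 2 powr (q + 2) * (Dv m)\<^sup>2 * wt q ?v" using wt_q(3) B by (intro mult_left_mono) auto
  finally show ?thesis unfolding c .
next
  case False
  let ?v = "vpt m j"
  have jN: "\<bar>j\<bar> = int (Nv m)" and c: "clampv m (j + s) = j"
    using False j s by (auto simp: vidx_def clampv_def)
  have "real_of_int \<bar>j\<bar> * Dv m = V" using jN V by (simp add: phase_mesh_def)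
  then have v: "\<bar>?v\<bar> = V" using d by (simp add: vpt_def abs_mult)
  have "\<bar>fv t x ?v\<bar> \<le> B * wt (q + 2) ?v" by (rule bfv[OF t])
  also have "\<dots> = B * (wt q ?v * (1 + V) powr (- 2))" unfolding wt_add by (simp add: wt_def v)
  also have "\<dots> \<le> B * (wt q ?v * Dv m)" using V B by (intro mult_left_mono) auto
  finally have "Dv m * \<bar>fv t x ?v\<bar> \<le> Dv m * (B * (wt q ?v * Dv m))" using d by (intro mult_left_mono) auto
  also have "\<dots> = 1 * (B * (Dv m)\<^sup>2 * wt q ?v)" by (simp add: power2_eq_square mult_ac)
  also have "\<dots> \<le> 2 powr (q + 2) * (B * (Dv m)\<^sup>2 * wt q ?v)"
    using B q by (intro mult_right_mono ge_one_powr_ge_zero) auto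
  finally have "Dv m * \<bar>fv t x ?v\<bar> \<le> B * 2 powr (q + 2) * (Dv m)\<^sup>2 * wt q ?v" by (simp only: mult_ac)
  then show ?thesis unfolding c using s d by (auto simp: abs_mult)
qed

text \<open>Both the upwind step and the shift along the line equal
  \<open>f - Dt * (v * fx + e * fv)\<close> up to the order claimed.\<close>

lemma upwind_consistency:
  obtains C where "0 \<le> C" "\<And>m V t i j. t \<in> {0..Tf} \<Longrightarrow> phase_mesh V m \<Longrightarrow> (1 + V) powr (- 2) \<le> Dv m \<Longrightarrow>
     Dv m \<le> 1 \<Longrightarrow> 0 \<le> Dt m \<Longrightarrow> Dt m \<le> 1 \<Longrightarrow> i \<in> xidx m \<Longrightarrow> j \<in> vidx m \<Longrightarrow>
    \<bar>upwind m (\<lambda>i. E t (xpt m i)) (grid m t) i j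
      - f t (xpt m i - vpt m j * Dt m) (vpt m j - E t (xpt m i) * Dt m)\<bar>
      \<le> C * Dt m * (Dx m + Dv m + Dt m) * wt q (vpt m j)"
proof -
  obtain C1 where C1: "0 \<le> C1" "\<And>t x v h e. t \<in> {0..Tf} \<Longrightarrow> 0 \<le> h \<Longrightarrow> h \<le> 1 \<Longrightarrow> \<bar>e\<bar> \<le> Ce \<Longrightarrow>
    \<bar>f t (x - v * h) (v - e * h) - (f t x v - h * (v * fx t x v + e * fv t x v))\<bar> \<le> C1 * h\<^sup>2 * wt q v"
    using shift_expansion by blast
  define w where "w = B * 2 powr (q + 2)"
  define C where "C = B + Ce * w + C1"
  have w: "0 \<le> w" unfolding w_def using B by simp
  have C: "0 \<le> C" "B \<le> C" "Ce * w \<le> C" "C1 \<le> C" unfolding C_def using B Ce w C1 by auto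
  show thesis
  proof (rule that[OF C(1)])
    fix m :: mesh and V t :: real and i j :: int
    assume t: "t \<in> {0..Tf}" and mesh: "phase_mesh V m" and V: "(1 + V) powr (- 2) \<le> Dv m" and d1: "Dv m \<le> 1"
      and dt: "0 \<le> Dt m" "Dt m \<le> 1" and ij: "i \<in> xidx m" "j \<in> vidx m"
    have d: "0 < Dv m" "0 < Dx m" and N: "real (Nx m) * Dx m = 1" using mesh by (auto simp: phase_mesh_def)
    let ?x = "xpt m i" and ?v = "vpt m j" and ?a = "Dt m / Dx m" and ?b = "Dt m / Dv m"
    define e where "e = E t ?x"
    have e: "\<bar>e\<bar> \<le> Ce" unfolding e_def by (rule bE[OF t])
    let ?f = "f t ?x ?v"
    define rw where "rw = f t (?x - Dx m) ?v - ?f + Dx m * fx t ?x ?v"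
    define re where "re = f t (?x + Dx m) ?v - ?f - Dx m * fx t ?x ?v"
    define rd where "rd = f t ?x (vpt m (clampv m (j - 1))) - ?f + Dv m * fv t ?x ?v"
    define ru where "ru = f t ?x (vpt m (clampv m (j + 1))) - ?f - Dv m * fv t ?x ?v"
    have rx: "\<bar>rw\<bar> \<le> B * wt (q + 2) ?v * (Dx m)\<^sup>2" "\<bar>re\<bar> \<le> B * wt (q + 2) ?v * (Dx m)\<^sup>2"
      using x_Taylor[OF t, of ?x "- Dx m" ?v] x_Taylor[OF t, of ?x "Dx m" ?v] unfolding rw_def re_def by auto
    have rv: "\<bar>rd\<bar> \<le> w * (Dv m)\<^sup>2 * wt q ?v" "\<bar>ru\<bar> \<le> w * (Dv m)\<^sup>2 * wt q ?v"
      using grid_v_difference[OF t ij(2) d(1) d1 mesh V, of "-1" ?x] grid_v_difference[OF t ij(2) d(1) d1 mesh V, of 1 ?x]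
      unfolding rd_def ru_def w_def by auto
    have u: "upwind m (\<lambda>i. E t (xpt m i)) (grid m t) i j = ?f - Dt m * (?v * fx t ?x ?v + e * fv t ?x ?v)
       + ?a * (pos_part ?v * rw + neg_part ?v * re) + ?b * (pos_part e * rd + neg_part e * ru)"
    proof -
      have "upwind m (\<lambda>i. E t (xpt m i)) (grid m t) i j = (1 - ?a * \<bar>?v\<bar> - ?b * \<bar>e\<bar>) * ?f
        + ?a * (pos_part ?v * (?f - Dx m * fx t ?x ?v + rw) + neg_part ?v * (?f + Dx m * fx t ?x ?v + re))
        + ?b * (pos_part e * (?f - Dv m * fv t ?x ?v + rd) + neg_part e * (?f + Dv m * fv t ?x ?v + ru))"
        unfolding upwind_eq[OF ij] grid_west_east[OF t ij(1) N] e_def[symmetric]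
        by (simp add: rw_def re_def rd_def ru_def)
      also have "\<dots> = ?f - (?a * Dx m) * ((pos_part ?v - neg_part ?v) * fx t ?x ?v)
        - (?b * Dv m) * ((pos_part e - neg_part e) * fv t ?x ?v)
        + ?a * (pos_part ?v * rw + neg_part ?v * re) + ?b * (pos_part e * rd + neg_part e * ru)"
        unfolding abs_parts by (simp add: algebra_simps add_divide_distrib diff_divide_distrib)
      also have "pos_part ?v - neg_part ?v = ?v" by (auto simp: pos_part_def neg_part_def)
      also have "pos_part e - neg_part e = e" by (auto simp: pos_part_def neg_part_def)
      also have "?a * Dx m = Dt m" using d by simp
      also have "?b * Dv m = Dt m" using d by simp
      finally show ?thesis by (simp add: distrib_left)
    qed
    have part: "\<bar>pos_part a * r1 + neg_part a * r2\<bar> \<le> \<bar>a\<bar> * r" if "\<bar>r1\<bar> \<le> r" "\<bar>r2\<bar> \<le> r" for a r1 r2 r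
    proof -
      have "\<bar>pos_part a * r1 + neg_part a * r2\<bar> \<le> pos_part a * \<bar>r1\<bar> + neg_part a * \<bar>r2\<bar>"
        using abs_triangle_ineq[of "pos_part a * r1" "neg_part a * r2"] by (simp add: abs_mult)
      also have "\<dots> \<le> pos_part a * r + neg_part a * r" using that by (intro add_mono mult_left_mono) auto
      finally show ?thesis by (simp add: abs_parts distrib_right)
    qed
    have X: "\<bar>?a * (pos_part ?v * rw + neg_part ?v * re)\<bar> \<le> B * Dt m * Dx m * wt q ?v"
    proof -
      have "\<bar>?a * (pos_part ?v * rw + neg_part ?v * re)\<bar> \<le> ?a * (\<bar>?v\<bar> * (B * wt (q + 2) ?v * (Dx m)\<^sup>2))"
        unfolding abs_mult[of ?a] using part[OF rx, of ?v] dt d by (intro mult_mono) auto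
      also have "\<dots> = B * Dt m * Dx m * (\<bar>?v\<bar> * wt (q + 1 + 1) ?v)" using d by (simp add: power2_eq_square add.assoc)
      also have "\<dots> \<le> B * Dt m * Dx m * wt q ?v"
        using abs_wt_1(1)[of ?v "q + 1"] wt_q(2)[of ?v] B dt d by (intro mult_left_mono) auto
      finally show ?thesis .
    qed
    have Y: "\<bar>?b * (pos_part e * rd + neg_part e * ru)\<bar> \<le> Ce * w * Dt m * Dv m * wt q ?v"
    proof -
      have "\<bar>?b * (pos_part e * rd + neg_part e * ru)\<bar> \<le> ?b * (\<bar>e\<bar> * (w * (Dv m)\<^sup>2 * wt q ?v))"
        unfolding abs_mult[of ?b] using part[OF rv, of e] dt d by (intro mult_mono) auto
      also have "\<dots> \<le> ?b * (Ce * (w * (Dv m)\<^sup>2 * wt q ?v))"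
        using e w dt d by (intro mult_left_mono mult_right_mono) auto
      also have "\<dots> = Ce * w * Dt m * Dv m * wt q ?v" using d by (simp add: power2_eq_square)
      finally show ?thesis .
    qed
    have Z: "\<bar>f t (?x - ?v * Dt m) (?v - e * Dt m) - (?f - Dt m * (?v * fx t ?x ?v + e * fv t ?x ?v))\<bar>
        \<le> C1 * (Dt m)\<^sup>2 * wt q ?v" by (rule C1(2)[OF t dt e])
    have "\<bar>upwind m (\<lambda>i. E t (xpt m i)) (grid m t) i j - f t (?x - ?v * Dt m) (?v - e * Dt m)\<bar>
      \<le> B * Dt m * Dx m * wt q ?v + Ce * w * Dt m * Dv m * wt q ?v + C1 * (Dt m)\<^sup>2 * wt q ?v"
      unfolding u by (rule order_trans[OF abs_le_three_terms(2)[OF X Y order_refl] add_left_mono[OF Z]])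
    also have "\<dots> = (B * Dx m + Ce * w * Dv m + C1 * Dt m) * (Dt m * wt q ?v)"
      by (simp add: algebra_simps power2_eq_square)
    also have "\<dots> \<le> (C * Dx m + C * Dv m + C * Dt m) * (Dt m * wt q ?v)"
      using C d dt by (intro mult_right_mono add_mono) auto
    also have "\<dots> = C * Dt m * (Dx m + Dv m + Dt m) * wt q ?v" by (simp add: algebra_simps)
    finally show "\<bar>upwind m (\<lambda>i. E t (xpt m i)) (grid m t) i j
      - f t (xpt m i - vpt m j * Dt m) (vpt m j - E t (xpt m i) * Dt m)\<bar>
      \<le> C * Dt m * (Dx m + Dv m + Dt m) * wt q (vpt m j)" unfolding e_def .
  qed
qed

text \<open>The grid moment is the integral of a step function, which differs from the integrand by one cell
  times its derivative inside the velocity range, and by the whole integrand outside. With the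
  weight \<open>q\<close> left after multiplication by \<open>v ^ k\<close>, two powers are kept for integrability and the
  others are evaluated at \<open>V\<close>.\<close>

lemma moment_quadrature:
  obtains C where "0 \<le> C" "\<And>m V t x k. t \<in> {0..Tf} \<Longrightarrow> phase_mesh V m \<Longrightarrow> 1 \<le> V \<Longrightarrow> Dv m \<le> 1 \<Longrightarrow> k \<le> 2 \<Longrightarrow>
    \<bar>mom k t x - (\<Sum>j\<in>vidx m. f t x (vpt m j) * vpt m j ^ k * Dv m)\<bar> \<le> C * (Dv m + 1 / V powr (q - 3))"
proof -
  define C1 where "C1 = 3 * B * 2 powr q"
  have C1: "0 \<le> C1" unfolding C1_def using B by simp
  define C where "C = (C1 + B) * pi"
  show thesis
  proof (rule that[of C])
    show "0 \<le> C" unfolding C_def using C1 B by simp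
    fix m :: mesh and V t x :: real and k :: nat
    assume t: "t \<in> {0..Tf}" and mesh: "phase_mesh V m" and V: "1 \<le> V" and d1: "Dv m \<le> 1" and k: "k \<le> 2"
    let ?d = "Dv m"
    have d: "0 < ?d" and NV: "real (Nv m) * ?d = V" using mesh by (auto simp: phase_mesh_def)
    define g where "g v = v ^ k * f t x v" for v
    define g' where "g' v = real k * v ^ (k - 1) * f t x v + v ^ k * fv t x v" for v
    have pw: "\<bar>v ^ l * y\<bar> \<le> B * wt q v" if "l \<le> 2" "\<bar>y\<bar> \<le> B * wt (q + 2) v" for v y l
    proof -
      have "\<bar>v ^ l * y\<bar> \<le> \<bar>v\<bar> ^ l * (B * wt (q + real l) v)"
        unfolding abs_mult power_abs using that wt_mono[of "q + real l" "q + 2" v] B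
        by (intro mult_left_mono order_trans[OF that(2)]) auto
      also have "\<dots> = B * (\<bar>v\<bar> ^ l * wt (q + real l) v)" by simp
      also have "\<dots> \<le> B * wt q v" by (intro mult_left_mono abs_wt_absorb B)
      finally show ?thesis .
    qed
    have gb: "\<bar>g v\<bar> \<le> B * wt q v" for v unfolding g_def using k bf[OF t] by (intro pw)
    have g'b: "\<bar>g' v\<bar> \<le> 3 * B * wt q v" for v
    proof -
      have "\<bar>v ^ (k - 1) * f t x v\<bar> \<le> B * wt q v" "\<bar>v ^ k * fv t x v\<bar> \<le> B * wt q v"
        using k bf[OF t, of x v] bfv[OF t, of x v] by (auto intro!: pw)
      moreover have "\<bar>real k * v ^ (k - 1) * f t x v\<bar> \<le> 2 * \<bar>v ^ (k - 1) * f t x v\<bar>"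
        using k by (simp add: abs_mult mult.assoc mult_right_mono)
      ultimately show ?thesis unfolding g'_def by linarith
    qed
    have gd: "(g has_real_derivative g' v) (at v)" for v
      unfolding g_def g'_def using Dv[OF t, of x v] by (auto intro!: derivative_eq_intros simp: mult_ac)
    have glip: "\<bar>g v - g u\<bar> \<le> C1 * ?d * wt q v" if "\<bar>v - u\<bar> \<le> ?d" for u v
    proof -
      have "norm (g v - g u) \<le> C1 * wt q v * norm (v - u)"
      proof (rule field_differentiable_bound[of "cball v 1" g g'])
        fix z assume z: "z \<in> cball v 1"
        show "(g has_real_derivative g' z) (at z within cball v 1)" by (rule has_field_derivative_at_within[OF gd])
        have "\<bar>g' z\<bar> \<le> 3 * B * wt q z" by (rule g'b)
        also have "\<dots> \<le> 3 * B * ((1 + 1) powr q * wt q v)"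
          using z q B by (intro mult_left_mono wt_shift) (auto simp: dist_real_def)
        finally show "norm (g' z) \<le> C1 * wt q v" unfolding C1_def by simp
      qed (use that d1 in \<open>auto simp: dist_real_def\<close>)
      also have "\<dots> \<le> C1 * wt q v * ?d" using that C1 by (intro mult_left_mono) auto
      finally show ?thesis by (simp add: mult_ac)
    qed
    let ?\<sigma> = "step_fun (vidx m) ?d g"
    have diff: "\<bar>g v - ?\<sigma> v\<bar> \<le> (C1 * ?d + B * (1 / V powr (q - 3))) * wt 2 v" for v
    proof (cases "\<lfloor>v / ?d\<rfloor> \<in> vidx m")
      case True
      have "\<bar>v - real_of_int \<lfloor>v / ?d\<rfloor> * ?d\<bar> \<le> ?d" using floor_cell[OF d, of v] by auto
      then have "\<bar>g v - ?\<sigma> v\<bar> \<le> C1 * ?d * wt q v" using True d by (simp add: step_fun_eq glip)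
      also have "\<dots> \<le> C1 * ?d * wt 2 v" using C1 d q by (intro mult_left_mono wt_mono) auto
      also have "\<dots> \<le> (C1 * ?d + B * (1 / V powr (q - 3))) * wt 2 v"
        using B by (intro mult_right_mono) auto
      finally show ?thesis .
    next
      case False
      let ?n = "\<lfloor>v / ?d\<rfloor>"
      have "V \<le> \<bar>v\<bar>"
      proof -
        consider "int (Nv m) + 1 \<le> ?n" | "?n + 1 \<le> - int (Nv m)" using False unfolding vidx_def by force
        then show ?thesis
        proof cases
          case 1
          then have "real (Nv m) * ?d \<le> real_of_int ?n * ?d" using d by (intro mult_right_mono) auto
          then show ?thesis using NV floor_cell[OF d, of v] by linarith
        next
          case 2
          then have "(real_of_int ?n + 1) * ?d \<le> (- real (Nv m)) * ?d" using d by (intro mult_right_mono) linarith+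
          then show ?thesis using NV floor_cell[OF d, of v] by (simp add: distrib_right)
        qed
      qed
      then have "wt (q - 2) v \<le> V powr (- (q - 2))" unfolding wt_def using V q by (intro powr_mono2') auto
      also have "\<dots> \<le> V powr (- (q - 3))" using V by (intro powr_mono) auto
      also have "\<dots> = 1 / V powr (q - 3)" by (rule powr_minus_divide)
      finally have wv: "wt (q - 2) v \<le> 1 / V powr (q - 3)" .
      have "\<bar>g v - ?\<sigma> v\<bar> \<le> B * wt q v" using False d gb by (simp add: step_fun_eq)
      also have "wt q v = wt (q - 2) v * wt 2 v" unfolding wt_add[symmetric] by simp
      also have "B * (wt (q - 2) v * wt 2 v) \<le> B * (1 / V powr (q - 3) * wt 2 v)"
        using wv B by (intro mult_left_mono mult_right_mono) auto
      also have "\<dots> \<le> (C1 * ?d + B * (1 / V powr (q - 3))) * wt 2 v"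
        using C1 d by (simp add: distrib_right)
      finally show ?thesis .
    qed
    have \<sigma>: "integrable lborel ?\<sigma>" "(LINT v|lborel. ?\<sigma> v) = (\<Sum>j\<in>vidx m. g (real_of_int j * ?d) * ?d)"
      by (rule step_fun_integral[OF finite_vidx d])+
    have gi: "integrable lborel g" unfolding g_def by (rule mom_bound(1)[OF t k])
    have ms: "(\<lambda>v. g v - ?\<sigma> v) \<in> borel_measurable borel"
      using borel_measurable_integrable[OF gi] borel_measurable_integrable[OF \<sigma>(1)]
      by (simp add: borel_measurable_diff)
    have "mom k t x - (\<Sum>j\<in>vidx m. f t x (vpt m j) * vpt m j ^ k * ?d) = (LINT v|lborel. g v) - (LINT v|lborel. ?\<sigma> v)"
      unfolding \<sigma>(2) mom_def g_def vpt_def by (simp add: mult_ac)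
    also have "\<dots> = (LINT v|lborel. g v - ?\<sigma> v)" using gi \<sigma>(1) by simp
    finally have "\<bar>mom k t x - (\<Sum>j\<in>vidx m. f t x (vpt m j) * vpt m j ^ k * ?d)\<bar>
       \<le> (C1 * ?d + B * (1 / V powr (q - 3))) * pi"
      using weighted_integral(2)[OF ms diff] by simp
    also have "\<dots> \<le> (C1 + B) * (?d + 1 / V powr (q - 3)) * pi"
    proof (intro mult_right_mono)
      have "a * y + b * z \<le> (a + b) * (y + z)" if "0 \<le> a" "0 \<le> b" "0 \<le> y" "0 \<le> z" for a b y z :: real
        using that by (simp add: algebra_simps add_nonneg_nonneg)
      from this[of C1 B ?d "1 / V powr (q - 3)"]
      show "C1 * ?d + B * (1 / V powr (q - 3)) \<le> (C1 + B) * (?d + 1 / V powr (q - 3))"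
        using C1 B d by (simp del: times_divide_eq_right)
    qed simp
    finally show "\<bar>mom k t x - (\<Sum>j\<in>vidx m. f t x (vpt m j) * vpt m j ^ k * ?d)\<bar> \<le> C * (?d + 1 / V powr (q - 3))"
      unfolding C_def by (simp add: mult_ac)
  qed
qed

end

section \<open>Errors of moments and field\<close>

definition mom_h :: "mesh \<Rightarrow> nat \<Rightarrow> gridfun \<Rightarrow> int \<Rightarrow> real" where
  "mom_h m k g i = (\<Sum>j\<in>vidx m. g i j * vpt m j ^ k * Dv m)"

lemma maxwellian_h_mxw:
  assumes "dens_h m g i \<noteq> 0"
  shows "maxwellian_h m g i j = mxw (mom_h m 0 g i) (mom_h m 1 g i) (mom_h m 2 g i) (vpt m j)"
proof -
  have 0: "mom_h m 0 g i = dens_h m g i" by (simp add: mom_h_def dens_h_def)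
  have 1: "mom_h m 1 g i = dens_h m g i * bulk_h m g i" using first_moment_h[OF assms] by (simp add: mom_h_def)
  have 2: "mom_h m 2 g i = dens_h m g i * (temp_h m g i + (bulk_h m g i)\<^sup>2)"
    using second_moment_h[OF assms] by (simp add: mom_h_def)
  show ?thesis unfolding maxwellian_h_def mxw_def 0 1 2 using assms by simp
qed

lemma temp_h_mom_h:
  assumes "dens_h m g i \<noteq> 0"
  shows "temp_h m g i = mom_h m 2 g i / mom_h m 0 g i - (mom_h m 1 g i / mom_h m 0 g i)\<^sup>2"
proof -
  have 0: "mom_h m 0 g i = dens_h m g i" by (simp add: mom_h_def dens_h_def)
  have 1: "mom_h m 1 g i = dens_h m g i * bulk_h m g i" using first_moment_h[OF assms] by (simp add: mom_h_def)
  have 2: "mom_h m 2 g i = dens_h m g i * (temp_h m g i + (bulk_h m g i)\<^sup>2)"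
    using second_moment_h[OF assms] by (simp add: mom_h_def)
  show ?thesis unfolding 0 1 2 using assms by simp
qed

lemma mom_h_bound:
  assumes q: "3 < q" and d: "0 < Dv m" "Dv m \<le> 1" and N: "0 \<le> N" and k: "k \<le> 2"
    and g: "\<And>j. j \<in> vidx m \<Longrightarrow> \<bar>g i j\<bar> \<le> N * wt q (vpt m j)"
  shows "\<bar>mom_h m k g i\<bar> \<le> N * (1 + 2 / (q - 3))"
proof -
  have "\<bar>mom_h m k g i\<bar> \<le> (\<Sum>j\<in>vidx m. \<bar>g i j * vpt m j ^ k * Dv m\<bar>)" unfolding mom_h_def by (rule sum_abs)
  also have "\<dots> \<le> (\<Sum>j\<in>vidx m. N * (wt (q - 2) (vpt m j) * Dv m))"
  proof (rule sum_mono)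
    fix j assume j: "j \<in> vidx m"
    let ?v = "vpt m j"
    have "\<bar>?v\<bar> ^ k * wt q ?v \<le> \<bar>?v\<bar> ^ k * wt (q - 2 + real k) ?v"
      using k by (intro mult_left_mono wt_mono) auto
    also have "\<dots> \<le> wt (q - 2) ?v" by (rule abs_wt_absorb)
    finally have w: "\<bar>?v\<bar> ^ k * wt q ?v \<le> wt (q - 2) ?v" .
    have "\<bar>g i j * ?v ^ k * Dv m\<bar> = \<bar>g i j\<bar> * \<bar>?v\<bar> ^ k * Dv m" using d by (simp add: abs_mult power_abs)
    also have "\<dots> \<le> (N * wt q ?v) * \<bar>?v\<bar> ^ k * Dv m" using g[OF j] d by (intro mult_right_mono) auto
    also have "\<dots> = N * ((\<bar>?v\<bar> ^ k * wt q ?v) * Dv m)" by (simp only: mult_ac)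
    also have "\<dots> \<le> N * (wt (q - 2) ?v * Dv m)" using w N d by (intro mult_left_mono mult_right_mono) auto
    finally show "\<bar>g i j * ?v ^ k * Dv m\<bar> \<le> N * (wt (q - 2) ?v * Dv m)" .
  qed
  also have "\<dots> = N * (\<Sum>j\<in>vidx m. wt (q - 2) (vpt m j) * Dv m)" by (simp only: sum_distrib_left)
  also have "\<dots> \<le> N * (1 + 2 / (q - 3))"
    using sum_wt[OF d(1), of "q - 2"] q d N by (intro mult_left_mono) auto
  finally show ?thesis .
qed

text \<open>The step is piecewise linear in the field, with slopes given by the difference quotients of the
  grid function.\<close>

lemma upwind_field_difference:
  assumes ij: "i \<in> xidx m" "j \<in> vidx m" and pos: "0 \<le> Dt m" "0 < Dv m"
    and h: "\<bar>g i (clampv m (j - 1)) - g i j\<bar> \<le> M * Dv m" "\<bar>g i (clampv m (j + 1)) - g i j\<bar> \<le> M * Dv m"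
  shows "\<bar>upwind m e g i j - upwind m e' g i j\<bar> \<le> 2 * M * Dt m * \<bar>e i - e' i\<bar>"
proof -
  let ?b = "Dt m / Dv m" and ?\<delta> = "\<bar>e i - e' i\<bar>"
  have "upwind m e g i j - upwind m e' g i j = ?b * ((pos_part (e i) - pos_part (e' i)) * (g i (clampv m (j - 1)) - g i j)
    + (neg_part (e i) - neg_part (e' i)) * (g i (clampv m (j + 1)) - g i j))"
    unfolding upwind_eq[OF ij] abs_parts[of "e i"] abs_parts[of "e' i"]
    by (simp add: algebra_simps add_divide_distrib diff_divide_distrib)
  also have "\<bar>\<dots>\<bar> \<le> ?b * (?\<delta> * (M * Dv m) + ?\<delta> * (M * Dv m))"
  proof -
    have p: "\<bar>pos_part (e i) - pos_part (e' i)\<bar> \<le> ?\<delta>" "\<bar>neg_part (e i) - neg_part (e' i)\<bar> \<le> ?\<delta>"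
      by (auto simp: pos_part_def neg_part_def)
    have "\<bar>(pos_part (e i) - pos_part (e' i)) * (g i (clampv m (j - 1)) - g i j)\<bar> \<le> ?\<delta> * (M * Dv m)"
      "\<bar>(neg_part (e i) - neg_part (e' i)) * (g i (clampv m (j + 1)) - g i j)\<bar> \<le> ?\<delta> * (M * Dv m)"
      unfolding abs_mult using p h by (auto intro!: mult_mono)
    then show ?thesis unfolding abs_mult[of ?b] using pos
      by (intro mult_mono order_trans[OF abs_triangle_ineq add_mono]) auto
  qed
  also have "\<dots> = 2 * M * Dt m * ?\<delta>" using pos by simp
  finally show ?thesis .
qed

context vp_solution
begin

text \<open>On every cell other than the one that starts at \<open>x\<close> the kernel has slope one; its jump affects a
  single cell and costs another multiple of \<open>Dx\<close>.\<close>

lemma field_quadrature: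
  obtains C where "0 \<le> C" "\<And>m V t i. t \<in> {0..Tf} \<Longrightarrow> phase_mesh V m \<Longrightarrow> i \<in> xidx m \<Longrightarrow>
    \<bar>E t (xpt m i) - (\<Sum>k\<in>xidx m. field_kernel (xpt m i) (xpt m k) * (mom 0 t (xpt m k) - 1) * Dx m)\<bar> \<le> C * Dx m"
proof -
  obtain L where L: "0 \<le> L" "\<And>s t x y k. s \<in> {0..Tf} \<Longrightarrow> t \<in> {0..Tf} \<Longrightarrow> k \<le> 2 \<Longrightarrow>
    \<bar>mom k s y - mom k t x\<bar> \<le> L * (\<bar>s - t\<bar> + \<bar>y - x\<bar>)"
    using mom_Lipschitz by blast
  define R where "R = B * pi + 1"
  have R: "1 \<le> R" unfolding R_def using B by simp
  show thesis
  proof (rule that[of "L + R + 2 * R"])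
    show "0 \<le> L + R + 2 * R" using L R by simp
    fix m :: mesh and V t :: real and i :: int
    assume t: "t \<in> {0..Tf}" and mesh: "phase_mesh V m" and i: "i \<in> xidx m"
    let ?d = "Dx m" and ?x = "xpt m i"
    have d: "0 < ?d" and N: "real (Nx m) * ?d = 1" using mesh by (auto simp: phase_mesh_def)
    have x: "?x \<in> {0..1}" "?x + ?d \<le> 1"
    proof -
      have "real_of_int i + 1 \<le> real (Nx m)" using i unfolding xidx_def by (auto simp: of_int_add[symmetric] simp del: of_int_add)
      then have "(real_of_int i + 1) * ?d \<le> 1" unfolding N[symmetric] using d by (intro mult_right_mono) auto
      then show "?x \<in> {0..1}" "?x + ?d \<le> 1" using i d by (auto simp: xpt_def xidx_def distrib_right)
    qed
    define \<rho> where "\<rho> y = mom 0 t y - 1" for y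
    define h where "h y = field_kernel ?x y * \<rho> y" for y
    let ?\<sigma> = "step_fun (xidx m) ?d h" and ?I = "\<lambda>y. indicator {0..1} y * h y :: real"
    have \<rho>b: "\<bar>\<rho> y\<bar> \<le> R" for y unfolding \<rho>_def R_def using mom_bound(2)[OF t, of 0 y] by linarith
    have hb: "\<bar>h y\<bar> \<le> R" if "y \<in> {0..1}" for y
    proof -
      have "\<bar>h y\<bar> \<le> 1 * R" unfolding h_def abs_mult using kernel_bound[OF x(1) that] \<rho>b by (intro mult_mono) auto
      then show ?thesis by simp
    qed
    \<comment> \<open>The three terms: regular cells, the cell with the jump, and the end point 1, which no cell covers.\<close>
    let ?G = "\<lambda>y. (L + R) * ?d * indicator {0..1} y + (2 * R * indicator {?x..<?x + ?d} y + R * indicator {1..1} y) :: real"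
    have diff: "\<bar>?I y - ?\<sigma> y\<bar> \<le> ?G y" for y
    proof (cases "y \<in> {0..<1}")
      case True
      let ?k = "\<lfloor>y / ?d\<rfloor>"
      let ?y = "xpt m ?k"
      have fc: "?y \<le> y" "y < ?y + ?d" unfolding xpt_def using floor_cell[OF d, of y] by auto
      have k: "?k \<in> xidx m"
      proof -
        have "0 \<le> ?k" using True d by simp
        moreover have "?k < int (Nx m)"
        proof -
          have "y < real (Nx m) * ?d" using True N by simp
          then have "y / ?d < real (Nx m)" using d by (simp add: pos_divide_less_eq)
          then show ?thesis by (simp add: floor_less_iff)
        qed
        ultimately show ?thesis by (simp add: xidx_def)
      qed
      have y01: "?y \<in> {0..1}" using fc True k d by (auto simp: xpt_def xidx_def)
      have \<sigma>: "?\<sigma> y = h ?y" using k d by (simp add: step_fun_eq xpt_def)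
      show ?thesis
      proof (cases "?k = i")
        case True': True
        then have "y \<in> {?x..<?x + ?d}" using fc by auto
        then have G: "2 * R \<le> ?G y" using L R d by (simp add: indicator_def)
        have "\<bar>?I y - ?\<sigma> y\<bar> \<le> R + R" unfolding \<sigma> using hb[of y] hb[OF y01] True by simp
        then show ?thesis using G by linarith
      next
        case False
        have same: "field_kernel ?x y - field_kernel ?x ?y = y - ?y"
        proof (cases "?k < i")
          case True
          then have "real_of_int ?k + 1 \<le> real_of_int i" by linarith
          then have "(real_of_int ?k + 1) * ?d \<le> real_of_int i * ?d" using d by (intro mult_right_mono) auto
          then have "?y + ?d \<le> ?x" by (simp add: xpt_def distrib_right)
          then show ?thesis using fc d by (simp add: field_kernel_def)
        next
          case False': False
          then have "real_of_int i < real_of_int ?k" using False by linarith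
          then have "?x < ?y" unfolding xpt_def using d by simp
          then show ?thesis using fc by (simp add: field_kernel_def)
        qed
        have "h y - h ?y = (field_kernel ?x y - field_kernel ?x ?y) * \<rho> y + field_kernel ?x ?y * (\<rho> y - \<rho> ?y)"
          unfolding h_def by (simp add: algebra_simps)
        then have "\<bar>h y - h ?y\<bar> \<le> \<bar>y - ?y\<bar> * \<bar>\<rho> y\<bar> + \<bar>field_kernel ?x ?y\<bar> * \<bar>\<rho> y - \<rho> ?y\<bar>"
          unfolding same abs_mult[symmetric] by (simp only: abs_triangle_ineq)
        also have "\<dots> \<le> ?d * R + 1 * (L * ?d)"
        proof (intro add_mono mult_mono)
          have "\<bar>\<rho> y - \<rho> ?y\<bar> \<le> L * \<bar>y - ?y\<bar>" unfolding \<rho>_def using L(2)[OF t t, of 0 y ?y] by simp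
          also have "\<dots> \<le> L * ?d" using fc L by (intro mult_left_mono) auto
          finally show "\<bar>\<rho> y - \<rho> ?y\<bar> \<le> L * ?d" .
        qed (use fc \<rho>b kernel_bound[OF x(1) y01] d in auto)
        finally have "\<bar>?I y - ?\<sigma> y\<bar> \<le> (L + R) * ?d" unfolding \<sigma> using True by (simp add: algebra_simps)
        moreover have "(L + R) * ?d \<le> ?G y" using True R by (simp add: indicator_def)
        ultimately show ?thesis by linarith
      qed
    next
      case False
      have k: "\<lfloor>y / ?d\<rfloor> \<notin> xidx m"
      proof
        assume k: "\<lfloor>y / ?d\<rfloor> \<in> xidx m"
        have "0 \<le> real_of_int \<lfloor>y / ?d\<rfloor> * ?d" using k d by (simp add: xidx_def)
        moreover have "(real_of_int \<lfloor>y / ?d\<rfloor> + 1) * ?d \<le> real (Nx m) * ?d"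
          using k d by (intro mult_right_mono) (auto simp: xidx_def)
        ultimately show False using False floor_cell[OF d, of y] N by (auto simp: distrib_right)
      qed
      show ?thesis
      proof (cases "y = 1")
        case True
        have "0 \<le> (L + R) * ?d" using L R d by simp
        then show ?thesis using k d hb[of 1] True x R by (simp add: step_fun_eq indicator_def)
      next
        case False': False
        then have "?I y - ?\<sigma> y = 0" using False k d by (auto simp: step_fun_eq indicator_def)
        moreover have "0 \<le> ?G y" using L R d by (intro add_nonneg_nonneg mult_nonneg_nonneg) auto
        ultimately show ?thesis by (simp only: abs_zero)
      qed
    qed
    have Ii: "integrable lborel ?I"
      unfolding h_def \<rho>_def dens_mom[symmetric] by (rule kernel_integrable[OF dens_continuous[OF t]])
    have \<sigma>i: "integrable lborel ?\<sigma>" "(LINT y|lborel. ?\<sigma> y) = (\<Sum>k\<in>xidx m. h (real_of_int k * ?d) * ?d)"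
      by (rule step_fun_integral[OF finite_xidx d])+
    have xd: "?x \<le> ?x + ?d" using d by simp
    note ind = indicator_integral(1,2)[of 0 1 "(L + R) * ?d", OF zero_le_one] indicator_integral(3,4)[OF xd, of "2 * R"]
      indicator_integral(1,2)[of 1 1 R, OF order_refl]
    have Gi: "integrable lborel ?G" using ind by (intro Bochner_Integration.integrable_add)
    have G: "(LINT y|lborel. ?G y) = (L + R + 2 * R) * ?d"
      using ind by (subst Bochner_Integration.integral_add, simp, simp)+ (simp add: algebra_simps)
    have "E t ?x - (\<Sum>k\<in>xidx m. field_kernel ?x (xpt m k) * (mom 0 t (xpt m k) - 1) * ?d)
      = (LINT y|lborel. ?I y) - (LINT y|lborel. ?\<sigma> y)"
      using E_eq'[OF t x(1)] unfolding \<sigma>i(2) h_def \<rho>_def dens_mom by (simp add: xpt_def)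
    moreover have "(LINT y|lborel. ?I y) - (LINT y|lborel. ?\<sigma> y) = (LINT y|lborel. ?I y - ?\<sigma> y)"
      by (rule Bochner_Integration.integral_diff[OF Ii \<sigma>i(1), symmetric])
    moreover have "\<bar>LINT y|lborel. ?I y - ?\<sigma> y\<bar> \<le> (LINT y|lborel. ?G y)"
      by (rule Bochner_Integration.integral_abs_bound_integral[OF Bochner_Integration.integrable_diff[OF Ii \<sigma>i(1)] Gi diff])
    ultimately show "\<bar>E t ?x - (\<Sum>k\<in>xidx m. field_kernel ?x (xpt m k) * (mom 0 t (xpt m k) - 1) * ?d)\<bar> \<le> (L + R + 2 * R) * ?d"
      unfolding G by simp
  qed
qed

text \<open>Quadrature error plus the moments of the pointwise error, which are summable because \<open>q > 3\<close>.\<close>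

lemma moment_error:
  obtains C where "0 \<le> C" "\<And>m V t i k g N. t \<in> {0..Tf} \<Longrightarrow> phase_mesh V m \<Longrightarrow> 1 \<le> V \<Longrightarrow> Dv m \<le> 1 \<Longrightarrow> k \<le> 2 \<Longrightarrow>
    0 \<le> N \<Longrightarrow> (\<And>j. j \<in> vidx m \<Longrightarrow> \<bar>f t (xpt m i) (vpt m j) - g i j\<bar> \<le> N * wt q (vpt m j)) \<Longrightarrow>
    \<bar>mom k t (xpt m i) - mom_h m k g i\<bar> \<le> C * (Dv m + 1 / V powr (q - 3) + N)"
proof -
  obtain C1 where C1: "0 \<le> C1" "\<And>m V t x k. t \<in> {0..Tf} \<Longrightarrow> phase_mesh V m \<Longrightarrow> 1 \<le> V \<Longrightarrow> Dv m \<le> 1 \<Longrightarrow> k \<le> 2 \<Longrightarrow>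
    \<bar>mom k t x - (\<Sum>j\<in>vidx m. f t x (vpt m j) * vpt m j ^ k * Dv m)\<bar> \<le> C1 * (Dv m + 1 / V powr (q - 3))"
    using moment_quadrature by blast
  define K where "K = 1 + 2 / (q - 3)"
  have K: "0 \<le> K" unfolding K_def using q by simp
  show thesis
  proof (rule that[of "C1 + K"])
    show "0 \<le> C1 + K" using C1 K by simp
    fix m :: mesh and V t N :: real and i :: int and k :: nat and g :: gridfun
    assume t: "t \<in> {0..Tf}" and mesh: "phase_mesh V m" and V: "1 \<le> V" and d1: "Dv m \<le> 1" and k: "k \<le> 2"
      and N: "0 \<le> N" and g: "\<And>j. j \<in> vidx m \<Longrightarrow> \<bar>f t (xpt m i) (vpt m j) - g i j\<bar> \<le> N * wt q (vpt m j)"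
    have d: "0 < Dv m" using mesh by (simp add: phase_mesh_def)
    have 1: "\<bar>mom k t (xpt m i) - mom_h m k (grid m t) i\<bar> \<le> C1 * (Dv m + 1 / V powr (q - 3))"
      unfolding mom_h_def by (rule C1(2)[OF t mesh V d1 k])
    have e: "mom_h m k (grid m t) i - mom_h m k g i = mom_h m k (\<lambda>i j. grid m t i j - g i j) i"
      unfolding mom_h_def by (simp add: sum_subtractf[symmetric] left_diff_distrib)
    have 2: "\<bar>mom_h m k (grid m t) i - mom_h m k g i\<bar> \<le> N * K"
      unfolding e K_def by (rule mom_h_bound[OF q d d1 N k]) (rule g)
    have "\<bar>mom k t (xpt m i) - mom_h m k g i\<bar> \<le> C1 * (Dv m + 1 / V powr (q - 3)) + N * K" using 1 2 by linarith
    also have "\<dots> \<le> (C1 + K) * ((Dv m + 1 / V powr (q - 3)) + N)"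
    proof -
      have "a * y + z * b \<le> (a + b) * (y + z)" if "0 \<le> a" "0 \<le> b" "0 \<le> y" "0 \<le> z" for a b y z :: real
        using that by (simp add: algebra_simps add_nonneg_nonneg)
      then show ?thesis using C1(1) K N d by simp
    qed
    finally show "\<bar>mom k t (xpt m i) - mom_h m k g i\<bar> \<le> (C1 + K) * (Dv m + 1 / V powr (q - 3) + N)" by simp
  qed
qed

lemma field_error:
  obtains C where "0 \<le> C" "\<And>m V t i g N. t \<in> {0..Tf} \<Longrightarrow> phase_mesh V m \<Longrightarrow> 1 \<le> V \<Longrightarrow> Dv m \<le> 1 \<Longrightarrow>
    0 \<le> N \<Longrightarrow> i \<in> xidx m \<Longrightarrow>
    (\<And>i j. i \<in> xidx m \<Longrightarrow> j \<in> vidx m \<Longrightarrow> \<bar>f t (xpt m i) (vpt m j) - g i j\<bar> \<le> N * wt q (vpt m j)) \<Longrightarrow>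
    \<bar>E t (xpt m i) - field_h m g i\<bar> \<le> C * (Dx m + (Dv m + 1 / V powr (q - 3) + N))"
proof -
  obtain C1 where C1: "0 \<le> C1" "\<And>m V t i. t \<in> {0..Tf} \<Longrightarrow> phase_mesh V m \<Longrightarrow> i \<in> xidx m \<Longrightarrow>
    \<bar>E t (xpt m i) - (\<Sum>k\<in>xidx m. field_kernel (xpt m i) (xpt m k) * (mom 0 t (xpt m k) - 1) * Dx m)\<bar> \<le> C1 * Dx m"
    using field_quadrature by blast
  obtain C2 where C2: "0 \<le> C2" "\<And>m V t i k g N. t \<in> {0..Tf} \<Longrightarrow> phase_mesh V m \<Longrightarrow> 1 \<le> V \<Longrightarrow> Dv m \<le> 1 \<Longrightarrow> k \<le> 2 \<Longrightarrow>
    0 \<le> N \<Longrightarrow> (\<And>j. j \<in> vidx m \<Longrightarrow> \<bar>f t (xpt m i) (vpt m j) - g i j\<bar> \<le> N * wt q (vpt m j)) \<Longrightarrow>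
    \<bar>mom k t (xpt m i) - mom_h m k g i\<bar> \<le> C2 * (Dv m + 1 / V powr (q - 3) + N)"
    using moment_error by blast
  show thesis
  proof (rule that[of "C1 + C2"])
    show "0 \<le> C1 + C2" using C1 C2 by simp
    fix m :: mesh and V t N :: real and i :: int and g :: gridfun
    assume t: "t \<in> {0..Tf}" and mesh: "phase_mesh V m" and V: "1 \<le> V" and d1: "Dv m \<le> 1"
      and N: "0 \<le> N" and i: "i \<in> xidx m"
      and g: "\<And>i j. i \<in> xidx m \<Longrightarrow> j \<in> vidx m \<Longrightarrow> \<bar>f t (xpt m i) (vpt m j) - g i j\<bar> \<le> N * wt q (vpt m j)"
    have d: "0 < Dx m" "0 < Dv m" and Nx: "real (Nx m) * Dx m = 1" using mesh by (auto simp: phase_mesh_def)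
    define r where "r = Dv m + 1 / V powr (q - 3) + N"
    have r: "0 \<le> r" unfolding r_def using d N by simp
    have x: "xpt m k \<in> {0..1}" if "k \<in> xidx m" for k
    proof -
      have "real_of_int k * Dx m \<le> real (Nx m) * Dx m" using that d by (intro mult_right_mono) (auto simp: xidx_def)
      then show ?thesis using that d unfolding Nx by (auto simp: xpt_def xidx_def)
    qed
    have im: "i mod int (Nx m) = i" using i by (simp add: xidx_def)
    have eq: "(\<Sum>k\<in>xidx m. field_kernel (xpt m i) (xpt m k) * (mom 0 t (xpt m k) - 1) * Dx m) - field_h m g i
      = (\<Sum>k\<in>xidx m. field_kernel (xpt m i) (xpt m k) * (mom 0 t (xpt m k) - mom_h m 0 g k) * Dx m)"
      unfolding field_h_def im sum_subtractf[symmetric]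
      by (intro sum.cong refl) (simp add: algebra_simps mom_h_def dens_h_def)
    have "\<bar>\<Sum>k\<in>xidx m. field_kernel (xpt m i) (xpt m k) * (mom 0 t (xpt m k) - mom_h m 0 g k) * Dx m\<bar>
      \<le> (\<Sum>k\<in>xidx m. \<bar>field_kernel (xpt m i) (xpt m k) * (mom 0 t (xpt m k) - mom_h m 0 g k) * Dx m\<bar>)"
      by (rule sum_abs)
    also have "\<dots> \<le> (\<Sum>k\<in>xidx m. C2 * r * Dx m)"
    proof (rule sum_mono)
      fix k assume k: "k \<in> xidx m"
      have "\<bar>mom 0 t (xpt m k) - mom_h m 0 g k\<bar> \<le> C2 * r"
        unfolding r_def by (rule C2(2)[where g = g and i = k and k = 0, OF t mesh V d1 _ N g[OF k]]) simp_all
      then have "\<bar>field_kernel (xpt m i) (xpt m k)\<bar> * \<bar>mom 0 t (xpt m k) - mom_h m 0 g k\<bar> \<le> 1 * (C2 * r)"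
        using kernel_bound[OF x[OF i] x[OF k]] by (intro mult_mono) auto
      then have "\<bar>field_kernel (xpt m i) (xpt m k)\<bar> * \<bar>mom 0 t (xpt m k) - mom_h m 0 g k\<bar> * Dx m \<le> C2 * r * Dx m"
        using d by (intro mult_right_mono) auto
      then show "\<bar>field_kernel (xpt m i) (xpt m k) * (mom 0 t (xpt m k) - mom_h m 0 g k) * Dx m\<bar> \<le> C2 * r * Dx m"
        using d by (simp add: abs_mult)
    qed
    also have "\<dots> = C2 * r" unfolding sum_distrib_left[symmetric] sum_Dx[OF Nx] by simp
    finally have "\<bar>(\<Sum>k\<in>xidx m. field_kernel (xpt m i) (xpt m k) * (mom 0 t (xpt m k) - 1) * Dx m) - field_h m g i\<bar> \<le> C2 * r"
      unfolding eq .
    then have "\<bar>E t (xpt m i) - field_h m g i\<bar> \<le> C1 * Dx m + C2 * r" using C1(2)[OF t mesh i] by linarith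
    also have "\<dots> \<le> (C1 + C2) * (Dx m + r)" using C1(1) C2(1) r d by (simp add: algebra_simps)
    finally show "\<bar>E t (xpt m i) - field_h m g i\<bar> \<le> (C1 + C2) * (Dx m + (Dv m + 1 / V powr (q - 3) + N))"
      unfolding r_def .
  qed
qed

end

section \<open>Propagation of the error over one step\<close>

lemma mom_region_mono:
  "mom_region r1 r2 \<tau> a0 a1 a2 \<Longrightarrow> r1' \<le> r1 \<Longrightarrow> r2 \<le> r2' \<Longrightarrow> \<tau>' \<le> \<tau> \<Longrightarrow> mom_region r1' r2' \<tau>' a0 a1 a2"
  by (auto simp: mom_region_def)

context vp_solution
begin

lemma relax_bound:
  obtains C where "0 \<le> C" "\<And>t x v. t \<in> {0..Tf} \<Longrightarrow> \<bar>relax t x v\<bar> \<le> C * wt q v"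
proof -
  obtain M where M: "0 \<le> M" "\<And>a0 a1 a2 v. mom_region \<rho>0 (B * pi) \<tau>0 a0 a1 a2 \<Longrightarrow> \<bar>mxw a0 a1 a2 v\<bar> \<le> M * wt q v"
    by (rule mxw_bounds[of q \<rho>0 \<tau>0 0 "B * pi"]) (use q B \<rho>0 \<tau>0 in auto)
  show thesis
  proof (rule that[of "1 / \<epsilon> * (M + B)"])
    show "0 \<le> 1 / \<epsilon> * (M + B)" using M B \<epsilon> by simp
    fix t x v :: real assume t: "t \<in> {0..Tf}"
    have 1: "\<bar>local_maxwellian (f t) x v\<bar> \<le> M * wt q v"
      unfolding local_maxwellian_mxw[OF t] by (rule M(2)[OF mom_in_region[OF t]]) auto
    have 2: "\<bar>f t x v\<bar> \<le> B * wt q v"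
      using bf[OF t, of x v] mult_left_mono[OF wt_q(3)[of v] B] by linarith
    have "\<bar>relax t x v\<bar> \<le> 1 / \<epsilon> * (M * wt q v + B * wt q v)"
      unfolding abs_mult using 1 2 \<epsilon> by (intro mult_mono) auto
    then show "\<bar>relax t x v\<bar> \<le> 1 / \<epsilon> * (M + B) * wt q v" by (simp only: distrib_left distrib_right mult.assoc)
  qed
qed

text \<open>With \<open>R\<close> the relaxation term of the solution at the new time and \<open>M\<close> its Maxwellian,
  \<open>(\<epsilon> + Dt) * f = \<epsilon> * (f - Dt * R) + Dt * M\<close> has the same form as the scheme, with \<open>f - Dt * R\<close> in place
  of the transported solution. Hence the error splits into the transport error, of size
  \<open>N * (1 + C * Dt) + C * Dt * h\<close>, and \<open>Dt / \<epsilon>\<close> times the error of the Maxwellians, which is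
  governed by the moments and needs to be known only to first order.\<close>

lemma step_error:
  fixes r1 r2 \<tau> Cb :: real
  assumes r: "0 < r1" "0 \<le> r2" "0 < \<tau>" and Cb: "0 \<le> Cb"
  obtains C where "0 \<le> C"
    "\<And>m V t0 t1 g N i j. t0 \<in> {0..Tf} \<Longrightarrow> t1 \<in> {0..Tf} \<Longrightarrow> t1 = t0 + Dt m \<Longrightarrow> phase_mesh V m \<Longrightarrow> 1 \<le> V \<Longrightarrow>
      (1 + V) powr (- 2) \<le> Dv m \<Longrightarrow> Dv m \<le> 1 \<Longrightarrow> 0 < Dt m \<Longrightarrow> Dt m \<le> 1 \<Longrightarrow>
      (\<And>i j. i \<in> xidx m \<Longrightarrow> j \<in> vidx m \<Longrightarrow> Dt m / Dx m * \<bar>vpt m j\<bar> + Dt m / Dv m * \<bar>field_h m g i\<bar> \<le> 1) \<Longrightarrow>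
      (\<And>i. i \<in> xidx m \<Longrightarrow> \<bar>field_h m g i\<bar> \<le> Cb) \<Longrightarrow>
      (\<And>i. i \<in> xidx m \<Longrightarrow> mom_region r1 r2 \<tau> (mom_h m 0 (transport_h m g) i) (mom_h m 1 (transport_h m g) i)
          (mom_h m 2 (transport_h m g) i)) \<Longrightarrow>
      0 \<le> N \<Longrightarrow>
      (\<And>i j. i \<in> xidx m \<Longrightarrow> j \<in> vidx m \<Longrightarrow> \<bar>f t0 (xpt m i) (vpt m j) - g i j\<bar> \<le> N * wt q (vpt m j)) \<Longrightarrow>
      i \<in> xidx m \<Longrightarrow> j \<in> vidx m \<Longrightarrow>
      \<bar>f t1 (xpt m i) (vpt m j) - step_h \<epsilon> m g i j\<bar>
        \<le> (N * (1 + C * Dt m) + C * Dt m * (Dx m + Dv m + Dt m + 1 / V powr (q - 3))) * wt q (vpt m j)"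
proof -
  \<comment> \<open>One region that contains the moments of the solution and those of the scheme.\<close>
  define s1 where "s1 = min r1 \<rho>0"
  define s2 where "s2 = max r2 (B * pi)"
  define \<sigma> where "\<sigma> = min \<tau> \<tau>0"
  have s: "0 < s1" "0 \<le> s2" "0 < \<sigma>" unfolding s1_def s2_def \<sigma>_def using r \<rho>0 \<tau>0 by auto
  obtain LM where LM: "0 \<le> LM" "\<And>a0 a1 a2 b0 b1 b2 v w. mom_region s1 s2 \<sigma> a0 a1 a2 \<Longrightarrow> mom_region s1 s2 \<sigma> b0 b1 b2 \<Longrightarrow> \<bar>v - w\<bar> \<le> 0 \<Longrightarrow>
      \<bar>mxw a0 a1 a2 v - mxw b0 b1 b2 w\<bar> \<le> LM * (\<bar>a0 - b0\<bar> + \<bar>a1 - b1\<bar> + \<bar>a2 - b2\<bar> + \<bar>v - w\<bar>) * wt q v"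
    by (rule mxw_bounds[of q s1 \<sigma> 0 s2]) (use q s in auto)
  obtain C1 where C1: "0 \<le> C1" "\<And>t0 t1 x v. t0 \<in> {0..Tf} \<Longrightarrow> t1 \<in> {0..Tf} \<Longrightarrow> t0 \<le> t1 \<Longrightarrow> x \<in> {0..1} \<Longrightarrow>
      \<bar>f t1 x v - f t0 (x - v * (t1 - t0)) (v - E t0 x * (t1 - t0)) - (t1 - t0) * relax t1 x v\<bar>
      \<le> C1 * (t1 - t0)\<^sup>2 * wt q v"
    using local_truncation by blast
  obtain C2 where C2: "0 \<le> C2" "\<And>m V t i j. t \<in> {0..Tf} \<Longrightarrow> phase_mesh V m \<Longrightarrow> (1 + V) powr (- 2) \<le> Dv m \<Longrightarrow>
     Dv m \<le> 1 \<Longrightarrow> 0 \<le> Dt m \<Longrightarrow> Dt m \<le> 1 \<Longrightarrow> i \<in> xidx m \<Longrightarrow> j \<in> vidx m \<Longrightarrow>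
    \<bar>upwind m (\<lambda>i. E t (xpt m i)) (grid m t) i j
      - f t (xpt m i - vpt m j * Dt m) (vpt m j - E t (xpt m i) * Dt m)\<bar>
      \<le> C2 * Dt m * (Dx m + Dv m + Dt m) * wt q (vpt m j)"
    using upwind_consistency by blast
  obtain C3 where C3: "0 \<le> C3" "\<And>m V t i g N. t \<in> {0..Tf} \<Longrightarrow> phase_mesh V m \<Longrightarrow> 1 \<le> V \<Longrightarrow> Dv m \<le> 1 \<Longrightarrow>
    0 \<le> N \<Longrightarrow> i \<in> xidx m \<Longrightarrow>
    (\<And>i j. i \<in> xidx m \<Longrightarrow> j \<in> vidx m \<Longrightarrow> \<bar>f t (xpt m i) (vpt m j) - g i j\<bar> \<le> N * wt q (vpt m j)) \<Longrightarrow>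
    \<bar>E t (xpt m i) - field_h m g i\<bar> \<le> C3 * (Dx m + (Dv m + 1 / V powr (q - 3) + N))"
    using field_error by blast
  obtain C5 where C5: "0 \<le> C5" "\<And>m V t i k g N. t \<in> {0..Tf} \<Longrightarrow> phase_mesh V m \<Longrightarrow> 1 \<le> V \<Longrightarrow> Dv m \<le> 1 \<Longrightarrow> k \<le> 2 \<Longrightarrow>
    0 \<le> N \<Longrightarrow> (\<And>j. j \<in> vidx m \<Longrightarrow> \<bar>f t (xpt m i) (vpt m j) - g i j\<bar> \<le> N * wt q (vpt m j)) \<Longrightarrow>
    \<bar>mom k t (xpt m i) - mom_h m k g i\<bar> \<le> C5 * (Dv m + 1 / V powr (q - 3) + N)"
    using moment_error by blast
  obtain CR where CR: "0 \<le> CR" "\<And>t x v. t \<in> {0..Tf} \<Longrightarrow> \<bar>relax t x v\<bar> \<le> CR * wt q v"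
    using relax_bound by blast
  define w where "w = B * 2 powr (q + 2) + B"
  define c where "c = (2 powr q - 1) * Cb + (C2 + 2 * w * C3)"
  define C6 where "C6 = C5 * (2 + CR + C1 + c)"
  define c7 where "c7 = 3 * LM * C6 / \<epsilon>"
  define C where "C = C1 + c + c7"
  have q2: "0 \<le> 2 powr q - (1::real)" using q ge_one_powr_ge_zero[of 2 q] by simp
  have w: "0 \<le> w" unfolding w_def using B by simp
  have wC: "0 \<le> C2 + 2 * w * C3" "0 \<le> (2 powr q - 1) * Cb" using C2 C3 w q2 Cb by auto
  have c0: "0 \<le> c" unfolding c_def using wC by linarith
  have C6: "0 \<le> C6" unfolding C6_def using C5 CR C1 c0 by simp
  have c7: "0 \<le> c7" unfolding c7_def using LM C6 \<epsilon> by simp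
  show thesis
  proof (rule that[of C])
    show "0 \<le> C" unfolding C_def using C1 c0 c7 by simp
    fix m :: mesh and V t0 t1 N :: real and g :: gridfun and i j :: int
    assume t0: "t0 \<in> {0..Tf}" and t1: "t1 \<in> {0..Tf}" and t01: "t1 = t0 + Dt m" and mesh: "phase_mesh V m" and V: "1 \<le> V"
      and Vd: "(1 + V) powr (- 2) \<le> Dv m" and d1: "Dv m \<le> 1" and dt: "0 < Dt m" "Dt m \<le> 1"
      and cfl: "\<And>i j. i \<in> xidx m \<Longrightarrow> j \<in> vidx m \<Longrightarrow> Dt m / Dx m * \<bar>vpt m j\<bar> + Dt m / Dv m * \<bar>field_h m g i\<bar> \<le> 1"
      and fb: "\<And>i. i \<in> xidx m \<Longrightarrow> \<bar>field_h m g i\<bar> \<le> Cb"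
      and reg: "\<And>i. i \<in> xidx m \<Longrightarrow> mom_region r1 r2 \<tau> (mom_h m 0 (transport_h m g) i) (mom_h m 1 (transport_h m g) i)
          (mom_h m 2 (transport_h m g) i)"
      and N: "0 \<le> N"
      and err: "\<And>i j. i \<in> xidx m \<Longrightarrow> j \<in> vidx m \<Longrightarrow> \<bar>f t0 (xpt m i) (vpt m j) - g i j\<bar> \<le> N * wt q (vpt m j)"
      and ij: "i \<in> xidx m" "j \<in> vidx m"
    have d: "0 < Dx m" "0 < Dv m" and Nx: "real (Nx m) * Dx m = 1" using mesh by (auto simp: phase_mesh_def)
    let ?tn = "transport_h m g" and ?dt = "Dt m"
    define h where "h = Dx m + Dv m + ?dt + 1 / V powr (q - 3)"
    have Vp: "0 \<le> 1 / V powr (q - 3)" by simp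
    have h: "0 \<le> h" "?dt \<le> h" "Dx m + Dv m + ?dt \<le> h" "Dx m + (Dv m + 1 / V powr (q - 3)) \<le> h"
      "Dv m + 1 / V powr (q - 3) \<le> h"
      unfolding h_def using d dt Vp by linarith+
    define K where "K = N * (1 + c * ?dt) + c * ?dt * h"
    have K0: "0 \<le> K" unfolding K_def using N c0 dt h by simp
    define G where "G i j = f t0 (xpt m i - vpt m j * ?dt) (vpt m j - E t0 (xpt m i) * ?dt)" for i j
    have A: "\<bar>G i j - ?tn i j\<bar> \<le> K * wt q (vpt m j)" if ij: "i \<in> xidx m" "j \<in> vidx m" for i j
    proof -
      let ?wt = "wt q (vpt m j)" and ?e = "\<lambda>i. E t0 (xpt m i)" and ?e' = "field_h m g"
      have 1: "\<bar>upwind m ?e (grid m t0) i j - G i j\<bar> \<le> C2 * ?dt * h * ?wt"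
      proof -
        have "\<bar>upwind m ?e (grid m t0) i j - G i j\<bar> \<le> C2 * ?dt * (Dx m + Dv m + ?dt) * ?wt"
          unfolding G_def by (rule C2(2)[OF t0 mesh Vd d1 less_imp_le[OF dt(1)] dt(2) ij])
        also have "\<dots> \<le> C2 * ?dt * h * ?wt" using h C2(1) dt by (intro mult_right_mono mult_left_mono) auto
        finally show ?thesis .
      qed
      have dv: "\<bar>grid m t0 i (clampv m (j + s)) - grid m t0 i j\<bar> \<le> w * ?wt * Dv m" if "s = 1 \<or> s = - 1" for s
      proof -
        have a: "\<bar>grid m t0 i (clampv m (j + s)) - grid m t0 i j - real_of_int s * Dv m * fv t0 (xpt m i) (vpt m j)\<bar>
            \<le> B * 2 powr (q + 2) * (Dv m)\<^sup>2 * ?wt"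
          by (rule grid_v_difference[OF t0 ij(2) d(2) d1 mesh Vd that])
        have b: "\<bar>real_of_int s * Dv m * fv t0 (xpt m i) (vpt m j)\<bar> \<le> Dv m * (B * ?wt)"
          using that d bfv[OF t0, of "xpt m i" "vpt m j"] mult_left_mono[OF wt_q(3)[of "vpt m j"] B]
          by (auto simp: abs_mult)
        have "(Dv m)\<^sup>2 \<le> Dv m" using d d1 by (simp add: power2_eq_square mult_left_le)
        then have "B * 2 powr (q + 2) * (Dv m)\<^sup>2 * ?wt \<le> B * 2 powr (q + 2) * Dv m * ?wt"
          using B by (intro mult_right_mono mult_left_mono) auto
        then have "\<bar>grid m t0 i (clampv m (j + s)) - grid m t0 i j\<bar> \<le> B * 2 powr (q + 2) * Dv m * ?wt + Dv m * (B * ?wt)"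
          using a b by linarith
        also have "\<dots> = w * ?wt * Dv m" unfolding w_def by (simp add: algebra_simps)
        finally show ?thesis .
      qed
      have 2: "\<bar>upwind m ?e (grid m t0) i j - upwind m ?e' (grid m t0) i j\<bar> \<le> 2 * w * C3 * ?dt * (h + N) * ?wt"
      proof -
        have "\<bar>upwind m ?e (grid m t0) i j - upwind m ?e' (grid m t0) i j\<bar> \<le> 2 * (w * ?wt) * ?dt * \<bar>?e i - ?e' i\<bar>"
          by (rule upwind_field_difference[where e = ?e and e' = ?e' and g = "grid m t0", OF ij less_imp_le[OF dt(1)] d(2)])
            (use dv[of "-1"] dv[of 1] in auto)
        also have "\<dots> \<le> 2 * (w * ?wt) * ?dt * (C3 * (h + N))"
        proof (rule mult_left_mono)
          have "\<bar>?e i - ?e' i\<bar> \<le> C3 * (Dx m + (Dv m + 1 / V powr (q - 3) + N))"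
            by (rule C3(2)[OF t0 mesh V d1 N ij(1) err])
          also have "\<dots> \<le> C3 * (h + N)" using h C3(1) by (intro mult_left_mono) auto
          finally show "\<bar>?e i - ?e' i\<bar> \<le> C3 * (h + N)" .
        qed (use w dt in auto)
        finally show ?thesis by (simp only: mult_ac)
      qed
      have 3: "\<bar>upwind m ?e' (grid m t0) i j - ?tn i j\<bar> \<le> N * (1 + ?dt * ((2 powr q - 1) * Cb)) * ?wt"
      proof -
        have "\<bar>upwind m ?e' (\<lambda>i j. grid m t0 i j - g i j) i j\<bar> \<le> N * (1 + ?dt * ((2 powr q - 1) * Cb)) * ?wt"
          by (rule upwind_weighted_abs[where e = ?e' and g = "\<lambda>i j. grid m t0 i j - g i j" and i = i and j = j,
              OF ij less_imp_le[OF dt(1)] d d1 _ cfl[OF ij] fb[OF ij(1)] N]) (use q err in auto)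
        then show ?thesis unfolding upwind_diff[OF ij] transport_h_upwind .
      qed
      have "\<bar>G i j - ?tn i j\<bar> \<le> C2 * ?dt * h * ?wt + 2 * w * C3 * ?dt * (h + N) * ?wt + N * (1 + ?dt * ((2 powr q - 1) * Cb)) * ?wt"
      proof -
        have "\<bar>a - d\<bar> \<le> x + y + z" if "\<bar>b - a\<bar> \<le> x" "\<bar>b - c\<bar> \<le> y" "\<bar>c - d\<bar> \<le> z" for a b c d x y z :: real
          using that by linarith
        from this[OF 1 2 3] show ?thesis .
      qed
      also have "\<dots> = (C2 * (?dt * h) + 2 * w * C3 * (?dt * h) + 2 * w * C3 * (?dt * N) + N + (2 powr q - 1) * Cb * (?dt * N)) * ?wt"
        by (simp add: algebra_simps)
      also have "\<dots> \<le> K * ?wt"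
      proof (rule mult_right_mono)
        have "(C2 + 2 * w * C3) * (?dt * h) \<le> c * (?dt * h)" unfolding c_def using wC dt h by (intro mult_right_mono) auto
        moreover have "(2 * w * C3 + (2 powr q - 1) * Cb) * (?dt * N) \<le> c * (?dt * N)"
          unfolding c_def using C2 dt N by (intro mult_right_mono) auto
        moreover have "K = N + c * (?dt * N) + c * (?dt * h)" unfolding K_def by (simp add: algebra_simps)
        ultimately show "C2 * (?dt * h) + 2 * w * C3 * (?dt * h) + 2 * w * C3 * (?dt * N) + N + (2 powr q - 1) * Cb * (?dt * N) \<le> K"
          by (simp only: distrib_right)
      qed simp
      finally show ?thesis .
    qed
    have x01: "xpt m i \<in> {0..1}" if "i \<in> xidx m" for i
    proof -
      have "real_of_int i * Dx m \<le> real (Nx m) * Dx m" using that d by (intro mult_right_mono) (auto simp: xidx_def)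
      then show ?thesis using that d unfolding Nx by (auto simp: xpt_def xidx_def)
    qed
    have T: "\<bar>f t1 (xpt m i) (vpt m j) - G i j - ?dt * relax t1 (xpt m i) (vpt m j)\<bar> \<le> C1 * ?dt\<^sup>2 * wt q (vpt m j)"
      if "i \<in> xidx m" for i j
      using C1(2)[OF t0 t1 _ x01[OF that], of "vpt m j"] dt unfolding t01 G_def by simp
    define N1 where "N1 = (CR + C1) * ?dt + K"
    have N1: "0 \<le> N1" unfolding N1_def using CR C1 dt K0 by simp
    have dt2: "?dt\<^sup>2 \<le> ?dt" "?dt\<^sup>2 \<le> ?dt * h" using dt h by (auto simp: power2_eq_square mult_left_le)
    have Bd: "\<bar>f t1 (xpt m i) (vpt m j) - ?tn i j\<bar> \<le> N1 * wt q (vpt m j)" if ij: "i \<in> xidx m" "j \<in> vidx m" for i j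
    proof -
      let ?wt = "wt q (vpt m j)" and ?R = "relax t1 (xpt m i) (vpt m j)"
      have "\<bar>?dt * ?R\<bar> \<le> ?dt * (CR * ?wt)" 
        unfolding abs_mult[of ?dt] abs_of_pos[OF dt(1)]
        by (rule mult_left_mono[OF CR(2)[OF t1]]) (use dt in simp)
      moreover have "C1 * ?dt\<^sup>2 * ?wt \<le> C1 * ?dt * ?wt" using dt2 C1(1) by (intro mult_right_mono mult_left_mono) auto
      moreover have "\<bar>a - c\<bar> \<le> z + y + x" if "\<bar>a - b - r\<bar> \<le> y'" "y' \<le> y" "\<bar>b - c\<bar> \<le> x" "\<bar>r\<bar> \<le> z" for a b c r x y y' z :: real
        using that by linarith
      ultimately have "\<bar>f t1 (xpt m i) (vpt m j) - ?tn i j\<bar> \<le> ?dt * (CR * ?wt) + C1 * ?dt * ?wt + K * ?wt"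
        using T[OF ij(1), of j] A[OF ij] by blast
      then show ?thesis unfolding N1_def by (simp add: algebra_simps)
    qed
    have Mo: "\<bar>mom k t1 (xpt m i) - mom_h m k ?tn i\<bar> \<le> C6 * (N + h)" if "k \<le> 2" for k
    proof -
      have "\<bar>mom k t1 (xpt m i) - mom_h m k ?tn i\<bar> \<le> C5 * (Dv m + 1 / V powr (q - 3) + N1)"
        by (rule C5(2)[where g = ?tn and i = i, OF t1 mesh V d1 that N1 Bd[OF ij(1)]])
      also have "\<dots> \<le> C5 * ((2 + CR + C1 + c) * (N + h))"
      proof (rule mult_left_mono)
        have "(CR + C1) * ?dt \<le> (CR + C1) * (N + h)" using CR(1) C1(1) h N by (intro mult_left_mono) auto
        moreover have "c * ?dt * (N + h) \<le> c * 1 * (N + h)" using c0 dt N h by (intro mult_right_mono mult_left_mono) auto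
        moreover have "K = N + c * ?dt * (N + h)" unfolding K_def by (simp add: algebra_simps)
        ultimately have "Dv m + 1 / V powr (q - 3) + N1 \<le> h + ((CR + C1) * (N + h) + (N + c * 1 * (N + h)))"
          unfolding N1_def using h by linarith
        also have "\<dots> \<le> (2 + CR + C1 + c) * (N + h)" using N h by (simp add: algebra_simps)
        finally show "Dv m + 1 / V powr (q - 3) + N1 \<le> (2 + CR + C1 + c) * (N + h)" .
      qed (rule C5(1))
      finally show ?thesis unfolding C6_def by (simp only: mult.assoc)
    qed
    let ?wt = "wt q (vpt m j)" and ?R = "relax t1 (xpt m i) (vpt m j)" and ?f = "f t1 (xpt m i) (vpt m j)"
    let ?M = "local_maxwellian (f t1) (xpt m i) (vpt m j)" and ?Mh = "maxwellian_h m ?tn i j"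
    have MM: "\<bar>?M - ?Mh\<bar> \<le> 3 * LM * C6 * (N + h) * ?wt"
    proof -
      have "dens_h m ?tn i = mom_h m 0 ?tn i" by (simp add: mom_h_def dens_h_def)
      then have "dens_h m ?tn i \<noteq> 0" using reg[OF ij(1)] r unfolding mom_region_def by linarith
      note mh = maxwellian_h_mxw[OF this, of j]
      have ra: "mom_region s1 s2 \<sigma> (mom 0 t1 (xpt m i)) (mom 1 t1 (xpt m i)) (mom 2 t1 (xpt m i))"
        by (rule mom_in_region[OF t1]) (auto simp: s1_def s2_def \<sigma>_def)
      have rb: "mom_region s1 s2 \<sigma> (mom_h m 0 ?tn i) (mom_h m 1 ?tn i) (mom_h m 2 ?tn i)"
        by (rule mom_region_mono[OF reg[OF ij(1)]]) (auto simp: s1_def s2_def \<sigma>_def)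
      have "\<bar>?M - ?Mh\<bar> \<le> LM * (\<bar>mom 0 t1 (xpt m i) - mom_h m 0 ?tn i\<bar> + \<bar>mom 1 t1 (xpt m i) - mom_h m 1 ?tn i\<bar>
          + \<bar>mom 2 t1 (xpt m i) - mom_h m 2 ?tn i\<bar> + \<bar>vpt m j - vpt m j\<bar>) * ?wt"
        unfolding local_maxwellian_mxw[OF t1] mh by (rule LM(2)[OF ra rb]) simp
      also have "\<dots> \<le> LM * (3 * (C6 * (N + h))) * ?wt"
      proof (intro mult_right_mono mult_left_mono)
        show "\<bar>mom 0 t1 (xpt m i) - mom_h m 0 ?tn i\<bar> + \<bar>mom 1 t1 (xpt m i) - mom_h m 1 ?tn i\<bar>
          + \<bar>mom 2 t1 (xpt m i) - mom_h m 2 ?tn i\<bar> + \<bar>vpt m j - vpt m j\<bar> \<le> 3 * (C6 * (N + h))"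
          using Mo[of 0] Mo[of 1] Mo[of 2] by simp
      qed (use LM in auto)
      finally show ?thesis by (simp only: mult_ac)
    qed
    have F: "\<bar>?f - ?dt * ?R - ?tn i j\<bar> \<le> C1 * ?dt\<^sup>2 * ?wt + K * ?wt"
      using T[OF ij(1), of j] A[OF ij] by linarith
    have "\<bar>?f - step_h \<epsilon> m g i j\<bar> \<le> (C1 * ?dt\<^sup>2 * ?wt + K * ?wt) + ?dt / \<epsilon> * (3 * LM * C6 * (N + h) * ?wt)"
    proof -
      let ?a = "C1 * ?dt\<^sup>2 * ?wt + K * ?wt" and ?b = "3 * LM * C6 * (N + h) * ?wt"
      have e: "0 < \<epsilon> + ?dt" using \<epsilon> dt by simp
      have R: "\<epsilon> * ?R = ?M - ?f" using \<epsilon> by simp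
      have "(\<epsilon> + ?dt) * ?f = \<epsilon> * (?f - ?dt * ?R) + ?dt * ?M"
        using arg_cong[OF R, of "\<lambda>y. ?dt * y"] by (simp only: algebra_simps)
      moreover have "(\<epsilon> + ?dt) * step_h \<epsilon> m g i j = \<epsilon> * ?tn i j + ?dt * ?Mh"
        using e by (simp add: step_h_def Let_def)
      ultimately have "(\<epsilon> + ?dt) * (?f - step_h \<epsilon> m g i j) = \<epsilon> * (?f - ?dt * ?R - ?tn i j) + ?dt * (?M - ?Mh)"
        by (simp only: right_diff_distrib) 
      then have "(\<epsilon> + ?dt) * \<bar>?f - step_h \<epsilon> m g i j\<bar> = \<bar>\<epsilon> * (?f - ?dt * ?R - ?tn i j) + ?dt * (?M - ?Mh)\<bar>"
        using e by (metis abs_mult abs_of_pos)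
      also have "\<dots> \<le> \<epsilon> * \<bar>?f - ?dt * ?R - ?tn i j\<bar> + ?dt * \<bar>?M - ?Mh\<bar>"
        using abs_triangle_ineq[of "\<epsilon> * (?f - ?dt * ?R - ?tn i j)" "?dt * (?M - ?Mh)"] \<epsilon> dt
        by (simp only: abs_mult abs_of_pos)
      also have "\<dots> \<le> \<epsilon> * ?a + ?dt * ?b" using F MM \<epsilon> dt by (intro add_mono mult_left_mono) auto
      also have "\<dots> \<le> (\<epsilon> + ?dt) * (?a + ?dt / \<epsilon> * ?b)"
      proof -
        have "(\<epsilon> + ?dt) * (a + ?dt / \<epsilon> * b) = \<epsilon> * a + ?dt * b + (?dt * a + ?dt * (?dt / \<epsilon> * b))" for a b
          using \<epsilon> by (simp add: algebra_simps add_divide_distrib)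
        moreover have "0 \<le> ?dt * ?a + ?dt * (?dt / \<epsilon> * ?b)" 
          by (intro add_nonneg_nonneg mult_nonneg_nonneg) (use dt \<epsilon> C1(1) K0 LM(1) C6 N h(1) in auto)
        ultimately show ?thesis by simp
      qed
      finally show ?thesis using e by (simp only: mult_le_cancel_left_pos)
    qed
    also have "\<dots> = (C1 * ?dt\<^sup>2 + K + c7 * (?dt * (N + h))) * ?wt"
      unfolding c7_def by (simp add: algebra_simps add_divide_distrib)
    also have "\<dots> \<le> (N * (1 + C * ?dt) + C * ?dt * h) * ?wt"
    proof (rule mult_right_mono)
      have "C1 * ?dt\<^sup>2 \<le> C1 * (?dt * h)" using dt2 C1(1) by (intro mult_left_mono) auto
      moreover have "0 \<le> C1 * (?dt * N)" using C1(1) dt N by simp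
      moreover have "N * (1 + C * ?dt) + C * ?dt * h = N + C1 * (?dt * N) + C1 * (?dt * h) + c * (?dt * N) + c * (?dt * h)
         + c7 * (?dt * (N + h))" unfolding C_def by (simp add: algebra_simps)
      moreover have "K = N + c * (?dt * N) + c * (?dt * h)" unfolding K_def by (simp add: algebra_simps)
      ultimately show "C1 * ?dt\<^sup>2 + K + c7 * (?dt * (N + h)) \<le> N * (1 + C * ?dt) + C * ?dt * h" by linarith
    qed simp
    finally show "\<bar>f t1 (xpt m i) (vpt m j) - step_h \<epsilon> m g i j\<bar>
        \<le> (N * (1 + C * Dt m) + C * Dt m * (Dx m + Dv m + Dt m + 1 / V powr (q - 3))) * wt q (vpt m j)"
      unfolding h_def .
  qed
qed

end

section \<open>Convergence\<close>

lemma Linf_le_Winf: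
  assumes "a + b \<le> N" shows "Linf_norm q (pderiv_xv a b g) \<le> Winf_norm N q g"
proof -
  have "Linf_norm q (pderiv_xv a b g) \<le> (\<Sum>b\<le>N - a. Linf_norm q (pderiv_xv a b g))"
    by (rule member_le_sum) (use assms in auto)
  also have "\<dots> \<le> Winf_norm N q g" unfolding Winf_norm_def by (rule member_le_sum) (use assms in auto)
  finally show ?thesis .
qed

text \<open>The growth bound is evaluated at the final time; all weighted derivatives share one constant.\<close>

lemma weighted_growth_bound:
  assumes g: "weighted_growth q f0 Tf f" and W: "Winf_norm 2 q f0 < \<infinity>"
  obtains B where "0 \<le> B"
    "\<And>t x v a b. t \<in> {0..Tf} \<Longrightarrow> a + b \<le> 2 \<Longrightarrow> \<bar>pderiv_xv a b (f t) x v\<bar> \<le> B * wt q v"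
proof -
  obtain C where C: "0 < C" "\<And>t. t \<in> {0..Tf} \<Longrightarrow> Winf_norm 2 q (f t) \<le> ennreal (C * exp (C * t)) * (Winf_norm 2 q f0 + 1)"
    using g unfolding weighted_growth_def by blast
  define X where "X = ennreal (C * exp (C * Tf)) * (Winf_norm 2 q f0 + 1)"
  have X: "X < \<infinity>" unfolding X_def using W by (simp add: ennreal_mult_less_top)
  show thesis
  proof (rule that[of "enn2real X"])
    fix t x v and a b :: nat assume t: "t \<in> {0..Tf}" and ab: "a + b \<le> 2"
    have "Linf_norm q (pderiv_xv a b (f t)) \<le> Winf_norm 2 q (f t)" by (rule Linf_le_Winf[OF ab])
    also have "\<dots> \<le> ennreal (C * exp (C * t)) * (Winf_norm 2 q f0 + 1)" by (rule C(2)[OF t])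
    also have "\<dots> \<le> X" unfolding X_def using t C(1) by (intro mult_right_mono ennreal_leI mult_left_mono) auto
    finally have le: "Linf_norm q (pderiv_xv a b (f t)) \<le> X" .
    have "\<bar>pderiv_xv a b (f t) x v\<bar> \<le> enn2real (Linf_norm q (pderiv_xv a b (f t))) * wt q v"
      by (rule Linf_norm_bound) (use le X in auto)
    also have "\<dots> \<le> enn2real X * wt q v" using le X by (intro mult_right_mono enn2real_mono) auto
    finally show "\<bar>pderiv_xv a b (f t) x v\<bar> \<le> enn2real X * wt q v" .
  qed simp
qed

lemma C_class_2_derivs:
  assumes "C_class 2 g"
  shows "((\<lambda>y. g y v) has_real_derivative deriv_x g x v) (at x)" "((\<lambda>w. g x w) has_real_derivative deriv_v g x v) (at v)"
    "((\<lambda>y. deriv_x g y v) has_real_derivative deriv_x (deriv_x g) x v) (at x)"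
    "((\<lambda>y. deriv_v g y v) has_real_derivative deriv_x (deriv_v g) x v) (at x)"
    "((\<lambda>w. deriv_v g x w) has_real_derivative deriv_v (deriv_v g) x v) (at v)"
  using assms by (simp_all add: numeral_2_eq_2 deriv_x_def deriv_v_def DERIV_deriv_iff_real_differentiable)

lemma vp_solution_exists:
  assumes q: "3 < q" and eps: "0 < \<epsilon>" and Tf: "0 < Tf" and init: "initial_datum q f0"
    and sol: "classical_solution \<epsilon> f0 Tf f E" and bnd: "solution_bounds q f0 Tf f E"
  obtains B \<rho>0 \<tau>0 Ce where "vp_solution q \<epsilon> Tf B \<rho>0 \<tau>0 Ce f (\<lambda>t. deriv_x (f t)) (\<lambda>t. deriv_v (f t))
    (\<lambda>t. deriv_x (deriv_x (f t))) (\<lambda>t. deriv_x (deriv_v (f t))) (\<lambda>t. deriv_v (deriv_v (f t))) E"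
proof -
  have W: "Winf_norm 2 (q + 2) f0 < \<infinity>" using init by (simp add: initial_datum_def)
  have gr: "weighted_growth (q + 2) f0 Tf f" using bnd by (simp add: solution_bounds_def)
  obtain B where B: "0 \<le> B"
    "\<And>t x v a b. t \<in> {0..Tf} \<Longrightarrow> a + b \<le> 2 \<Longrightarrow> \<bar>pderiv_xv a b (f t) x v\<bar> \<le> B * wt (q + 2) v"
    using weighted_growth_bound[OF gr W] by blast
  have "\<exists>c>0. \<forall>t\<in>{0..Tf}. \<forall>x. dens (f t) x \<ge> c" using bnd by (simp only: solution_bounds_def)
  then obtain \<rho>0 where \<rho>: "0 < \<rho>0" "\<And>t x. t \<in> {0..Tf} \<Longrightarrow> \<rho>0 \<le> dens (f t) x" by auto
  have "\<exists>c>0. \<forall>t\<in>{0..Tf}. \<forall>x. temp (f t) x \<ge> c" using bnd by (simp only: solution_bounds_def)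
  then obtain \<tau>0 where \<tau>: "0 < \<tau>0" "\<And>t x. t \<in> {0..Tf} \<Longrightarrow> \<tau>0 \<le> temp (f t) x" by auto
  obtain Ce where Ce: "\<And>t x. t \<in> {0..Tf} \<Longrightarrow> \<bar>E t x\<bar> \<le> Ce"
    using bnd unfolding solution_bounds_def by blast
  have Ce0: "0 \<le> Ce" using Ce[of 0 0] Tf by (simp add: order_trans[OF abs_ge_zero])
  have cl: "C_class 2 (f t)" if "t \<in> {0..Tf}" for t using bnd that unfolding solution_bounds_def by blast
  have co: "continuous_on ({0..Tf} \<times> UNIV \<times> UNIV) (\<lambda>(t, x, v). pderiv_xv a b (f t) x v)" if "a + b \<le> 2" for a b
    using bnd that unfolding solution_bounds_def by blast
  have p: "pderiv_xv 0 0 g = g" "pderiv_xv 1 0 g = deriv_x g" "pderiv_xv 0 1 g = deriv_v g"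
    "pderiv_xv 2 0 g = deriv_x (deriv_x g)" "pderiv_xv 1 1 g = deriv_x (deriv_v g)"
    "pderiv_xv 0 2 g = deriv_v (deriv_v g)" for g
    by (simp_all add: pderiv_xv_def numeral_2_eq_2)
  obtain \<phi> where \<phi>: "\<And>t x. t \<in> {0..Tf} \<Longrightarrow> (E t has_real_derivative dens (f t) x - 1) (at x)"
    using sol unfolding classical_solution_def by blast
  have td: "((\<lambda>s. f s x v) has_real_derivative
        1 / \<epsilon> * (local_maxwellian (f t) x v - f t x v) - v * deriv_x (f t) x v - E t x * deriv_v (f t) x v) (at t within {0..Tf})"
    if t: "t \<in> {0..Tf}" for t x v
  proof -
    obtain ft where ft: "((\<lambda>s. f s x v) has_real_derivative ft) (at t within {0..Tf})"
      "ft + v * deriv_x (f t) x v + E t x * deriv_v (f t) x v = 1 / \<epsilon> * (local_maxwellian (f t) x v - f t x v)"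
      using sol t unfolding classical_solution_def by blast
    have "ft = 1 / \<epsilon> * (local_maxwellian (f t) x v - f t x v) - v * deriv_x (f t) x v - E t x * deriv_v (f t) x v"
      using ft(2) by (simp only:)
    then show ?thesis using ft(1) by simp
  qed
  have Eeq: "E t x = (LINT y:{0..1}|lborel. field_kernel x y * (dens (f t) y - 1))" if "t \<in> {0..Tf}" "x \<in> {0..1}" for t x
    using sol that unfolding classical_solution_def by blast
  have per: "f t (x + 1) v = f t x v" if "t \<in> {0..Tf}" for t x v
    using sol that unfolding classical_solution_def periodic_x_def by metis
  \<comment> \<open>The mixed derivative is taken first in velocity, as in the weighted norm.\<close>
  have "vp_solution q \<epsilon> Tf B \<rho>0 \<tau>0 Ce f (\<lambda>t. deriv_x (f t)) (\<lambda>t. deriv_v (f t))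
    (\<lambda>t. deriv_x (deriv_x (f t))) (\<lambda>t. deriv_x (deriv_v (f t))) (\<lambda>t. deriv_v (deriv_v (f t))) E"
  proof
    fix t x v :: real assume t: "t \<in> {0..Tf}"
    show "\<bar>f t x v\<bar> \<le> B * wt (q + 2) v" using B(2)[OF t, of 0 0 x v] by (simp add: p)
    show "\<bar>deriv_x (f t) x v\<bar> \<le> B * wt (q + 2) v" using B(2)[OF t, of 1 0 x v] by (simp only: p)
    show "\<bar>deriv_v (f t) x v\<bar> \<le> B * wt (q + 2) v" using B(2)[OF t, of 0 1 x v] by (simp only: p)
    show "\<bar>deriv_x (deriv_x (f t)) x v\<bar> \<le> B * wt (q + 2) v" using B(2)[OF t, of 2 0 x v] by (simp only: p)
    show "\<bar>deriv_x (deriv_v (f t)) x v\<bar> \<le> B * wt (q + 2) v" using B(2)[OF t, of 1 1 x v] by (simp only: p)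
    show "\<bar>deriv_v (deriv_v (f t)) x v\<bar> \<le> B * wt (q + 2) v" using B(2)[OF t, of 0 2 x v] by (simp only: p)
    note C_class_2_derivs[OF cl[OF t]]
    then show "((\<lambda>y. f t y v) has_real_derivative deriv_x (f t) x v) (at x)"
      "((\<lambda>w. f t x w) has_real_derivative deriv_v (f t) x v) (at v)"
      "((\<lambda>y. deriv_x (f t) y v) has_real_derivative deriv_x (deriv_x (f t)) x v) (at x)"
      "((\<lambda>y. deriv_v (f t) y v) has_real_derivative deriv_x (deriv_v (f t)) x v) (at x)"
      "((\<lambda>w. deriv_v (f t) x w) has_real_derivative deriv_v (deriv_v (f t)) x v) (at v)" by blast+
  next
    show "continuous_on ({0..Tf} \<times> UNIV \<times> UNIV) (\<lambda>(s, x, v). deriv_x (f s) x v)"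
      using co[of 1 0] unfolding p by simp
    show "continuous_on ({0..Tf} \<times> UNIV \<times> UNIV) (\<lambda>(s, x, v). deriv_v (f s) x v)"
      using co[of 0 1] unfolding p by simp
  qed (use q eps Tf B(1) \<rho> \<tau> Ce0 Ce \<phi> td Eeq per in auto)
  then show thesis by (rule that)
qed

text \<open>The a priori bounds are derived with the barrier constant \<open>C0\<close> for which the mesh is admissible.
  The region of moments that determines the Lipschitz constants is then computed from a barrier
  constant \<open>C1\<close> fixed in advance, so that the final constant depends neither on \<open>C0\<close> nor on the mesh. If
  no such constant exists, or if \<open>D\<close> vanishes, no mesh is admissible.\<close>

lemma convergence:
  assumes q: "3 < q" and Cm: "1 \<le> Cm"
    and mx: "\<And>m g i N v. 0 < Dv m \<Longrightarrow> 0 \<le> N \<Longrightarrow>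
       (\<And>j. j \<in> vidx m \<Longrightarrow> 0 \<le> g i j \<and> g i j \<le> N * wt q (vpt m j)) \<Longrightarrow>
       0 < dens_h m g i \<Longrightarrow> 0 < temp_h m g i \<Longrightarrow> 64 * (Dv m)\<^sup>2 \<le> temp_h m g i \<Longrightarrow>
       maxwellian (dens_h m g i) (bulk_h m g i) (temp_h m g i) v \<le> Cm * N * wt q v"
    and eps: "0 < \<epsilon>" and al: "1 \<le> \<alpha>" "\<alpha> \<le> 2" and Tf: "0 < Tf" and init: "initial_datum q f0"
    and sol: "classical_solution \<epsilon> f0 Tf f E" and bnd: "solution_bounds q f0 Tf f E"
    and eta: "0 < \<eta>1" "\<eta>1 < \<eta>2" "\<eta>2 < 1"
  shows "\<exists>C. \<forall>C0 \<gamma> l m V Nt. mesh_ok (CM_const q) Cm q \<alpha> f0 C0 \<epsilon> Tf \<eta>1 \<eta>2 \<gamma> l V m \<and> real Nt * Dt m = Tf \<longrightarrow>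
     Linf_error m q (f Tf) (f_h \<epsilon> m f0 Nt) + field_error m (E Tf) (E_h \<epsilon> m f0 Nt)
       \<le> C * (Dx m + Dv m + Dt m + 1 / V powr (q - 3))"
proof (cases "(\<exists>C1>0. \<forall>x v. C1 * exp (- (\<bar>v\<bar> powr \<alpha>)) \<le> f0 x v) \<and> 0 < D_int \<alpha> (beta_E \<alpha> \<epsilon> Tf)")
  case True
  then obtain C1 where C1: "0 < C1" "\<And>x v. C1 * exp (- (\<bar>v\<bar> powr \<alpha>)) \<le> f0 x v" by blast
  define D where "D = D_int \<alpha> (beta_E \<alpha> \<epsilon> Tf)"
  have D0: "0 < D" using True by (simp add: D_def)
  define F where "F = enn2real (Linf_norm q f0)"
  have "Linf_norm q f0 \<le> Winf_norm 2 q f0" using Linf_le_Winf[of 0 0 2 q f0] by (simp add: pderiv_xv_def)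
  also have "\<dots> < \<infinity>" using init by (simp add: initial_datum_def)
  finally have "\<bar>f0 x v\<bar> \<le> F * wt q v" for x v unfolding F_def by (rule Linf_norm_bound)
  then have f0F: "f0 x v \<le> F * wt q v" for x v by (meson abs_le_D1)
  have "0 < C1 * exp (- (\<bar>0\<bar> powr \<alpha>))" using C1(1) by simp
  also have "\<dots> \<le> F * wt q 0" using C1(2)[of 0 0] f0F[of 0 0] by linarith
  finally have F0: "0 < F" by (simp add: wt_def)
  let ?CE = "C_E1 \<epsilon> Tf" and ?CE2 = "C_E2 q \<epsilon> Tf"
  have CE: "3 \<le> ?CE" by (rule C_E1_ge[OF eps Tf])
  have CE2: "0 \<le> ?CE2" unfolding C_E2_def using CE q ge_one_powr_ge_zero[of 2 q] by simp
  define R where "R = \<alpha> * ?CE * (3 / 2 + ?CE * Tf) + 1 / \<epsilon>"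
  define L where "L = C1 * exp (- (R * Tf))"
  define sb where "sb = (1 + ?CE2) * F * exp ((?CE2 + (Cm - 1) / \<epsilon>) * Tf)"
  define K where "K = 1 + 2 / (q - 1)"
  define r1 where "r1 = L * (D / 2)"
  define r2 where "r2 = sb * (1 + 2 / (q - 3))"
  define \<tau> where "\<tau> = L * D ^ 3 / (1024 * (sb * K))"
  have K0: "0 < K" unfolding K_def using q by (simp add: add_pos_pos)
  have L0: "0 < L" unfolding L_def using C1 by simp
  have sb0: "0 < sb" unfolding sb_def using CE2 F0 by simp
  have r: "0 < r1" "0 \<le> r2" "0 < \<tau>" "0 \<le> ?CE"
    unfolding r1_def r2_def \<tau>_def using L0 D0 sb0 K0 q CE by auto
  obtain B \<rho>0 \<tau>0 Ce where "vp_solution q \<epsilon> Tf B \<rho>0 \<tau>0 Ce f (\<lambda>t. deriv_x (f t)) (\<lambda>t. deriv_v (f t))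
    (\<lambda>t. deriv_x (deriv_x (f t))) (\<lambda>t. deriv_x (deriv_v (f t))) (\<lambda>t. deriv_v (deriv_v (f t))) E"
    using vp_solution_exists[OF q eps Tf init sol bnd] by blast
  then interpret vp: vp_solution q \<epsilon> Tf B \<rho>0 \<tau>0 Ce f "\<lambda>t. deriv_x (f t)" "\<lambda>t. deriv_v (f t)"
    "\<lambda>t. deriv_x (deriv_x (f t))" "\<lambda>t. deriv_x (deriv_v (f t))" "\<lambda>t. deriv_v (deriv_v (f t))" E .
  obtain Cs where Cs: "0 \<le> Cs" "\<And>m V t0 t1 g N i j. t0 \<in> {0..Tf} \<Longrightarrow> t1 \<in> {0..Tf} \<Longrightarrow> t1 = t0 + Dt m \<Longrightarrow> phase_mesh V m \<Longrightarrow> 1 \<le> V \<Longrightarrow>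
      (1 + V) powr (- 2) \<le> Dv m \<Longrightarrow> Dv m \<le> 1 \<Longrightarrow> 0 < Dt m \<Longrightarrow> Dt m \<le> 1 \<Longrightarrow>
      (\<And>i j. i \<in> xidx m \<Longrightarrow> j \<in> vidx m \<Longrightarrow> Dt m / Dx m * \<bar>vpt m j\<bar> + Dt m / Dv m * \<bar>field_h m g i\<bar> \<le> 1) \<Longrightarrow>
      (\<And>i. i \<in> xidx m \<Longrightarrow> \<bar>field_h m g i\<bar> \<le> ?CE) \<Longrightarrow>
      (\<And>i. i \<in> xidx m \<Longrightarrow> mom_region r1 r2 \<tau> (mom_h m 0 (transport_h m g) i) (mom_h m 1 (transport_h m g) i)
          (mom_h m 2 (transport_h m g) i)) \<Longrightarrow>
      0 \<le> N \<Longrightarrow>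
      (\<And>i j. i \<in> xidx m \<Longrightarrow> j \<in> vidx m \<Longrightarrow> \<bar>f t0 (xpt m i) (vpt m j) - g i j\<bar> \<le> N * wt q (vpt m j)) \<Longrightarrow>
      i \<in> xidx m \<Longrightarrow> j \<in> vidx m \<Longrightarrow>
      \<bar>f t1 (xpt m i) (vpt m j) - step_h \<epsilon> m g i j\<bar>
        \<le> (N * (1 + Cs * Dt m) + Cs * Dt m * (Dx m + Dv m + Dt m + 1 / V powr (q - 3))) * wt q (vpt m j)"
    using vp.step_error[OF r] by blast
  obtain CF where CF: "0 \<le> CF" "\<And>m V t i g N. t \<in> {0..Tf} \<Longrightarrow> phase_mesh V m \<Longrightarrow> 1 \<le> V \<Longrightarrow> Dv m \<le> 1 \<Longrightarrow>
    0 \<le> N \<Longrightarrow> i \<in> xidx m \<Longrightarrow>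
    (\<And>i j. i \<in> xidx m \<Longrightarrow> j \<in> vidx m \<Longrightarrow> \<bar>f t (xpt m i) (vpt m j) - g i j\<bar> \<le> N * wt q (vpt m j)) \<Longrightarrow>
    \<bar>E t (xpt m i) - field_h m g i\<bar> \<le> CF * (Dx m + (Dv m + 1 / V powr (q - 3) + N))"
    using vp.field_error by blast
  define X where "X = exp (Cs * Tf)"
  show ?thesis
  proof (intro exI[of _ "X + CF * (1 + X)"] allI impI, elim conjE)
    fix C0 \<gamma> l :: real and m :: mesh and V :: real and Nt :: nat
    assume ok: "mesh_ok (CM_const q) Cm q \<alpha> f0 C0 \<epsilon> Tf \<eta>1 \<eta>2 \<gamma> l V m" and Nt: "real Nt * Dt m = Tf"
    note basic = mesh_ok_basic[OF ok q eps al Tf eta]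
    interpret sr: scheme_run q \<epsilon> \<alpha> Tf V m f0 by (rule basic(1))
    have eta1: "\<eta>1 < 1" using eta by linarith
    note vel = mesh_ok_velocity_step[OF ok q eps al Tf Cm eta(1) eta1 F_def F0 f0F basic(5) D_def]
    have rate: "sr.rate = R" by (simp add: sr.rate_def R_def)
    have sup: "sr.sup_bound Cm F = sb" by (simp add: sr.sup_bound_def sr.growth_def sb_def)
    have C0: "0 < C0" "\<And>x v. C0 * exp (- (\<bar>v\<bar> powr \<alpha>)) \<le> f0 x v" using ok by (auto simp: mesh_ok_def)
    have lower0: "sr.lower 0 c" if "\<And>x v. c * exp (- (\<bar>v\<bar> powr \<alpha>)) \<le> f0 x v" for c
      using that by (simp add: sr.lower_def tail_profile_def)
    have ap: "sr.lower n C0 \<and> sr.upper Cm F n \<and> sr.mass_ok n" if "real n * Dt m \<le> Tf" for n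
    proof (rule sr.apriori[OF Cm mx[OF sr.pos(3)] F0 _ C0(1) lower0[OF C0(2)] _ _ _ D0 basic(5)[folded D_def] vel(2) _ that])
      show "sr.upper Cm F 0" using f0F by (simp add: sr.upper_def)
      show "sr.mass_ok 0" using basic(6) by (simp add: sr.mass_ok_def mass_h_def dens_h_def sum_distrib_left sum_distrib_right mult_ac)
      show "0 < V" using basic(2) by linarith
      show "?CE * (sr.sup_bound Cm F * V powr - q) \<le> 1"
        using mesh_ok_boundary[OF ok q eps Tf Cm F_def F0] unfolding sup sb_def by (simp only: mult.assoc)
      show "64 * (Dv m)\<^sup>2 \<le> C0 * exp (- (sr.rate * Tf)) * D ^ 3 / (1024 * (sr.sup_bound Cm F * (1 + 2 / (q - 1))))"
        using vel(3) unfolding rate R_def sup sb_def .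
    qed auto
    have field_ok: "\<forall>i\<in>xidx m. \<bar>E_h \<epsilon> m f0 n i\<bar> \<le> ?CE" if n: "real n * Dt m \<le> Tf" for n
      using ap[OF n] by (intro sr.field_ok_if_mass_ok sr.lower_nonneg[of n C0] n) (use C0 in auto)
    have time: "real k * Dt m \<le> Tf" if "k \<le> n" "real n * Dt m \<le> Tf" for k n
      using mult_right_mono[of "real k" "real n" "Dt m"] that sr.pos by simp
    have region: "mom_region r1 r2 \<tau> (mom_h m 0 (transport_h m (f_h \<epsilon> m f0 n)) i) (mom_h m 1 (transport_h m (f_h \<epsilon> m f0 n)) i)
          (mom_h m 2 (transport_h m (f_h \<epsilon> m f0 n)) i)" if n: "real (Suc n) * Dt m \<le> Tf" and i: "i \<in> xidx m" for n i
    proof -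
      let ?g = "transport_h m (f_h \<epsilon> m f0 n)"
      have n': "real n * Dt m \<le> Tf" by (rule time[OF _ n]) simp
      have "sr.lower n C1"
        by (rule sr.lower_run[OF field_ok _ lower0[OF C1(2)] n'])
          (use C1(1) time[OF less_imp_le n'] in auto)
      then have lo: "L * tail_profile \<alpha> (beta_E \<alpha> \<epsilon> Tf) (vpt m j) \<le> ?g i j" if "j \<in> vidx m" for j
        using sr.lower_step(2)[OF _ _ field_ok[OF n'] n i that, of C1] C1(1) unfolding L_def rate by simp
      have up: "?g i j \<le> sb * wt q (vpt m j)" if "j \<in> vidx m" for j
        using sr.upper_transport(2)[OF _ Cm F0 field_ok[OF n'] n' i that] ap[OF n'] unfolding sup by blast
      have b: "0 \<le> beta_E \<alpha> \<epsilon> Tf" unfolding beta_E_def using al CE Tf by simp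
      have q1: "1 < q" using q by simp
      have dv: "0 < Dv m" "Dv m \<le> 1" using sr.pos basic(4) by auto
      note tl = temp_lower[where g = ?g and i = i and \<alpha> = \<alpha>, OF dv(1) q1 dv(2) L0 sb0 b lo up D0 basic(5)[folded D_def] vel(2)]
      have abs: "\<bar>?g i j\<bar> \<le> sb * wt q (vpt m j)" if "j \<in> vidx m" for j
      proof -
        have "0 \<le> L * tail_profile \<alpha> (beta_E \<alpha> \<epsilon> Tf) (vpt m j)" using L0 by simp
        then show ?thesis using lo[OF that] up[OF that] by simp
      qed
      have mb: "\<bar>mom_h m k ?g i\<bar> \<le> r2" if "k \<le> 2" for k
        unfolding r2_def by (rule mom_h_bound[where g = ?g and i = i, OF q dv less_imp_le[OF sb0] that abs])
      have e: "mom_h m 0 ?g i = dens_h m ?g i" by (simp add: mom_h_def dens_h_def)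
      have nz: "dens_h m ?g i \<noteq> 0" using tl(1) r(1) unfolding r1_def by linarith
      show ?thesis
        unfolding mom_region_def temp_h_mom_h[OF nz, symmetric]
        using tl(1,3) mb[of 0] mb[of 1] mb[of 2] unfolding e r1_def \<tau>_def K_def by auto
    qed
    define h where "h = Dx m + Dv m + Dt m + 1 / V powr (q - 3)"
    have Vp: "0 \<le> 1 / V powr (q - 3)" by simp
    have h: "0 \<le> h" "Dx m + (Dv m + 1 / V powr (q - 3)) \<le> h" unfolding h_def using sr.pos Vp by linarith+
    have err: "\<forall>i\<in>xidx m. \<forall>j\<in>vidx m. \<bar>f (real n * Dt m) (xpt m i) (vpt m j) - f_h \<epsilon> m f0 n i j\<bar>
        \<le> (h * (exp (Cs * (real n * Dt m)) - 1)) * wt q (vpt m j)" if "real n * Dt m \<le> Tf" for n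
      using that
    proof (induction n)
      case 0
      have "f 0 = f0" using sol by (simp add: classical_solution_def)
      then show ?case by simp
    next
      case (Suc n)
      let ?t = "real n * Dt m" and ?N = "h * (exp (Cs * (real n * Dt m)) - 1)"
      have n: "?t \<le> Tf" by (rule time[OF _ Suc.prems]) simp
      have t: "?t \<in> {0..Tf}" "real (Suc n) * Dt m \<in> {0..Tf}" using n Suc.prems sr.pos by auto
      have N: "0 \<le> ?N" using h Cs sr.pos by simp
      have fo: "\<bar>field_h m (f_h \<epsilon> m f0 n) i\<bar> \<le> ?CE" if "i \<in> xidx m" for i
        using field_ok[OF n] that by (simp add: E_h_def)
      show ?case
      proof (intro ballI)
        fix i j assume ij: "i \<in> xidx m" "j \<in> vidx m"
        have d1: "Dv m \<le> 1" "Dt m \<le> 1" using basic(4) sr.dt_half by auto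
        have ts: "real (Suc n) * Dt m = ?t + Dt m" by (simp add: algebra_simps)
        have "\<bar>f (real (Suc n) * Dt m) (xpt m i) (vpt m j) - step_h \<epsilon> m (f_h \<epsilon> m f0 n) i j\<bar>
          \<le> (?N * (1 + Cs * Dt m) + Cs * Dt m * h) * wt q (vpt m j)"
          unfolding h_def
          by (rule Cs(2)[OF t ts sr.mesh basic(2,3) d1(1) sr.dt d1(2) sr.cfl[OF _ fo] fo region[OF Suc.prems] _ _ ij])
            (use N Suc.IH[OF n] in \<open>auto simp: h_def\<close>)
        also have "\<dots> \<le> (h * (exp (Cs * (real (Suc n) * Dt m)) - 1)) * wt q (vpt m j)"
        proof (rule mult_right_mono)
          have "?N * (1 + Cs * Dt m) + Cs * Dt m * h = h * (exp (Cs * ?t) * (1 + Cs * Dt m) - 1)"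
            by (simp add: algebra_simps)
          also have "\<dots> \<le> h * (exp (Cs * ?t) * exp (Cs * Dt m) - 1)"
            using h by (intro mult_left_mono diff_right_mono exp_ge_add_one_self) auto
          also have "exp (Cs * ?t) * exp (Cs * Dt m) = exp (Cs * (real (Suc n) * Dt m))"
            unfolding exp_add[symmetric] by (simp add: algebra_simps)
          finally show "?N * (1 + Cs * Dt m) + Cs * Dt m * h \<le> h * (exp (Cs * (real (Suc n) * Dt m)) - 1)" .
        qed simp
        finally show "\<bar>f (real (Suc n) * Dt m) (xpt m i) (vpt m j) - f_h \<epsilon> m f0 (Suc n) i j\<bar>
          \<le> (h * (exp (Cs * (real (Suc n) * Dt m)) - 1)) * wt q (vpt m j)" by simp
      qed
    qed
    have X1: "1 \<le> X" unfolding X_def using Cs Tf by simp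
    have final: "\<bar>f Tf (xpt m i) (vpt m j) - f_h \<epsilon> m f0 Nt i j\<bar> \<le> (X * h) * wt q (vpt m j)"
      if "i \<in> xidx m" "j \<in> vidx m" for i j
    proof -
      have "\<bar>f Tf (xpt m i) (vpt m j) - f_h \<epsilon> m f0 Nt i j\<bar> \<le> (h * (X - 1)) * wt q (vpt m j)"
        using err[of Nt] that unfolding Nt X_def by simp
      also have "\<dots> \<le> (X * h) * wt q (vpt m j)" using h by (intro mult_right_mono) (auto simp: algebra_simps)
      finally show ?thesis .
    qed
    have Nx0: "0 < Nx m" using sr.Nx by (cases "Nx m = 0") auto
    have 1: "Linf_error m q (f Tf) (f_h \<epsilon> m f0 Nt) \<le> X * h"
      unfolding Linf_error_def
    proof (rule cSUP_least)
      show "xidx m \<times> vidx m \<noteq> {}" using Nx0 by (auto simp: xidx_def vidx_def)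
      fix z assume "z \<in> xidx m \<times> vidx m"
      then show "(case z of (i, j) \<Rightarrow> \<bar>f Tf (xpt m i) (vpt m j) - f_h \<epsilon> m f0 Nt i j\<bar> * (1 + \<bar>vpt m j\<bar>) powr q) \<le> X * h"
        using final by (auto simp: wt_le_iff)
    qed
    have 2: "field_error m (E Tf) (E_h \<epsilon> m f0 Nt) \<le> CF * ((1 + X) * h)"
      unfolding field_error_def
    proof (rule cSUP_least)
      show "xidx m \<noteq> {}" using Nx0 by (auto simp: xidx_def)
      fix i assume i: "i \<in> xidx m"
      have T: "Tf \<in> {0..Tf}" using Tf by simp
      have d1: "Dv m \<le> 1" using basic(4) by simp
      have "\<bar>E Tf (xpt m i) - field_h m (f_h \<epsilon> m f0 Nt) i\<bar> \<le> CF * (Dx m + (Dv m + 1 / V powr (q - 3) + X * h))"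
        by (rule CF(2)[OF T sr.mesh basic(2) d1 _ i final]) (use X1 h in auto)
      also have "\<dots> \<le> CF * ((1 + X) * h)" using h CF(1) by (intro mult_left_mono) (auto simp: distrib_right)
      finally show "\<bar>E Tf (xpt m i) - E_h \<epsilon> m f0 Nt i\<bar> \<le> CF * ((1 + X) * h)" by (simp add: E_h_def)
    qed
    have "Linf_error m q (f Tf) (f_h \<epsilon> m f0 Nt) + field_error m (E Tf) (E_h \<epsilon> m f0 Nt) \<le> X * h + CF * ((1 + X) * h)"
      using 1 2 by (rule add_mono)
    also have "\<dots> = (X + CF * (1 + X)) * h" by (simp add: algebra_simps)
    finally show "Linf_error m q (f Tf) (f_h \<epsilon> m f0 Nt) + field_error m (E Tf) (E_h \<epsilon> m f0 Nt)
       \<le> (X + CF * (1 + X)) * (Dx m + Dv m + Dt m + 1 / V powr (q - 3))" unfolding h_def .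
  qed
next
  case False
  have no: "\<not> mesh_ok (CM_const q) Cm q \<alpha> f0 C0 \<epsilon> Tf \<eta>1 \<eta>2 \<gamma> l V m" for C0 \<gamma> l V m
  proof
    assume ok: "mesh_ok (CM_const q) Cm q \<alpha> f0 C0 \<epsilon> Tf \<eta>1 \<eta>2 \<gamma> l V m"
    let ?D = "D_int \<alpha> (beta_E \<alpha> \<epsilon> Tf)"
    have "\<exists>C1>0. \<forall>x v. C1 * exp (- (\<bar>v\<bar> powr \<alpha>)) \<le> f0 x v" using ok unfolding mesh_ok_def by blast
    then have "\<not> 0 < ?D" using False by blast
    moreover have "0 \<le> ?D" unfolding D_int_def by (intro Bochner_Integration.integral_nonneg) auto
    ultimately have D: "?D = 0" by linarith
    have "Dv m < r_Dv (CM_const q) Cm q \<alpha> f0 C0 \<epsilon> Tf \<eta>1 \<eta>2 \<gamma> l (Dx m)" and "0 < Dv m"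
      using ok unfolding mesh_ok_def phase_mesh_def by auto
    from less_r_Dv(1)[OF this(1)] this(2) show False unfolding D by simp
  qed
  then show ?thesis by blast
qed

theorem theorem3p2:
  fixes q :: real
  assumes "q > 3"
  shows "\<exists>CM>0. \<exists>CMax>0.
    \<forall>\<epsilon> \<alpha> f0 Tf f E \<eta>1 \<eta>2.
      0 < \<epsilon> \<and> 1 \<le> \<alpha> \<and> \<alpha> \<le> 2 \<and> initial_datum q f0 \<and>
      0 < Tf \<and> classical_solution \<epsilon> f0 Tf f E \<and> solution_bounds q f0 Tf f E \<and>
      0 < \<eta>1 \<and> \<eta>1 < \<eta>2 \<and> \<eta>2 < 1 \<longrightarrow>
      (\<exists>C. \<forall>C0 \<gamma> l m V\<^sub>M Nt.
        0 < C0 \<and> (\<forall>x v. C0 * exp (- (\<bar>v\<bar> powr \<alpha>)) \<le> f0 x v) \<and>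
        1 / 2 \<le> \<gamma> \<and> \<gamma> < 1 \<and>
        admissible_l q \<alpha> \<epsilon> Tf \<gamma> f0 l \<and>
        phase_mesh V\<^sub>M m \<and> real Nt * Dt m = Tf \<and>
        Dx m < r_Dx \<alpha> \<epsilon> Tf l \<and>
        Dv m < r_Dv CM CMax q \<alpha> f0 C0 \<epsilon> Tf \<eta>1 \<eta>2 \<gamma> l (Dx m) \<and>
        \<eta>1 * (Dv m / C_E1 \<epsilon> Tf) < Dt m \<and> Dt m < \<eta>2 * (Dv m / C_E1 \<epsilon> Tf) \<and>
        V\<^sub>M = C_E1 \<epsilon> Tf / Dv m powr \<gamma> \<longrightarrow>
        Linf_error m q (f Tf) (f_h \<epsilon> m f0 Nt) + field_error m (E Tf) (E_h \<epsilon> m f0 Nt)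
          \<le> C * (Dx m + Dv m + Dt m + 1 / V\<^sub>M powr (q - 3)))"
proof -
  obtain Cm where Cm: "1 \<le> Cm"
    "\<And>m g i N v. 0 < Dv m \<Longrightarrow> 0 \<le> N \<Longrightarrow>
       (\<And>j. j \<in> vidx m \<Longrightarrow> 0 \<le> g i j \<and> g i j \<le> N * wt q (vpt m j)) \<Longrightarrow>
       0 < dens_h m g i \<Longrightarrow> 0 < temp_h m g i \<Longrightarrow> 64 * (Dv m)\<^sup>2 \<le> temp_h m g i \<Longrightarrow>
       maxwellian (dens_h m g i) (bulk_h m g i) (temp_h m g i) v \<le> Cm * N * wt q v"
    using maxwellian_grid_bound[OF assms] by blast
  show ?thesis
  proof (rule exI[of _ "CM_const q"], rule conjI[OF CM_const_root(1)[OF assms]], rule exI[of _ Cm], intro conjI allI impI)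
    show "0 < Cm" using Cm(1) by linarith
    fix \<epsilon> \<alpha> :: real and f0 :: "real \<Rightarrow> real \<Rightarrow> real" and Tf :: real and f :: "real \<Rightarrow> real \<Rightarrow> real \<Rightarrow> real"
      and E :: "real \<Rightarrow> real \<Rightarrow> real" and \<eta>1 \<eta>2 :: real
    assume a: "0 < \<epsilon> \<and> 1 \<le> \<alpha> \<and> \<alpha> \<le> 2 \<and> initial_datum q f0 \<and>
      0 < Tf \<and> classical_solution \<epsilon> f0 Tf f E \<and> solution_bounds q f0 Tf f E \<and>
      0 < \<eta>1 \<and> \<eta>1 < \<eta>2 \<and> \<eta>2 < 1"
    then have "\<exists>C. \<forall>C0 \<gamma> l m V Nt. mesh_ok (CM_const q) Cm q \<alpha> f0 C0 \<epsilon> Tf \<eta>1 \<eta>2 \<gamma> l V m \<and> real Nt * Dt m = Tf \<longrightarrow>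
     Linf_error m q (f Tf) (f_h \<epsilon> m f0 Nt) + field_error m (E Tf) (E_h \<epsilon> m f0 Nt)
       \<le> C * (Dx m + Dv m + Dt m + 1 / V powr (q - 3))"
      by (intro convergence[OF assms Cm]) auto
    then obtain C where C: "\<And>C0 \<gamma> l m V Nt. mesh_ok (CM_const q) Cm q \<alpha> f0 C0 \<epsilon> Tf \<eta>1 \<eta>2 \<gamma> l V m \<Longrightarrow> real Nt * Dt m = Tf \<Longrightarrow>
     Linf_error m q (f Tf) (f_h \<epsilon> m f0 Nt) + field_error m (E Tf) (E_h \<epsilon> m f0 Nt)
       \<le> C * (Dx m + Dv m + Dt m + 1 / V powr (q - 3))" by blast
    show "\<exists>C. \<forall>C0 \<gamma> l m V\<^sub>M Nt.
        0 < C0 \<and> (\<forall>x v. C0 * exp (- (\<bar>v\<bar> powr \<alpha>)) \<le> f0 x v) \<and>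
        1 / 2 \<le> \<gamma> \<and> \<gamma> < 1 \<and>
        admissible_l q \<alpha> \<epsilon> Tf \<gamma> f0 l \<and>
        phase_mesh V\<^sub>M m \<and> real Nt * Dt m = Tf \<and>
        Dx m < r_Dx \<alpha> \<epsilon> Tf l \<and>
        Dv m < r_Dv (CM_const q) Cm q \<alpha> f0 C0 \<epsilon> Tf \<eta>1 \<eta>2 \<gamma> l (Dx m) \<and>
        \<eta>1 * (Dv m / C_E1 \<epsilon> Tf) < Dt m \<and> Dt m < \<eta>2 * (Dv m / C_E1 \<epsilon> Tf) \<and>
        V\<^sub>M = C_E1 \<epsilon> Tf / Dv m powr \<gamma> \<longrightarrow>
        Linf_error m q (f Tf) (f_h \<epsilon> m f0 Nt) + field_error m (E Tf) (E_h \<epsilon> m f0 Nt)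
          \<le> C * (Dx m + Dv m + Dt m + 1 / V\<^sub>M powr (q - 3))"
      by (intro exI[of _ C] allI impI C) (auto simp only: mesh_ok_def)
  qed
qed

end
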